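(* Let $R$ be a unital commutative Hausdorff topological $\mathbb{Q}$-algebra whose group of units $R^\times$ is dense in $R$. Let $E,F\in\mathrm{TopSMod}_R$ and let $\mathcal U\subset\underline E$ be an open subfunctor (of functors $\Lambda\to\mathrm{Top}$). For every $n\in\mathbb N$ let a map $f_n:\mathcal U(\lambda^n)\to\underline F(\lambda^n)$ be given. The following are equivalent: (i) There is a $\mathcal C^\infty_{MS}$ natural transformation $f:\mathcal U\Rightarrow\underline F$ of functors $\Lambda\to\mathrm{Top}$ with $f_{\lambda^n}=f_n$ for all $n$. (ii) The family $(f_n)_n$ is a natural transformation $\mathcal U\Rightarrow\underline F$, and each $f_n$ is $\mathcal C^\infty$ over $R$ and its derivative $df_n(x):\underline E(\lambda^n)\to\underline F(\lambda^n)$ is $\lambda^n_0$-linear at every point $x\in\mathcal U(\lambda^n)$. If moreover $R$, $E$ and $F$ are locally $k_\omega$, then (i) and (ii) are also equivalent to each of: (i') There is a $\mathcal C^\infty_{MS}$ natural transformation $f:\mathcal U\Rightarrow\underline F$ of functors $\Lambda^\infty\to\mathrm{Top}$ with $f_{\lambda^n}=f_n$ for all $n$. (ii') There is a map $f_\infty:\mathcal U(\lambda^\infty)\to\underline F(\lambda^\infty)$ with $f_\infty|_{\mathcal U(\lambda^n)}=f_n$ for all $n$, such that $(f_n)_n$ together with $f_\infty$ is a natural transformation $\mathcal U\Rightarrow\underline F$ of functors on $\Lambda^\infty$, and $f_\infty$ is $\mathcal C^\infty$ over $R$ with $\lambda_0^\infty$-linear derivative $df_\infty(x)$ at every point $x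$.
   Context: Grassmann algebras: for $n\in\mathbb N$, $\lambda^n=R[\theta_1,\dots,\theta_n]$ is the Grassmann algebra (free supercommutative $R$-superalgebra) on odd generators $\theta_1,\dots,\theta_n$ ($\lambda^0=R$), and $\lambda^\infty=R[\theta_i:i\in\mathbb N]=\bigcup_n\lambda^n$. For $I=(i_1<\dots<i_k)$ put $\theta_I=\theta_{i_1}\cdots\theta_{i_k}$; $\lambda^n=\bigoplus_I R\theta_I$ carries the product topology and $\lambda^\infty$ the direct limit topology. Each $\lambda=\lambda_0\oplus\lambda_1$ is $\mathbb Z/2$-graded. $\Lambda^\infty$ is the category with objects $\lambda^n$ ($n\in\mathbb N$) and $\lambda^\infty$, morphisms the even unital $R$-algebra morphisms; $\Lambda$ is its full subcategory on the $\lambda^n$, $n<\infty$. For each $\lambda$, $\varepsilon:\lambda\to R$ is the morphism killing all $\theta_i$, and $\lambda^+=\ker\varepsilon$. Graded modules: $\mathrm{TopSMod}_R$ is the category of Hausdorff graded topological $R$-modules $E=E_0\oplus E_1$ (direct sum of two topological $R$-modules) with even continuous $R$-linear maps. $E\otimes\lambda^N=\prod_{|I|\le N}E\theta_I$ has the product topology ($E\theta_I\cong E$) and $E\otimes\lambda^\infty=\varinjlim_N E\otimes\lambda^N$ in Top. $\underline E(\lambda)=(E\otimes\lambda)_0=E_0\otimes\lambda_0\oplus E_1\otimes\lambda_1$ with the subspace topology, and $\underline E(\varphi)=(\mathrm{id}_E\otimes\varphi)|_{\underline E(\lambda)}$; this gives functors $\underline E:\Lambda\to\mathrm{Top}$ and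 $\Lambda^\infty\to\mathrm{Top}$. For $\lambda\in\Lambda$, $\underline E(\lambda)$ is a topological $\lambda_0$-module (and topological $R$-module); if $R,E$ are locally $k_\omega$ this also holds for $\lambda^\infty$. A Hausdorff space is $k_\omega$ if it is the topological direct limit of an increasing sequence of compact subsets, and locally $k_\omega$ if each point has an open $k_\omega$ neighbourhood. Open subfunctors: a subfunctor $\mathcal U\subset\underline E$ is open if every $\mathcal U(\lambda)$ is open in $\underline E(\lambda)$. For open $U\subset E_0$, $\underline E_U(\lambda)=\underline E(\varepsilon)^{-1}(U)$; every open subfunctor of $\underline E$ is of the form $\underline E_U$ with $U=\mathcal U(R)$, and we use this formula to define $\mathcal U(\lambda^\infty)$ as well. Differentiability (Bertram–Glöckner–Neeb): let $S$ be a commutative Hausdorff topological ring with dense units, $X,Y$ Hausdorff topological $S$-modules, $U\subset X$ open, $g:U\to Y$ continuous. Put $U^{[1]}=\{(x,v,t)\in X\times X\times S: x,x+tv\in U\}$. Then $g$ is $\mathcal C^1$ over $S$ if there is a continuous $g^{[1]}:U^{[1]}\to Y$ with $g(x+tv)-g(x)=t\,g^{[1]}(x,v,t)$ on $U^{[1]}$; $g$ is $\mathcal C^{k+1}$ if $g^{[1]}$ is $\mathcal C^k$; $\mathcal C^\infty$ if $\mathcal C^k$ for all $k$. One sets $dg(x)v=g^{[1]}(x,v,0)$. $\mathcal C^k_{MS}$: for $\mathcal U=\underline E_U$, let $\mathcal U^{[1]}(\lambda)$ be the set of $(x,v,t)\in\underline E(\lambda)\times\underline E(\lambda)\times\lambda_0$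 whose image under $\varepsilon$ lies in $U^{[1]}$ (computed over $R$). A natural transformation $f:\mathcal U\Rightarrow\underline F$ is $\mathcal C^1_{MS}$ if there is a natural transformation $f^{[1]}:\mathcal U^{[1]}\Rightarrow\underline F$ with $f_\lambda(x+vt)-f_\lambda(x)=t\cdot f^{[1]}_\lambda(x,v,t)$ for all $\lambda$ and $(x,v,t)\in\mathcal U^{[1]}(\lambda)$; inductively $\mathcal C^{k+1}_{MS}$ if $f^{[1]}$ is $\mathcal C^k_{MS}$, and $\mathcal C^\infty_{MS}$ (smooth) if $\mathcal C^k_{MS}$ for all $k$. The same definition over $\Lambda^\infty$ instead of $\Lambda$ is used in (i'). *)

theory Defs
  imports "HOL-Analysis.Analysis" "HOL-Library.Extended_Nat"
begin

text \<open>Generators are indexed by natural numbers; lambda^n uses theta_0,...,theta_(n-1),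
  lambda^infinity uses all theta_i.  An element sum_I c_I theta_I is stored as the
  coefficient function I |-> c_I on (finite) index sets.  Objects are indexed by enat.\<close>

definition idx :: "enat \<Rightarrow> nat set set" where
  "idx n = (case n of enat m \<Rightarrow> Pow {..<m} | \<infinity> \<Rightarrow> {I. finite I})"

definition supp :: "(nat set \<Rightarrow> 'v::zero) \<Rightarrow> nat set set" where
  "supp x = {I. x I \<noteq> 0}"

text \<open>Carrier of V \<otimes> lambda^n for a coefficient space V\<close>
definition coef :: "enat \<Rightarrow> (nat set \<Rightarrow> 'v::zero) set" where
  "coef n = {x. finite (supp x) \<and> supp x \<subseteq> idx n}"

definition dlim_topology :: "(nat \<Rightarrow> 'a topology) \<Rightarrow> 'a topology" where
  "dlim_topology T = topology (\<lambda>V. V \<subseteq> (\<Union>n. topspace (T n)) \<and>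
                                  (\<forall>n. openin (T n) (V \<inter> topspace (T n))))"

text \<open>Topology on V \<otimes> lambda^n: product topology (finite n), direct limit (n = infinity).
  For finite n the subspace of the full product consisting of families supported on
  Pow {..<n} is the finite product prod_{I} V.\<close>
definition coef_top :: "enat \<Rightarrow> (nat set \<Rightarrow> 'v::{zero,topological_space}) topology" where
  "coef_top n = (case n of
      enat m \<Rightarrow> subtopology (product_topology (\<lambda>_. euclidean) UNIV) (coef (enat m))
    | \<infinity> \<Rightarrow> dlim_topology (\<lambda>m. subtopology (product_topology (\<lambda>_. euclidean) UNIV) (coef (enat m))))"

definition gsign :: "nat set \<Rightarrow> nat set \<Rightarrow> int" where
  "gsign I J = (-1) ^ card {(i, j). i \<in> I \<and> j \<in> J \<and> j < i}"

definition gmul :: "(nat set \<Rightarrow> 'r::comm_ring_1) \<Rightarrow> (nat set \<Rightarrow> 'r) \<Rightarrow> nat set \<Rightarrow> 'r" where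
  "gmul a b K = (\<Sum>I\<in>Pow K. of_int (gsign I (K - I)) * a I * b (K - I))"

definition gone :: "nat set \<Rightarrow> 'r::comm_ring_1" where
  "gone K = (if K = {} then 1 else 0)"

definition gbasis :: "nat set \<Rightarrow> nat set \<Rightarrow> 'r::comm_ring_1" where
  "gbasis I K = (if K = I then 1 else 0)"

definition gsmul :: "'r::comm_ring_1 \<Rightarrow> (nat set \<Rightarrow> 'r) \<Rightarrow> nat set \<Rightarrow> 'r" where
  "gsmul r a K = r * a K"

definition gadd :: "(nat set \<Rightarrow> 'r::comm_ring_1) \<Rightarrow> (nat set \<Rightarrow> 'r) \<Rightarrow> nat set \<Rightarrow> 'r" where
  "gadd a b K = a K + b K"

definition grass :: "enat \<Rightarrow> (nat set \<Rightarrow> 'r::comm_ring_1) set" where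
  "grass n = coef n"

definition grass0 :: "enat \<Rightarrow> (nat set \<Rightarrow> 'r::comm_ring_1) set" where
  "grass0 n = {a \<in> grass n. \<forall>I. odd (card I) \<longrightarrow> a I = 0}"

definition grass1 :: "enat \<Rightarrow> (nat set \<Rightarrow> 'r::comm_ring_1) set" where
  "grass1 n = {a \<in> grass n. \<forall>I. even (card I) \<longrightarrow> a I = 0}"

definition grass0_top :: "enat \<Rightarrow> (nat set \<Rightarrow> 'r::{comm_ring_1,topological_space}) topology" where
  "grass0_top n = subtopology (coef_top n) (grass0 n)"

definition ghom :: "enat \<Rightarrow> enat \<Rightarrow> ((nat set \<Rightarrow> 'r::comm_ring_1) \<Rightarrow> (nat set \<Rightarrow> 'r)) \<Rightarrow> bool" where
  "ghom m n \<phi> \<longleftrightarrow>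
     (\<forall>a\<in>grass m. \<phi> a \<in> grass n) \<and>
     (\<forall>a\<in>grass m. \<forall>b\<in>grass m. \<phi> (gadd a b) = gadd (\<phi> a) (\<phi> b)) \<and>
     (\<forall>r. \<forall>a\<in>grass m. \<phi> (gsmul r a) = gsmul r (\<phi> a)) \<and>
     (\<forall>a\<in>grass m. \<forall>b\<in>grass m. \<phi> (gmul a b) = gmul (\<phi> a) (\<phi> b)) \<and>
     \<phi> gone = gone \<and>
     (\<forall>a\<in>grass0 m. \<phi> a \<in> grass0 n) \<and>
     (\<forall>a\<in>grass1 m. \<phi> a \<in> grass1 n)"

text \<open>The augmentation epsilon : lambda -> R = lambda^0 (kills all theta_i)\<close>
definition geps :: "(nat set \<Rightarrow> 'r::comm_ring_1) \<Rightarrow> nat set \<Rightarrow> 'r" where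
  "geps a K = (if K = {} then a {} else 0)"

text \<open>A graded module E = E0 + E1 is given by two types with scalar multiplications
  s0, s1; its elements are pairs.  E \<otimes> lambda has elements nat set => E0 x E1.\<close>

definition esmul :: "('r \<Rightarrow> 'e0 \<Rightarrow> 'e0) \<Rightarrow> ('r \<Rightarrow> 'e1 \<Rightarrow> 'e1) \<Rightarrow> 'r \<Rightarrow> 'e0 \<times> 'e1 \<Rightarrow> 'e0 \<times> 'e1" where
  "esmul s0 s1 r p = (s0 r (fst p), s1 r (snd p))"

text \<open>underline E (lambda) = (E \<otimes> lambda)_0 = E0 \<otimes> lambda_0 + E1 \<otimes> lambda_1\<close>
definition ev :: "enat \<Rightarrow> (nat set \<Rightarrow> ('e0::zero) \<times> ('e1::zero)) set" where
  "ev n = {x \<in> coef n. \<forall>I. (even (card I) \<longrightarrow> snd (x I) = 0) \<and> (odd (card I) \<longrightarrow> fst (x I) = 0)}"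

definition ev_top :: "enat \<Rightarrow> (nat set \<Rightarrow> ('e0::{zero,topological_space}) \<times> ('e1::{zero,topological_space})) topology" where
  "ev_top n = subtopology (coef_top n) (ev n)"

text \<open>(id_E \<otimes> phi) x = sum_I x_I \<otimes> phi(theta_I)\<close>
definition tmap :: "('r::comm_ring_1 \<Rightarrow> 'e \<Rightarrow> 'e::comm_monoid_add) \<Rightarrow> ((nat set \<Rightarrow> 'r) \<Rightarrow> (nat set \<Rightarrow> 'r))
                      \<Rightarrow> (nat set \<Rightarrow> 'e) \<Rightarrow> nat set \<Rightarrow> 'e" where
  "tmap s \<phi> x K = (\<Sum>I\<in>supp x. s (\<phi> (gbasis I) K) (x I))"

definition tmul :: "('r::comm_ring_1 \<Rightarrow> 'e \<Rightarrow> 'e::comm_monoid_add) \<Rightarrow> (nat set \<Rightarrow> 'e) \<Rightarrow> (nat set \<Rightarrow> 'r) \<Rightarrow> nat set \<Rightarrow> 'e" where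
  "tmul s x a K = (\<Sum>I\<in>Pow K. s (of_int (gsign I (K - I)) * a (K - I)) (x I))"

definition tsmul :: "('r \<Rightarrow> 'e \<Rightarrow> 'e) \<Rightarrow> (nat set \<Rightarrow> 'e) \<Rightarrow> 'r \<Rightarrow> nat set \<Rightarrow> 'e" where
  "tsmul s x r K = s r (x K)"

definition tadd :: "(nat set \<Rightarrow> 'e::plus) \<Rightarrow> (nat set \<Rightarrow> 'e) \<Rightarrow> nat set \<Rightarrow> 'e" where
  "tadd x y K = x K + y K"

definition tdiff :: "(nat set \<Rightarrow> 'e::minus) \<Rightarrow> (nat set \<Rightarrow> 'e) \<Rightarrow> nat set \<Rightarrow> 'e" where
  "tdiff x y K = x K - y K"

definition Hausdorff_top_module :: "('r::{comm_ring_1,topological_space} \<Rightarrow> 'e::{ab_group_add,topological_group_add,t2_space} \<Rightarrow> 'e) \<Rightarrow> bool" where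
  "Hausdorff_top_module s \<longleftrightarrow> module s \<and> continuous_on UNIV (\<lambda>(r, x). s r x)"

definition is_k_omega :: "'a topology \<Rightarrow> bool" where
  "is_k_omega T \<longleftrightarrow> Hausdorff_space T \<and>
     (\<exists>K :: nat \<Rightarrow> 'a set. incseq K \<and> (\<forall>n. compactin T (K n)) \<and> (\<Union>n. K n) = topspace T \<and>
        (\<forall>V. V \<subseteq> topspace T \<longrightarrow> (openin T V \<longleftrightarrow> (\<forall>n. openin (subtopology T (K n)) (V \<inter> K n)))))"

definition locally_k_omega :: "'a topology \<Rightarrow> bool" where
  "locally_k_omega T \<longleftrightarrow> Hausdorff_space T \<and>
     (\<forall>x\<in>topspace T. \<exists>V. openin T V \<and> x \<in> V \<and> is_k_omega (subtopology T V))"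

text \<open>Image topology along an injective map (used to build the iterated domains)\<close>
definition img_topology :: "('a \<Rightarrow> 'b) \<Rightarrow> 'a topology \<Rightarrow> 'b topology" where
  "img_topology f T = topology (\<lambda>V. \<exists>W. openin T W \<and> V = f ` W)"

section \<open>Iterated domains X, X x X x S, (X x X x S) x (X x X x S) x S, ...\<close>

datatype ('x, 's) tw = Base 'x | Tri "('x, 's) tw" "('x, 's) tw" 's

fun tw_add :: "('x \<Rightarrow> 'x \<Rightarrow> 'x) \<Rightarrow> ('s \<Rightarrow> 's \<Rightarrow> 's) \<Rightarrow> ('x, 's) tw \<Rightarrow> ('x, 's) tw \<Rightarrow> ('x, 's) tw" where
  "tw_add pa sa (Base x) (Base y) = Base (pa x y)"
| "tw_add pa sa (Tri a b t) (Tri a' b' t') = Tri (tw_add pa sa a a') (tw_add pa sa b b') (sa t t')"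
| "tw_add pa sa p q = undefined"

fun tw_scal :: "('x \<Rightarrow> 's \<Rightarrow> 'x) \<Rightarrow> ('s \<Rightarrow> 's \<Rightarrow> 's) \<Rightarrow> ('x, 's) tw \<Rightarrow> 's \<Rightarrow> ('x, 's) tw" where
  "tw_scal px sm (Base x) t = Base (px x t)"
| "tw_scal px sm (Tri a b s) t = Tri (tw_scal px sm a t) (tw_scal px sm b t) (sm s t)"

fun tw_map :: "('x \<Rightarrow> 'x) \<Rightarrow> ('s \<Rightarrow> 's) \<Rightarrow> ('x, 's) tw \<Rightarrow> ('x, 's) tw" where
  "tw_map f g (Base x) = Base (f x)"
| "tw_map f g (Tri a b s) = Tri (tw_map f g a) (tw_map f g b) (g s)"

record ('x, 's) tmod =
  mcar :: "'x set"
  mtop :: "'x topology"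
  madd :: "'x \<Rightarrow> 'x \<Rightarrow> 'x"
  mscal :: "'x \<Rightarrow> 's \<Rightarrow> 'x"
  scar :: "'s set"
  stop :: "'s topology"
  sadd :: "'s \<Rightarrow> 's \<Rightarrow> 's"
  smul :: "'s \<Rightarrow> 's \<Rightarrow> 's"

fun tw_car :: "('x, 's) tmod \<Rightarrow> nat \<Rightarrow> ('x, 's) tw set" where
  "tw_car M 0 = Base ` mcar M"
| "tw_car M (Suc k) = {Tri a b t | a b t. a \<in> tw_car M k \<and> b \<in> tw_car M k \<and> t \<in> scar M}"

fun tw_top :: "('x, 's) tmod \<Rightarrow> nat \<Rightarrow> ('x, 's) tw topology" where
  "tw_top M 0 = img_topology Base (mtop M)"
| "tw_top M (Suc k) = img_topology (\<lambda>(a, b, t). Tri a b t)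
                         (prod_topology (tw_top M k) (prod_topology (tw_top M k) (stop M)))"

definition tw_plus :: "('x, 's) tmod \<Rightarrow> ('x, 's) tw \<Rightarrow> ('x, 's) tw \<Rightarrow> ('x, 's) tw" where
  "tw_plus M = tw_add (madd M) (sadd M)"

definition tw_times :: "('x, 's) tmod \<Rightarrow> ('x, 's) tw \<Rightarrow> 's \<Rightarrow> ('x, 's) tw" where
  "tw_times M = tw_scal (mscal M) (smul M)"

fun tw_dom :: "('x, 's) tmod \<Rightarrow> 'x set \<Rightarrow> nat \<Rightarrow> ('x, 's) tw set" where
  "tw_dom M U 0 = Base ` U"
| "tw_dom M U (Suc k) = {Tri a b t | a b t. a \<in> tw_dom M U k \<and> b \<in> tw_car M k \<and> t \<in> scar M \<and>
                                       tw_plus M a (tw_times M b t) \<in> tw_dom M U k}"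

record ('y, 's) cmod =
  ytop :: "'y topology"
  ydiff :: "'y \<Rightarrow> 'y \<Rightarrow> 'y"
  yscal :: "'y \<Rightarrow> 's \<Rightarrow> 'y"

section \<open>C^k over a topological ring (Bertram--Gloeckner--Neeb)\<close>

fun BGN_Ck :: "('x, 's) tmod \<Rightarrow> 'x set \<Rightarrow> ('y, 's) cmod \<Rightarrow> nat \<Rightarrow> nat \<Rightarrow> (('x, 's) tw \<Rightarrow> 'y) \<Rightarrow> bool" where
  "BGN_Ck M U Y 0 j g = continuous_map (subtopology (tw_top M j) (tw_dom M U j)) (ytop Y) g"
| "BGN_Ck M U Y (Suc k) j g =
     (continuous_map (subtopology (tw_top M j) (tw_dom M U j)) (ytop Y) g \<and>
      (\<exists>g1. (\<forall>a b t. Tri a b t \<in> tw_dom M U (Suc j) \<longrightarrow>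
               ydiff Y (g (tw_plus M a (tw_times M b t))) (g a) = yscal Y (g1 (Tri a b t)) t) \<and>
            BGN_Ck M U Y k (Suc j) g1))"

definition base_fun :: "('x \<Rightarrow> 'y) \<Rightarrow> ('x, 's) tw \<Rightarrow> 'y" where
  "base_fun h p = (case p of Base x \<Rightarrow> h x | Tri a b t \<Rightarrow> undefined)"

definition BGN_smooth :: "('x, 's) tmod \<Rightarrow> 'x set \<Rightarrow> ('y, 's) cmod \<Rightarrow> ('x \<Rightarrow> 'y) \<Rightarrow> bool" where
  "BGN_smooth M U Y h \<longleftrightarrow> (\<forall>k. BGN_Ck M U Y k 0 (base_fun h))"

text \<open>dg(x)v = g^[1](x,v,0), g^[1] the (unique, by density of units) difference quotient map\<close>
definition BGN_deriv :: "('x, 's) tmod \<Rightarrow> 'x set \<Rightarrow> ('y, 's) cmod \<Rightarrow> 's \<Rightarrow> ('x \<Rightarrow> 'y) \<Rightarrow> 'x \<Rightarrow> 'x \<Rightarrow> 'y" where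
  "BGN_deriv M U Y z h x v =
     (SOME g1. continuous_map (subtopology (tw_top M 1) (tw_dom M U 1)) (ytop Y) g1 \<and>
        (\<forall>a b t. Tri a b t \<in> tw_dom M U 1 \<longrightarrow>
           ydiff Y (base_fun h (tw_plus M a (tw_times M b t))) (base_fun h a) = yscal Y (g1 (Tri a b t)) t))
     (Tri (Base x) (Base v) z)"

definition Emod_R :: "('r::{comm_ring_1,topological_space} \<Rightarrow> 'e0 \<Rightarrow> 'e0) \<Rightarrow> ('r \<Rightarrow> 'e1 \<Rightarrow> 'e1) \<Rightarrow> enat
     \<Rightarrow> (nat set \<Rightarrow> ('e0::{ab_group_add,topological_space}) \<times> ('e1::{ab_group_add,topological_space}), 'r) tmod" where
  "Emod_R s0 s1 n = \<lparr> mcar = ev n, mtop = ev_top n, madd = tadd,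
      mscal = tsmul (esmul s0 s1), scar = UNIV, stop = euclidean, sadd = (+), smul = (*) \<rparr>"

definition Fcod_R :: "('r::{comm_ring_1,topological_space} \<Rightarrow> 'f0 \<Rightarrow> 'f0) \<Rightarrow> ('r \<Rightarrow> 'f1 \<Rightarrow> 'f1) \<Rightarrow> enat
     \<Rightarrow> (nat set \<Rightarrow> ('f0::{ab_group_add,topological_space}) \<times> ('f1::{ab_group_add,topological_space}), 'r) cmod" where
  "Fcod_R s0 s1 n = \<lparr> ytop = ev_top n, ydiff = tdiff, yscal = tsmul (esmul s0 s1) \<rparr>"

definition Emod_L :: "('r::{comm_ring_1,topological_space} \<Rightarrow> 'e0 \<Rightarrow> 'e0) \<Rightarrow> ('r \<Rightarrow> 'e1 \<Rightarrow> 'e1) \<Rightarrow> enat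
     \<Rightarrow> (nat set \<Rightarrow> ('e0::{ab_group_add,topological_space}) \<times> ('e1::{ab_group_add,topological_space}), nat set \<Rightarrow> 'r) tmod" where
  "Emod_L s0 s1 n = \<lparr> mcar = ev n, mtop = ev_top n, madd = tadd,
      mscal = tmul (esmul s0 s1), scar = grass0 n, stop = grass0_top n, sadd = gadd, smul = gmul \<rparr>"

definition Fcod_L :: "('r::{comm_ring_1,topological_space} \<Rightarrow> 'f0 \<Rightarrow> 'f0) \<Rightarrow> ('r \<Rightarrow> 'f1 \<Rightarrow> 'f1) \<Rightarrow> enat
     \<Rightarrow> (nat set \<Rightarrow> ('f0::{ab_group_add,topological_space}) \<times> ('f1::{ab_group_add,topological_space}), nat set \<Rightarrow> 'r) cmod" where
  "Fcod_L s0 s1 n = \<lparr> ytop = ev_top n, ydiff = tdiff, yscal = tmul (esmul s0 s1) \<rparr>"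

definition open_subfunctor ::
  "('r::{comm_ring_1,topological_space} \<Rightarrow> 'e0 \<Rightarrow> 'e0) \<Rightarrow> ('r \<Rightarrow> 'e1 \<Rightarrow> 'e1)
   \<Rightarrow> (nat \<Rightarrow> (nat set \<Rightarrow> ('e0::{ab_group_add,topological_space}) \<times> ('e1::{ab_group_add,topological_space})) set) \<Rightarrow> bool" where
  "open_subfunctor s0 s1 \<U> \<longleftrightarrow>
     (\<forall>n. \<U> n \<subseteq> ev (enat n) \<and> openin (ev_top (enat n)) (\<U> n)) \<and>
     (\<forall>m n (\<phi> :: (nat set \<Rightarrow> 'r) \<Rightarrow> nat set \<Rightarrow> 'r). ghom (enat m) (enat n) \<phi> \<longrightarrow>
         (\<forall>x\<in>\<U> m. tmap (esmul s0 s1) \<phi> x \<in> \<U> n))"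

definition Uobj ::
  "('r::{comm_ring_1,topological_space} \<Rightarrow> 'e0 \<Rightarrow> 'e0) \<Rightarrow> ('r \<Rightarrow> 'e1 \<Rightarrow> 'e1)
   \<Rightarrow> (nat \<Rightarrow> (nat set \<Rightarrow> ('e0::{ab_group_add,topological_space}) \<times> ('e1::{ab_group_add,topological_space})) set)
   \<Rightarrow> enat \<Rightarrow> (nat set \<Rightarrow> 'e0 \<times> 'e1) set" where
  "Uobj s0 s1 \<U> ob = (case ob of enat n \<Rightarrow> \<U> n
      | \<infinity> \<Rightarrow> {x \<in> ev \<infinity>. tmap (esmul s0 s1) (geps :: (nat set \<Rightarrow> 'r) \<Rightarrow> _) x \<in> \<U> 0})"

fun MS_dom ::
  "('r::{comm_ring_1,topological_space} \<Rightarrow> 'e0 \<Rightarrow> 'e0) \<Rightarrow> ('r \<Rightarrow> 'e1 \<Rightarrow> 'e1)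
   \<Rightarrow> (nat \<Rightarrow> (nat set \<Rightarrow> ('e0::{ab_group_add,topological_space}) \<times> ('e1::{ab_group_add,topological_space})) set)
   \<Rightarrow> enat \<Rightarrow> nat \<Rightarrow> (nat set \<Rightarrow> 'e0 \<times> 'e1, nat set \<Rightarrow> 'r) tw set" where
  "MS_dom s0 s1 \<U> ob 0 = Base ` Uobj s0 s1 \<U> ob"
| "MS_dom s0 s1 \<U> ob (Suc k) = {p \<in> tw_car (Emod_L s0 s1 ob) (Suc k).
      tw_map (tmap (esmul s0 s1) geps) geps p \<in> tw_dom (Emod_L s0 s1 (enat 0)) (\<U> 0) (Suc k)}"

text \<open>g is a natural transformation U^[k] => underline F of functors on the full subcategory
  with object set Obj (Obj = finite n: Lambda; Obj = UNIV: Lambda^infinity), i.e. all components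
  are continuous maps into F(lambda) and the naturality squares commute.\<close>
definition MS_natural ::
  "enat set \<Rightarrow> ('r::{comm_ring_1,topological_space} \<Rightarrow> 'e0 \<Rightarrow> 'e0) \<Rightarrow> ('r \<Rightarrow> 'e1 \<Rightarrow> 'e1)
   \<Rightarrow> ('r \<Rightarrow> 'f0 \<Rightarrow> 'f0) \<Rightarrow> ('r \<Rightarrow> 'f1 \<Rightarrow> 'f1)
   \<Rightarrow> (nat \<Rightarrow> (nat set \<Rightarrow> ('e0::{ab_group_add,topological_space}) \<times> ('e1::{ab_group_add,topological_space})) set)
   \<Rightarrow> nat \<Rightarrow> (enat \<Rightarrow> (nat set \<Rightarrow> 'e0 \<times> 'e1, nat set \<Rightarrow> 'r) tw
                 \<Rightarrow> nat set \<Rightarrow> ('f0::{ab_group_add,topological_space}) \<times> ('f1::{ab_group_add,topological_space})) \<Rightarrow> bool" where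
  "MS_natural Obj s0 s1 t0 t1 \<U> k g \<longleftrightarrow>
     (\<forall>ob\<in>Obj. continuous_map (subtopology (tw_top (Emod_L s0 s1 ob) k) (MS_dom s0 s1 \<U> ob k))
                              (ev_top ob) (g ob)) \<and>
     (\<forall>m\<in>Obj. \<forall>n\<in>Obj. \<forall>\<phi>. ghom m n \<phi> \<longrightarrow>
        (\<forall>p\<in>MS_dom s0 s1 \<U> m k. g n (tw_map (tmap (esmul s0 s1) \<phi>) \<phi> p) = tmap (esmul t0 t1) \<phi> (g m p)))"

fun MS_Ck ::
  "enat set \<Rightarrow> ('r::{comm_ring_1,topological_space} \<Rightarrow> 'e0 \<Rightarrow> 'e0) \<Rightarrow> ('r \<Rightarrow> 'e1 \<Rightarrow> 'e1)
   \<Rightarrow> ('r \<Rightarrow> 'f0 \<Rightarrow> 'f0) \<Rightarrow> ('r \<Rightarrow> 'f1 \<Rightarrow> 'f1)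
   \<Rightarrow> (nat \<Rightarrow> (nat set \<Rightarrow> ('e0::{ab_group_add,topological_space}) \<times> ('e1::{ab_group_add,topological_space})) set)
   \<Rightarrow> nat \<Rightarrow> nat \<Rightarrow> (enat \<Rightarrow> (nat set \<Rightarrow> 'e0 \<times> 'e1, nat set \<Rightarrow> 'r) tw
                 \<Rightarrow> nat set \<Rightarrow> ('f0::{ab_group_add,topological_space}) \<times> ('f1::{ab_group_add,topological_space})) \<Rightarrow> bool" where
  "MS_Ck Obj s0 s1 t0 t1 \<U> 0 j g = MS_natural Obj s0 s1 t0 t1 \<U> j g"
| "MS_Ck Obj s0 s1 t0 t1 \<U> (Suc k) j g =
     (MS_natural Obj s0 s1 t0 t1 \<U> j g \<and>
      (\<exists>g1. (\<forall>ob\<in>Obj. \<forall>a b t. Tri a b t \<in> MS_dom s0 s1 \<U> ob (Suc j) \<longrightarrow>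
               tdiff (g ob (tw_plus (Emod_L s0 s1 ob) a (tw_times (Emod_L s0 s1 ob) b t))) (g ob a)
                 = tmul (esmul t0 t1) (g1 ob (Tri a b t)) t) \<and>
            MS_Ck Obj s0 s1 t0 t1 \<U> k (Suc j) g1))"

definition MS_smooth where
  "MS_smooth Obj s0 s1 t0 t1 \<U> f \<longleftrightarrow> (\<forall>k. MS_Ck Obj s0 s1 t0 t1 \<U> k 0 f)"

definition Lam :: "enat set" where "Lam = {n. n \<noteq> \<infinity>}"

end

theory Submission
  imports Defs "HOL-Library.Function_Algebras"
begin

text \<open>A difference quotient over \<open>\<lambda>\<^sub>0\<close> restricts to one over \<open>R\<close>, and density of the units makes all
  difference quotients unique, hence natural and \<open>\<lambda>\<^sub>0\<close>-linear in the direction. Conversely, a scalar in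
  \<open>\<lambda>\<^sub>0\<close> is its body plus a sum of monomials \<open>\<alpha>\<beta>\<close> with \<open>\<alpha>\<close>, \<open>\<beta>\<close> odd. Naturality under rescaling a
  generic odd generator gives \<open>f (x + v\<alpha>\<beta>) = f x + df x v \<alpha>\<beta>\<close>, so the quotient over \<open>R\<close> extends to the
  scalar by adding one monomial at a time, and the extension inherits the hypotheses, which allows
  iteration. For \<open>\<lambda>\<^sup>\<infinity>\<close>, a compatible family of quotients on the finite levels is continuous on the union
  because countable direct limits of locally \<open>k\<^sub>\<omega>\<close> spaces commute with finite products.\<close>

section \<open>The Grassmann algebra\<close>

text \<open>Division by an even scalar \<open>t\<close> is the obstacle. The defining equation fixes
  the quotient only where the body of \<open>t\<close> is a unit; at nilpotent \<open>t\<close> it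
  leaves most of the value open. So existence needs an explicit formula, while equations between
  quotients are checked at unit bodies, where \<open>t\<close> cancels, and extended by continuity.
  For the existence of quotients, naturality in the Grassmann algebra is used only on the first
  level, where it yields the expansion along \<alpha>\<beta>. Smoothness over R together with this
  expansion is the invariant \<open>ksm\<close>. It refers to a single Grassmann algebra and passes
  to the quotient, so the tower of quotients is built for each \<open>n\<close> separately;
  naturality of each new level then follows from uniqueness. Each iterated domain is itself regarded
  as an R-module (\<open>RM j\<close>). Smoothness over R thus starts afresh on every level, and
  differentiation over R never has to be interleaved with differentiation over
  \<open>\<lambda>\<^sub>0\<close>.\<close>

lemma tadd_eq [simp]: "tadd x y = x + (y :: nat set \<Rightarrow> 'e::plus)"
  by (simp add: fun_eq_iff tadd_def)

lemma tdiff_eq [simp]: "tdiff x y = x - (y :: nat set \<Rightarrow> 'e::minus)"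
  by (simp add: fun_eq_iff tdiff_def)

lemma gadd_eq [simp]: "gadd a b = a + (b :: nat set \<Rightarrow> 'r::comm_ring_1)"
  by (simp add: fun_eq_iff gadd_def)

section \<open>Signs of shuffles and the laws of the Grassmann product\<close>

lemma gsign_empty [simp]: "gsign {} J = 1" "gsign I {} = 1"
  by (simp_all add: gsign_def)

lemma finite_inversions: "finite I \<Longrightarrow> finite J \<Longrightarrow> finite {(i, j). i \<in> I \<and> j \<in> J \<and> j < (i::nat)}"
  by (rule finite_subset[of _ "I \<times> J"]) auto

lemma gsign_Un_right:
  assumes "finite I" "finite J" "finite L" "J \<inter> L = {}"
  shows "gsign I (J \<union> L) = gsign I J * gsign I L"
proof -
  have "{(i, j). i \<in> I \<and> j \<in> J \<union> L \<and> j < i}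
      = {(i, j). i \<in> I \<and> j \<in> J \<and> j < i} \<union> {(i, j). i \<in> I \<and> j \<in> L \<and> j < i}"
    by auto
  moreover have "card ({(i, j). i \<in> I \<and> j \<in> J \<and> j < i} \<union> {(i, j). i \<in> I \<and> j \<in> L \<and> j < i})
      = card {(i, j). i \<in> I \<and> j \<in> J \<and> j < i} + card {(i, j). i \<in> I \<and> j \<in> L \<and> j < i}"
    using assms by (intro card_Un_disjoint finite_inversions) auto
  ultimately show ?thesis by (simp add: gsign_def power_add)
qed

lemma gsign_Un_left:
  assumes "finite I" "finite J" "finite L" "I \<inter> J = {}"
  shows "gsign (I \<union> J) L = gsign I L * gsign J L"
proof -
  have "{(i, j). i \<in> I \<union> J \<and> j \<in> L \<and> j < i}
      = {(i, j). i \<in> I \<and> j \<in> L \<and> j < i} \<union> {(i, j). i \<in> J \<and> j \<in> L \<and> j < i}"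
    by auto
  moreover have "card ({(i, j). i \<in> I \<and> j \<in> L \<and> j < i} \<union> {(i, j). i \<in> J \<and> j \<in> L \<and> j < i})
      = card {(i, j). i \<in> I \<and> j \<in> L \<and> j < i} + card {(i, j). i \<in> J \<and> j \<in> L \<and> j < i}"
    using assms by (intro card_Un_disjoint finite_inversions) auto
  ultimately show ?thesis by (simp add: gsign_def power_add)
qed

text \<open>Every pair in \<open>I \<times> J\<close> is an inversion in exactly one of the two
  orders, so the two counts add up to the product of the cardinalities.\<close>

lemma gsign_swap:
  assumes "finite I" "finite J" "I \<inter> J = {}"
  shows "gsign I J * gsign J I = (-1) ^ (card I * card J)"
proof -
  let ?A = "{(i, j). i \<in> I \<and> j \<in> J \<and> j < i}" and ?B = "{(j, i). j \<in> J \<and> i \<in> I \<and> i < j}"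
  have "prod.swap ` ?B = {(i, j). i \<in> I \<and> j \<in> J \<and> i < j}"
    by (auto simp: image_iff)
  then have "card ?B = card {(i, j). i \<in> I \<and> j \<in> J \<and> i < j}"
    by (metis (no_types, lifting) card_image inj_swap inj_on_subset subset_UNIV)
  moreover have "?A \<union> {(i, j). i \<in> I \<and> j \<in> J \<and> i < j} = I \<times> J"
    using assms(3) by (auto simp: not_less_iff_gr_or_eq)
  moreover have "card (?A \<union> {(i, j). i \<in> I \<and> j \<in> J \<and> i < j})
      = card ?A + card {(i, j). i \<in> I \<and> j \<in> J \<and> i < j}"
  proof (rule card_Un_disjoint)
    show "finite ?A" "finite {(i, j). i \<in> I \<and> j \<in> J \<and> i < j}"
      using assms by (auto intro: finite_subset[of _ "I \<times> J"])
  qed auto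
  ultimately have "card ?A + card ?B = card I * card J"
    by (simp add: card_cartesian_product)
  then show ?thesis by (simp add: gsign_def flip: power_add)
qed

lemma gsign_square [simp]: "gsign I J * gsign I J = 1"
  by (simp add: gsign_def flip: power_mult_distrib)

text \<open>The algebra is the case where R is a module over itself, so laws of \<open>gmul\<close>
  become instances of laws of \<open>tmul\<close>.\<close>

lemma gmul_tmul: "gmul a b = tmul (*) a b"
  by (auto simp: fun_eq_iff gmul_def tmul_def mult_ac)

lemma module_mult: "module ((*) :: 'r::comm_ring_1 \<Rightarrow> 'r \<Rightarrow> 'r)"
  by unfold_locales (auto simp: algebra_simps)

text \<open>The sum over the infinite set \<open>Pow K\<close> is 0 by convention, so products never
  carry junk at infinite index sets.\<close>

lemma tmul_infinite [simp]: "infinite K \<Longrightarrow> tmul s x a K = 0"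
  by (simp add: tmul_def)

lemma gmul_infinite [simp]: "infinite K \<Longrightarrow> gmul a b K = 0"
  by (simp add: gmul_def)

context module begin

lemma tmul_add_left: "tmul scale (x + y) a = tmul scale x a + tmul scale y a"
  by (simp add: fun_eq_iff tmul_def scale_right_distrib sum.distrib)

lemma tmul_add_right: "tmul scale x (a + b) = tmul scale x a + tmul scale x b"
  by (simp add: fun_eq_iff tmul_def distrib_left scale_left_distrib sum.distrib)

lemma tmul_zero_left [simp]: "tmul scale 0 a = 0"
  by (simp add: fun_eq_iff tmul_def)

lemma tmul_zero_right [simp]: "tmul scale x 0 = 0"
  by (simp add: fun_eq_iff tmul_def)

lemma tmul_minus_left: "tmul scale (- x) a = - tmul scale x a"
  by (simp add: fun_eq_iff tmul_def sum_negf)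

lemma tmul_minus_right: "tmul scale x (- a) = - tmul scale x a"
  by (simp add: fun_eq_iff tmul_def sum_negf)

lemma tmul_diff_left: "tmul scale (x - y) a = tmul scale x a - tmul scale y a"
  by (simp add: fun_eq_iff tmul_def scale_right_diff_distrib sum_subtractf)

lemma tmul_diff_right: "tmul scale x (a - b) = tmul scale x a - tmul scale x b"
  by (simp add: fun_eq_iff tmul_def right_diff_distrib scale_left_diff_distrib sum_subtractf)

text \<open>Both sides run over the splittings of \<open>K\<close> into three disjoint parts
  \<open>J\<close>, \<open>L\<close>, \<open>M\<close>. The signs agree because each side carries
  the product of the signs of the three pairs.\<close>

lemma tmul_assoc: "tmul scale (tmul scale x a) b = tmul scale x (gmul a b)"
proof
  fix K :: "nat set"
  show "tmul scale (tmul scale x a) b K = tmul scale x (gmul a b) K"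
  proof (cases "finite K")
    case True
    define g where "g J L M = ((of_int (gsign (J \<union> L) M) * b M) * (of_int (gsign J L) * a L)) *s x J"
      for J L M
    define h where "h J L M = ((of_int (gsign J (L \<union> M)) * (of_int (gsign L M) * a L * b M))) *s x J"
      for J L M
    have fin: "finite I" if "I \<subseteq> K" for I using that True finite_subset by blast
    have gh: "g J L M = h J L M" if "J \<union> L \<union> M = K" "J \<inter> L = {}" "J \<inter> M = {}" "L \<inter> M = {}" for J L M
    proof -
      have f: "finite J" "finite L" "finite M" using that fin by auto
      have "gsign (J \<union> L) M * gsign J L = gsign J (L \<union> M) * gsign L M"
        using f that by (simp add: gsign_Un_left gsign_Un_right)
      then have "of_int (gsign (J \<union> L) M) * of_int (gsign J L)
          = (of_int (gsign J (L \<union> M)) * of_int (gsign L M) :: 'a)"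
        by (metis of_int_mult)
      then have "of_int (gsign (J \<union> L) M) * b M * (of_int (gsign J L) * a L)
          = of_int (gsign J (L \<union> M)) * (of_int (gsign L M) * a L * b M)"
        by (metis (no_types, opaque_lifting) mult.assoc mult.commute)
      then show ?thesis by (simp add: g_def h_def)
    qed
    have "tmul scale (tmul scale x a) b K = (\<Sum>I\<in>Pow K. \<Sum>J\<in>Pow I. g J (I - J) (K - I))"
      unfolding tmul_def scale_sum_right
    proof (intro sum.cong refl, goal_cases)
      case (1 I J)
      then have "J \<union> (I - J) = I" by auto
      then show ?case by (simp add: g_def)
    qed
    also have "\<dots> = (\<Sum>(I, J)\<in>(SIGMA I:Pow K. Pow I). g J (I - J) (K - I))"
      using True by (subst sum.Sigma) (auto intro: finite_subset)
    \<comment> \<open>A nested pair \<open>J \<subseteq> I\<close> is recorded as the disjoint pair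
      \<open>J\<close>, \<open>L = I - J\<close>.\<close>
    also have "\<dots> = (\<Sum>(J, L)\<in>(SIGMA J:Pow K. Pow (K - J)). h J L (K - J - L))"
    proof (rule sum.reindex_bij_witness[where j = "\<lambda>(I, J). (J, I - J)" and i = "\<lambda>(J, L). (J \<union> L, J)"], goal_cases)
      case (5 p)
      obtain I J where p: "p = (I, J)" by force
      with 5 have IJ: "J \<subseteq> I" "I \<subseteq> K" by auto
      then have "K - J - (I - J) = K - I" by auto
      moreover have "g J (I - J) (K - I) = h J (I - J) (K - I)"
        using IJ by (intro gh) auto
      ultimately show ?case by (simp add: p)
    qed auto
    also have "\<dots> = (\<Sum>J\<in>Pow K. \<Sum>L\<in>Pow (K - J). h J L (K - J - L))"
      using True by (subst sum.Sigma) auto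
    also have "\<dots> = tmul scale x (gmul a b) K"
      unfolding tmul_def gmul_def
    proof (intro sum.cong refl, goal_cases)
      case (1 J)
      have "h J L (K - J - L) = (of_int (gsign J (K - J)) * (of_int (gsign L (K - J - L)) * a L * b (K - J - L))) *s x J"
        if "L \<in> Pow (K - J)" for L
      proof -
        have "L \<union> (K - J - L) = K - J" using that by auto
        then show ?thesis by (simp add: h_def)
      qed
      then show ?case by (simp add: sum_distrib_left scale_sum_left)
    qed
    finally show ?thesis .
  qed simp
qed

end

lemma gmul_assoc: "gmul (gmul a b) c = gmul a (gmul b c)"
  unfolding gmul_tmul[of "gmul a b" c] gmul_tmul[of a "gmul b c"]
  by (simp add: gmul_tmul[of a b] module.tmul_assoc[OF module_mult])

lemma gmul_add_left: "gmul (a + b) c = gmul a c + gmul b c"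
  and gmul_add_right: "gmul c (a + b) = gmul c a + gmul c b"
  and gmul_minus_left: "gmul (- a) c = - gmul a c"
  and gmul_minus_right: "gmul c (- a) = - gmul c a"
  and gmul_zero_left [simp]: "gmul 0 c = 0"
  and gmul_zero_right [simp]: "gmul c 0 = 0"
  by (simp_all add: gmul_tmul module_mult module.tmul_add_left module.tmul_add_right
      module.tmul_minus_left module.tmul_minus_right module.tmul_diff_left module.tmul_diff_right
      module.tmul_zero_left module.tmul_zero_right)

text \<open>The grading automorphism: it collects the sign that arises when an odd element is moved
  past \<open>b\<close>.\<close>

definition gconj :: "(nat set \<Rightarrow> 'r::comm_ring_1) \<Rightarrow> nat set \<Rightarrow> 'r" where
  "gconj b I = (-1) ^ card I * b I"

text \<open>The factors are exchanged by \<open>I |-> K - I\<close>. Only terms with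
  \<open>card I\<close> odd occur, and there \<open>gsign_swap\<close> leaves the sign of the
  complementary factor.\<close>

lemma gmul_odd_swap:
  assumes "\<And>I. even (card I) \<Longrightarrow> a I = 0"
  shows "gmul a b = gmul (gconj b) a"
proof
  fix K :: "nat set"
  show "gmul a b K = gmul (gconj b) a K"
  proof (cases "finite K")
    case True
    have "(\<Sum>I\<in>Pow K. of_int (gsign I (K - I)) * a I * b (K - I))
        = (\<Sum>I\<in>Pow K. of_int (gsign I (K - I)) * gconj b I * a (K - I))"
    proof (rule sum.reindex_bij_witness[where i = "\<lambda>I. K - I" and j = "\<lambda>I. K - I"], goal_cases)
      case (5 I)
      then have I: "K - (K - I) = I" by auto
      have f: "finite I" "finite (K - I)" using 5 True finite_subset by auto
      have s: "gsign (K - I) I * gsign I (K - I) = (-1) ^ (card (K - I) * card I)"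
        using f by (intro gsign_swap) auto
      show ?case
      proof (cases "even (card I)")
        case True then show ?thesis by (simp add: assms I)
      next
        case False
        then have "gsign (K - I) I * gsign I (K - I) = (-1) ^ card (K - I)"
          unfolding s by (simp add: power_mult uminus_power_if)
        then have "gsign (K - I) I * (gsign I (K - I) * gsign I (K - I)) = (-1) ^ card (K - I) * gsign I (K - I)"
          by (simp only: mult.assoc[symmetric])
        then have "gsign (K - I) I = (-1) ^ card (K - I) * gsign I (K - I)" by simp
        then have "of_int (gsign (K - I) I) * (-1) ^ card (K - I) = (of_int (gsign I (K - I)) :: 'a)"
          by (auto simp: uminus_power_if)
        then have "of_int (gsign (K - I) I) * ((-1) ^ card (K - I) * b (K - I)) * a I
           = of_int (gsign I (K - I)) * a I * b (K - I)"
          by (metis (no_types, opaque_lifting) mult.assoc mult.commute)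
        then show ?thesis by (simp add: gconj_def I)
      qed
    qed auto
    then show ?thesis by (simp add: gmul_def)
  qed simp
qed

lemma gmul_even_commute:
  assumes "\<And>I. odd (card I) \<Longrightarrow> a I = 0"
  shows "gmul a b = gmul b a"
proof
  fix K :: "nat set"
  show "gmul a b K = gmul b a K"
  proof (cases "finite K")
    case True
    have "(\<Sum>I\<in>Pow K. of_int (gsign I (K - I)) * a I * b (K - I))
        = (\<Sum>I\<in>Pow K. of_int (gsign I (K - I)) * b I * a (K - I))"
    proof (rule sum.reindex_bij_witness[where i = "\<lambda>I. K - I" and j = "\<lambda>I. K - I"], goal_cases)
      case (5 I)
      then have I: "K - (K - I) = I" by auto
      have f: "finite I" "finite (K - I)" using 5 True finite_subset by auto
      have s: "gsign (K - I) I * gsign I (K - I) = (-1) ^ (card (K - I) * card I)"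
        using f by (intro gsign_swap) auto
      show ?case
      proof (cases "odd (card I)")
        case True then show ?thesis by (simp add: assms I)
      next
        case False
        then have "gsign (K - I) I * gsign I (K - I) = 1"
          unfolding s by simp
        then have "gsign (K - I) I * (gsign I (K - I) * gsign I (K - I)) = gsign I (K - I)"
          by (simp only: mult.assoc[symmetric] mult_1)
        then show ?thesis by (simp add: I)
      qed
    qed auto
    then show ?thesis by (simp add: gmul_def)
  qed simp
qed

text \<open>Supercommutativity gives \<open>a a = - a a\<close>, and 2 is invertible.\<close>

lemma gmul_odd_square:
  fixes a :: "nat set \<Rightarrow> 'r::comm_ring_1"
  assumes odd: "\<And>I. even (card I) \<Longrightarrow> a I = 0" and half: "\<exists>y::'r. of_nat 2 * y = 1"
  shows "gmul a a = 0"
proof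
  fix K
  have "gconj a = - a"
    using odd by (auto simp: gconj_def fun_eq_iff uminus_power_if)
  then have "gmul a a = - gmul a a"
    using gmul_odd_swap[of a a] odd by (simp add: gmul_minus_left)
  then have "gmul a a K = - gmul a a K" by (metis uminus_apply)
  then have "of_nat 2 * gmul a a K = 0"
    by (metis add.right_inverse mult_2 of_nat_numeral)
  then show "gmul a a K = 0 K"
    using half by (metis mult.commute mult.left_commute mult.right_neutral mult_zero_right zero_fun_apply)
qed

section \<open>Index sets, supports and parity\<close>

lemma finite_idx: "I \<in> idx n \<Longrightarrow> finite I"
  by (auto simp: idx_def split: enat.splits intro: finite_subset)

lemma empty_idx [simp]: "{} \<in> idx n"
  by (auto simp: idx_def split: enat.splits)

lemma idx_subset: "I \<in> idx n \<Longrightarrow> J \<subseteq> I \<Longrightarrow> J \<in> idx n"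
  by (auto simp: idx_def split: enat.splits intro: finite_subset)

lemma idx_Un: "I \<in> idx n \<Longrightarrow> J \<in> idx n \<Longrightarrow> I \<union> J \<in> idx n"
  by (auto simp: idx_def split: enat.splits)

lemma idx_mono: "m \<le> n \<Longrightarrow> idx m \<subseteq> idx n"
  by (auto simp: idx_def split: enat.splits intro: finite_subset)

lemma idx_enat: "idx (enat n) = Pow {..<n}"
  by (simp add: idx_def)

lemma finite_idx_enat [simp]: "finite (idx (enat n))"
  by (simp add: idx_enat)

lemma coef_enat: "x \<in> coef (enat n) \<longleftrightarrow> (\<forall>I. x I \<noteq> 0 \<longrightarrow> I \<subseteq> {..<n})"
proof -
  have "finite (supp x)" if "supp x \<subseteq> Pow {..<n}"
    using finite_subset[OF that] by simp
  then show ?thesis by (auto simp: coef_def supp_def idx_enat)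
qed

lemma coef_nz: "x \<in> coef n \<Longrightarrow> x I \<noteq> 0 \<Longrightarrow> I \<in> idx n"
  by (auto simp: coef_def supp_def)

lemma coef_mono: "m \<le> n \<Longrightarrow> coef m \<subseteq> coef n"
  using idx_mono[of m n] by (auto simp: coef_def)

text \<open>Finitely many finite index sets involve only finitely many generators. This makes level
  infinity the union of the finite levels.\<close>

lemma coef_infinity: "x \<in> coef \<infinity> \<Longrightarrow> \<exists>N. x \<in> coef (enat N)"
proof -
  assume x: "x \<in> coef \<infinity>"
  then have "finite (\<Union> (supp x))" by (auto simp: coef_def idx_def)
  then obtain N where "\<Union> (supp x) \<subseteq> {..<N}"
    using finite_nat_iff_bounded by blast
  then show ?thesis by (auto simp: coef_enat supp_def intro!: exI[of _ N])
qed

lemma coef_zero [simp]: "0 \<in> coef n"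
  by (simp add: coef_def supp_def)

lemma coef_add: "x \<in> coef n \<Longrightarrow> y \<in> coef n \<Longrightarrow> x + y \<in> coef n"
  for x :: "nat set \<Rightarrow> 'e::monoid_add"
proof -
  assume "x \<in> coef n" "y \<in> coef n"
  moreover have "supp (x + y) \<subseteq> supp x \<union> supp y" by (auto simp: supp_def)
  ultimately show ?thesis unfolding coef_def by (auto intro: finite_subset)
qed

lemma coef_minus: "x \<in> coef n \<Longrightarrow> - x \<in> coef n"
  for x :: "nat set \<Rightarrow> 'e::group_add"
  by (simp add: coef_def supp_def)

lemma coef_diff: "x \<in> coef n \<Longrightarrow> y \<in> coef n \<Longrightarrow> x - y \<in> coef n"
  for x :: "nat set \<Rightarrow> 'e::group_add"
  using coef_add[of x n "- y"] coef_minus[of y n] by simp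

lemma (in module) coef_tmul:
  assumes "x \<in> coef n" "a \<in> coef n"
  shows "tmul scale x a \<in> coef n"
proof -
  have "supp (tmul scale x a) \<subseteq> (\<lambda>(I, J). I \<union> J) ` (supp x \<times> supp a)"
  proof
    fix K assume "K \<in> supp (tmul scale x a)"
    then have "tmul scale x a K \<noteq> 0" by (simp add: supp_def)
    then obtain I where I: "I \<subseteq> K" "(of_int (gsign I (K - I)) * a (K - I)) *s x I \<noteq> 0"
      unfolding tmul_def by (meson Pow_iff sum.not_neutral_contains_not_neutral)
    then have "I \<in> supp x" "K - I \<in> supp a" "K = I \<union> (K - I)"
      by (auto simp: supp_def)
    then show "K \<in> (\<lambda>(I, J). I \<union> J) ` (supp x \<times> supp a)" by blast
  qed
  moreover have "finite ((\<lambda>(I, J). I \<union> J) ` (supp x \<times> supp a))"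
    using assms by (auto simp: coef_def)
  moreover have "(\<lambda>(I, J). I \<union> J) ` (supp x \<times> supp a) \<subseteq> idx n"
    using assms by (auto simp: coef_def intro: idx_Un)
  ultimately show ?thesis unfolding coef_def by (auto intro: finite_subset)
qed

lemma coef_gmul: "a \<in> coef n \<Longrightarrow> b \<in> coef n \<Longrightarrow> gmul a b \<in> coef n"
  by (simp add: gmul_tmul module.coef_tmul[OF module_mult])

lemma (in module) tmul_not_supp:
  assumes "\<And>I. I \<subseteq> K \<Longrightarrow> x I = 0 \<or> a (K - I) = 0"
  shows "tmul scale x a K = 0"
  unfolding tmul_def
proof (intro sum.neutral ballI)
  fix I assume "I \<in> Pow K"
  with assms[of I] show "(of_int (gsign I (K - I)) * a (K - I)) *s x I = 0" by auto
qed

text \<open>\<open>p\<close> and \<open>q\<close> are parities, with \<open>True\<close> for even.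
  Cardinalities add under disjoint union, so the product lives in the parity
  \<open>p = q\<close>.\<close>

lemma (in module) tmul_parity:
  assumes "\<And>I. p \<noteq> even (card I) \<Longrightarrow> x I = 0" "\<And>I. q \<noteq> even (card I) \<Longrightarrow> a I = 0"
    and "(p = q) \<noteq> even (card K)"
  shows "tmul scale x a K = 0"
proof (cases "finite K")
  case True
  show ?thesis
  proof (rule tmul_not_supp)
    fix I assume "I \<subseteq> K"
    then have "card K = card I + card (K - I)"
      using True by (metis card_Diff_subset card_mono finite_subset le_add_diff_inverse)
    then show "x I = 0 \<or> a (K - I) = 0"
      using assms by (metis even_add)
  qed
qed simp

lemma grass0_iff: "a \<in> grass0 n \<longleftrightarrow> a \<in> coef n \<and> (\<forall>I. odd (card I) \<longrightarrow> a I = 0)"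
  by (simp add: grass0_def grass_def)

lemma grass1_iff: "a \<in> grass1 n \<longleftrightarrow> a \<in> coef n \<and> (\<forall>I. even (card I) \<longrightarrow> a I = 0)"
  by (simp add: grass1_def grass_def)

lemma grass0_gmul: "a \<in> grass0 n \<Longrightarrow> b \<in> grass0 n \<Longrightarrow> gmul a b \<in> grass0 n"
  unfolding grass0_iff gmul_tmul
  by (auto intro: module.coef_tmul[OF module_mult]
      module.tmul_parity[OF module_mult, where p = True and q = True])

lemma grass1_gmul: "a \<in> grass1 n \<Longrightarrow> b \<in> grass1 n \<Longrightarrow> gmul a b \<in> grass0 n"
  unfolding grass0_iff grass1_iff gmul_tmul
  by (auto intro: module.coef_tmul[OF module_mult]
      module.tmul_parity[OF module_mult, where p = False and q = False])

lemma grass01_gmul: "a \<in> grass0 n \<Longrightarrow> b \<in> grass1 n \<Longrightarrow> gmul a b \<in> grass1 n"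
  unfolding grass0_iff grass1_iff gmul_tmul
  by (auto intro: module.coef_tmul[OF module_mult]
      module.tmul_parity[OF module_mult, where p = True and q = False])

lemma grass0_add: "a \<in> grass0 n \<Longrightarrow> b \<in> grass0 n \<Longrightarrow> a + b \<in> grass0 n"
  by (simp add: grass0_iff coef_add)

lemma grass1_add: "a \<in> grass1 n \<Longrightarrow> b \<in> grass1 n \<Longrightarrow> a + b \<in> grass1 n"
  by (simp add: grass1_iff coef_add)

lemma grass0_diff: "a \<in> grass0 n \<Longrightarrow> b \<in> grass0 n \<Longrightarrow> a - b \<in> grass0 n"
  by (simp add: grass0_iff coef_diff)

lemma grass0_zero [simp]: "0 \<in> grass0 n"
  by (simp add: grass0_iff)

lemma grass0_mono: "m \<le> n \<Longrightarrow> grass0 m \<subseteq> grass0 n"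
  using coef_mono[of m n] by (auto simp: grass0_iff)

lemma grass1_mono: "m \<le> n \<Longrightarrow> grass1 m \<subseteq> grass1 n"
  using coef_mono[of m n] by (auto simp: grass1_iff)

lemma ev_iff: "x \<in> ev n \<longleftrightarrow> x \<in> coef n \<and>
    (\<forall>I. (even (card I) \<longrightarrow> snd (x I) = 0) \<and> (odd (card I) \<longrightarrow> fst (x I) = 0))"
  by (simp add: ev_def)

lemma ev_add: "x \<in> ev n \<Longrightarrow> y \<in> ev n \<Longrightarrow> x + y \<in> ev n"
  for x :: "nat set \<Rightarrow> 'a::ab_group_add \<times> 'b::ab_group_add"
  by (simp add: ev_iff coef_add)

lemma ev_diff: "x \<in> ev n \<Longrightarrow> y \<in> ev n \<Longrightarrow> x - y \<in> ev n"
  for x :: "nat set \<Rightarrow> 'a::ab_group_add \<times> 'b::ab_group_add"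
  by (simp add: ev_iff coef_diff)

lemma ev_zero [simp]: "0 \<in> ev n"
  by (simp add: ev_iff)

lemma ev_mono: "m \<le> n \<Longrightarrow> ev m \<subseteq> ev n"
  using coef_mono[of m n] by (auto simp: ev_iff)

lemma ev_infinity: "x \<in> ev \<infinity> \<Longrightarrow> \<exists>N. x \<in> ev (enat N)"
  using coef_infinity by (auto simp: ev_iff)

lemma grass0_infinity: "a \<in> grass0 \<infinity> \<Longrightarrow> \<exists>N. a \<in> grass0 (enat N)"
  using coef_infinity by (auto simp: grass0_iff)

lemma module_esmul:
  assumes "module s0" "module s1"
  shows "module (esmul s0 s1)"
proof -
  interpret a: module s0 by fact
  interpret b: module s1 by fact
  show ?thesis
    by unfold_locales
      (auto simp: esmul_def a.scale_right_distrib b.scale_right_distrib a.scale_left_distrib b.scale_left_distrib)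
qed

lemma ev_tmul:
  assumes "module s0" "module s1" "x \<in> ev n" "a \<in> grass0 n"
  shows "tmul (esmul s0 s1) x a \<in> ev n"
proof -
  interpret a: module s0 by fact
  interpret b: module s1 by fact
  interpret m: module "esmul s0 s1" by (rule module_esmul) fact+
  have f: "fst (tmul (esmul s0 s1) x a K) = tmul s0 (\<lambda>I. fst (x I)) a K" for K
    by (simp add: tmul_def esmul_def fst_sum)
  have s: "snd (tmul (esmul s0 s1) x a K) = tmul s1 (\<lambda>I. snd (x I)) a K" for K
    by (simp add: tmul_def esmul_def snd_sum)
  show ?thesis
    using assms unfolding ev_iff grass0_iff f s
    by (auto intro!: m.coef_tmul a.tmul_parity[where p = True and q = True]
        b.tmul_parity[where p = False and q = True])
qed

text \<open>The embedding of R as the constants; through it linearity over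
  \<open>\<lambda>\<^sub>0\<close> is compared with linearity over R.\<close>

abbreviation rc :: "'r::comm_ring_1 \<Rightarrow> nat set \<Rightarrow> 'r" where "rc r \<equiv> gsmul r gone"

lemma rc_apply: "rc r K = (if K = {} then r else 0)"
  by (simp add: gsmul_def gone_def)

lemma rc_empty [simp]: "rc r {} = r" and rc_nonempty [simp]: "K \<noteq> {} \<Longrightarrow> rc r K = 0"
  by (simp_all add: rc_apply)

lemma rc_grass0 [simp]: "rc r \<in> grass0 n"
  by (auto simp: grass0_iff coef_def supp_def rc_apply intro: finite_subset[of _ "{{}}"])

lemma rc_zero [simp]: "rc 0 = 0"
  by (simp add: fun_eq_iff rc_apply)

lemma rc_one: "rc 1 = gone"
  by (simp add: fun_eq_iff rc_apply gone_def)

lemma rc_add: "rc (r + s) = rc r + rc s"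
  by (simp add: fun_eq_iff rc_apply)

lemma (in module) tmul_rc: "finite K \<Longrightarrow> tmul scale x (rc r) K = r *s x K"
proof -
  assume K: "finite K"
  have "tmul scale x (rc r) K = (\<Sum>I\<in>Pow K. if I = K then r *s x K else 0)"
    unfolding tmul_def by (intro sum.cong) (auto simp: rc_apply)
  also have "\<dots> = r *s x K" using K by simp
  finally show ?thesis .
qed

lemma coef_infinite: "x \<in> coef n \<Longrightarrow> infinite K \<Longrightarrow> x K = 0"
  using coef_nz finite_idx by blast

text \<open>The support condition takes care of infinite \<open>K\<close>, where the left side is 0
  by convention.\<close>

lemma (in module) tmul_rc_coef: "x \<in> coef n \<Longrightarrow> tmul scale x (rc r) = tsmul scale x r"
proof
  fix K assume "x \<in> coef n"
  then show "tmul scale x (rc r) K = tsmul scale x r K"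
    by (cases "finite K") (auto simp: tmul_rc tsmul_def coef_infinite)
qed

lemma (in module) tmul_gone: "x \<in> coef n \<Longrightarrow> tmul scale x gone = x"
  using tmul_rc_coef[of x n 1] by (simp add: rc_one tsmul_def fun_eq_iff)

lemma gmul_rc_right: "finite K \<Longrightarrow> gmul a (rc r) K = r * a K"
  by (simp add: gmul_tmul module.tmul_rc[OF module_mult])

lemma gmul_rc_left: "finite K \<Longrightarrow> gmul (rc r) a K = r * a K"
  by (subst gmul_even_commute) (auto simp: gmul_rc_right rc_apply)

lemma gmul_gone: "a \<in> coef n \<Longrightarrow> gmul a gone = a" "a \<in> coef n \<Longrightarrow> gmul gone a = a"
proof -
  assume a: "a \<in> coef n"
  show "gmul a gone = a"
    using module.tmul_gone[OF module_mult a] by (simp add: gmul_tmul)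
  then show "gmul gone a = a"
    by (subst gmul_even_commute) (auto simp: gone_def)
qed

lemma rc_mult: "rc (r * s) = gmul (rc r) (rc s)"
proof
  fix K :: "nat set" show "rc (r * s) K = gmul (rc r) (rc s) K"
    by (cases "finite K") (auto simp: gmul_rc_left rc_apply)
qed

lemma grass0_commute: "a \<in> grass0 n \<Longrightarrow> gmul a b = gmul b a"
  by (rule gmul_even_commute) (auto simp: grass0_iff)

lemma gmul_empty: "gmul a b {} = a {} * b {}"
  by (simp add: gmul_def)

lemma (in module) tmul_empty: "tmul scale x b {} = b {} *s x {}"
  by (simp add: tmul_def)

text \<open>Induction on the size of the index set: modulo smaller index sets, \<open>t\<close> acts by its body.\<close>
lemma (in module) tmul_unit_cancel:
  assumes x: "x \<in> coef n" and y: "y \<in> coef n" and u: "t {} * u = 1"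
    and eq: "tmul scale x t = tmul scale y t"
  shows "x = y"
proof -
  define d where "d = x - y"
  have d: "d \<in> coef n" unfolding d_def using x y by (rule coef_diff)
  have dt: "tmul scale d t = 0" using eq by (simp add: d_def tmul_diff_left)
  have "d K = 0" if "finite K" for K
    using that
  proof (induction K rule: finite_psubset_induct)
    case (psubset K)
    have "0 = tmul scale d t K" by (simp add: dt)
    also have "\<dots> = (\<Sum>I\<in>Pow K. if I = K then t {} *s d K else 0)"
      unfolding tmul_def using psubset.IH by (intro sum.cong) auto
    also have "\<dots> = t {} *s d K" using psubset.hyps by simp
    finally have "(t {} * u) *s d K = 0"
      by (metis mult.commute scale_scale scale_zero_right)
    then show ?case by (simp add: u)
  qed
  then have "d = 0" using coef_infinite[OF d] by (auto simp: fun_eq_iff)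
  then show ?thesis by (simp add: d_def)
qed

section \<open>Functoriality\<close>

text \<open>The elementary tensor of the vector \<open>c\<close> with the algebra element
  \<open>u\<close>.\<close>

definition ten :: "('r \<Rightarrow> 'e \<Rightarrow> 'e) \<Rightarrow> (nat set \<Rightarrow> 'r) \<Rightarrow> 'e \<Rightarrow> nat set \<Rightarrow> 'e" where
  "ten s u c K = s (u K) c"

lemma gbasis_coef: "I \<in> idx n \<Longrightarrow> gbasis I \<in> coef n"
  by (auto simp: coef_def supp_def gbasis_def intro: finite_subset[of _ "{I}"])

lemma gbasis_empty: "gbasis {} = gone"
  by (simp add: fun_eq_iff gbasis_def gone_def)

lemma gsmul_coef: "a \<in> coef n \<Longrightarrow> gsmul r a \<in> coef n"
proof -
  assume "a \<in> coef n"
  moreover have "supp (gsmul r a) \<subseteq> supp a" by (auto simp: supp_def gsmul_def)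
  ultimately show ?thesis unfolding coef_def by (auto intro: finite_subset)
qed

lemma gsmul_grass0: "a \<in> grass0 n \<Longrightarrow> gsmul r a \<in> grass0 n"
  by (simp add: grass0_iff gsmul_coef) (simp add: gsmul_def)

lemma gsmul_grass1: "a \<in> grass1 n \<Longrightarrow> gsmul r a \<in> grass1 n"
  by (simp add: grass1_iff gsmul_coef) (simp add: gsmul_def)

lemma gbasis_grass0: "I \<in> idx n \<Longrightarrow> even (card I) \<Longrightarrow> gbasis I \<in> grass0 n"
  by (auto simp: grass0_iff gbasis_coef) (auto simp: gbasis_def)

lemma gbasis_grass1: "I \<in> idx n \<Longrightarrow> odd (card I) \<Longrightarrow> gbasis I \<in> grass1 n"
  by (auto simp: grass1_iff gbasis_coef) (auto simp: gbasis_def)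

lemma gmul_gsmul_left: "gmul (gsmul r a) b = gsmul r (gmul a b)"
  by (auto simp: fun_eq_iff gmul_def gsmul_def sum_distrib_left mult_ac)

section \<open>Morphisms and their action on coefficient families\<close>

lemma ghomD:
  assumes "ghom m n \<phi>"
  shows "a \<in> coef m \<Longrightarrow> \<phi> a \<in> coef n"
    and "a \<in> coef m \<Longrightarrow> b \<in> coef m \<Longrightarrow> \<phi> (a + b) = \<phi> a + \<phi> b"
    and "a \<in> coef m \<Longrightarrow> \<phi> (gsmul r a) = gsmul r (\<phi> a)"
    and "a \<in> coef m \<Longrightarrow> b \<in> coef m \<Longrightarrow> \<phi> (gmul a b) = gmul (\<phi> a) (\<phi> b)"
    and "\<phi> gone = gone"
    and "a \<in> grass0 m \<Longrightarrow> \<phi> a \<in> grass0 n"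
    and "a \<in> grass1 m \<Longrightarrow> \<phi> a \<in> grass1 n"
  using assms by (simp_all add: ghom_def grass_def)

lemma ghomI:
  assumes "\<And>a. a \<in> coef m \<Longrightarrow> \<phi> a \<in> coef n"
    and "\<And>a b. a \<in> coef m \<Longrightarrow> b \<in> coef m \<Longrightarrow> \<phi> (a + b) = \<phi> a + \<phi> b"
    and "\<And>r a. a \<in> coef m \<Longrightarrow> \<phi> (gsmul r a) = gsmul r (\<phi> a)"
    and "\<And>a b. a \<in> coef m \<Longrightarrow> b \<in> coef m \<Longrightarrow> \<phi> (gmul a b) = gmul (\<phi> a) (\<phi> b)"
    and "\<phi> gone = gone"
    and "\<And>a. a \<in> grass0 m \<Longrightarrow> \<phi> a \<in> grass0 n"
    and "\<And>a. a \<in> grass1 m \<Longrightarrow> \<phi> a \<in> grass1 n"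
  shows "ghom m n \<phi>"
  using assms by (simp add: ghom_def grass_def)

lemma ghom_zero: "ghom m n \<phi> \<Longrightarrow> \<phi> 0 = 0"
proof -
  assume "ghom m n \<phi>"
  then have "\<phi> (gsmul 0 0) = gsmul 0 (\<phi> 0)" by (rule ghomD) simp
  moreover have "gsmul 0 a = 0" for a :: "nat set \<Rightarrow> 'a" by (simp add: fun_eq_iff gsmul_def)
  ultimately show ?thesis by simp
qed

lemma ghom_rc: "ghom m n \<phi> \<Longrightarrow> \<phi> (rc r) = rc r"
  using ghomD(3)[of m n \<phi> gone r] ghomD(5)[of m n \<phi>] gbasis_coef[of "{}" m]
  by (simp add: gbasis_empty)

context module begin

lemma tmul_ten: "tmul scale (ten scale u c) a = ten scale (gmul u a) c"
  by (simp add: fun_eq_iff tmul_def ten_def gmul_def scale_sum_left mult_ac)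

lemma ten_coef: "a \<in> coef n \<Longrightarrow> ten scale a c \<in> coef n"
proof -
  assume "a \<in> coef n"
  moreover have "supp (ten scale a c) \<subseteq> supp a" by (auto simp: supp_def ten_def)
  ultimately show ?thesis unfolding coef_def by (auto intro: finite_subset)
qed

lemma ten_gbasis: "ten scale (gbasis I) c = (\<lambda>K. if K = I then c else 0)"
  by (auto simp: fun_eq_iff ten_def gbasis_def)

text \<open>A family of finite support is built up by adding one tensor of a vector with a monomial
  at a time, so additive identities need only be checked on elementary tensors.\<close>

lemma coef_induct [consumes 1, case_names zero add]:
  fixes x :: "nat set \<Rightarrow> 'b"
  assumes x: "x \<in> coef n" and zero: "P 0"
    and add: "\<And>x I c. x \<in> coef n \<Longrightarrow> I \<in> idx n \<Longrightarrow> P x \<Longrightarrow> P (x + ten scale (gbasis I) c)"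
  shows "P x"
proof -
  have "\<forall>x :: nat set \<Rightarrow> 'b. supp x \<subseteq> A \<longrightarrow> x \<in> coef n \<longrightarrow> P x" if "finite A" for A
    using that
  proof (induction A)
    case empty
    have "x = 0" if "supp x \<subseteq> {}" for x :: "nat set \<Rightarrow> 'b"
      using that by (auto simp: supp_def fun_eq_iff)
    then show ?case using zero by blast
  next
    case (insert I A)
    show ?case
    proof (intro allI impI)
      fix x :: "nat set \<Rightarrow> 'b" assume x: "supp x \<subseteq> insert I A" "x \<in> coef n"
      show "P x"
      proof (cases "x I = 0")
        case True then show ?thesis using x insert.IH by (auto simp: supp_def)
      next
        case False
        define y where "y = x(I := 0)"
        have "supp y \<subseteq> supp x" by (auto simp: y_def supp_def)
        moreover have "supp y \<subseteq> A" using x by (auto simp: y_def supp_def)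
        ultimately have y: "supp y \<subseteq> A" "y \<in> coef n"
          using x by (auto simp: coef_def intro: finite_subset)
        have "x = y + ten scale (gbasis I) (x I)"
          by (auto simp: fun_eq_iff y_def ten_gbasis)
        moreover have "P (y + ten scale (gbasis I) (x I))"
          using y insert.IH x(2) False by (intro add) (auto intro: coef_nz)
        ultimately show ?thesis by simp
      qed
    qed
  qed
  then show ?thesis using x by (auto simp: coef_def)
qed

lemma tmap_superset:
  assumes "finite A" "supp x \<subseteq> A"
  shows "tmap scale \<phi> x K = (\<Sum>I\<in>A. \<phi> (gbasis I) K *s x I)"
  unfolding tmap_def using assms by (intro sum.mono_neutral_left) (auto simp: supp_def)

lemma tmap_zero [simp]: "tmap scale \<phi> 0 = 0"
  by (simp add: fun_eq_iff tmap_def supp_def)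

lemma tmap_add:
  assumes "x \<in> coef m" "y \<in> coef m"
  shows "tmap scale \<phi> (x + y) = tmap scale \<phi> x + tmap scale \<phi> y"
proof
  fix K
  let ?A = "supp x \<union> supp y"
  have A: "finite ?A" using assms by (auto simp: coef_def)
  have "supp (x + y) \<subseteq> ?A" by (auto simp: supp_def)
  then show "tmap scale \<phi> (x + y) K = (tmap scale \<phi> x + tmap scale \<phi> y) K"
    using A by (simp add: tmap_superset[of ?A] scale_right_distrib sum.distrib)
qed

lemma tmap_minus:
  "tmap scale \<phi> (- x) = - tmap scale \<phi> x"
  by (simp add: fun_eq_iff tmap_def supp_def sum_negf)

lemma tmap_diff:
  assumes "x \<in> coef m" "y \<in> coef m"
  shows "tmap scale \<phi> (x - y) = tmap scale \<phi> x - tmap scale \<phi> y"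
  using tmap_add[of x m "- y" \<phi>] assms coef_minus[of y] by (simp add: tmap_minus)

end

lemma ten_mult: "ten (*) u c = gsmul c u"
  by (simp add: fun_eq_iff ten_def gsmul_def)

text \<open>A morphism is R-linear, hence determined by its values on the monomials. Facts about
  \<open>tmap\<close> thereby apply to the morphism itself.\<close>

lemma ghom_tmap:
  fixes \<phi> :: "(nat set \<Rightarrow> 'r::comm_ring_1) \<Rightarrow> nat set \<Rightarrow> 'r"
  assumes "ghom m n \<phi>" "a \<in> coef m"
  shows "\<phi> a = tmap (*) \<phi> a"
  using assms(2)
proof (induction a rule: module.coef_induct[OF module_mult, consumes 1, case_names zero add])
  case zero
  then show ?case using ghom_zero[OF assms(1)] by (simp add: module.tmap_zero[OF module_mult] del: zero_fun_apply)
next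
  case (add x I c)
  have b: "(gbasis I :: nat set \<Rightarrow> 'r) \<in> coef m" "gsmul c (gbasis I) \<in> coef m"
    using add by (auto intro: gbasis_coef gsmul_coef)
  have "tmap (*) \<phi> (gsmul c (gbasis I)) = gsmul c (\<phi> (gbasis I))"
  proof
    fix K
    have "supp (gsmul c (gbasis I)) \<subseteq> {I}" by (auto simp: supp_def gsmul_def gbasis_def)
    then show "tmap (*) \<phi> (gsmul c (gbasis I)) K = gsmul c (\<phi> (gbasis I)) K"
      by (subst module.tmap_superset[OF module_mult, of "{I}"]) (auto simp: gsmul_def gbasis_def)
  qed
  then show ?case
    using add b by (simp add: ten_mult ghomD[OF assms(1)] module.tmap_add[OF module_mult] del: plus_fun_apply)
qed

context module begin

lemma tmap_ten:
  assumes "ghom m n \<phi>" "a \<in> coef m"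
  shows "tmap scale \<phi> (ten scale a c) = ten scale (\<phi> a) c"
proof
  fix K
  have f: "finite (supp a)" using assms by (simp add: coef_def)
  have "supp (ten scale a c) \<subseteq> supp a" by (auto simp: supp_def ten_def)
  then have "tmap scale \<phi> (ten scale a c) K = (\<Sum>I\<in>supp a. \<phi> (gbasis I) K *s (a I *s c))"
    using f by (simp add: tmap_superset[of "supp a"] ten_def)
  also have "\<dots> = ten scale (tmap (*) \<phi> a) c K"
    by (simp add: ten_def tmap_def scale_sum_left)
  finally show "tmap scale \<phi> (ten scale a c) K = ten scale (\<phi> a) c K"
    by (simp add: ghom_tmap[OF assms])
qed

lemma coef_tmap:
  assumes \<phi>: "ghom m n \<phi>" and "x \<in> coef m"
  shows "tmap scale \<phi> x \<in> coef n"
  using assms(2)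
proof (induction x rule: coef_induct)
  case (add x I c)
  then have "(gbasis I :: nat set \<Rightarrow> 'a) \<in> coef m" by (auto intro: gbasis_coef)
  then show ?case
    using add by (simp add: tmap_add[where m = m] ten_coef tmap_ten[OF \<phi>] coef_add ghomD[OF \<phi>] del: plus_fun_apply)
qed (simp del: zero_fun_apply)

text \<open>The map \<open>id \<otimes> \<phi>\<close> is semilinear along \<open>\<phi>\<close>; on
  elementary tensors this is the multiplicativity of \<open>\<phi>\<close>.\<close>

lemma tmap_tmul:
  assumes \<phi>: "ghom m n \<phi>" and "x \<in> coef m" and a: "a \<in> coef m"
  shows "tmap scale \<phi> (tmul scale x a) = tmul scale (tmap scale \<phi> x) (\<phi> a)"
  using assms(2)
proof (induction x rule: coef_induct)
  case (add x I c)
  then have "(gbasis I :: nat set \<Rightarrow> 'a) \<in> coef m" by (auto intro: gbasis_coef)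
  then show ?case
    using add a
    by (simp add: tmap_add[where m = m] tmul_add_left ten_coef coef_tmul tmap_ten[OF \<phi>] tmul_ten
        coef_gmul ghomD[OF \<phi>] del: plus_fun_apply)
qed (simp del: zero_fun_apply)

end

text \<open>Sorting the generator \<open>i\<close> to the front costs a sign that is its own
  inverse. If \<open>card I\<close> is even, both factors are odd, which exhibits an even monomial
  of positive degree as a product of two odd elements.\<close>

lemma gbasis_split:
  assumes "finite I" "i \<in> I"
  shows "(gbasis I :: nat set \<Rightarrow> 'a::comm_ring_1) = gmul (gsmul (of_int (gsign {i} (I - {i}))) (gbasis {i})) (gbasis (I - {i}))"
proof
  fix K
  show "(gbasis I K :: 'a) = gmul (gsmul (of_int (gsign {i} (I - {i}))) (gbasis {i})) (gbasis (I - {i})) K"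
  proof (cases "finite K")
    case True
    have eq: "K = I" if "{i} \<subseteq> K" "K - {i} = I - {i}" using that assms by auto
    have "(gmul (gbasis {i}) (gbasis (I - {i})) K :: 'a)
        = (\<Sum>J\<in>Pow K. if J = {i} then of_int (gsign {i} (K - {i})) * gbasis (I - {i}) (K - {i}) else 0)"
      unfolding gmul_def by (intro sum.cong) (auto simp: gbasis_def)
    also have "\<dots> = (if i \<in> K then of_int (gsign {i} (K - {i})) * gbasis (I - {i}) (K - {i}) else 0)"
      using True by simp
    also have "\<dots> = of_int (gsign {i} (I - {i})) * gbasis I K"
      using assms eq by (auto simp: gbasis_def)
    finally have "(gmul (gbasis {i}) (gbasis (I - {i})) K :: 'a) = of_int (gsign {i} (I - {i})) * gbasis I K" .
    moreover have "of_int (gsign {i} (I - {i})) * of_int (gsign {i} (I - {i})) = (1 :: 'a)"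
      by (simp flip: of_int_mult)
    ultimately show ?thesis
      by (simp add: gmul_gsmul_left gsmul_def flip: mult.assoc)
  qed (use assms in \<open>auto simp: gbasis_def\<close>)
qed

text \<open>A monomial of positive even degree is a product of two odd monomials, and odd elements have
  vanishing body.\<close>
lemma ghom_body_gbasis:
  fixes \<phi> :: "(nat set \<Rightarrow> 'a::comm_ring_1) \<Rightarrow> nat set \<Rightarrow> 'a"
  assumes \<phi>: "ghom m n \<phi>" and I: "I \<in> idx m" "I \<noteq> {}"
  shows "\<phi> (gbasis I) {} = 0"
proof (cases "odd (card I)")
  case True
  then show ?thesis using ghomD(7)[OF \<phi> gbasis_grass1[of I m]] I by (simp add: grass1_iff)
next
  case False
  obtain i where i: "i \<in> I" using I by auto
  have f: "finite I" using I finite_idx by blast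
  have c: "(gbasis {i} :: nat set \<Rightarrow> 'a) \<in> coef m" "(gbasis (I - {i}) :: nat set \<Rightarrow> 'a) \<in> coef m"
    using I i by (auto intro!: gbasis_coef intro: idx_subset)
  have "\<phi> (gbasis I) = gmul (gsmul (of_int (gsign {i} (I - {i}))) (\<phi> (gbasis {i}))) (\<phi> (gbasis (I - {i})))"
    using c by (subst gbasis_split[OF f i]) (simp only: ghomD(3)[OF \<phi>] ghomD(4)[OF \<phi>] gsmul_coef)
  moreover have "\<phi> (gbasis {i}) {} = 0"
    using ghomD(7)[OF \<phi> gbasis_grass1[of "{i}" m]] I i idx_subset[of I m "{i}"] by (auto simp: grass1_iff)
  ultimately show ?thesis by (simp add: gmul_empty gsmul_def)
qed

text \<open>All monomials other than 1 are sent to elements without body, so only the coefficient at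
  \<open>{}\<close> contributes. Every condition on bodies is therefore respected by all
  morphisms.\<close>

lemma (in module) tmap_body:
  assumes \<phi>: "ghom m n \<phi>" and "x \<in> coef m"
  shows "tmap scale \<phi> x {} = x {}"
proof -
  have f: "finite (insert {} (supp x))" using assms by (simp add: coef_def)
  have "tmap scale \<phi> x {} = (\<Sum>I\<in>insert {} (supp x). \<phi> (gbasis I) {} *s x I)"
    using f by (intro tmap_superset) auto
  also have "\<dots> = (\<Sum>I\<in>insert {} (supp x). if I = {} then x I else 0)"
  proof (intro sum.cong refl, goal_cases)
    case (1 I)
    then show ?case
      using assms ghom_body_gbasis[OF \<phi>, of I]
      by (cases "I = {}") (auto simp: gbasis_empty ghomD(5)[OF \<phi>] gone_def coef_def)
  qed
  also have "\<dots> = x {}" using f by (simp add: sum.delta)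
  finally show ?thesis .
qed

lemma ghom_body: "ghom m n \<phi> \<Longrightarrow> a \<in> coef m \<Longrightarrow> \<phi> a {} = a {}"
  using module.tmap_body[OF module_mult, of m n \<phi> a] ghom_tmap[of m n \<phi> a] by simp

lemma ev_tmap:
  assumes s: "module s0" "module s1" and \<phi>: "ghom m n \<phi>" and x: "x \<in> ev m"
  shows "tmap (esmul s0 s1) \<phi> x \<in> ev n"
proof -
  interpret a: module s0 by fact
  interpret b: module s1 by fact
  interpret m: module "esmul s0 s1" by (rule module_esmul) fact+
  have xc: "x \<in> coef m" using x by (simp add: ev_iff)
  have I: "I \<in> idx m" if "I \<in> supp x" for I using that xc by (auto simp: coef_def)
  have "fst (tmap (esmul s0 s1) \<phi> x K) = 0" if "odd (card K)" for K
    unfolding tmap_def fst_sum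
  proof (intro sum.neutral ballI)
    fix I assume "I \<in> supp x"
    with I that x ghomD(6)[OF \<phi> gbasis_grass0[of I m]] show "fst (esmul s0 s1 (\<phi> (gbasis I) K) (x I)) = 0"
      by (cases "even (card I)") (auto simp: esmul_def grass0_iff ev_iff)
  qed
  moreover have "snd (tmap (esmul s0 s1) \<phi> x K) = 0" if "even (card K)" for K
    unfolding tmap_def snd_sum
  proof (intro sum.neutral ballI)
    fix I assume "I \<in> supp x"
    with I that x ghomD(7)[OF \<phi> gbasis_grass1[of I m]] show "snd (esmul s0 s1 (\<phi> (gbasis I) K) (x I)) = 0"
      by (cases "even (card I)") (auto simp: esmul_def grass1_iff ev_iff)
  qed
  ultimately show ?thesis
    using m.coef_tmap[OF \<phi> xc] by (simp add: ev_iff)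
qed

section \<open>Inclusions, rescalings, the augmentation and substitutions\<close>

lemma ghom_source_mono: "ghom m n \<phi> \<Longrightarrow> m' \<le> m \<Longrightarrow> ghom m' n \<phi>"
  by (rule ghomI) (use coef_mono grass0_mono grass1_mono in \<open>blast dest: ghomD\<close>)+

lemma ghom_id: "m \<le> n \<Longrightarrow> ghom m n (\<lambda>a. a)"
  by (rule ghomI) (use coef_mono[of m n] grass0_mono[of m n] grass1_mono[of m n] in auto)

lemma (in module) tmap_id: "x \<in> coef m \<Longrightarrow> tmap scale (\<lambda>a. a) x = x"
proof (induction x rule: coef_induct)
  case (add x I c)
  then have "(gbasis I :: nat set \<Rightarrow> 'a) \<in> coef m" by (auto intro: gbasis_coef)
  then show ?case
    using add by (simp add: tmap_add[where m = m] ten_coef tmap_ten[OF ghom_id[OF order_refl]] del: plus_fun_apply)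
qed (simp del: zero_fun_apply)

text \<open>Each generator is multiplied by its own factor \<open>s i\<close>; the map is
  multiplicative because \<open>prod s\<close> splits over disjoint unions.\<close>

lemma ghom_diag: "ghom n n (\<lambda>(a :: nat set \<Rightarrow> 'r::comm_ring_1) I. prod s I * a I)"
proof (rule ghomI)
  fix a :: "nat set \<Rightarrow> 'r" assume a: "a \<in> coef n"
  have "supp (\<lambda>I. prod s I * a I) \<subseteq> supp a" by (auto simp: supp_def)
  with a show "(\<lambda>I. prod s I * a I) \<in> coef n"
    by (auto simp: coef_def intro: finite_subset)
next
  fix a b :: "nat set \<Rightarrow> 'r"
  show "(\<lambda>I. prod s I * gmul a b I) = gmul (\<lambda>I. prod s I * a I) (\<lambda>I. prod s I * b I)"
  proof
    fix K
    show "prod s K * gmul a b K = gmul (\<lambda>I. prod s I * a I) (\<lambda>I. prod s I * b I) K"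
    proof (cases "finite K")
      case True
      have "prod s K * (of_int (gsign I (K - I)) * a I * b (K - I))
        = of_int (gsign I (K - I)) * (prod s I * a I) * (prod s (K - I) * b (K - I))" if "I \<subseteq> K" for I
      proof -
        have "prod s K = prod s I * prod s (K - I)"
          using True that by (metis mult.commute prod.subset_diff)
        then show ?thesis by (simp add: mult_ac)
      qed
      then show ?thesis unfolding gmul_def sum_distrib_left by (intro sum.cong) auto
    qed simp
  qed
next
  fix a :: "nat set \<Rightarrow> 'r" assume a: "a \<in> grass0 n"
  have "supp (\<lambda>I. prod s I * a I) \<subseteq> supp a" by (auto simp: supp_def)
  with a show "(\<lambda>I. prod s I * a I) \<in> grass0 n"
    by (auto simp: grass0_iff coef_def intro: finite_subset)
next
  fix a :: "nat set \<Rightarrow> 'r" assume a: "a \<in> grass1 n"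
  have "supp (\<lambda>I. prod s I * a I) \<subseteq> supp a" by (auto simp: supp_def)
  with a show "(\<lambda>I. prod s I * a I) \<in> grass1 n"
    by (auto simp: grass1_iff coef_def intro: finite_subset)
qed (auto simp: fun_eq_iff distrib_left gsmul_def gone_def mult_ac)

lemma (in module) tmap_diag:
  assumes "x \<in> coef m"
  shows "tmap scale (\<lambda>a I. prod s I * a I) x = (\<lambda>K. prod s K *s x K)"
  using assms
proof (induction x rule: coef_induct)
  case (add x I c)
  then have "(gbasis I :: nat set \<Rightarrow> 'a) \<in> coef m" by (auto intro: gbasis_coef)
  then have "tmap scale (\<lambda>a I. prod s I * a I) (x + ten scale (gbasis I) c)
      = (\<lambda>K. prod s K *s x K) + ten scale (\<lambda>K. prod s K * gbasis I K) c"
    using add by (simp add: tmap_add[where m = m] ten_coef tmap_ten[OF ghom_diag])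
  also have "\<dots> = (\<lambda>K. prod s K *s (x + ten scale (gbasis I) c) K)"
    by (simp add: fun_eq_iff ten_def scale_right_distrib)
  finally show ?case .
qed (simp add: fun_eq_iff tmap_def supp_def)

lemma ghom_geps: "ghom m n (geps :: (nat set \<Rightarrow> 'r::comm_ring_1) \<Rightarrow> _)"
proof (rule ghomI)
  have "supp (geps a) \<subseteq> {{}}" for a :: "nat set \<Rightarrow> 'r" by (auto simp: supp_def geps_def)
  then show c: "geps a \<in> coef n" for a :: "nat set \<Rightarrow> 'r"
    by (simp add: coef_def) (metis empty_idx finite.emptyI finite_insert finite_subset insert_subset empty_subsetI subset_trans)
  show "a \<in> grass0 m \<Longrightarrow> geps a \<in> grass0 n" for a :: "nat set \<Rightarrow> 'r"
    using c by (auto simp: grass0_iff) (auto simp: geps_def)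
  show "a \<in> grass1 m \<Longrightarrow> geps a \<in> grass1 n" for a :: "nat set \<Rightarrow> 'r"
    using c by (auto simp: grass1_iff) (auto simp: geps_def)
  fix a b :: "nat set \<Rightarrow> 'r"
  show "geps (gmul a b) = gmul (geps a) (geps b)"
  proof
    fix K show "geps (gmul a b) K = gmul (geps a) (geps b) K"
    proof (cases "K = {}")
      case False
      have "gmul (geps a) (geps b) K = 0"
        unfolding gmul_tmul using False by (intro module.tmul_not_supp[OF module_mult]) (auto simp: geps_def)
      with False show ?thesis by (simp add: geps_def)
    qed (simp add: geps_def gmul_empty)
  qed
qed (auto simp: fun_eq_iff geps_def gsmul_def gone_def)

lemma (in module) tmap_geps:
  assumes "x \<in> coef m"
  shows "tmap scale geps x = (\<lambda>K. if K = {} then x {} else 0)"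
  using assms
proof (induction x rule: coef_induct)
  case (add x I c)
  then have "(gbasis I :: nat set \<Rightarrow> 'a) \<in> coef m" by (auto intro: gbasis_coef)
  then have "tmap scale geps (x + ten scale (gbasis I) c)
      = (\<lambda>K. if K = {} then x {} else 0) + ten scale (geps (gbasis I)) c"
    using add by (simp add: tmap_add[where m = m] ten_coef tmap_ten[OF ghom_geps[of m m]])
  also have "\<dots> = (\<lambda>K. if K = {} then (x + ten scale (gbasis I) c) {} else 0)"
    by (simp add: fun_eq_iff ten_def geps_def)
  finally show ?case .
qed (simp add: fun_eq_iff tmap_def supp_def)

definition glow :: "nat \<Rightarrow> (nat set \<Rightarrow> 'r::comm_ring_1) \<Rightarrow> nat set \<Rightarrow> 'r" where
  "glow n a I = (if n \<in> I then 0 else a I)"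

text \<open>With \<open>n\<close> as largest index the generator stands at the right end of every
  monomial, so its coefficient is extracted without a sign.\<close>

definition ghigh :: "nat \<Rightarrow> (nat set \<Rightarrow> 'r::comm_ring_1) \<Rightarrow> nat set \<Rightarrow> 'r" where
  "ghigh n a I = (if n \<in> I then 0 else a (insert n I))"

text \<open>Substitutes \<open>\<alpha>\<close> for the generator \<open>\<theta>\<^sub>n\<close> in \<open>a = glow n a + ghigh n a \<theta>\<^sub>n\<close>.\<close>
definition gsubst :: "nat \<Rightarrow> (nat set \<Rightarrow> 'r::comm_ring_1) \<Rightarrow> (nat set \<Rightarrow> 'r) \<Rightarrow> nat set \<Rightarrow> 'r" where
  "gsubst n \<alpha> a = glow n a + gmul (ghigh n a) \<alpha>"

lemma glow_coef: "a \<in> coef (enat (Suc n)) \<Longrightarrow> glow n a \<in> coef (enat n)"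
  unfolding coef_enat glow_def by (auto simp: less_Suc_eq subset_iff)

lemma ghigh_coef: "a \<in> coef (enat (Suc n)) \<Longrightarrow> ghigh n a \<in> coef (enat n)"
  unfolding coef_enat ghigh_def by (auto simp: less_Suc_eq subset_iff)

lemma ghigh_zero: "a \<in> coef (enat n) \<Longrightarrow> ghigh n a = 0"
  unfolding coef_enat ghigh_def fun_eq_iff
  by (metis insert_subset lessThan_iff less_irrefl zero_fun_apply)

lemma glow_id: "a \<in> coef (enat n) \<Longrightarrow> glow n a = a"
  unfolding coef_enat glow_def fun_eq_iff by fastforce

lemma glow_gmul: "glow n (gmul a b) = gmul (glow n a) (glow n b)"
proof
  fix K show "glow n (gmul a b) K = gmul (glow n a) (glow n b) K"
  proof (cases "n \<in> K")
    case True
    have "gmul (glow n a) (glow n b) K = 0"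
      unfolding gmul_tmul using True by (intro module.tmul_not_supp[OF module_mult]) (auto simp: glow_def)
    with True show ?thesis by (simp add: glow_def)
  next
    case False
    then show ?thesis by (auto simp: glow_def gmul_def intro!: sum.cong)
  qed
qed

lemma gsign_insert_max_right:
  assumes "finite I" "finite J" "I \<subseteq> {..<n}" "n \<notin> J"
  shows "gsign I (insert n J) = gsign I J"
proof -
  have "{(i, j). i \<in> I \<and> j \<in> insert n J \<and> j < i} = {(i, j). i \<in> I \<and> j \<in> J \<and> j < i}"
    using assms by fastforce
  then show ?thesis by (simp add: gsign_def)
qed

lemma gsign_insert_max_left:
  assumes "finite I" "finite J" "J \<subseteq> {..<n}" "n \<notin> I"
  shows "gsign (insert n I) J = gsign I J * (-1) ^ card J"
proof -
  have "{(i, j). i \<in> {n} \<and> j \<in> J \<and> j < i} = Pair n ` J" using assms by auto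
  moreover have "card (Pair n ` J) = card J" by (intro card_image) (auto intro: inj_onI)
  ultimately have "gsign {n} J = (-1) ^ card J" by (simp only: gsign_def)
  then show ?thesis using gsign_Un_left[of I "{n}" J] assms by simp
qed

text \<open>Moving the generator \<open>n\<close> to the right past \<open>glow n b\<close>
  conjugates that factor, and the term containing the generator twice vanishes.\<close>

lemma ghigh_gmul:
  assumes "a \<in> coef (enat (Suc n))" "b \<in> coef (enat (Suc n))"
  shows "ghigh n (gmul a b) = gmul (glow n a) (ghigh n b) + gmul (ghigh n a) (gconj (glow n b))"
proof
  fix K
  have r: "gmul (glow n a) (ghigh n b) + gmul (ghigh n a) (gconj (glow n b)) \<in> coef (enat n)"
  proof (intro coef_add coef_gmul glow_coef ghigh_coef assms)
    have "glow n b I = 0 \<Longrightarrow> gconj (glow n b) I = 0" for I by (simp add: gconj_def)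
    with glow_coef[OF assms(2)] show "gconj (glow n b) \<in> coef (enat n)" unfolding coef_enat by metis
  qed
  have l: "ghigh n (gmul a b) \<in> coef (enat n)"
    by (intro ghigh_coef coef_gmul assms)
  show "ghigh n (gmul a b) K = (gmul (glow n a) (ghigh n b) + gmul (ghigh n a) (gconj (glow n b))) K"
  proof (cases "K \<subseteq> {..<n}")
    case False
    then show ?thesis using r l unfolding coef_enat by metis
  next
    case K: True
    then have fK: "finite K" and nK: "n \<notin> K" by (auto intro: finite_subset)
    have inj: "inj_on (insert n) (Pow K)"
      using nK by (intro inj_onI) (metis Pow_iff insert_ident subsetD)
    have d: "Pow K \<inter> insert n ` Pow K = {}" using nK by auto
    have "ghigh n (gmul a b) K
      = (\<Sum>I\<in>Pow (insert n K). of_int (gsign I (insert n K - I)) * a I * b (insert n K - I))"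
      using nK by (simp add: ghigh_def gmul_def)
    \<comment> \<open>The subsets of \<open>insert n K\<close> are split by whether they contain
      \<open>n\<close>, that is, by which factor supplies the generator.\<close>
    also have "\<dots> = (\<Sum>I\<in>Pow K. of_int (gsign I (insert n K - I)) * a I * b (insert n K - I))
      + (\<Sum>I\<in>Pow K. of_int (gsign (insert n I) (insert n K - insert n I)) * a (insert n I) * b (insert n K - insert n I))"
      unfolding Pow_insert using fK d inj
      by (subst sum.union_disjoint) (auto simp: sum.reindex)
    also have "(\<Sum>I\<in>Pow K. of_int (gsign I (insert n K - I)) * a I * b (insert n K - I))
      = gmul (glow n a) (ghigh n b) K"
      unfolding gmul_def
    proof (intro sum.cong refl, goal_cases)
      case (1 I)
      then have "insert n K - I = insert n (K - I)" "n \<notin> I" using nK by auto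
      moreover have "gsign I (insert n (K - I)) = gsign I (K - I)"
        using 1 K nK fK by (intro gsign_insert_max_right) (auto intro: finite_subset)
      ultimately show ?case using nK by (simp add: glow_def ghigh_def)
    qed
    also have "(\<Sum>I\<in>Pow K. of_int (gsign (insert n I) (insert n K - insert n I)) * a (insert n I) * b (insert n K - insert n I))
      = gmul (ghigh n a) (gconj (glow n b)) K"
      unfolding gmul_def
    proof (intro sum.cong refl, goal_cases)
      case (1 I)
      then have "insert n K - insert n I = K - I" "n \<notin> I" using nK by auto
      moreover have "gsign (insert n I) (K - I) = gsign I (K - I) * (-1) ^ card (K - I)"
        using 1 K nK fK by (intro gsign_insert_max_left) (auto intro: finite_subset)
      ultimately show ?case using nK by (simp add: glow_def ghigh_def gconj_def)
    qed
    finally show ?thesis by simp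
  qed
qed

text \<open>The point is multiplicativity. It holds because \<alpha>, like the generator it
  replaces, is odd and squares to 0: it passes \<open>glow n b\<close> with the same sign, and the
  term containing it twice vanishes.\<close>

lemma ghom_gsubst:
  fixes \<alpha> :: "nat set \<Rightarrow> 'r::comm_ring_1"
  assumes half: "\<exists>y::'r. of_nat 2 * y = 1"
    and \<alpha>: "\<alpha> \<in> grass1 (enat n)"
  shows "ghom (enat (Suc n)) (enat n) (gsubst n \<alpha>)"
proof (rule ghomI)
  have odd: "\<And>I. even (card I) \<Longrightarrow> \<alpha> I = 0" and \<alpha>c: "\<alpha> \<in> coef (enat n)"
    using \<alpha> by (auto simp: grass1_iff)
  have sq: "gmul \<alpha> \<alpha> = 0" using odd half by (rule gmul_odd_square)
  show "gsubst n \<alpha> a \<in> coef (enat n)" if "a \<in> coef (enat (Suc n))" for a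
    unfolding gsubst_def using that \<alpha>c by (intro coef_add coef_gmul glow_coef ghigh_coef)
  show "gsubst n \<alpha> (a + b) = gsubst n \<alpha> a + gsubst n \<alpha> b" for a b
  proof -
    have "glow n (a + b) = glow n a + glow n b" "ghigh n (a + b) = ghigh n a + ghigh n b"
      by (auto simp: fun_eq_iff glow_def ghigh_def)
    then show ?thesis by (simp add: gsubst_def gmul_add_left)
  qed
  show "gsubst n \<alpha> (gsmul r a) = gsmul r (gsubst n \<alpha> a)" for r a
  proof -
    have "glow n (gsmul r a) = gsmul r (glow n a)" "ghigh n (gsmul r a) = gsmul r (ghigh n a)"
      by (auto simp: fun_eq_iff glow_def ghigh_def gsmul_def)
    then show ?thesis by (simp add: gsubst_def gmul_gsmul_left) (simp add: fun_eq_iff gsmul_def distrib_left)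
  qed
  show "gsubst n \<alpha> gone = gone"
  proof -
    have "glow n gone = (gone :: nat set \<Rightarrow> 'r)" "ghigh n gone = (0 :: nat set \<Rightarrow> 'r)"
      by (auto simp: fun_eq_iff glow_def ghigh_def gone_def)
    then show ?thesis by (simp add: gsubst_def)
  qed
  show "gsubst n \<alpha> (gmul a b) = gmul (gsubst n \<alpha> a) (gsubst n \<alpha> b)"
    if "a \<in> coef (enat (Suc n))" "b \<in> coef (enat (Suc n))" for a b
  proof -
    let ?la = "glow n a" and ?lb = "glow n b" and ?ha = "ghigh n a" and ?hb = "ghigh n b"
    have 1: "gmul (gmul ?ha \<alpha>) ?lb = gmul (gmul ?ha (gconj ?lb)) \<alpha>"
      by (simp add: gmul_assoc gmul_odd_swap[where a = \<alpha> and b = ?lb, OF odd])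
    have "gmul (gmul ?ha \<alpha>) (gmul ?hb \<alpha>) = gmul ?ha (gmul (gmul \<alpha> ?hb) \<alpha>)"
      by (simp add: gmul_assoc)
    also have "\<dots> = 0"
      by (simp add: gmul_assoc gmul_odd_swap[where a = \<alpha> and b = ?hb, OF odd] sq)
    finally have 2: "gmul (gmul ?ha \<alpha>) (gmul ?hb \<alpha>) = 0" .
    show ?thesis
      unfolding gsubst_def
      using 1 2 by (simp add: glow_gmul ghigh_gmul[OF that] gmul_add_left gmul_add_right gmul_assoc add_ac)
  qed
  show "gsubst n \<alpha> a \<in> grass0 (enat n)" if "a \<in> grass0 (enat (Suc n))" for a
  proof -
    have "glow n a \<in> grass0 (enat n)" using that glow_coef by (auto simp: grass0_iff) (auto simp: glow_def)
    moreover have "ghigh n a \<in> grass1 (enat n)"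
    proof -
      have "ghigh n a I = 0" if e: "even (card I)" for I
      proof (cases "finite I \<and> n \<notin> I")
        case True
        then have "odd (card (insert n I))" using e by simp
        then show ?thesis using \<open>a \<in> grass0 (enat (Suc n))\<close> by (simp add: ghigh_def grass0_iff)
      next
        case False
        then show ?thesis using coef_infinite[of "ghigh n a" "enat n" I] ghigh_coef[of a n] that
            \<open>a \<in> grass0 (enat (Suc n))\<close>
          by (auto simp: grass0_iff) (auto simp: ghigh_def)
      qed
      then show ?thesis using that ghigh_coef by (auto simp: grass0_iff grass1_iff)
    qed
    ultimately show ?thesis unfolding gsubst_def
      using \<alpha> by (intro grass0_add grass1_gmul)
  qed
  show "gsubst n \<alpha> a \<in> grass1 (enat n)" if "a \<in> grass1 (enat (Suc n))" for a
  proof -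
    have "glow n a \<in> grass1 (enat n)" using that glow_coef by (auto simp: grass1_iff) (auto simp: glow_def)
    moreover have "ghigh n a \<in> grass0 (enat n)"
    proof -
      have "ghigh n a I = 0" if e: "odd (card I)" for I
      proof (cases "finite I \<and> n \<notin> I")
        case True
        then have "even (card (insert n I))" using e by simp
        then show ?thesis using \<open>a \<in> grass1 (enat (Suc n))\<close> by (simp add: ghigh_def grass1_iff)
      next
        case False
        then show ?thesis using e by (auto simp: ghigh_def)
      qed
      then show ?thesis using that ghigh_coef by (auto simp: grass0_iff grass1_iff)
    qed
    ultimately show ?thesis unfolding gsubst_def
      using \<alpha> by (intro grass1_add grass01_gmul)
  qed
qed

lemma gsubst_id: "a \<in> coef (enat n) \<Longrightarrow> gsubst n \<alpha> a = a"
  by (simp add: gsubst_def glow_id ghigh_zero)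

lemma gsubst_gbasis: "\<alpha> \<in> coef m \<Longrightarrow> gsubst n \<alpha> (gbasis {n}) = \<alpha>"
proof -
  assume "\<alpha> \<in> coef m"
  moreover have "glow n (gbasis {n}) = (0 :: nat set \<Rightarrow> 'a)" "ghigh n (gbasis {n}) = (gone :: nat set \<Rightarrow> 'a)"
    by (auto simp: fun_eq_iff glow_def ghigh_def gbasis_def gone_def)
  ultimately show ?thesis by (simp add: gsubst_def gmul_gone)
qed

section \<open>Topologies\<close>

lemma openin_dlim_topology:
  "openin (dlim_topology T) V \<longleftrightarrow> V \<subseteq> (\<Union>n. topspace (T n)) \<and> (\<forall>n. openin (T n) (V \<inter> topspace (T n)))"
proof -
  have "istopology (\<lambda>V. V \<subseteq> (\<Union>n. topspace (T n)) \<and> (\<forall>n. openin (T n) (V \<inter> topspace (T n))))"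
    unfolding istopology_def
  proof (rule conjI; intro allI impI; rule conjI)
    fix V W
    assume V: "V \<subseteq> (\<Union>n. topspace (T n)) \<and> (\<forall>n. openin (T n) (V \<inter> topspace (T n)))"
      and W: "W \<subseteq> (\<Union>n. topspace (T n)) \<and> (\<forall>n. openin (T n) (W \<inter> topspace (T n)))"
    show "V \<inter> W \<subseteq> (\<Union>n. topspace (T n))" using V by blast
    show "\<forall>n. openin (T n) (V \<inter> W \<inter> topspace (T n))"
    proof
      fix n
      have "openin (T n) ((V \<inter> topspace (T n)) \<inter> (W \<inter> topspace (T n)))"
        using V W by (metis openin_Int)
      moreover have "(V \<inter> topspace (T n)) \<inter> (W \<inter> topspace (T n)) = V \<inter> W \<inter> topspace (T n)" by auto
      ultimately show "openin (T n) (V \<inter> W \<inter> topspace (T n))" by simp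
    qed
  next
    fix \<K> assume \<K>: "\<forall>K\<in>\<K>. K \<subseteq> (\<Union>n. topspace (T n)) \<and> (\<forall>n. openin (T n) (K \<inter> topspace (T n)))"
    then show "\<Union>\<K> \<subseteq> (\<Union>n. topspace (T n))" by blast
    show "\<forall>n. openin (T n) (\<Union>\<K> \<inter> topspace (T n))"
    proof
      fix n
      have "openin (T n) (\<Union>K\<in>\<K>. K \<inter> topspace (T n))" using \<K> by (intro openin_Union) auto
      then show "openin (T n) (\<Union>\<K> \<inter> topspace (T n))" by (subst Int_Union2)
    qed
  qed
  then show ?thesis by (simp add: dlim_topology_def)
qed

lemma topspace_dlim_topology: "topspace (dlim_topology T) = (\<Union>n. topspace (T n))"
proof (rule antisym)
  show "(\<Union>n. topspace (T n)) \<subseteq> topspace (dlim_topology T)"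
  proof (rule openin_subset, unfold openin_dlim_topology, intro conjI allI)
    fix n
    have "(\<Union>n. topspace (T n)) \<inter> topspace (T n) = topspace (T n)" by auto
    then show "openin (T n) ((\<Union>n. topspace (T n)) \<inter> topspace (T n))" by simp
  qed simp
next
  have "openin (dlim_topology T) (topspace (dlim_topology T))" by simp
  then show "topspace (dlim_topology T) \<subseteq> (\<Union>n. topspace (T n))"
    by (simp only: openin_dlim_topology)
qed

text \<open>The coordinate test belongs to the finite levels, which carry the product topology. Maps
  into level infinity are factored through a finite level where possible.\<close>

lemma continuous_map_into_coef:
  "continuous_map Z (coef_top (enat n)) g \<longleftrightarrow>
    (\<forall>z\<in>topspace Z. g z \<in> coef (enat n)) \<and> (\<forall>K. continuous_map Z euclidean (\<lambda>z. g z K))"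
  by (auto simp: coef_top_def continuous_map_in_subtopology continuous_map_componentwise_UNIV)

lemma topspace_coef_top [simp]: "topspace (coef_top n) = coef n"
proof (cases n)
  case (enat m) then show ?thesis by (simp add: coef_top_def)
next
  case infinity
  then show ?thesis
    using coef_infinity coef_mono[of "enat _" \<infinity>] by (auto simp: coef_top_def topspace_dlim_topology)
qed

lemma topspace_ev_top [simp]: "topspace (ev_top n) = ev n"
  by (auto simp: ev_top_def ev_iff)

lemma topspace_grass0_top [simp]: "topspace (grass0_top n) = grass0 n"
  by (auto simp: grass0_top_def grass0_iff)

lemma continuous_map_into_ev:
  "continuous_map Z (ev_top (enat n)) g \<longleftrightarrow>
    (\<forall>z\<in>topspace Z. g z \<in> ev (enat n)) \<and> (\<forall>K. continuous_map Z euclidean (\<lambda>z. g z K))"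
  unfolding ev_top_def continuous_map_in_subtopology continuous_map_into_coef
  by (auto simp: ev_iff Pi_iff)

lemma continuous_map_into_grass0:
  "continuous_map Z (grass0_top (enat n)) g \<longleftrightarrow>
    (\<forall>z\<in>topspace Z. g z \<in> grass0 (enat n)) \<and> (\<forall>K. continuous_map Z euclidean (\<lambda>z. g z K))"
  unfolding grass0_top_def continuous_map_in_subtopology continuous_map_into_coef
  by (auto simp: grass0_iff Pi_iff)

lemma continuous_map_coef_incl:
  assumes "enat m \<le> n"
  shows "continuous_map (coef_top (enat m)) (coef_top n) (\<lambda>x. x)"
proof (cases n)
  case (enat k)
  then show ?thesis
    using assms coef_mono[of "enat m" n] continuous_map_into_coef[of "coef_top (enat m)" m "\<lambda>x. x"]
    by (auto simp: continuous_map_into_coef)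
next
  case infinity
  show ?thesis
    unfolding continuous_map_def
    proof (intro conjI allI impI)
      show "(\<lambda>x. x) \<in> topspace (coef_top (enat m)) \<rightarrow> topspace (coef_top n)"
        using coef_mono[OF assms] by auto
    next
      fix U :: "(nat set \<Rightarrow> 'a) set" assume "openin (coef_top n) U"
      then have "openin (coef_top (enat m)) (U \<inter> topspace (coef_top (enat m)))"
        using infinity by (simp add: coef_top_def openin_dlim_topology)
      then show "openin (coef_top (enat m)) {x \<in> topspace (coef_top (enat m)). x \<in> U}"
        by (simp add: Collect_conj_eq Int_commute)
    qed
qed

lemma continuous_map_coef_coordinate:
  "continuous_map (coef_top n) euclidean (\<lambda>x :: nat set \<Rightarrow> 'a::{zero,topological_space}. x K)"
proof (cases n)
  have "continuous_map (coef_top (enat m)) (coef_top (enat m)) (\<lambda>x :: nat set \<Rightarrow> 'a. x)" for m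
    by simp
  then have c: "continuous_map (coef_top (enat m)) euclidean (\<lambda>x :: nat set \<Rightarrow> 'a. x K)" for m
    unfolding continuous_map_into_coef by blast
  {
    case (enat m)
    then show ?thesis using c by simp
  }
  case infinity
  show ?thesis
    unfolding continuous_map_def
  proof (intro conjI allI impI)
    fix U :: "'a set" assume "openin euclidean U"
    then have "openin (coef_top (enat m)) {x \<in> topspace (coef_top (enat m)). x K \<in> U}" for m
      using c by (rule openin_continuous_map_preimage[rotated])
    moreover have "{x \<in> coef n. x K \<in> U} \<inter> coef (enat m) = {x \<in> coef (enat m). x K \<in> U}" for m
      using coef_mono[of "enat m" n] infinity by auto
    moreover have "coef n = (\<Union>m. coef (enat m))"
      using coef_infinity coef_mono[of "enat _" n] infinity by auto
    moreover have T: "openin (coef_top n) V \<longleftrightarrow> V \<subseteq> (\<Union>m. coef (enat m)) \<and>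
      (\<forall>m. openin (coef_top (enat m)) (V \<inter> coef (enat m)))" for V :: "(nat set \<Rightarrow> 'a) set"
      using infinity by (simp add: coef_top_def openin_dlim_topology)
    ultimately show "openin (coef_top n) {x \<in> topspace (coef_top n). x K \<in> U}"
      unfolding T by auto
  qed simp
qed

lemma continuous_map_ev_coordinate: "continuous_map (ev_top n) euclidean (\<lambda>x. x K)"
  unfolding ev_top_def by (intro continuous_map_from_subtopology continuous_map_coef_coordinate)

lemma continuous_map_grass0_coordinate: "continuous_map (grass0_top n) euclidean (\<lambda>x. x K)"
  unfolding grass0_top_def by (intro continuous_map_from_subtopology continuous_map_coef_coordinate)

lemma continuous_map_ev_incl:
  "enat m \<le> n \<Longrightarrow> continuous_map (ev_top (enat m)) (ev_top n) (\<lambda>x. x)"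
  unfolding ev_top_def continuous_map_in_subtopology
  using ev_mono[of "enat m" n]
  by (auto intro!: continuous_map_from_subtopology continuous_map_coef_incl)

lemma continuous_map_grass0_incl:
  "enat m \<le> n \<Longrightarrow> continuous_map (grass0_top (enat m)) (grass0_top n) (\<lambda>x. x)"
  unfolding grass0_top_def continuous_map_in_subtopology
  using grass0_mono[of "enat m" n]
  by (auto intro!: continuous_map_from_subtopology continuous_map_coef_incl)

text \<open>The constants already live on level 0, where the coordinate test applies; the inclusion
  carries the result to every level.\<close>

lemma continuous_map_rc: "continuous_map euclidean (grass0_top n) (rc :: 'r::{comm_ring_1,topological_space} \<Rightarrow> _)"
proof -
  have c: "continuous_map euclidean euclidean (\<lambda>r :: 'r. rc r K)" for K
    by (cases "K = {}") (auto simp: rc_apply)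
  have "continuous_map euclidean (grass0_top (enat 0)) (rc :: 'r \<Rightarrow> _)"
    unfolding continuous_map_into_grass0 using c by simp
  from continuous_map_compose[OF this continuous_map_grass0_incl[of 0 n]] show ?thesis
    by (simp add: comp_def flip: zero_enat_def)
qed

section \<open>Continuity of the algebraic operations\<close>

lemma continuous_map_binop:
  assumes "continuous_on UNIV (\<lambda>(x, y). f x y)"
    and "continuous_map Z euclidean g" "continuous_map Z euclidean h"
  shows "continuous_map Z euclidean (\<lambda>z. f (g z) (h z))"
proof -
  have "continuous_map Z euclidean (\<lambda>z. (g z, h z))"
    using assms(2,3) continuous_map_pairedI[of Z euclidean g euclidean h]
    by simp
  from continuous_map_compose[OF this, of euclidean "\<lambda>(x, y). f x y"] assms(1)
  show ?thesis by (simp add: comp_def)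
qed

lemma continuous_map_plus:
  fixes g h :: "_ \<Rightarrow> 'a::topological_monoid_add"
  assumes "continuous_map Z euclidean g" "continuous_map Z euclidean h"
  shows "continuous_map Z euclidean (\<lambda>z. g z + h z)"
  by (rule continuous_map_binop[OF _ assms]) (auto simp: case_prod_beta intro!: continuous_intros)

lemma continuous_map_uminus:
  fixes g :: "_ \<Rightarrow> 'a::topological_group_add"
  assumes "continuous_map Z euclidean g"
  shows "continuous_map Z euclidean (\<lambda>z. - g z)"
proof -
  have "continuous_map euclidean euclidean (uminus :: 'a \<Rightarrow> 'a)"
    by (auto intro!: continuous_intros)
  from continuous_map_compose[OF assms this] show ?thesis by (simp add: comp_def)
qed

lemma continuous_map_times:
  fixes g h :: "_ \<Rightarrow> 'a::topological_semigroup_mult"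
  assumes "continuous_map Z euclidean g" "continuous_map Z euclidean h"
  shows "continuous_map Z euclidean (\<lambda>z. g z * h z)"
  by (rule continuous_map_binop[OF _ assms]) (auto simp: case_prod_beta intro!: continuous_intros)

lemma continuous_map_sum_top:
  fixes g :: "_ \<Rightarrow> _ \<Rightarrow> 'a::{comm_monoid_add,topological_monoid_add}"
  assumes "\<And>i. i \<in> A \<Longrightarrow> continuous_map Z euclidean (\<lambda>z. g z i)"
  shows "continuous_map Z euclidean (\<lambda>z. \<Sum>i\<in>A. g z i)"
  using assms by (induction A rule: infinite_finite_induct) (auto intro!: continuous_map_plus)

text \<open>Coefficients in a graded module are pairs, so addition of pairs has to be
  continuous.\<close>

instance prod :: (topological_monoid_add, topological_monoid_add) topological_monoid_add
proof
  fix a b :: "'a \<times> 'b"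
  have 1: "LIM x (nhds a \<times>\<^sub>F nhds b). fst x :> nhds a" "LIM x (nhds a \<times>\<^sub>F nhds b). snd x :> nhds b"
    by (rule filterlim_fst filterlim_snd)+
  have "((\<lambda>x. (fst (fst x) + fst (snd x), snd (fst x) + snd (snd x))) \<longlongrightarrow> (fst a + fst b, snd a + snd b))
      (nhds a \<times>\<^sub>F nhds b)"
    by (intro tendsto_Pair tendsto_add tendsto_fst tendsto_snd 1)
  then show "LIM x (nhds a \<times>\<^sub>F nhds b). fst x + snd x :> nhds (a + b)"
    by (simp add: plus_prod_def)
qed

instance prod :: (topological_group_add, topological_group_add) topological_group_add
proof
  fix a :: "'a \<times> 'b"
  have "((\<lambda>x. (- fst x, - snd x)) \<longlongrightarrow> (- fst a, - snd a)) (nhds a)"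
    by (intro tendsto_Pair tendsto_minus tendsto_fst tendsto_snd filterlim_ident)
  moreover have "- x = (- fst x, - snd x)" for x :: "'a \<times> 'b"
    by (simp add: uminus_prod_def)
  ultimately show "(uminus \<longlongrightarrow> - a) (nhds a)" by presburger
qed

lemma Hausdorff_top_moduleD:
  assumes "Hausdorff_top_module s"
  shows "module s" "continuous_on UNIV (\<lambda>(r, x). s r x)"
  using assms by (auto simp: Hausdorff_top_module_def)

lemma Hausdorff_top_module_esmul:
  fixes s0 :: "'a::{comm_ring_1,topological_space} \<Rightarrow> 'b::{ab_group_add,topological_group_add,t2_space} \<Rightarrow> 'b"
    and s1 :: "'a \<Rightarrow> 'c::{ab_group_add,topological_group_add,t2_space} \<Rightarrow> 'c"
  assumes "Hausdorff_top_module s0" "Hausdorff_top_module s1"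
  shows "Hausdorff_top_module (esmul s0 s1)"
proof -
  note c = assms[THEN Hausdorff_top_moduleD(2)]
  have "continuous_on UNIV (\<lambda>x :: 'a \<times> 'b \<times> 'c. (fst x, fst (snd x)))"
    and "continuous_on UNIV (\<lambda>x :: 'a \<times> 'b \<times> 'c. (fst x, snd (snd x)))"
    by (intro continuous_intros)+
  from continuous_on_compose2[OF c(1) this(1)] continuous_on_compose2[OF c(2) this(2)]
  have "continuous_on UNIV (\<lambda>x :: 'a \<times> 'b \<times> 'c. s0 (fst x) (fst (snd x)))"
    and "continuous_on UNIV (\<lambda>x :: 'a \<times> 'b \<times> 'c. s1 (fst x) (snd (snd x)))"
    by simp_all
  then show ?thesis
    using assms[THEN Hausdorff_top_moduleD(1)]
    by (auto simp: Hausdorff_top_module_def module_esmul esmul_def case_prod_beta intro!: continuous_intros)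
qed

lemma continuous_map_scal:
  assumes "Hausdorff_top_module s"
    and "continuous_map Z euclidean r" "continuous_map Z euclidean x"
  shows "continuous_map Z euclidean (\<lambda>z. s (r z) (x z))"
  by (rule continuous_map_binop[OF Hausdorff_top_moduleD(2)[OF assms(1)] assms(2,3)])

lemma continuous_map_tmul_coordinate:
  fixes s :: "'r::{comm_ring_1,topological_space,topological_semigroup_mult} \<Rightarrow> 'e::{ab_group_add,topological_group_add,t2_space} \<Rightarrow> 'e"
  assumes "Hausdorff_top_module s"
    and "\<And>K. continuous_map Z euclidean (\<lambda>z. x z K)" "\<And>K. continuous_map Z euclidean (\<lambda>z. a z K)"
  shows "continuous_map Z euclidean (\<lambda>z. tmul s (x z) (a z) K)"
  unfolding tmul_def
  by (intro continuous_map_sum_top continuous_map_scal[OF assms(1)] continuous_map_times assms(2,3)) simp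

lemma Hausdorff_top_module_mult:
  "Hausdorff_top_module ((*) :: 'r::{comm_ring_1,topological_group_add,topological_semigroup_mult,t2_space} \<Rightarrow> 'r \<Rightarrow> 'r)"
  by (auto simp: Hausdorff_top_module_def module_mult case_prod_beta intro!: continuous_intros)

lemma continuous_map_gmul_coordinate:
  fixes a b :: "_ \<Rightarrow> nat set \<Rightarrow> 'r::{comm_ring_1,topological_group_add,topological_semigroup_mult,t2_space}"
  assumes "\<And>K. continuous_map Z euclidean (\<lambda>z. a z K)" "\<And>K. continuous_map Z euclidean (\<lambda>z. b z K)"
  shows "continuous_map Z euclidean (\<lambda>z. gmul (a z) (b z) K)"
  unfolding gmul_tmul by (rule continuous_map_tmul_coordinate[OF Hausdorff_top_module_mult assms])

section \<open>Topology of the iterated domains\<close>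

lemma openin_img_topology:
  assumes "inj f"
  shows "openin (img_topology f T) V \<longleftrightarrow> (\<exists>W. openin T W \<and> V = f ` W)"
proof -
  have "istopology (\<lambda>V. \<exists>W. openin T W \<and> V = f ` W)"
    unfolding istopology_def
  proof (intro conjI allI impI; (elim exE conjE)?)
    fix V W V' W' assume "openin T W" "V = f ` W" "openin T W'" "V' = f ` W'"
    then show "\<exists>W. openin T W \<and> V \<inter> V' = f ` W"
      using image_Int[OF assms, of W W'] by blast
  next
    fix \<K> assume "\<forall>K\<in>\<K>. \<exists>W. openin T W \<and> K = f ` W"
    then obtain w where "\<And>K. K \<in> \<K> \<Longrightarrow> openin T (w K) \<and> K = f ` w K" by metis
    then show "\<exists>W. openin T W \<and> \<Union>\<K> = f ` W"
      by (intro exI[of _ "\<Union>K\<in>\<K>. w K"]) (auto simp: image_UN)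
  qed
  then show ?thesis by (simp add: img_topology_def)
qed

lemma topspace_img_topology:
  assumes "inj f"
  shows "topspace (img_topology f T) = f ` topspace T"
proof (rule antisym)
  show "f ` topspace T \<subseteq> topspace (img_topology f T)"
    by (rule openin_subset) (auto simp: openin_img_topology[OF assms])
  have "openin (img_topology f T) (topspace (img_topology f T))" by simp
  then show "topspace (img_topology f T) \<subseteq> f ` topspace T"
    unfolding openin_img_topology[OF assms] using openin_subset by blast
qed

lemma homeomorphic_map_img_topology:
  assumes "inj f"
  shows "homeomorphic_map T (img_topology f T) f"
proof -
  have "continuous_map T (img_topology f T) f"
    unfolding continuous_map_def
  proof (intro conjI allI impI)
    fix V assume "openin (img_topology f T) V"
    then obtain W where W: "openin T W" "V = f ` W" by (auto simp: openin_img_topology[OF assms])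
    then have "{x \<in> topspace T. f x \<in> V} = W"
      using assms openin_subset[OF W(1)] by (auto simp: inj_image_mem_iff)
    with W show "openin T {x \<in> topspace T. f x \<in> V}" by simp
  qed (simp add: topspace_img_topology[OF assms])
  moreover have "open_map T (img_topology f T) f"
    by (auto simp: open_map_def openin_img_topology[OF assms])
  ultimately show ?thesis
    using assms by (intro bijective_open_imp_homeomorphic_map) (auto simp: topspace_img_topology inj_on_def)
qed

lemma inj_Base: "inj Base" and inj_Tri: "inj (\<lambda>(a, b, t). Tri a b t)"
  by (auto intro!: injI)

text \<open>Projections are named so that maps between iterated domains can be assembled from
  continuous ones.\<close>

definition unBase :: "('x, 's) tw \<Rightarrow> 'x" where "unBase p = (case p of Base x \<Rightarrow> x | Tri a b t \<Rightarrow> undefined)"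
definition tw1 :: "('x, 's) tw \<Rightarrow> ('x, 's) tw" where "tw1 p = (case p of Base x \<Rightarrow> undefined | Tri a b t \<Rightarrow> a)"
definition tw2 :: "('x, 's) tw \<Rightarrow> ('x, 's) tw" where "tw2 p = (case p of Base x \<Rightarrow> undefined | Tri a b t \<Rightarrow> b)"
definition tw3 :: "('x, 's) tw \<Rightarrow> 's" where "tw3 p = (case p of Base x \<Rightarrow> undefined | Tri a b t \<Rightarrow> t)"

lemma tw_sel [simp]: "unBase (Base x) = x" "tw1 (Tri a b t) = a" "tw2 (Tri a b t) = b" "tw3 (Tri a b t) = t"
  by (simp_all add: unBase_def tw1_def tw2_def tw3_def)

lemma continuous_map_Base: "continuous_map (mtop M) (tw_top M 0) Base"
  using homeomorphic_imp_continuous_map[OF homeomorphic_map_img_topology[OF inj_Base]] by simp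

lemma continuous_map_img_inverse:
  assumes "inj f" "\<And>x. g (f x) = x"
  shows "continuous_map (img_topology f T) T g"
proof -
  obtain h where h: "homeomorphic_maps T (img_topology f T) f h"
    using homeomorphic_map_maps[THEN iffD1, OF homeomorphic_map_img_topology[OF assms(1)]] by blast
  then have "continuous_map (img_topology f T) T h" by (simp add: homeomorphic_maps_def)
  then show ?thesis
    by (rule continuous_map_eq) (use h assms(2) in \<open>auto simp: homeomorphic_maps_def topspace_img_topology[OF assms(1)]\<close>)
qed

lemma continuous_map_unBase: "continuous_map (tw_top M 0) (mtop M) unBase"
  using continuous_map_img_inverse[OF inj_Base, of unBase] by simp

lemma continuous_map_twP:
  "continuous_map (tw_top M (Suc k)) (prod_topology (tw_top M k) (prod_topology (tw_top M k) (stop M)))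
     (\<lambda>p. (tw1 p, tw2 p, tw3 p))"
  using continuous_map_img_inverse[OF inj_Tri, of "\<lambda>p. (tw1 p, tw2 p, tw3 p)"] by auto

lemma continuous_map_tw1: "continuous_map (tw_top M (Suc k)) (tw_top M k) tw1"
  and continuous_map_tw2: "continuous_map (tw_top M (Suc k)) (tw_top M k) tw2"
  and continuous_map_tw3: "continuous_map (tw_top M (Suc k)) (stop M) tw3"
  using continuous_map_twP[of M k] by (simp_all only: continuous_map_paired)

lemma continuous_map_Tri:
  assumes "continuous_map Z (tw_top M k) a" "continuous_map Z (tw_top M k) b" "continuous_map Z (stop M) t"
  shows "continuous_map Z (tw_top M (Suc k)) (\<lambda>z. Tri (a z) (b z) (t z))"
proof -
  let ?P = "prod_topology (tw_top M k) (prod_topology (tw_top M k) (stop M))"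
  have "continuous_map Z ?P (\<lambda>z. (a z, b z, t z))"
    using assms by (intro continuous_map_pairedI)
  moreover have "continuous_map ?P (tw_top M (Suc k)) (\<lambda>(a, b, t). Tri a b t)"
    using homeomorphic_map_img_topology[OF inj_Tri, of ?P] by (auto dest: homeomorphic_imp_continuous_map)
  ultimately show ?thesis using continuous_map_compose by (fastforce simp: comp_def)
qed

lemma topspace_tw_top:
  assumes "topspace (mtop M) = mcar M" "topspace (stop M) = scar M"
  shows "topspace (tw_top M k) = tw_car M k"
proof (induction k)
  case (Suc k)
  then show ?case using assms by (force simp: topspace_img_topology[OF inj_Tri] image_iff)
qed (use assms in \<open>simp add: topspace_img_topology[OF inj_Base]\<close>)

lemma tw_dom_subset_car: "U \<subseteq> mcar M \<Longrightarrow> tw_dom M U k \<subseteq> tw_car M k"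
  by (induction k) auto

lemma tw_arith [simp]:
  "tw_plus M (Base x) (Base y) = Base (madd M x y)"
  "tw_plus M (Tri a b t) (Tri a' b' t') = Tri (tw_plus M a a') (tw_plus M b b') (sadd M t t')"
  "tw_times M (Base x) u = Base (mscal M x u)"
  "tw_times M (Tri a b t) u = Tri (tw_times M a u) (tw_times M b u) (smul M t u)"
  by (simp_all add: tw_plus_def tw_times_def)

section \<open>Calculus of iterated difference quotients\<close>

lemma BGN_continuous:
  "BGN_Ck M U Y k j g \<Longrightarrow> continuous_map (subtopology (tw_top M j) (tw_dom M U j)) (ytop Y) g"
  by (cases k) auto

lemma BGN_mono: "BGN_Ck M U Y (Suc k) j g \<Longrightarrow> BGN_Ck M U Y k j g"
proof (induction k arbitrary: j g)
  case (Suc k)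
  from Suc.prems obtain g1 where "continuous_map (subtopology (tw_top M j) (tw_dom M U j)) (ytop Y) g"
    "\<forall>a b t. Tri a b t \<in> tw_dom M U (Suc j) \<longrightarrow>
       ydiff Y (g (tw_plus M a (tw_times M b t))) (g a) = yscal Y (g1 (Tri a b t)) t"
    "BGN_Ck M U Y (Suc k) (Suc j) g1" by (subst (asm) BGN_Ck.simps(2)) blast
  with Suc.IH[of "Suc j" g1] show ?case by (subst BGN_Ck.simps(2)) blast
qed simp

lemma BGN_cong:
  assumes "\<And>p. p \<in> tw_dom M U j \<Longrightarrow> g p = h p" and g: "BGN_Ck M U Y k j g"
  shows "BGN_Ck M U Y k j h"
proof -
  have "continuous_map (subtopology (tw_top M j) (tw_dom M U j)) (ytop Y) h"
    using BGN_continuous[OF g] assms(1) by (auto elim!: continuous_map_eq)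
  moreover have "ydiff Y (h (tw_plus M a (tw_times M b t))) (h a) = ydiff Y (g (tw_plus M a (tw_times M b t))) (g a)"
    if "Tri a b t \<in> tw_dom M U (Suc j)" for a b t
    using that assms(1) by auto
  ultimately show ?thesis using g by (cases k) (auto simp del: tw_dom.simps)
qed

text \<open>An affine map \<open>L\<close> along the change of scalars \<open>\<rho>\<close>, with
  linear part \<open>L'\<close>; the second equation is the linearity of \<open>L'\<close>. Both
  maps are recorded because the induced map on triples, \<open>L\<close> on the base point and
  \<open>L'\<close> on the direction, is again of this kind.\<close>

definition affine_map :: "('x, 's) tmod \<Rightarrow> nat \<Rightarrow> ('y, 't) tmod \<Rightarrow> nat \<Rightarrow> ('s \<Rightarrow> 't)
    \<Rightarrow> (('x, 's) tw \<Rightarrow> ('y, 't) tw) \<Rightarrow> (('x, 's) tw \<Rightarrow> ('y, 't) tw) \<Rightarrow> bool" where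
  "affine_map M' j' M j \<rho> L L' \<longleftrightarrow>
    continuous_map (tw_top M' j') (tw_top M j) L \<and> continuous_map (tw_top M' j') (tw_top M j) L' \<and>
    (\<forall>a\<in>tw_car M' j'. \<forall>b\<in>tw_car M' j'. \<forall>t\<in>scar M'.
      L (tw_plus M' a (tw_times M' b t)) = tw_plus M (L a) (tw_times M (L' b) (\<rho> t)) \<and>
      L' (tw_plus M' a (tw_times M' b t)) = tw_plus M (L' a) (tw_times M (L' b) (\<rho> t)))"

text \<open>The chain rule for an affine map in the source and a linear map in the target: a
  quotient of \<open>P \<circ> g \<circ> L\<close> is the same composite formed with the quotient of
  \<open>g\<close> and the induced map on triples. It covers restriction of scalars, inclusion of
  levels and fixing a direction.\<close>

lemma BGN_transport:
  assumes top: "topspace (mtop M) = mcar M" "topspace (stop M) = scar M"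
      "topspace (mtop M') = mcar M'" "topspace (stop M') = scar M'"
    and U: "U \<subseteq> mcar M" "U' \<subseteq> mcar M'"
    and \<rho>: "continuous_map (stop M') (stop M) \<rho>"
      "\<And>u v t. u \<in> scar M' \<Longrightarrow> v \<in> scar M' \<Longrightarrow> t \<in> scar M' \<Longrightarrow>
         \<rho> (sadd M' u (smul M' v t)) = sadd M (\<rho> u) (smul M (\<rho> v) (\<rho> t))"
    and P: "continuous_map (ytop Y) (ytop Y') P"
      "\<And>y z. y \<in> topspace (ytop Y) \<Longrightarrow> z \<in> topspace (ytop Y) \<Longrightarrow> P (ydiff Y y z) = ydiff Y' (P y) (P z)"
      "\<And>y t. y \<in> topspace (ytop Y) \<Longrightarrow> t \<in> scar M' \<Longrightarrow> P (yscal Y y (\<rho> t)) = yscal Y' (P y) t"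
    and "affine_map M' j' M j \<rho> L L'" "\<And>p. p \<in> tw_dom M' U' j' \<Longrightarrow> L p \<in> tw_dom M U j"
    and "BGN_Ck M U Y k j g"
  shows "BGN_Ck M' U' Y' k j' (\<lambda>p. P (g (L p)))"
  using assms(12-)
proof (induction k arbitrary: j j' L L' g)
  have cont: "continuous_map (subtopology (tw_top M' j') (tw_dom M' U' j')) (ytop Y') (\<lambda>p. P (g (L p)))"
    if "affine_map M' j' M j \<rho> L L'" "\<And>p. p \<in> tw_dom M' U' j' \<Longrightarrow> L p \<in> tw_dom M U j"
      "continuous_map (subtopology (tw_top M j) (tw_dom M U j)) (ytop Y) g" for j' j L L' g
  proof -
    have "continuous_map (subtopology (tw_top M' j') (tw_dom M' U' j')) (subtopology (tw_top M j) (tw_dom M U j)) L"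
      using that(1,2) by (auto simp: affine_map_def continuous_map_in_subtopology intro: continuous_map_from_subtopology)
    from continuous_map_compose[OF continuous_map_compose[OF this that(3)] P(1)]
    show ?thesis by (simp add: comp_def)
  qed
  {
    case 0
    then show ?case using cont by simp
  next
    case (Suc k)
    note aff = Suc.prems(1) and dom = Suc.prems(2)
    from Suc.prems(3) obtain g1 where gc: "continuous_map (subtopology (tw_top M j) (tw_dom M U j)) (ytop Y) g"
      and g1: "\<And>a b t. Tri a b t \<in> tw_dom M U (Suc j) \<Longrightarrow>
               ydiff Y (g (tw_plus M a (tw_times M b t))) (g a) = yscal Y (g1 (Tri a b t)) t"
      and g1C: "BGN_Ck M U Y k (Suc j) g1" by auto
    \<comment> \<open>\<open>L1\<close> is induced by \<open>L\<close> on triples and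
      \<open>L1'\<close> is its linear part: they differ only on the base point, since direction and
      scalar are already transformed linearly.\<close>
    define L1 where "L1 p = Tri (L (tw1 p)) (L' (tw2 p)) (\<rho> (tw3 p))" for p
    define L1' where "L1' p = Tri (L' (tw1 p)) (L' (tw2 p)) (\<rho> (tw3 p))" for p
    have Lc: "continuous_map (tw_top M' j') (tw_top M j) L" "continuous_map (tw_top M' j') (tw_top M j) L'"
      using aff by (auto simp: affine_map_def)
    have Lin: "L (tw_plus M' a (tw_times M' b t)) = tw_plus M (L a) (tw_times M (L' b) (\<rho> t))"
      "L' (tw_plus M' a (tw_times M' b t)) = tw_plus M (L' a) (tw_times M (L' b) (\<rho> t))"
      if "a \<in> tw_car M' j'" "b \<in> tw_car M' j'" "t \<in> scar M'" for a b t
      using aff that by (auto simp: affine_map_def)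
    have L'car: "L' b \<in> tw_car M j" if "b \<in> tw_car M' j'" for b
      using Lc(2) that continuous_map_image_subset_topspace[OF Lc(2)] by (auto simp: topspace_tw_top top)
    have \<rho>car: "\<rho> t \<in> scar M" if "t \<in> scar M'" for t
      using that continuous_map_image_subset_topspace[OF \<rho>(1)] top by auto
    have "affine_map M' (Suc j') M (Suc j) \<rho> L1 L1'"
      unfolding affine_map_def
    proof (intro conjI ballI)
      show "continuous_map (tw_top M' (Suc j')) (tw_top M (Suc j)) L1"
        unfolding L1_def
        by (intro continuous_map_Tri continuous_map_compose[OF continuous_map_tw1 Lc(1), unfolded comp_def]
            continuous_map_compose[OF continuous_map_tw2 Lc(2), unfolded comp_def]
            continuous_map_compose[OF continuous_map_tw3 \<rho>(1), unfolded comp_def])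
      show "continuous_map (tw_top M' (Suc j')) (tw_top M (Suc j)) L1'"
        unfolding L1'_def
        by (intro continuous_map_Tri continuous_map_compose[OF continuous_map_tw1 Lc(2), unfolded comp_def]
            continuous_map_compose[OF continuous_map_tw2 Lc(2), unfolded comp_def]
            continuous_map_compose[OF continuous_map_tw3 \<rho>(1), unfolded comp_def])
    qed (auto simp: L1_def L1'_def Lin \<rho>(2))
    moreover have dom1: "L1 p \<in> tw_dom M U (Suc j)" if p: "p \<in> tw_dom M' U' (Suc j')" for p
    proof -
      obtain a b t where p: "p = Tri a b t" "a \<in> tw_dom M' U' j'" "b \<in> tw_car M' j'" "t \<in> scar M'"
        "tw_plus M' a (tw_times M' b t) \<in> tw_dom M' U' j'" using p by auto
      moreover have "a \<in> tw_car M' j'" using p(2) tw_dom_subset_car[OF U(2)] by auto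
      ultimately show ?thesis using dom[of a] dom[of "tw_plus M' a (tw_times M' b t)"]
        by (auto simp: L1_def L'car \<rho>car Lin)
    qed
    ultimately have C: "BGN_Ck M' U' Y' k (Suc j') (\<lambda>p. P (g1 (L1 p)))"
      using g1C by (rule Suc.IH)
    have "ydiff Y' (P (g (L (tw_plus M' a (tw_times M' b t))))) (P (g (L a))) = yscal Y' (P (g1 (L1 (Tri a b t)))) t"
      if d: "Tri a b t \<in> tw_dom M' U' (Suc j')" for a b t
    proof -
      from d have ab: "a \<in> tw_dom M' U' j'" "b \<in> tw_car M' j'" "t \<in> scar M'"
        "tw_plus M' a (tw_times M' b t) \<in> tw_dom M' U' j'" by auto
      have a: "a \<in> tw_car M' j'" using ab tw_dom_subset_car[OF U(2)] by auto
      have d1: "Tri (L a) (L' b) (\<rho> t) \<in> tw_dom M U (Suc j)" using dom1[OF d] by (simp only: L1_def tw_sel)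
      have gin: "g p \<in> topspace (ytop Y)" if "p \<in> tw_dom M U j" for p
        using continuous_map_image_subset_topspace[OF gc] that tw_dom_subset_car[OF U(1)]
        by (auto simp: topspace_tw_top[OF top(1,2)])
      have g1in: "g1 p \<in> topspace (ytop Y)" if "p \<in> tw_dom M U (Suc j)" for p
        using continuous_map_image_subset_topspace[OF BGN_continuous[OF g1C]] that tw_dom_subset_car[OF U(1)]
        by (auto simp: topspace_tw_top[OF top(1,2)] simp del: tw_dom.simps tw_car.simps tw_top.simps)
      have "ydiff Y' (P (g (L (tw_plus M' a (tw_times M' b t))))) (P (g (L a)))
        = P (ydiff Y (g (L (tw_plus M' a (tw_times M' b t)))) (g (L a)))"
        using gin dom[OF ab(1)] dom[OF ab(4)] by (simp add: P(2))
      also have "\<dots> = P (yscal Y (g1 (Tri (L a) (L' b) (\<rho> t))) (\<rho> t))"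
        using g1[OF d1] Lin[OF a ab(2,3)] by simp
      also have "\<dots> = yscal Y' (P (g1 (L1 (Tri a b t)))) t"
        using g1in[OF d1] ab(3) by (simp add: P(3) L1_def)
      finally show ?thesis .
    qed
    with C cont[OF aff dom gc] show ?case by auto
  }
qed

section \<open>Density of units and uniqueness of difference quotients\<close>

definition scalR :: "('x, 'r::{comm_ring_1,topological_space}) tmod \<Rightarrow> bool" where
  "scalR M \<longleftrightarrow> topspace (mtop M) = mcar M \<and> scar M = UNIV \<and> stop M = euclidean \<and> sadd M = (+) \<and> smul M = (*)"

lemma Fcod_R_simps [simp]:
  "ytop (Fcod_R t0 t1 n) = ev_top n" "ydiff (Fcod_R t0 t1 n) = tdiff"
  "yscal (Fcod_R t0 t1 n) = tsmul (esmul t0 t1)"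
  by (simp_all add: Fcod_R_def)

definition dense_units :: "'r::{comm_ring_1,topological_space} itself \<Rightarrow> bool" where
  "dense_units _ \<longleftrightarrow> closure {u::'r. \<exists>v. u * v = 1} = UNIV"

text \<open>If the values at \<open>c\<close> differed, the preimages of disjoint neighbourhoods
  would meet in an open set containing \<open>c\<close>, and that set contains a unit. This is the
  standard way below to divide an identity by \<open>s\<close> and then set
  \<open>s = 0\<close>.\<close>

lemma unit_limit_unique:
  fixes A B :: "'r::{comm_ring_1,topological_space} \<Rightarrow> 'v::t2_space"
  assumes "dense_units TYPE('r)" "open S" "c \<in> S"
    and A: "continuous_map (subtopology euclidean S) euclidean A"
    and B: "continuous_map (subtopology euclidean S) euclidean B"
    and eq: "\<And>s u. s \<in> S \<Longrightarrow> s * u = 1 \<Longrightarrow> A s = B s"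
  shows "A c = B c"
proof (rule ccontr)
  assume "A c \<noteq> B c"
  then obtain V W where VW: "open V" "open W" "A c \<in> V" "B c \<in> W" "V \<inter> W = {}"
    using hausdorff by metis
  have "openin (subtopology euclidean S) {s \<in> S. A s \<in> V}" "openin (subtopology euclidean S) {s \<in> S. B s \<in> W}"
    using openin_continuous_map_preimage[OF A, of V] openin_continuous_map_preimage[OF B, of W] VW by auto
  then have "open ({s \<in> S. A s \<in> V} \<inter> {s \<in> S. B s \<in> W})"
    using assms(2) by (intro open_Int) (auto simp: openin_open_eq)
  moreover have "c \<in> {s \<in> S. A s \<in> V} \<inter> {s \<in> S. B s \<in> W}" using assms(3) VW by auto
  moreover have "c \<in> closure {u::'r. \<exists>v. u * v = 1}" using assms(1) by (simp add: dense_units_def)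
  ultimately have "({s \<in> S. A s \<in> V} \<inter> {s \<in> S. B s \<in> W}) \<inter> {u::'r. \<exists>v. u * v = 1} \<noteq> {}"
    using open_Int_closure_eq_empty by blast
  then obtain s u where "s \<in> S" "A s \<in> V" "B s \<in> W" "s * u = 1" by blast
  with eq VW(5) show False by auto
qed

lemma continuous_map_path_coordinate:
  assumes "continuous_map (subtopology T D) (ev_top n) g" "continuous_map (subtopology euclidean S) T \<gamma>"
    and "\<And>s. s \<in> S \<Longrightarrow> \<gamma> s \<in> D"
  shows "continuous_map (subtopology euclidean S) euclidean (\<lambda>s. g (\<gamma> s) K)"
proof -
  have "continuous_map (subtopology euclidean S) (subtopology T D) \<gamma>"
    using assms by (auto simp: continuous_map_in_subtopology)
  from continuous_map_compose[OF continuous_map_compose[OF this assms(1)] continuous_map_ev_coordinate]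
  show ?thesis by (simp add: comp_def)
qed

lemma open_path_preimage:
  assumes "continuous_map euclidean T \<gamma>" "openin T D"
  shows "open {s. \<gamma> s \<in> D}"
  using openin_continuous_map_preimage[OF assms] by simp

lemma Tri_mem_tw_dom_1 [simp]:
  "Tri p q t \<in> tw_dom M W 1 \<longleftrightarrow> (\<exists>x v. p = Base x \<and> q = Base v \<and> x \<in> W \<and> v \<in> mcar M \<and> t \<in> scar M \<and>
     madd M x (mscal M v t) \<in> W)"
  unfolding One_nat_def by auto

lemma tw_dom_1_cases:
  assumes "p \<in> tw_dom M W 1"
  obtains x v t where "p = Tri (Base x) (Base v) t" "x \<in> W" "v \<in> mcar M" "t \<in> scar M" "madd M x (mscal M v t) \<in> W"
  using assms unfolding One_nat_def by auto

text \<open>In the definition of smoothness the quotient may depend on the order \<open>k\<close>;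
  here one \<open>h1\<close> serves all orders.\<close>

definition rsm :: "('x, 's) tmod \<Rightarrow> 'x set \<Rightarrow> ('y, 's) cmod \<Rightarrow> ('x \<Rightarrow> 'y) \<Rightarrow> (('x, 's) tw \<Rightarrow> 'y) \<Rightarrow> bool" where
  "rsm M W Y h h1 \<longleftrightarrow>
    continuous_map (subtopology (tw_top M 0) (tw_dom M W 0)) (ytop Y) (base_fun h) \<and>
    (\<forall>a b t. Tri a b t \<in> tw_dom M W 1 \<longrightarrow>
       ydiff Y (base_fun h (tw_plus M a (tw_times M b t))) (base_fun h a) = yscal Y (h1 (Tri a b t)) t) \<and>
    (\<forall>k. BGN_Ck M W Y k 1 h1)"

lemma base_fun_Base [simp]: "base_fun h (Base x) = h x"
  by (simp add: base_fun_def)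

lemma rsm_quotient:
  assumes "rsm M W Y h h1" "x \<in> W" "v \<in> mcar M" "t \<in> scar M" "madd M x (mscal M v t) \<in> W"
  shows "ydiff Y (h (madd M x (mscal M v t))) (h x) = yscal Y (h1 (Tri (Base x) (Base v) t)) t"
proof -
  have "Tri (Base x) (Base v) t \<in> tw_dom M W 1" using assms by auto
  then show ?thesis using assms(1) unfolding rsm_def by fastforce
qed

lemma rsm_continuous:
  "rsm M W Y h h1 \<Longrightarrow> continuous_map (subtopology (tw_top M 1) (tw_dom M W 1)) (ytop Y) h1"
  unfolding rsm_def using BGN_continuous by blast

lemma continuous_map_on_Base:
  assumes "continuous_map (subtopology (tw_top M 0) (tw_dom M W 0)) T (base_fun h)"
  shows "continuous_map (subtopology (mtop M) W) T h"
proof -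
  have "continuous_map (subtopology (mtop M) W) (subtopology (tw_top M 0) (tw_dom M W 0)) Base"
    using continuous_map_Base[of M] by (auto simp: continuous_map_in_subtopology intro: continuous_map_from_subtopology)
  from continuous_map_compose[OF this assms] show ?thesis by (simp add: comp_def)
qed

lemma BGN_smooth_continuous:
  "BGN_smooth M W Y h \<Longrightarrow> continuous_map (subtopology (mtop M) W) (ytop Y) h"
  using BGN_continuous continuous_map_on_Base unfolding BGN_smooth_def by blast

lemma rsm_smooth: "rsm M W Y h h1 \<Longrightarrow> BGN_smooth M W Y h"
  unfolding BGN_smooth_def
proof
  fix k assume r: "rsm M W Y h h1"
  show "BGN_Ck M W Y k 0 (base_fun h)"
  proof (cases k)
    case 0
    then show ?thesis using r by (simp add: rsm_def del: tw_dom.simps tw_top.simps)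
  next
    case (Suc k')
    then show ?thesis using r unfolding rsm_def Suc BGN_Ck.simps One_nat_def by blast
  qed
qed

text \<open>Continuity is asked only along lines. For two points at level infinity it can be checked
  on a finite level containing both.\<close>

definition path_module :: "('x, 'r::{comm_ring_1,topological_space}) tmod \<Rightarrow> bool" where
  "path_module M \<longleftrightarrow> scalR M \<and>
    (\<forall>x\<in>mcar M. \<forall>v\<in>mcar M. continuous_map euclidean (mtop M) (\<lambda>s. madd M x (mscal M v s)))"

lemma continuous_map_Tri_Base:
  assumes "continuous_map Z (mtop M) a" "continuous_map Z (mtop M) b" "continuous_map Z (stop M) t"
  shows "continuous_map Z (tw_top M 1) (\<lambda>z. Tri (Base (a z)) (Base (b z)) (t z))"
  unfolding One_nat_def
  by (intro continuous_map_Tri assms(3) continuous_map_compose[OF assms(1) continuous_map_Base, unfolded comp_def]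
      continuous_map_compose[OF assms(2) continuous_map_Base, unfolded comp_def])

locale target =
  fixes t0 :: "'r::{comm_ring_1,topological_group_add,topological_semigroup_mult,t2_space} \<Rightarrow> 'f0::{ab_group_add,topological_group_add,t2_space} \<Rightarrow> 'f0"
    and t1 :: "'r \<Rightarrow> 'f1::{ab_group_add,topological_group_add,t2_space} \<Rightarrow> 'f1"
  assumes F0: "Hausdorff_top_module t0" and F1: "Hausdorff_top_module t1"
    and units: "dense_units TYPE('r)"
begin

abbreviation "\<tau> \<equiv> esmul t0 t1"

lemma F: "Hausdorff_top_module \<tau>"
  by (rule Hausdorff_top_module_esmul[OF F0 F1])

sublocale F: module "esmul t0 t1"
  by (rule Hausdorff_top_moduleD(1)[OF F])

lemmas tmul_ev = ev_tmul[OF Hausdorff_top_moduleD(1)[OF F0] Hausdorff_top_moduleD(1)[OF F1]]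

lemma tsmul_cancel: "tsmul \<tau> x s K = tsmul \<tau> y s K \<Longrightarrow> s * u = 1 \<Longrightarrow> x K = y K"
proof -
  assume eq: "tsmul \<tau> x s K = tsmul \<tau> y s K" and "s * u = 1"
  then have u: "u * s = 1" by (simp add: mult.commute)
  have "\<tau> u (\<tau> s (x K)) = \<tau> u (\<tau> s (y K))" using eq by (simp add: tsmul_def)
  then show ?thesis by (simp add: u)
qed

text \<open>With \<open>x\<close> and \<open>v\<close> fixed, the two quotients agree at every
  scalar of the line that is a unit, since it can be cancelled; density and continuity give the
  remaining scalars.\<close>

lemma quotient_unique:
  assumes M: "path_module M" and W: "openin (mtop M) W"
    and c1: "continuous_map (subtopology (tw_top M 1) (tw_dom M W 1)) (ev_top n) g1"
    and c2: "continuous_map (subtopology (tw_top M 1) (tw_dom M W 1)) (ev_top n) g2"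
    and eq: "\<And>x v t. x \<in> W \<Longrightarrow> v \<in> mcar M \<Longrightarrow> madd M x (mscal M v t) \<in> W \<Longrightarrow>
        tsmul \<tau> (g1 (Tri (Base x) (Base v) t)) t = tsmul \<tau> (g2 (Tri (Base x) (Base v) t)) t"
    and p: "p \<in> tw_dom M W 1"
  shows "g1 p = g2 p"
proof
  fix K
  obtain x v t where pd: "p = Tri (Base x) (Base v) t" "x \<in> W" "v \<in> mcar M" "madd M x (mscal M v t) \<in> W"
    using p by (rule tw_dom_1_cases)
  have sc: "topspace (mtop M) = mcar M" "scar M = UNIV" "stop M = euclidean"
    using M by (auto simp: path_module_def scalR_def)
  have xW: "x \<in> mcar M" using openin_subset[OF W] pd sc by auto
  let ?S = "{s. madd M x (mscal M v s) \<in> W}"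
  have \<gamma>: "continuous_map euclidean (mtop M) (\<lambda>s. madd M x (mscal M v s))"
    using M pd xW by (simp add: path_module_def)
  have S: "open ?S" using \<gamma> W by (rule open_path_preimage)
  have path: "continuous_map (subtopology euclidean ?S) (tw_top M 1) (\<lambda>s. Tri (Base x) (Base v) s)"
    using pd xW sc by (intro continuous_map_Tri_Base) (auto intro: continuous_map_from_subtopology)
  have dom: "Tri (Base x) (Base v) s \<in> tw_dom M W 1" if "s \<in> ?S" for s
    using that pd sc by auto
  have "g1 (Tri (Base x) (Base v) t) K = g2 (Tri (Base x) (Base v) t) K"
  proof (rule unit_limit_unique[OF units S])
    show "t \<in> ?S" using pd by simp
    show "continuous_map (subtopology euclidean ?S) euclidean (\<lambda>s. g1 (Tri (Base x) (Base v) s) K)"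
      by (rule continuous_map_path_coordinate[OF c1 path dom])
    show "continuous_map (subtopology euclidean ?S) euclidean (\<lambda>s. g2 (Tri (Base x) (Base v) s) K)"
      by (rule continuous_map_path_coordinate[OF c2 path dom])
  next
    fix s u :: 'r assume s: "s \<in> ?S" and su: "s * u = 1"
    show "g1 (Tri (Base x) (Base v) s) K = g2 (Tri (Base x) (Base v) s) K"
      using tsmul_cancel[OF fun_cong[OF eq[of x v s]] su] pd s by simp
  qed
  then show "g1 p K = g2 p K" by (simp add: pd)
qed

text \<open>The quotients belonging to the different orders coincide on the domain by uniqueness, so
  the first of them has all orders of differentiability.\<close>

lemma smooth_rsm:
  assumes M: "path_module M" and W: "openin (mtop M) W"
    and h: "BGN_smooth M W (Fcod_R t0 t1 n) h"
  shows "\<exists>h1. rsm M W (Fcod_R t0 t1 n) h h1"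
proof -
  define Y where "Y = Fcod_R t0 t1 n"
  define Q where "Q g1 \<longleftrightarrow> (\<forall>a b t. Tri a b t \<in> tw_dom M W 1 \<longrightarrow>
      ydiff Y (base_fun h (tw_plus M a (tw_times M b t))) (base_fun h a) = yscal Y (g1 (Tri a b t)) t)" for g1
  have "\<exists>g1. Q g1 \<and> BGN_Ck M W Y k 1 g1" for k
    using h unfolding BGN_smooth_def Y_def[symmetric] Q_def One_nat_def
    by (auto simp del: tw_dom.simps tw_top.simps dest!: spec[of _ "Suc k"])
  then obtain g1 where Q: "\<And>k. Q (g1 k)" and C: "\<And>k. BGN_Ck M W Y k 1 (g1 k)" by metis
  have c: "continuous_map (subtopology (tw_top M 1) (tw_dom M W 1)) (ev_top n) (g1 k)" for k
    using BGN_continuous[OF C] by (simp add: Y_def)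
  have sc: "scar M = UNIV" using M by (simp add: path_module_def scalR_def)
  have Qe: "h (madd M x (mscal M v t)) - h x = tsmul \<tau> (g (Tri (Base x) (Base v) t)) t"
    if "Q g" "x \<in> W" "v \<in> mcar M" "madd M x (mscal M v t) \<in> W" for g x v t
  proof -
    have "Tri (Base x) (Base v) t \<in> tw_dom M W 1" using that sc by auto
    from that(1)[unfolded Q_def, rule_format, OF this] show ?thesis by (simp add: Y_def)
  qed
  have "g1 k p = g1 0 p" if "p \<in> tw_dom M W 1" for k p
  proof (rule quotient_unique[OF M W c c _ that])
    fix x v t assume a: "x \<in> W" "v \<in> mcar M" "madd M x (mscal M v t) \<in> W"
    then show "tsmul \<tau> (g1 k (Tri (Base x) (Base v) t)) t = tsmul \<tau> (g1 0 (Tri (Base x) (Base v) t)) t"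
      using Qe[OF Q a] by metis
  qed
  then have "BGN_Ck M W Y k 1 (g1 0)" for k
    using C by (rule BGN_cong)
  moreover have "continuous_map (subtopology (tw_top M 0) (tw_dom M W 0)) (ytop Y) (base_fun h)"
    using h BGN_continuous unfolding BGN_smooth_def Y_def by blast
  ultimately have "rsm M W Y h (g1 0)"
    using Q[of 0] unfolding rsm_def Q_def by blast
  then show ?thesis unfolding Y_def by blast
qed

text \<open>\<open>BGN_deriv\<close> is a choice; it agrees with every continuous difference quotient.\<close>
lemma BGN_deriv_eq:
  assumes M: "path_module M" and W: "openin (mtop M) W"
    and c: "continuous_map (subtopology (tw_top M 1) (tw_dom M W 1)) (ev_top n) g1"
    and eq: "\<And>x v t. x \<in> W \<Longrightarrow> v \<in> mcar M \<Longrightarrow> madd M x (mscal M v t) \<in> W \<Longrightarrow>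
        h (madd M x (mscal M v t)) - h x = tsmul \<tau> (g1 (Tri (Base x) (Base v) t)) t"
    and x: "x \<in> W" "v \<in> mcar M" "madd M x (mscal M v 0) \<in> W"
  shows "BGN_deriv M W (Fcod_R t0 t1 n) 0 h x v = g1 (Tri (Base x) (Base v) 0)"
proof -
  have sc: "scar M = UNIV" using M by (simp add: path_module_def scalR_def)
  define Q where "Q g1 \<longleftrightarrow> continuous_map (subtopology (tw_top M 1) (tw_dom M W 1)) (ytop (Fcod_R t0 t1 n)) g1 \<and>
        (\<forall>a b t. Tri a b t \<in> tw_dom M W 1 \<longrightarrow>
           ydiff (Fcod_R t0 t1 n) (base_fun h (tw_plus M a (tw_times M b t))) (base_fun h a)
             = yscal (Fcod_R t0 t1 n) (g1 (Tri a b t)) t)" for g1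
  have "Q g1" unfolding Q_def using c eq by auto
  from someI[of Q, OF this] have Q: "Q (SOME g. Q g)" .
  have Qc: "continuous_map (subtopology (tw_top M 1) (tw_dom M W 1)) (ev_top n) g" if "Q g" for g
    using that unfolding Q_def by simp
  have Qe: "h (madd M x (mscal M v t)) - h x = tsmul \<tau> (g (Tri (Base x) (Base v) t)) t"
    if "Q g" "x \<in> W" "v \<in> mcar M" "madd M x (mscal M v t) \<in> W" for g x v t
  proof -
    have "Tri (Base x) (Base v) t \<in> tw_dom M W 1" using that sc by auto
    from that(1)[unfolded Q_def, THEN conjunct2, rule_format, OF this] show ?thesis by simp
  qed
  have "(SOME g. Q g) (Tri (Base x) (Base v) 0) = g1 (Tri (Base x) (Base v) 0)"
  proof (rule quotient_unique[OF M W _ c])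
    show "continuous_map (subtopology (tw_top M 1) (tw_dom M W 1)) (ev_top n) (SOME g. Q g)"
      by (rule Qc[OF Q])
    show "Tri (Base x) (Base v) 0 \<in> tw_dom M W 1" using x sc by auto
  next
    fix x v t assume a: "x \<in> W" "v \<in> mcar M" "madd M x (mscal M v t) \<in> W"
    then show "tsmul \<tau> ((SOME g. Q g) (Tri (Base x) (Base v) t)) t = tsmul \<tau> (g1 (Tri (Base x) (Base v) t)) t"
      using eq[OF a] Qe[OF Q a] by simp
  qed
  then show ?thesis unfolding BGN_deriv_def Q_def .
qed

section \<open>Sums of smooth maps and products with linear functionals\<close>

lemma tsmul_add: "tsmul \<tau> (x + y) r = tsmul \<tau> x r + tsmul \<tau> y r"
  and tsmul_diff: "tsmul \<tau> (x - y) r = tsmul \<tau> x r - tsmul \<tau> y r"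
  by (simp_all add: fun_eq_iff tsmul_def F.scale_right_distrib F.scale_right_diff_distrib)

lemma tsmul_tmul: "tsmul \<tau> (tmul \<tau> x a) r = tmul \<tau> (tsmul \<tau> x r) a"
  by (simp add: fun_eq_iff tsmul_def tmul_def F.scale_sum_right mult.commute)

lemma tmul_gsmul: "tmul \<tau> x (gsmul r a) = tsmul \<tau> (tmul \<tau> x a) r"
  by (simp add: fun_eq_iff tsmul_def tmul_def gsmul_def F.scale_sum_right mult_ac)

lemma tsmul_ev: "x \<in> ev n \<Longrightarrow> tsmul \<tau> x r \<in> ev n"
  using tmul_ev[of x n "rc r"] F.tmul_rc_coef[of x n r] by (simp add: ev_iff)

lemma BGN_add:
  assumes "BGN_Ck M U (Fcod_R t0 t1 (enat n)) k j g" "BGN_Ck M U (Fcod_R t0 t1 (enat n)) k j h"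
  shows "BGN_Ck M U (Fcod_R t0 t1 (enat n)) k j (\<lambda>p. g p + h p)"
  using assms
proof (induction k arbitrary: j g h)
  have cont: "continuous_map Z (ev_top (enat n)) (\<lambda>p. g p + h p)"
    if "continuous_map Z (ev_top (enat n)) g" "continuous_map Z (ev_top (enat n)) h"
    for Z :: "('a, 'r) tw topology" and g h :: "_ \<Rightarrow> nat set \<Rightarrow> 'f0 \<times> 'f1"
    using that unfolding continuous_map_into_ev by (auto intro: ev_add continuous_map_plus)
  {
    case 0
    then show ?case using cont by (simp del: plus_fun_apply)
  next
    case (Suc k)
    let ?Y = "Fcod_R t0 t1 (enat n)" and ?T = "subtopology (tw_top M j) (tw_dom M U j)"
    obtain g1 where g: "continuous_map ?T (ev_top (enat n)) g" "BGN_Ck M U ?Y k (Suc j) g1"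
      "\<And>a b t. Tri a b t \<in> tw_dom M U (Suc j) \<Longrightarrow> g (tw_plus M a (tw_times M b t)) - g a = tsmul \<tau> (g1 (Tri a b t)) t"
      using Suc.prems(1) by (auto simp del: tw_dom.simps tw_top.simps)
    obtain h1 where h: "continuous_map ?T (ev_top (enat n)) h" "BGN_Ck M U ?Y k (Suc j) h1"
      "\<And>a b t. Tri a b t \<in> tw_dom M U (Suc j) \<Longrightarrow> h (tw_plus M a (tw_times M b t)) - h a = tsmul \<tau> (h1 (Tri a b t)) t"
      using Suc.prems(2) by (auto simp del: tw_dom.simps tw_top.simps)
    have "BGN_Ck M U ?Y k (Suc j) (\<lambda>p. g1 p + h1 p)" using g(2) h(2) by (rule Suc.IH)
    moreover have "(g (tw_plus M a (tw_times M b t)) + h (tw_plus M a (tw_times M b t))) - (g a + h a)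
       = tsmul \<tau> (g1 (Tri a b t) + h1 (Tri a b t)) t" if "Tri a b t \<in> tw_dom M U (Suc j)" for a b t
      unfolding tsmul_add g(3)[OF that, symmetric] h(3)[OF that, symmetric] by simp
    ultimately show ?case using cont[OF g(1) h(1)]
      by (auto simp del: tw_dom.simps tw_top.simps plus_fun_apply intro!: exI[of _ "\<lambda>p. g1 p + h1 p"])
  }
qed

text \<open>The product rule for an R-linear functional \<open>lf\<close>. The quotient is a sum of
  products of the same form, so the induction runs over all \<open>g\<close> and \<open>lf\<close>
  at once.\<close>

lemma BGN_mult:
  assumes M: "scalR M" and U: "U \<subseteq> mcar M"
    and "BGN_Ck M U (Fcod_R t0 t1 (enat n)) k j g"
    and "continuous_map (tw_top M j) euclidean lf"
    and "\<And>a b t. a \<in> tw_car M j \<Longrightarrow> b \<in> tw_car M j \<Longrightarrow> lf (tw_plus M a (tw_times M b t)) = lf a + lf b * t"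
  shows "BGN_Ck M U (Fcod_R t0 t1 (enat n)) k j (\<lambda>p. tsmul \<tau> (g p) (lf p))"
  using assms(3-)
proof (induction k arbitrary: j g lf)
  have cont: "continuous_map (subtopology T D) (ev_top (enat n)) (\<lambda>p. tsmul \<tau> (g p) (lf p))"
    if "continuous_map (subtopology T D) (ev_top (enat n)) g" "continuous_map T euclidean lf"
    for T :: "('a, 'r) tw topology" and D lf and g :: "_ \<Rightarrow> nat set \<Rightarrow> 'f0 \<times> 'f1"
    using that(1) continuous_map_from_subtopology[OF that(2), of D] unfolding continuous_map_into_ev
    by (auto intro!: tsmul_ev simp: tsmul_def intro!: continuous_map_scal[OF F])
  {
    case 0
    then show ?case using cont[OF _ "0.prems"(2)] by simp
  next
    case (Suc k)
    let ?Y = "Fcod_R t0 t1 (enat n)" and ?T = "subtopology (tw_top M j) (tw_dom M U j)"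
    have sc: "topspace (mtop M) = mcar M" "scar M = UNIV" "stop M = euclidean" "sadd M = (+)" "smul M = (*)"
      using M by (auto simp: scalR_def)
    note lf = Suc.prems(2,3)
    obtain g1 where g: "continuous_map ?T (ev_top (enat n)) g" "BGN_Ck M U ?Y k (Suc j) g1"
      "\<And>a b t. Tri a b t \<in> tw_dom M U (Suc j) \<Longrightarrow> g (tw_plus M a (tw_times M b t)) - g a = tsmul \<tau> (g1 (Tri a b t)) t"
      using Suc.prems(1) by (auto simp del: tw_dom.simps tw_top.simps)
    have c1: "continuous_map (tw_top M (Suc j)) euclidean (\<lambda>p. lf (tw1 p))"
      and c2: "continuous_map (tw_top M (Suc j)) euclidean (\<lambda>p. lf (tw2 p))"
      and c3: "continuous_map (tw_top M (Suc j)) euclidean tw3"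
      using continuous_map_compose[OF continuous_map_tw1 lf(1)] continuous_map_compose[OF continuous_map_tw2 lf(1)]
        continuous_map_tw3[of M j] sc(3) by (simp_all only: comp_def)
    have l1: "lf (tw1 (tw_plus M a (tw_times M b t))) = lf (tw1 a) + lf (tw1 b) * t"
      and l2: "lf (tw2 (tw_plus M a (tw_times M b t))) = lf (tw2 a) + lf (tw2 b) * t"
      and l3: "tw3 (tw_plus M a (tw_times M b t)) = tw3 a + tw3 b * t"
      if "a \<in> tw_car M (Suc j)" "b \<in> tw_car M (Suc j)" for a b t
      using that lf(2) by (auto simp: sc)
    have A: "BGN_Ck M U ?Y k (Suc j) (\<lambda>p. tsmul \<tau> (g1 p) (lf (tw1 p)))"
      by (rule Suc.IH[OF g(2) c1 l1])
    have "BGN_Ck M U ?Y k (Suc j) (\<lambda>p. tsmul \<tau> (g1 p) (tw3 p))"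
      by (rule Suc.IH[OF g(2) c3 l3])
    then have B: "BGN_Ck M U ?Y k (Suc j) (\<lambda>p. tsmul \<tau> (tsmul \<tau> (g1 p) (tw3 p)) (lf (tw2 p)))"
      by (rule Suc.IH[OF _ c2 l2])
    have aff: "affine_map M (Suc j) M j (\<lambda>s. s) tw1 tw1"
      unfolding affine_map_def using continuous_map_tw1[of M j] by auto
    have "BGN_Ck M U ?Y k (Suc j) (\<lambda>p. g (tw1 p))"
      by (rule BGN_transport[where P = "\<lambda>y. y" and M = M and M' = M and Y = ?Y and U = U and j = j, OF _ _ _ _ _ _ _ _ _ _ _ aff])
        (use BGN_mono[OF Suc.prems(1)] in \<open>auto simp: sc U\<close>)
    then have C: "BGN_Ck M U ?Y k (Suc j) (\<lambda>p. tsmul \<tau> (g (tw1 p)) (lf (tw2 p)))"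
      by (rule Suc.IH[OF _ c2 l2])
    \<comment> \<open>Obtained by expanding \<open>(g + g1 t) (lf a + lf b t) - g lf a\<close> and
      dividing by \<open>t\<close>. The middle term keeps a factor \<open>t\<close>, which is why
      \<open>tw3\<close> appears as a linear functional.\<close>
    define k1 where "k1 p = tsmul \<tau> (g1 p) (lf (tw1 p)) + tsmul \<tau> (tsmul \<tau> (g1 p) (tw3 p)) (lf (tw2 p))
        + tsmul \<tau> (g (tw1 p)) (lf (tw2 p))" for p
    have D: "BGN_Ck M U ?Y k (Suc j) k1"
      using BGN_add[OF BGN_add[OF A B] C] unfolding k1_def .
    have E: "tsmul \<tau> (g (tw_plus M a (tw_times M b t))) (lf (tw_plus M a (tw_times M b t))) - tsmul \<tau> (g a) (lf a)
       = tsmul \<tau> (k1 (Tri a b t)) t" if d: "Tri a b t \<in> tw_dom M U (Suc j)" for a b t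
    proof -
      have ab: "a \<in> tw_car M j" "b \<in> tw_car M j" using d tw_dom_subset_car[OF U] by auto
      have gs: "g (tw_plus M a (tw_times M b t)) = g a + tsmul \<tau> (g1 (Tri a b t)) t"
        using g(3)[OF d] by (simp add: algebra_simps)
      show ?thesis unfolding gs lf(2)[OF ab] k1_def
        by (simp add: fun_eq_iff tsmul_def F.scale_right_distrib F.scale_left_distrib algebra_simps)
    qed
    show ?case using cont[OF g(1) lf(1)] D E
      by (auto simp del: tw_dom.simps tw_top.simps intro!: exI[of _ k1])
  }
qed

end

section \<open>The construction over one Grassmann algebra\<close>

text \<open>An abstract topological module over the even part of one Grassmann algebra,
  \<open>n\<close> being fixed, with zero element \<open>z\<close>. The axiom \<open>U_nil\<close>
  makes \<open>U\<close> stable under increments whose scalar has no body.\<close>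

locale gtower = target t0 t1
  for t0 :: "'r::{comm_ring_1,topological_group_add,topological_semigroup_mult,t2_space} \<Rightarrow> 'f0::{ab_group_add,topological_group_add,t2_space} \<Rightarrow> 'f0"
    and t1 :: "'r \<Rightarrow> 'f1::{ab_group_add,topological_group_add,t2_space} \<Rightarrow> 'f1" +
  fixes n :: nat and M :: "('x, nat set \<Rightarrow> 'r) tmod" and z :: 'x and U :: "'x set"
  assumes M_top: "topspace (mtop M) = mcar M"
    and M_simps [simp]: "scar M = grass0 (enat n)" "stop M = grass0_top (enat n)" "sadd M = gadd" "smul M = gmul"
    and z: "z \<in> mcar M"
    and M_add_cont: "continuous_map (prod_topology (mtop M) (mtop M)) (mtop M) (\<lambda>(x, y). madd M x y)"
    and M_mul_cont: "continuous_map (prod_topology (mtop M) (grass0_top (enat n))) (mtop M) (\<lambda>(x, c). mscal M x c)"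
    and M_add_assoc: "x \<in> mcar M \<Longrightarrow> y \<in> mcar M \<Longrightarrow> w \<in> mcar M \<Longrightarrow>
      madd M (madd M x y) w = madd M x (madd M y w)"
    and M_add_commute: "x \<in> mcar M \<Longrightarrow> y \<in> mcar M \<Longrightarrow> madd M x y = madd M y x"
    and M_add_zero: "x \<in> mcar M \<Longrightarrow> madd M x z = x"
    and M_mul_add_left: "x \<in> mcar M \<Longrightarrow> y \<in> mcar M \<Longrightarrow> c \<in> grass0 (enat n) \<Longrightarrow>
      mscal M (madd M x y) c = madd M (mscal M x c) (mscal M y c)"
    and M_mul_add_right: "x \<in> mcar M \<Longrightarrow> c \<in> grass0 (enat n) \<Longrightarrow> d \<in> grass0 (enat n) \<Longrightarrow>
      mscal M x (c + d) = madd M (mscal M x c) (mscal M x d)"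
    and M_mul_assoc: "x \<in> mcar M \<Longrightarrow> c \<in> grass0 (enat n) \<Longrightarrow> d \<in> grass0 (enat n) \<Longrightarrow>
      mscal M (mscal M x c) d = mscal M x (gmul c d)"
    and M_mul_zero: "x \<in> mcar M \<Longrightarrow> mscal M x 0 = z"
    and U_open: "openin (mtop M) U"
    and U_nil: "x \<in> U \<Longrightarrow> v \<in> mcar M \<Longrightarrow> c \<in> grass0 (enat n) \<Longrightarrow> c {} = 0 \<Longrightarrow> madd M x (mscal M v c) \<in> U"
begin

abbreviation tpl (infixl "\<boxplus>" 65) where "p \<boxplus> q \<equiv> tw_plus M p q"
abbreviation tti (infixl "\<boxdot>" 70) where "p \<boxdot> c \<equiv> tw_times M p c"
abbreviation "C \<equiv> tw_car M"
abbreviation "D \<equiv> tw_dom M U"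
abbreviation "\<Lambda>0 \<equiv> grass0 (enat n)"

primrec tw0 :: "nat \<Rightarrow> ('x, nat set \<Rightarrow> 'r) tw" where
  "tw0 0 = Base z"
| "tw0 (Suc j) = Tri (tw0 j) (tw0 j) 0"

section \<open>Module laws and domains on the iterated levels\<close>

lemma M_add_closed: "x \<in> mcar M \<Longrightarrow> y \<in> mcar M \<Longrightarrow> madd M x y \<in> mcar M"
  using continuous_map_image_subset_topspace[OF M_add_cont] by (force simp: M_top)

lemma M_mul_closed: "x \<in> mcar M \<Longrightarrow> c \<in> \<Lambda>0 \<Longrightarrow> mscal M x c \<in> mcar M"
  using continuous_map_image_subset_topspace[OF M_mul_cont] by (force simp: M_top)

lemma tw0_C [simp]: "tw0 j \<in> C j"
  by (induction j) (auto simp: z)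

lemma C_add: "p \<in> C j \<Longrightarrow> q \<in> C j \<Longrightarrow> p \<boxplus> q \<in> C j"
  by (induction j arbitrary: p q) (auto simp: M_add_closed grass0_add)

lemma C_mul: "p \<in> C j \<Longrightarrow> c \<in> \<Lambda>0 \<Longrightarrow> p \<boxdot> c \<in> C j"
  by (induction j arbitrary: p) (auto simp: M_mul_closed grass0_gmul)

lemma add_assoc: "p \<in> C j \<Longrightarrow> q \<in> C j \<Longrightarrow> w \<in> C j \<Longrightarrow> p \<boxplus> q \<boxplus> w = p \<boxplus> (q \<boxplus> w)"
  by (induction j arbitrary: p q w) (auto simp: M_add_assoc add.assoc)

lemma add_commute: "p \<in> C j \<Longrightarrow> q \<in> C j \<Longrightarrow> p \<boxplus> q = q \<boxplus> p"
  by (induction j arbitrary: p q) (auto simp: M_add_commute add.commute)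

lemma add_left_commute: "p \<in> C j \<Longrightarrow> q \<in> C j \<Longrightarrow> w \<in> C j \<Longrightarrow> p \<boxplus> (q \<boxplus> w) = q \<boxplus> (p \<boxplus> w)"
  using add_assoc[of p j q w] add_assoc[of q j p w] add_commute[of p j q] by simp

lemma add_zero: "p \<in> C j \<Longrightarrow> p \<boxplus> tw0 j = p"
  by (induction j arbitrary: p) (auto simp: M_add_zero)

lemma mul_add_left: "p \<in> C j \<Longrightarrow> q \<in> C j \<Longrightarrow> c \<in> \<Lambda>0 \<Longrightarrow> (p \<boxplus> q) \<boxdot> c = p \<boxdot> c \<boxplus> q \<boxdot> c"
  by (induction j arbitrary: p q) (auto simp: M_mul_add_left gmul_add_left)

lemma mul_add_right: "p \<in> C j \<Longrightarrow> c \<in> \<Lambda>0 \<Longrightarrow> d \<in> \<Lambda>0 \<Longrightarrow> p \<boxdot> (c + d) = p \<boxdot> c \<boxplus> p \<boxdot> d"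
  by (induction j arbitrary: p) (auto simp: M_mul_add_right gmul_add_right)

lemma mul_assoc: "p \<in> C j \<Longrightarrow> c \<in> \<Lambda>0 \<Longrightarrow> d \<in> \<Lambda>0 \<Longrightarrow> p \<boxdot> c \<boxdot> d = p \<boxdot> gmul c d"
  by (induction j arbitrary: p) (auto simp: M_mul_assoc gmul_assoc)

lemma mul_zero: "p \<in> C j \<Longrightarrow> p \<boxdot> 0 = tw0 j"
  by (induction j arbitrary: p) (auto simp: M_mul_zero)

lemma tw0_mul: "c \<in> \<Lambda>0 \<Longrightarrow> tw0 j \<boxdot> c = tw0 j"
  using mul_assoc[of "tw0 j" j 0 c] mul_zero[of "tw0 j" j] by simp

lemma topspace_C: "topspace (tw_top M j) = C j"
  by (rule topspace_tw_top) (simp_all add: M_top)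

lemma cm_add:
  assumes "continuous_map Z (tw_top M j) f" "continuous_map Z (tw_top M j) g"
  shows "continuous_map Z (tw_top M j) (\<lambda>x. f x \<boxplus> g x)"
  using assms
proof (induction j arbitrary: f g)
  case 0
  have "continuous_map Z (prod_topology (mtop M) (mtop M)) (\<lambda>x. (unBase (f x), unBase (g x)))"
    using 0 by (intro continuous_map_pairedI) (auto simp del: tw_top.simps
        intro: continuous_map_compose[OF _ continuous_map_unBase, unfolded comp_def])
  from continuous_map_compose[OF continuous_map_compose[OF this M_add_cont] continuous_map_Base]
  show ?case
    by (rule continuous_map_eq)
      (use 0[THEN continuous_map_image_subset_topspace] in \<open>force simp: topspace_C image_subset_iff simp del: tw_top.simps\<close>)
next
  case (Suc j)
  have s: "tw3 (f x) + tw3 (g x) \<in> \<Lambda>0" if "x \<in> topspace Z" for x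
    using Suc.prems[THEN continuous_map_image_subset_topspace] that
    by (force simp: topspace_C image_subset_iff grass0_add simp del: tw_top.simps)
  have c3: "continuous_map Z (grass0_top (enat n)) (\<lambda>x. tw3 (f x))" "continuous_map Z (grass0_top (enat n)) (\<lambda>x. tw3 (g x))"
    using Suc.prems[THEN continuous_map_compose[OF _ continuous_map_tw3]] by (simp_all add: comp_def)
  have "continuous_map Z (tw_top M (Suc j))
    (\<lambda>x. Tri (tw1 (f x) \<boxplus> tw1 (g x)) (tw2 (f x) \<boxplus> tw2 (g x)) (tw3 (f x) + tw3 (g x)))"
  proof (intro continuous_map_Tri Suc.IH)
    show "continuous_map Z (stop M) (\<lambda>x. tw3 (f x) + tw3 (g x))"
      using s c3 by (auto simp: continuous_map_into_grass0 intro: continuous_map_plus)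
  qed (use Suc.prems in \<open>auto simp del: tw_top.simps intro: continuous_map_compose[OF _ continuous_map_tw1, unfolded comp_def]
       continuous_map_compose[OF _ continuous_map_tw2, unfolded comp_def]\<close>)
  then show ?case
    by (rule continuous_map_eq)
      (use Suc.prems[THEN continuous_map_image_subset_topspace] in \<open>force simp: topspace_C image_subset_iff simp del: tw_top.simps\<close>)
qed

lemma cm_mul:
  assumes "continuous_map Z (tw_top M j) f" "continuous_map Z (grass0_top (enat n)) c"
  shows "continuous_map Z (tw_top M j) (\<lambda>x. f x \<boxdot> c x)"
  using assms(1)
proof (induction j arbitrary: f)
  case 0
  have "continuous_map Z (prod_topology (mtop M) (grass0_top (enat n))) (\<lambda>x. (unBase (f x), c x))"
    using 0 assms(2) by (intro continuous_map_pairedI) (auto simp del: tw_top.simps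
        intro: continuous_map_compose[OF _ continuous_map_unBase, unfolded comp_def])
  from continuous_map_compose[OF continuous_map_compose[OF this M_mul_cont] continuous_map_Base]
  show ?case
    by (rule continuous_map_eq)
      (use 0[THEN continuous_map_image_subset_topspace] in \<open>force simp: topspace_C image_subset_iff simp del: tw_top.simps\<close>)
next
  case (Suc j)
  have s: "gmul (tw3 (f x)) (c x) \<in> \<Lambda>0" if "x \<in> topspace Z" for x
    using Suc.prems[THEN continuous_map_image_subset_topspace] continuous_map_image_subset_topspace[OF assms(2)] that
    by (force simp: topspace_C image_subset_iff grass0_gmul simp del: tw_top.simps)
  have c3: "continuous_map Z (grass0_top (enat n)) (\<lambda>x. tw3 (f x))"
    using Suc.prems[THEN continuous_map_compose[OF _ continuous_map_tw3]] by (simp_all add: comp_def)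
  have "continuous_map Z (tw_top M (Suc j))
    (\<lambda>x. Tri (tw1 (f x) \<boxdot> c x) (tw2 (f x) \<boxdot> c x) (gmul (tw3 (f x)) (c x)))"
  proof (intro continuous_map_Tri Suc.IH)
    show "continuous_map Z (stop M) (\<lambda>x. gmul (tw3 (f x)) (c x))"
      using s c3 assms(2) by (auto simp: continuous_map_into_grass0 intro!: continuous_map_gmul_coordinate)
  qed (use Suc.prems in \<open>auto simp del: tw_top.simps intro: continuous_map_compose[OF _ continuous_map_tw1, unfolded comp_def]
       continuous_map_compose[OF _ continuous_map_tw2, unfolded comp_def]\<close>)
  then show ?case
    by (rule continuous_map_eq)
      (use Suc.prems[THEN continuous_map_image_subset_topspace] in \<open>force simp: topspace_C image_subset_iff simp del: tw_top.simps\<close>)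
qed

lemma cm_path:
  assumes "p \<in> C j" "q \<in> C j"
  shows "continuous_map euclidean (tw_top M j) (\<lambda>s. p \<boxplus> q \<boxdot> rc s)"
  using assms by (intro cm_add cm_mul continuous_map_rc) (auto simp: topspace_C)

lemma D_C: "D j \<subseteq> C j"
  using openin_subset[OF U_open] by (intro tw_dom_subset_car) (simp add: M_top)

text \<open>A triple belongs to the domain when its base point and its end point do, and both depend
  continuously on it.\<close>

lemma D_open: "openin (tw_top M j) (D j)"
proof (induction j)
  case 0
  then show ?case using U_open by (auto simp: openin_img_topology[OF inj_Base])
next
  case (Suc j)
  have c: "continuous_map (tw_top M (Suc j)) (tw_top M j) (\<lambda>p. tw1 p \<boxplus> tw2 p \<boxdot> tw3 p)"
    using continuous_map_tw3[of M j] by (intro cm_add cm_mul continuous_map_tw1 continuous_map_tw2) auto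
  have "openin (tw_top M (Suc j)) ({p \<in> topspace (tw_top M (Suc j)). tw1 p \<in> D j} \<inter>
    {p \<in> topspace (tw_top M (Suc j)). tw1 p \<boxplus> tw2 p \<boxdot> tw3 p \<in> D j})"
    using Suc by (intro openin_Int openin_continuous_map_preimage[OF continuous_map_tw1] openin_continuous_map_preimage[OF c])
  also have "{p \<in> topspace (tw_top M (Suc j)). tw1 p \<in> D j} \<inter>
    {p \<in> topspace (tw_top M (Suc j)). tw1 p \<boxplus> tw2 p \<boxdot> tw3 p \<in> D j} = D (Suc j)"
    unfolding topspace_C using D_C[of j] by auto
  finally show ?case .
qed

lemma gmul_cc: "c \<in> \<Lambda>0 \<Longrightarrow> gmul c d = gmul d c"
  by (rule grass0_commute)

text \<open>Moving a triple \<open>(a, b, t)\<close> by \<open>c\<close> in direction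
  \<open>(a', b', t')\<close> moves its end point in direction \<open>a' + b' t + b t'\<close>, up
  to a remainder with another factor \<open>c\<close>. This is the differential of
  \<open>(a, b, t) |-> a + b t\<close>.\<close>

lemma line_identity:
  assumes "a \<in> C j" "a' \<in> C j" "b \<in> C j" "b' \<in> C j" "t \<in> \<Lambda>0" "t' \<in> \<Lambda>0" "c \<in> \<Lambda>0"
  shows "(a \<boxplus> a' \<boxdot> c) \<boxplus> (b \<boxplus> b' \<boxdot> c) \<boxdot> (t + gmul t' c)
    = (a \<boxplus> b \<boxdot> t) \<boxplus> (a' \<boxplus> b' \<boxdot> t \<boxplus> b \<boxdot> t' \<boxplus> b' \<boxdot> t' \<boxdot> c) \<boxdot> c"
proof -
  note mem = assms C_add C_mul grass0_gmul grass0_add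
  have e: "gmul c t = gmul t c" "gmul c (gmul t' c) = gmul (gmul t' c) c"
    using assms by (auto intro: gmul_cc)
  show ?thesis
    using assms
    by (simp add: mem mul_add_left[where j = j] mul_add_right[where j = j] mul_assoc[where j = j]
        add_assoc[where j = j] add_commute[where j = j] add_left_commute[where j = j] e)
qed

text \<open>Stability under bodiless scalars climbs the tower: by \<open>line_identity\<close> the
  end point of the moved triple is again moved by the same scalar \<open>c\<close>.\<close>

lemma D_nil: "p \<in> D j \<Longrightarrow> q \<in> C j \<Longrightarrow> c \<in> \<Lambda>0 \<Longrightarrow> c {} = 0 \<Longrightarrow> p \<boxplus> q \<boxdot> c \<in> D j"
proof (induction j arbitrary: p q)
  case 0
  then show ?case using U_nil by auto
next
  case (Suc j)
  obtain a b t where p: "p = Tri a b t" "a \<in> D j" "b \<in> C j" "t \<in> \<Lambda>0" "a \<boxplus> b \<boxdot> t \<in> D j"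
    using Suc.prems by auto
  obtain a' b' t' where q: "q = Tri a' b' t'" "a' \<in> C j" "b' \<in> C j" "t' \<in> \<Lambda>0"
    using Suc.prems by auto
  have a: "a \<in> C j" using p D_C by auto
  have "(a \<boxplus> b \<boxdot> t) \<boxplus> (a' \<boxplus> b' \<boxdot> t \<boxplus> b \<boxdot> t' \<boxplus> b' \<boxdot> t' \<boxdot> c) \<boxdot> c \<in> D j"
    using p q a Suc.prems by (intro Suc.IH C_add C_mul)
  moreover have "a \<boxplus> a' \<boxdot> c \<in> D j" using p q Suc.prems by (intro Suc.IH)
  ultimately show ?case
    using p q a Suc.prems line_identity[of a j a' b b' t t' c]
    by (auto simp: C_add C_mul grass0_gmul grass0_add)
qed

text \<open>The level \<open>j\<close> domain as a module over R. Differentiation over R on this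
  level forms iterated domains of its own, hence \<open>tw\<close> over \<open>tw\<close>.\<close>

definition RM :: "nat \<Rightarrow> (('x, nat set \<Rightarrow> 'r) tw, 'r) tmod" where
  "RM j = \<lparr> mcar = C j, mtop = tw_top M j, madd = tw_plus M, mscal = (\<lambda>p r. p \<boxdot> rc r),
     scar = UNIV, stop = euclidean, sadd = (+), smul = (*) \<rparr>"

lemma RM_simps [simp]:
  "mcar (RM j) = C j" "mtop (RM j) = tw_top M j" "madd (RM j) = tw_plus M"
  "mscal (RM j) p r = p \<boxdot> rc r" "scar (RM j) = UNIV" "stop (RM j) = euclidean"
  "sadd (RM j) = (+)" "smul (RM j) = (*)"
  by (simp_all add: RM_def)

lemma scalR_RM: "scalR (RM j)"
  by (simp add: scalR_def topspace_C)

lemma path_module_RM: "path_module (RM j)"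
  using cm_path by (simp add: path_module_def scalR_RM)

abbreviation "Y \<equiv> Fcod_R t0 t1 (enat n)"

abbreviation sm :: "nat \<Rightarrow> (('x, nat set \<Rightarrow> 'r) tw \<Rightarrow> nat set \<Rightarrow> 'f0 \<times> 'f1) \<Rightarrow> bool" where
  "sm j h \<equiv> BGN_smooth (RM j) (D j) Y h"

abbreviation rs where "rs j h h1 \<equiv> rsm (RM j) (D j) Y h h1"

text \<open>The invariant of the tower. The expansion along \<alpha>\<beta> is the trace that
  naturality leaves in a single Grassmann algebra; \<open>h1\<close> at scalar 0 is the derivative
  over R.\<close>

definition ksm where
  "ksm j h h1 \<longleftrightarrow> rs j h h1 \<and>
    (\<forall>x\<in>D j. \<forall>v\<in>C j. \<forall>\<alpha>\<in>grass1 (enat n). \<forall>\<beta>\<in>grass1 (enat n).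
      h (x \<boxplus> v \<boxdot> gmul \<alpha> \<beta>) = h x + tmul \<tau> (h1 (Tri (Base x) (Base v) 0)) (gmul \<alpha> \<beta>))"

section \<open>Smooth maps over R on one level of the tower\<close>

lemma sm_rs: "sm j h \<Longrightarrow> \<exists>h1. rs j h h1"
  using smooth_rsm[OF path_module_RM, of j "D j"] D_open by simp

lemma sm_ev: "sm j h \<Longrightarrow> p \<in> D j \<Longrightarrow> h p \<in> ev (enat n)"
  using continuous_map_image_subset_topspace[OF BGN_smooth_continuous] D_C[of j] by (force simp: topspace_C)

lemma rs_line:
  assumes "rs j h h1" "x \<in> D j" "v \<in> C j" "x \<boxplus> v \<boxdot> rc s \<in> D j"
  shows "h (x \<boxplus> v \<boxdot> rc s) - h x = tsmul \<tau> (h1 (Tri (Base x) (Base v) s)) s"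
  using rsm_quotient[OF assms(1), of x v s] assms by simp

lemma rs_dom: "x \<in> D j \<Longrightarrow> v \<in> C j \<Longrightarrow> x \<boxplus> v \<boxdot> rc s \<in> D j \<Longrightarrow> Tri (Base x) (Base v) s \<in> tw_dom (RM j) (D j) 1"
  by simp

lemma line_zero: "x \<in> C j \<Longrightarrow> v \<in> C j \<Longrightarrow> x \<boxplus> v \<boxdot> 0 = x"
  by (simp add: mul_zero[where j = j] add_zero)

lemma rs_ev:
  assumes "rs j h h1" "x \<in> D j" "v \<in> C j" "x \<boxplus> v \<boxdot> rc s \<in> D j"
  shows "h1 (Tri (Base x) (Base v) s) \<in> ev (enat n)"
proof -
  have "Tri (Base x) (Base v) s \<in> topspace (subtopology (tw_top (RM j) 1) (tw_dom (RM j) (D j) 1))"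
  proof -
    have "topspace (tw_top (RM j) 1) = tw_car (RM j) 1"
      by (rule topspace_tw_top) (simp_all add: topspace_C)
    moreover have "tw_dom (RM j) (D j) 1 \<subseteq> tw_car (RM j) 1"
      by (rule tw_dom_subset_car) (simp add: D_C)
    ultimately show ?thesis using rs_dom[OF assms(2-4)] by (simp only: topspace_subtopology) blast
  qed
  then show ?thesis using continuous_map_image_subset_topspace[OF rsm_continuous[OF assms(1)]] by force
qed

lemma rs_path:
  assumes "rs j h h1"
    and "continuous_map (subtopology euclidean S) (tw_top M j) x" "continuous_map (subtopology euclidean S) (tw_top M j) v"
    and "continuous_map (subtopology euclidean S) euclidean r"
    and "\<And>s. s \<in> S \<Longrightarrow> x s \<in> D j" "\<And>s. s \<in> S \<Longrightarrow> x s \<boxplus> v s \<boxdot> rc (r s) \<in> D j"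
  shows "continuous_map (subtopology euclidean S) euclidean (\<lambda>s. h1 (Tri (Base (x s)) (Base (v s)) (r s)) K)"
proof (rule continuous_map_path_coordinate[where g = h1 and \<gamma> = "\<lambda>s. Tri (Base (x s)) (Base (v s)) (r s)"])
  show "continuous_map (subtopology (tw_top (RM j) 1) (tw_dom (RM j) (D j) 1)) (ev_top (enat n)) h1"
    using rsm_continuous[OF assms(1)] by simp
  show "continuous_map (subtopology euclidean S) (tw_top (RM j) 1) (\<lambda>s. Tri (Base (x s)) (Base (v s)) (r s))"
    using assms by (intro continuous_map_Tri_Base) auto
  have "v s \<in> C j" if "s \<in> S" for s
    using continuous_map_image_subset_topspace[OF assms(3)] that by (auto simp: topspace_C)
  then show "Tri (Base (x s)) (Base (v s)) (r s) \<in> tw_dom (RM j) (D j) 1" if "s \<in> S" for s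
    using assms that by (intro rs_dom)
qed

lemma sm_path:
  assumes "sm j h" "continuous_map (subtopology euclidean S) (tw_top M j) x" "\<And>s. s \<in> S \<Longrightarrow> x s \<in> D j"
  shows "continuous_map (subtopology euclidean S) euclidean (\<lambda>s. h (x s) K)"
  using BGN_smooth_continuous[OF assms(1)] assms(2,3)
  by (intro continuous_map_path_coordinate[where g = h and \<gamma> = x]) auto

lemma sm_add:
  assumes "sm j g" "sm j h"
  shows "sm j (\<lambda>p. g p + h p)"
proof -
  have "BGN_Ck (RM j) (D j) Y k 0 (base_fun (\<lambda>p. g p + h p))" for k
    by (rule BGN_cong[OF _ BGN_add[of "RM j" "D j" n k 0 "base_fun g" "base_fun h"]])
      (use assms in \<open>auto simp: BGN_smooth_def\<close>)
  then show ?thesis by (simp add: BGN_smooth_def)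
qed

lemma sm_mult:
  assumes "sm j g" "continuous_map (tw_top M j) euclidean l"
    and "\<And>p q s. p \<in> C j \<Longrightarrow> q \<in> C j \<Longrightarrow> l (p \<boxplus> q \<boxdot> rc s) = l p + l q * s"
  shows "sm j (\<lambda>p. tsmul \<tau> (g p) (l p))"
proof -
  have c: "continuous_map (tw_top (RM j) 0) euclidean (\<lambda>q. l (unBase q))"
    using continuous_map_compose[OF continuous_map_unBase[of "RM j"], of euclidean l] assms(2)
    by (simp add: comp_def)
  have "BGN_Ck (RM j) (D j) Y k 0 (base_fun (\<lambda>p. tsmul \<tau> (g p) (l p)))" for k
  proof (rule BGN_cong)
    show "BGN_Ck (RM j) (D j) Y k 0 (\<lambda>q. tsmul \<tau> (base_fun g q) (l (unBase q)))"
      by (rule BGN_mult[OF scalR_RM _ _ c]) (use assms D_C in \<open>auto simp: BGN_smooth_def\<close>)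
  qed auto
  then show ?thesis by (simp add: BGN_smooth_def)
qed

lemma sm_tmul:
  assumes "sm j g" "c \<in> \<Lambda>0"
  shows "sm j (\<lambda>p. tmul \<tau> (g p) c)"
proof -
  have P: "continuous_map (ytop Y) (ytop Y) (\<lambda>y. tmul \<tau> y c)"
    using assms(2) continuous_map_ev_coordinate[of "enat n"]
    by (auto simp: continuous_map_into_ev intro!: tmul_ev continuous_map_tmul_coordinate[OF F])
  have aff: "affine_map (RM j) 0 (RM j) 0 (\<lambda>s. s) (\<lambda>p. p) (\<lambda>p. p)"
    by (simp add: affine_map_def)
  have "BGN_Ck (RM j) (D j) Y k 0 (base_fun (\<lambda>p. tmul \<tau> (g p) c))" for k
  proof (rule BGN_cong)
    show "BGN_Ck (RM j) (D j) Y k 0 (\<lambda>q. tmul \<tau> (base_fun g q) c)"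
      by (rule BGN_transport[where P = "\<lambda>y. tmul \<tau> y c" and M = "RM j" and M' = "RM j" and Y = Y
          and U = "D j" and j = 0 and g = "base_fun g", OF _ _ _ _ _ _ _ _ P _ _ aff])
        (use assms D_C in \<open>auto simp: BGN_smooth_def topspace_C F.tmul_diff_left tsmul_tmul\<close>)
  qed auto
  then show ?thesis by (simp add: BGN_smooth_def)
qed

text \<open>Inserting a base point into a triple with fixed direction \<open>e\<close> and scalar 0
  is affine, with linear part \<open>p |-> (p, 0, 0)\<close>.\<close>

lemma rs_direction:
  assumes h: "rs j h h1" and e: "e \<in> C j"
  shows "sm j (\<lambda>p. h1 (Tri (Base p) (Base e) 0))"
proof -
  define L where "L q = Tri (Base (unBase q)) (Base e) (0 :: 'r)" for q :: "(('x, nat set \<Rightarrow> 'r) tw, 'r) tw"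
  define L' where "L' q = Tri (Base (unBase q)) (Base (tw0 j)) (0 :: 'r)" for q :: "(('x, nat set \<Rightarrow> 'r) tw, 'r) tw"
  have c: "continuous_map (tw_top (RM j) 0) (mtop (RM j)) unBase" by (rule continuous_map_unBase)
  have aff: "affine_map (RM j) 0 (RM j) 1 (\<lambda>s. s) L L'"
    unfolding affine_map_def L_def L'_def
  proof (intro conjI ballI)
    show "continuous_map (tw_top (RM j) 0) (tw_top (RM j) 1) (\<lambda>q. Tri (Base (unBase q)) (Base e) 0)"
      using e c by (intro continuous_map_Tri_Base) (auto simp: topspace_C)
    show "continuous_map (tw_top (RM j) 0) (tw_top (RM j) 1) (\<lambda>q. Tri (Base (unBase q)) (Base (tw0 j)) 0)"
      using c by (intro continuous_map_Tri_Base) (auto simp: topspace_C)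
  qed (use e in \<open>auto simp: tw0_mul add_zero[where j = j] mul_zero\<close>)
  have dom: "L p \<in> tw_dom (RM j) (D j) 1" if "p \<in> tw_dom (RM j) (D j) 0" for p
    using that e D_C by (auto simp: L_def line_zero[where j = j] subset_iff)
  have "BGN_Ck (RM j) (D j) Y k 0 (base_fun (\<lambda>p. h1 (Tri (Base p) (Base e) 0)))" for k
  proof (rule BGN_cong)
    show "BGN_Ck (RM j) (D j) Y k 0 (\<lambda>q. h1 (L q))"
      by (rule BGN_transport[where P = "\<lambda>y. y" and M = "RM j" and M' = "RM j" and Y = Y
          and U = "D j" and j = 1 and g = h1, OF _ _ _ _ _ _ _ _ _ _ _ aff dom])
        (use h D_C in \<open>auto simp: rsm_def topspace_C simp del: tw_dom.simps One_nat_def\<close>)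
  qed (auto simp: L_def)
  then show ?thesis by (simp add: BGN_smooth_def)
qed

text \<open>Replacing the scalar by its body is R-linear and stays in the domain, because scalar and
  body differ by an element without body. The result is the quotient for scalars in R, defined on
  all triples, from which the extension starts.\<close>

lemma rs_body_quotient:
  assumes h: "rs j h h1"
  shows "sm (Suc j) (\<lambda>p. h1 (Tri (Base (tw1 p)) (Base (tw2 p)) (tw3 p {})))"
proof -
  define L where "L q = Tri (Base (tw1 (unBase q))) (Base (tw2 (unBase q))) (tw3 (unBase q) {})"
    for q :: "(('x, nat set \<Rightarrow> 'r) tw, 'r) tw"
  have c: "continuous_map (tw_top (RM (Suc j)) 0) (tw_top M (Suc j)) unBase"
    using continuous_map_unBase[of "RM (Suc j)"] by simp
  have aff: "affine_map (RM (Suc j)) 0 (RM j) 1 (\<lambda>s. s) L L"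
    unfolding affine_map_def
  proof (intro conjI ballI)
    have "continuous_map (tw_top (RM (Suc j)) 0) (tw_top (RM j) 1) L"
      unfolding L_def
    proof (intro continuous_map_Tri_Base)
      show "continuous_map (tw_top (RM (Suc j)) 0) (stop (RM j)) (\<lambda>q. tw3 (unBase q) {})"
        using continuous_map_compose[OF continuous_map_compose[OF c continuous_map_tw3] , of euclidean "\<lambda>t. t {}"]
          continuous_map_grass0_coordinate[of "enat n" "{}"] by (simp add: comp_def)
    qed (use continuous_map_compose[OF c continuous_map_tw1] continuous_map_compose[OF c continuous_map_tw2] in
        \<open>auto simp: comp_def simp del: tw_top.simps\<close>)
    then show "continuous_map (tw_top (RM (Suc j)) 0) (tw_top (RM j) 1) L"
      "continuous_map (tw_top (RM (Suc j)) 0) (tw_top (RM j) 1) L" by simp_all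
  qed (auto simp: L_def gmul_empty)
  have dom: "L p \<in> tw_dom (RM j) (D j) 1" if pd: "p \<in> tw_dom (RM (Suc j)) (D (Suc j)) 0" for p
  proof -
    from pd obtain p' where "p = Base p'" "p' \<in> D (Suc j)" by (auto simp del: tw_dom.simps(2))
    then obtain a b t where p: "p = Base (Tri a b t)" "a \<in> D j" "b \<in> C j" "t \<in> \<Lambda>0" "a \<boxplus> b \<boxdot> t \<in> D j"
      by auto
    have a: "a \<in> C j" using p D_C by auto
    \<comment> \<open>Minus the nilpotent part of \<open>t\<close>; adding it to \<open>t\<close>
      leaves the body.\<close>
    define c where "c = rc (t {}) - t"
    have c: "c \<in> \<Lambda>0" "c {} = 0" "rc (t {}) = t + c" using p by (auto simp: c_def intro: grass0_diff)
    have "(a \<boxplus> b \<boxdot> t) \<boxplus> b \<boxdot> c \<in> D j" by (rule D_nil[OF p(5,3) c(1,2)])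
    also have "(a \<boxplus> b \<boxdot> t) \<boxplus> b \<boxdot> c = a \<boxplus> b \<boxdot> rc (t {})"
      using p a c by (simp add: mul_add_right[where j = j] add_assoc[where j = j] C_mul)
    finally show ?thesis using p by (simp add: L_def)
  qed
  have "BGN_Ck (RM (Suc j)) (D (Suc j)) Y k 0 (base_fun (\<lambda>p. h1 (Tri (Base (tw1 p)) (Base (tw2 p)) (tw3 p {}))))" for k
  proof (rule BGN_cong)
    show "BGN_Ck (RM (Suc j)) (D (Suc j)) Y k 0 (\<lambda>q. h1 (L q))"
      by (rule BGN_transport[where P = "\<lambda>y. y" and M = "RM j" and M' = "RM (Suc j)" and Y = Y
          and U = "D j" and j = 1 and g = h1, OF _ _ _ _ _ _ _ _ _ _ _ aff dom])
        (use h D_C in \<open>auto simp: rsm_def topspace_C simp del: tw_dom.simps One_nat_def tw_top.simps tw_car.simps\<close>)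
  qed (auto simp: L_def)
  then show ?thesis by (simp add: BGN_smooth_def)
qed

end

text \<open>The body is kept for every \<open>S\<close>, so that restricting the scalar changes only
  its nilpotent part and the end point stays in the domain.\<close>

definition grestr :: "nat set set \<Rightarrow> (nat set \<Rightarrow> 'r::comm_ring_1) \<Rightarrow> nat set \<Rightarrow> 'r" where
  "grestr S t K = (if K = {} \<or> K \<in> S then t K else 0)"

lemma grestr_grass0: "t \<in> grass0 n \<Longrightarrow> grestr S t \<in> grass0 n"
proof -
  assume t: "t \<in> grass0 n"
  have "supp (grestr S t) \<subseteq> supp t" by (auto simp: supp_def grestr_def)
  with t show ?thesis by (auto simp: grass0_iff coef_def grestr_def intro: finite_subset)
qed

text \<open>Exchanging the two inner factors turns the square into
  \<open>- \<alpha>\<alpha>\<beta>\<beta>\<close>, and odd elements square to 0.\<close>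

lemma gmul_odd_product:
  assumes "\<exists>y::'r::comm_ring_1. of_nat 2 * y = 1"
    and \<alpha>: "\<alpha> \<in> grass1 n" and \<beta>: "\<beta> \<in> grass1 (n :: enat)"
  shows "gmul (\<alpha> :: nat set \<Rightarrow> 'r) \<beta> \<in> grass0 n" "gmul \<alpha> \<beta> {} = 0"
    "gmul (gmul \<alpha> \<beta>) (gmul \<alpha> \<beta>) = 0"
proof -
  have o: "\<And>I. even (card I) \<Longrightarrow> \<alpha> I = 0" "\<And>I. even (card I) \<Longrightarrow> \<beta> I = 0"
    using assms by (auto simp: grass1_iff)
  show "gmul \<alpha> \<beta> \<in> grass0 n" using \<alpha> \<beta> by (rule grass1_gmul)
  show "gmul \<alpha> \<beta> {} = 0" using o by (simp add: gmul_empty)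
  have sq: "gmul \<alpha> \<alpha> = 0" using o(1) assms(1) by (rule gmul_odd_square)
  have "gmul (gmul \<alpha> \<beta>) (gmul \<alpha> \<beta>) = gmul \<alpha> (gmul (gmul \<beta> \<alpha>) \<beta>)" by (simp add: gmul_assoc)
  also have "gmul \<beta> \<alpha> = gmul (gconj \<alpha>) \<beta>" using o(2) by (rule gmul_odd_swap)
  also have "gconj \<alpha> = - \<alpha>" using o(1) by (auto simp: gconj_def fun_eq_iff uminus_power_if)
  also have "gmul \<alpha> (gmul (gmul (- \<alpha>) \<beta>) \<beta>) = - gmul (gmul \<alpha> \<alpha>) (gmul \<beta> \<beta>)"
    by (simp add: gmul_assoc gmul_minus_left gmul_minus_right)
  finally show "gmul (gmul \<alpha> \<beta>) (gmul \<alpha> \<beta>) = 0" by (simp add: sq)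
qed

lemma continuous_map_rc_coordinate:
  "continuous_map (subtopology euclidean S) euclidean (\<lambda>s. rc s K :: 'r::{comm_ring_1,topological_space})"
  by (cases "K = {}") (auto simp: rc_apply)

lemma continuous_map_diff:
  fixes g h :: "_ \<Rightarrow> 'a::topological_group_add"
  assumes "continuous_map Z euclidean g" "continuous_map Z euclidean h"
  shows "continuous_map Z euclidean (\<lambda>z. g z - h z)"
  using continuous_map_plus[OF assms(1) continuous_map_uminus[OF assms(2)]] by simp

lemma (in target) tsmul_cancel_fun: "tsmul \<tau> x s = tsmul \<tau> y s \<Longrightarrow> s * u = 1 \<Longrightarrow> x = y"
  using tsmul_cancel[of x s _ y u] by (metis ext)

section \<open>Extending the quotient monomial by monomial\<close>

context gtower begin

text \<open>The tangent direction \<open>(0, 0, 1)\<close>: along it base point and direction stay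
  fixed and only the body of the scalar moves.\<close>

definition bdir :: "nat \<Rightarrow> ('x, nat set \<Rightarrow> 'r) tw" where "bdir j = Tri (tw0 j) (tw0 j) gone"

lemma gone_grass0 [simp]: "gone \<in> grass0 m"
  using rc_grass0[of 1] by (simp add: rc_one)

lemma bdir_C [simp]: "bdir j \<in> C (Suc j)"
  by (simp add: bdir_def)

lemma bdir_line: "a \<in> C j \<Longrightarrow> b \<in> C j \<Longrightarrow> Tri a b t \<boxplus> bdir j \<boxdot> rc s = Tri a b (t + rc s)"
  using rc_grass0[of s "enat n"] by (simp add: bdir_def tw0_mul add_zero[where j = j] gmul_gone[where n = "enat n"] grass0_iff)

lemma D_SucE:
  assumes "p \<in> D (Suc j)"
  obtains a b t where "p = Tri a b t" "a \<in> D j" "b \<in> C j" "t \<in> \<Lambda>0" "a \<boxplus> b \<boxdot> t \<in> D j" "a \<in> C j"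
  using assms D_C[of j] by auto

lemma Tri_D: "Tri a b t \<in> D (Suc j) \<longleftrightarrow> a \<in> D j \<and> b \<in> C j \<and> t \<in> \<Lambda>0 \<and> a \<boxplus> b \<boxdot> t \<in> D j"
  by auto

text \<open>Scalars with the same body differ by one without body, so \<open>D_nil\<close> moves one
  end point to the other.\<close>

lemma D_same_body:
  assumes "a \<in> C j" "b \<in> C j" "t \<in> \<Lambda>0" "a \<boxplus> b \<boxdot> t \<in> D j" "c \<in> \<Lambda>0" "c {} = t {}"
  shows "a \<boxplus> b \<boxdot> c \<in> D j"
proof -
  define d where "d = c - t"
  have d: "d \<in> \<Lambda>0" "d {} = 0" "c = t + d" using assms by (auto simp: d_def intro: grass0_diff)
  have "(a \<boxplus> b \<boxdot> t) \<boxplus> b \<boxdot> d \<in> D j" by (rule D_nil[OF assms(4,2) d(1,2)])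
  also have "(a \<boxplus> b \<boxdot> t) \<boxplus> b \<boxdot> d = a \<boxplus> b \<boxdot> c"
    using assms d by (simp add: mul_add_right[where j = j] add_assoc[where j = j] C_mul)
  finally show ?thesis .
qed

text \<open>Adding one monomial to the scalar: the correction term is the derivative in the direction of
  the body of the scalar, which is computed by differentiating the defining identity.\<close>
lemma quotient_on_restriction:
  assumes h: "ksm j h h1" and "finite S" "S \<subseteq> {I. I \<subseteq> {..<n} \<and> even (card I) \<and> I \<noteq> {}}"
  shows "\<exists>H. sm (Suc j) H \<and> (\<forall>a b t. Tri a b t \<in> D (Suc j) \<longrightarrow>
    tmul \<tau> (H (Tri a b t)) (grestr S t) = h (a \<boxplus> b \<boxdot> grestr S t) - h a)"
  using assms(2,3)
proof (induction S)
  case empty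
  have r: "rs j h h1" using h by (simp add: ksm_def)
  let ?H = "\<lambda>p. h1 (Tri (Base (tw1 p)) (Base (tw2 p)) (tw3 p {}))"
  have "tmul \<tau> (?H (Tri a b t)) (grestr {} t) = h (a \<boxplus> b \<boxdot> grestr {} t) - h a"
    if d: "Tri a b t \<in> D (Suc j)" for a b t
  proof -
    have g: "grestr {} t = rc (t {})" by (auto simp: fun_eq_iff grestr_def)
    have ab: "a \<in> D j" "b \<in> C j" "t \<in> \<Lambda>0" "a \<boxplus> b \<boxdot> t \<in> D j" "a \<in> C j" using d D_C[of j] by auto
    have m: "a \<boxplus> b \<boxdot> rc (t {}) \<in> D j" by (rule D_same_body[OF ab(5,2,3,4)]) simp_all
    have "h1 (Tri (Base a) (Base b) (t {})) \<in> ev (enat n)" by (rule rs_ev[OF r ab(1,2) m])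
    then show ?thesis
      unfolding g rs_line[OF r ab(1,2) m] by (simp add: ev_iff F.tmul_rc_coef[where n = "enat n"])
  qed
  with rs_body_quotient[OF r] show ?case by blast
next
  case (insert I S)
  have "S \<subseteq> {I. I \<subseteq> {..<n} \<and> even (card I) \<and> I \<noteq> {}}" using insert.prems by auto
  from insert.IH[OF this] obtain H where H: "sm (Suc j) H"
    and Heq: "\<And>a b t. Tri a b t \<in> D (Suc j) \<Longrightarrow>
      tmul \<tau> (H (Tri a b t)) (grestr S t) = h (a \<boxplus> b \<boxdot> grestr S t) - h a" by blast
  obtain H1 where H1: "rs (Suc j) H H1" using sm_rs[OF H] by blast
  have r: "rs j h h1" using h by (simp add: ksm_def)
  have I: "I \<subseteq> {..<n}" "even (card I)" "I \<noteq> {}" "finite I"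
    using insert.prems finite_subset[of I "{..<n}"] by auto
  then have Ix: "I \<in> idx (enat n)" by (simp add: idx_enat)
  have gI: "(gbasis I :: nat set \<Rightarrow> 'r) \<in> \<Lambda>0" using Ix I(2) by (rule gbasis_grass0)
  \<comment> \<open>Let \<open>T\<close> be the restricted scalar, \<open>\<sigma>\<close> the new
    monomial with its coefficient, \<open>y = a + b T\<close>, and \<open>dH\<close> the derivative
    of \<open>H\<close> along \<open>bdir j\<close>. As \<open>\<sigma>\<close> squares to 0,
    \<open>(H + dH \<sigma>) (T + \<sigma>)\<close> equals \<open>H T + (dH T + H) \<sigma>\<close>.
    If the bracket is the derivative of \<open>h\<close> at \<open>y\<close> in direction
    \<open>b\<close>, the expansion in \<open>ksm\<close> turns this into
    \<open>h (y + b \<sigma>) - h a\<close>.\<close>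
  define H' where "H' p = H p + tsmul \<tau> (tmul \<tau> (H1 (Tri (Base p) (Base (bdir j)) 0)) (gbasis I)) (tw3 p I)" for p
  have lc: "continuous_map (tw_top M (Suc j)) euclidean (\<lambda>p. tw3 p I)"
    using continuous_map_compose[OF continuous_map_tw3[of M j], of euclidean "\<lambda>t. t I"]
      continuous_map_grass0_coordinate[of "enat n" I] by (simp add: comp_def del: tw_top.simps)
  have "sm (Suc j) H'"
    unfolding H'_def
  proof (intro sm_add H sm_mult lc sm_tmul gI rs_direction[OF H1])
    show "tw3 (p \<boxplus> q \<boxdot> rc s) I = tw3 p I + tw3 q I * s" if "p \<in> C (Suc j)" "q \<in> C (Suc j)" for p q s
      using that I by (auto simp: gmul_rc_right mult.commute)
  qed (rule bdir_C)
  moreover have "tmul \<tau> (H' (Tri a b t)) (grestr (insert I S) t) = h (a \<boxplus> b \<boxdot> grestr (insert I S) t) - h a"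
    if d: "Tri a b t \<in> D (Suc j)" for a b t
  proof -
    define p where "p = Tri a b t"
    define T where "T = grestr S t"
    define \<sigma> where "\<sigma> = gsmul (t I) (gbasis I)"
    define y where "y = a \<boxplus> b \<boxdot> T"
    define dH where "dH = H1 (Tri (Base p) (Base (bdir j)) 0)"
    have ab: "a \<in> D j" "b \<in> C j" "t \<in> \<Lambda>0" "a \<boxplus> b \<boxdot> t \<in> D j" "a \<in> C j" using d D_C[of j] by auto
    have pD: "p \<in> D (Suc j)" using d by (simp add: p_def)
    have pC: "p \<in> C (Suc j)" using pD D_C by blast
    have T: "T \<in> \<Lambda>0" "T {} = t {}" using ab by (auto simp: T_def grestr_grass0) (simp add: grestr_def)
    have y: "y \<in> D j" unfolding y_def by (rule D_same_body[OF ab(5,2,3,4) T])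
    have yC: "y \<in> C j" using y D_C by auto
    have T\<sigma>: "grestr (insert I S) t = T + \<sigma>"
      using insert.hyps I by (auto simp: T_def \<sigma>_def fun_eq_iff grestr_def gsmul_def gbasis_def)
    have \<sigma>0: "\<sigma> \<in> \<Lambda>0" unfolding \<sigma>_def using gI by (rule gsmul_grass0)
    have \<sigma>\<sigma>: "gmul \<sigma> \<sigma> = 0"
    proof
      fix K show "gmul \<sigma> \<sigma> K = 0 K"
        unfolding gmul_tmul using I
        by (simp, intro module.tmul_not_supp[OF module_mult]) (auto simp: \<sigma>_def gsmul_def gbasis_def)
    qed
    \<comment> \<open>The invariant speaks only of products of two odd elements. Splitting off one
      generator from the even set \<open>I\<close> leaves a monomial of odd degree.\<close>
    obtain \<alpha> \<beta> where \<alpha>\<beta>: "\<alpha> \<in> grass1 (enat n)" "\<beta> \<in> grass1 (enat n)" "\<sigma> = gmul \<alpha> \<beta>"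
    proof -
      obtain i where i: "i \<in> I" using I by auto
      show thesis
      proof (rule that)
        show "gsmul (t I) (gsmul (of_int (gsign {i} (I - {i}))) (gbasis {i})) \<in> grass1 (enat n)"
          using Ix i idx_subset[of I "enat n" "{i}"] by (intro gsmul_grass1 gbasis_grass1) auto
        show "gbasis (I - {i}) \<in> grass1 (enat n)"
          using Ix i I idx_subset[of I "enat n" "I - {i}"] by (intro gbasis_grass1) auto
        show "\<sigma> = gmul (gsmul (t I) (gsmul (of_int (gsign {i} (I - {i}))) (gbasis {i}))) (gbasis (I - {i}))"
          unfolding \<sigma>_def using gbasis_split[OF I(4) i, where ?'a = 'r] by (simp add: gmul_gsmul_left)
      qed
    qed
    \<comment> \<open>The equation for \<open>H\<close> is written at the scalar with body raised by
      \<open>s\<close>, and its instance at \<open>s = 0\<close> is subtracted. Dividing by a unit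
      \<open>s\<close> and letting \<open>s\<close> tend to 0 gives the product rule on the left and
      the derivative of \<open>h\<close> on the right.\<close>
    have key: "tmul \<tau> dH T + H p = h1 (Tri (Base y) (Base b) 0)"
    proof
      fix K
      let ?S = "{s. p \<boxplus> bdir j \<boxdot> rc s \<in> D (Suc j)}"
      let ?\<Delta> = "\<lambda>s. H1 (Tri (Base p) (Base (bdir j)) s)"
      have line: "p \<boxplus> bdir j \<boxdot> rc s = Tri a b (t + rc s)" for s
        unfolding p_def using ab by (intro bdir_line)
      have yline: "y \<boxplus> b \<boxdot> rc s = a \<boxplus> b \<boxdot> (T + rc s)" for s
        unfolding y_def using ab T by (simp add: mul_add_right[where j = j] add_assoc[where j = j] C_mul)
      have ydom: "y \<boxplus> b \<boxdot> rc s \<in> D j" if "s \<in> ?S" for s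
      proof -
        have "t + rc s \<in> \<Lambda>0" "a \<boxplus> b \<boxdot> (t + rc s) \<in> D j"
          using that unfolding line mem_Collect_eq Tri_D by auto
        from D_same_body[OF ab(5,2) this, of "T + rc s"] show ?thesis
          unfolding yline using T by (simp add: grass0_add)
      qed
      have "(tmul \<tau> (?\<Delta> 0) T + H (p \<boxplus> bdir j \<boxdot> rc 0)) K = h1 (Tri (Base y) (Base b) 0) K"
      proof (rule unit_limit_unique[OF units])
        show "open ?S" by (rule open_path_preimage[OF cm_path[OF pC bdir_C] D_open])
        show "0 \<in> ?S" using pD pC by (simp add: line_zero[where j = "Suc j"] del: tw_dom.simps tw_car.simps)
        have c: "continuous_map (subtopology euclidean ?S) (tw_top M (Suc j)) (\<lambda>s. p \<boxplus> bdir j \<boxdot> rc s)"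
          by (intro continuous_map_from_subtopology cm_path pC bdir_C)
        have cc: "continuous_map (subtopology euclidean ?S) (tw_top M i) (\<lambda>s. q)" if "q \<in> C i" for q i
          using that by (simp add: topspace_C)
        show "continuous_map (subtopology euclidean ?S) euclidean
            (\<lambda>s. (tmul \<tau> (?\<Delta> s) T + H (p \<boxplus> bdir j \<boxdot> rc s)) K)"
          unfolding plus_fun_apply
          by (intro continuous_map_plus continuous_map_tmul_coordinate[OF F] rs_path[OF H1] sm_path[OF H]
              cc c pC bdir_C pD) (auto simp del: tw_dom.simps)
        show "continuous_map (subtopology euclidean ?S) euclidean (\<lambda>s. h1 (Tri (Base y) (Base b) s) K)"
          using y yC ab ydom by (intro rs_path[OF r] cc) auto
      next
        fix s u assume s: "s \<in> ?S" and su: "s * u = 1"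
        have sD: "Tri a b (t + rc s) \<in> D (Suc j)" using s by (simp add: line del: tw_dom.simps)
        have E1: "H (p \<boxplus> bdir j \<boxdot> rc s) - H p = tsmul \<tau> (?\<Delta> s) s"
          using s by (intro rs_line[OF H1] pD bdir_C) auto
        \<comment> \<open>Since \<open>grestr\<close> keeps the body, restriction commutes with
          moving it.\<close>
        have gr: "grestr S (t + rc s) = T + rc s" by (auto simp: fun_eq_iff T_def grestr_def)
        have E2: "tmul \<tau> (H (p \<boxplus> bdir j \<boxdot> rc s)) (T + rc s) = h (y \<boxplus> b \<boxdot> rc s) - h a"
          using Heq[OF sD] by (simp only: line gr yline)
        have E3: "tmul \<tau> (H p) T = h y - h a"
          using Heq[OF d] by (simp only: p_def T_def y_def)
        have E4: "h (y \<boxplus> b \<boxdot> rc s) - h y = tsmul \<tau> (h1 (Tri (Base y) (Base b) s)) s"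
          using y ab ydom[OF s] by (intro rs_line[OF r])
        have Hc: "H (p \<boxplus> bdir j \<boxdot> rc s) \<in> coef (enat n)"
          using sm_ev[OF H] s by (auto simp: ev_iff simp del: tw_dom.simps)
        have "tsmul \<tau> (tmul \<tau> (?\<Delta> s) T + H (p \<boxplus> bdir j \<boxdot> rc s)) s
          = tmul \<tau> (H (p \<boxplus> bdir j \<boxdot> rc s) - H p) T + tmul \<tau> (H (p \<boxplus> bdir j \<boxdot> rc s)) (rc s)"
          unfolding E1 by (simp add: tsmul_add tsmul_tmul F.tmul_rc_coef[OF Hc])
        also have "\<dots> = tmul \<tau> (H (p \<boxplus> bdir j \<boxdot> rc s)) (T + rc s) - tmul \<tau> (H p) T"
          by (simp add: F.tmul_diff_left F.tmul_add_right)
        also have "\<dots> = tsmul \<tau> (h1 (Tri (Base y) (Base b) s)) s"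
          unfolding E2 E3 E4[symmetric] by simp
        finally show "(tmul \<tau> (?\<Delta> s) T + H (p \<boxplus> bdir j \<boxdot> rc s)) K = h1 (Tri (Base y) (Base b) s) K"
          by (rule fun_cong[OF tsmul_cancel_fun[OF _ su]])
      qed
      then show "(tmul \<tau> dH T + H p) K = h1 (Tri (Base y) (Base b) 0) K"
        using pC by (simp add: dH_def line_zero[where j = "Suc j"] del: tw_dom.simps tw_car.simps)
    qed
    have H'p: "H' p = H p + tmul \<tau> dH \<sigma>"
      by (simp add: H'_def dH_def \<sigma>_def tmul_gsmul p_def)
    have "tmul \<tau> (H' p) (T + \<sigma>) = tmul \<tau> (H p) T + tmul \<tau> (tmul \<tau> dH T + H p) \<sigma>"
      unfolding H'p
      by (simp add: F.tmul_add_left F.tmul_add_right F.tmul_assoc \<sigma>\<sigma> gmul_cc[OF \<sigma>0, of T] add_ac)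
    also have "\<dots> = h y - h a + tmul \<tau> (h1 (Tri (Base y) (Base b) 0)) \<sigma>"
      using Heq[OF d] by (simp only: key) (simp only: p_def T_def y_def)
    also have "\<dots> = h (y \<boxplus> b \<boxdot> \<sigma>) - h a"
      using h y ab \<alpha>\<beta> by (auto simp: ksm_def)
    also have "y \<boxplus> b \<boxdot> \<sigma> = a \<boxplus> b \<boxdot> (T + \<sigma>)"
      unfolding y_def using ab T \<sigma>0 by (simp add: mul_add_right[where j = j] add_assoc[where j = j] C_mul)
    finally show ?thesis by (simp only: T\<sigma> p_def)
  qed
  ultimately show ?case by blast
qed

text \<open>The defining equation of \<open>G\<close> is differentiated in the direction
  \<open>(a', b', t')\<close>: the product rule applies on the left, and on the right the
  differential of the end point is read off from \<open>line_identity\<close>.\<close>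

lemma quotient_derivative:
  assumes r: "rs j h h1" and R: "rs (Suc j) G G1"
    and eq: "\<And>a b t. Tri a b t \<in> D (Suc j) \<Longrightarrow> tmul \<tau> (G (Tri a b t)) t = h (a \<boxplus> b \<boxdot> t) - h a"
    and p: "Tri a b t \<in> D (Suc j)" and p': "Tri a' b' t' \<in> C (Suc j)"
  shows "tmul \<tau> (G1 (Tri (Base (Tri a b t)) (Base (Tri a' b' t')) 0)) t + tmul \<tau> (G (Tri a b t)) t'
    = h1 (Tri (Base (a \<boxplus> b \<boxdot> t)) (Base (a' \<boxplus> b' \<boxdot> t \<boxplus> b \<boxdot> t')) 0) - h1 (Tri (Base a) (Base a') 0)"
    (is "?L = ?R")
proof
  fix K
  define p where "p = Tri a b t"
  define q where "q = Tri a' b' t'"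
  define y where "y = a \<boxplus> b \<boxdot> t"
  define w where "w = a' \<boxplus> b' \<boxdot> t \<boxplus> b \<boxdot> t'"
  \<comment> \<open>The second-order part of the moving end point; it enters with a factor
    \<open>s\<close> and disappears at \<open>s = 0\<close>.\<close>
  define w1 where "w1 = b' \<boxdot> t'"
  have ab: "a \<in> D j" "b \<in> C j" "t \<in> \<Lambda>0" "y \<in> D j" "a \<in> C j" using p D_C[of j] by (auto simp: y_def)
  have ab': "a' \<in> C j" "b' \<in> C j" "t' \<in> \<Lambda>0" using p' by auto
  have pD: "p \<in> D (Suc j)" and qC: "q \<in> C (Suc j)" using p p' by (auto simp: p_def q_def)
  have pC: "p \<in> C (Suc j)" using pD D_C by blast
  have yC: "y \<in> C j" using ab D_C by auto
  have wC: "w \<in> C j" "w1 \<in> C j" unfolding w_def w1_def using ab ab' by (auto intro!: C_add C_mul)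
  have sR: "sm (Suc j) G" using R by (rule rsm_smooth)
  let ?S = "{s. p \<boxplus> q \<boxdot> rc s \<in> D (Suc j)}"
  let ?t = "\<lambda>s. t + gmul t' (rc s)"
  let ?\<Delta> = "\<lambda>s. G1 (Tri (Base p) (Base q) s)"
  have line: "p \<boxplus> q \<boxdot> rc s = Tri (a \<boxplus> a' \<boxdot> rc s) (b \<boxplus> b' \<boxdot> rc s) (?t s)" for s
    by (simp add: p_def q_def)
  have yline: "(a \<boxplus> a' \<boxdot> rc s) \<boxplus> (b \<boxplus> b' \<boxdot> rc s) \<boxdot> ?t s = y \<boxplus> (w \<boxplus> w1 \<boxdot> rc s) \<boxdot> rc s" for s
    unfolding y_def w_def w1_def using ab ab' by (intro line_identity) auto
  have dom: "a \<boxplus> a' \<boxdot> rc s \<in> D j" "y \<boxplus> (w \<boxplus> w1 \<boxdot> rc s) \<boxdot> rc s \<in> D j" if "s \<in> ?S" for s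
    using that unfolding line mem_Collect_eq Tri_D yline by auto
  have "(tmul \<tau> (?\<Delta> 0) (?t 0) + tmul \<tau> (G p) t') K
    = (h1 (Tri (Base y) (Base (w \<boxplus> w1 \<boxdot> rc 0)) 0) - h1 (Tri (Base a) (Base a') 0)) K"
  proof (rule unit_limit_unique[OF units])
    show "open ?S" by (rule open_path_preimage[OF cm_path[OF pC qC] D_open])
    show "0 \<in> ?S" using pD pC qC by (simp add: line_zero[where j = "Suc j"] del: tw_dom.simps tw_car.simps)
    have cc: "continuous_map (subtopology euclidean ?S) (tw_top M i) (\<lambda>s. q)" if "q \<in> C i" for q i
      using that by (simp add: topspace_C)
    have cw: "continuous_map (subtopology euclidean ?S) (tw_top M j) (\<lambda>s. w \<boxplus> w1 \<boxdot> rc s)"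
      by (intro continuous_map_from_subtopology cm_path wC)
    show "continuous_map (subtopology euclidean ?S) euclidean (\<lambda>s. (tmul \<tau> (?\<Delta> s) (?t s) + tmul \<tau> (G p) t') K)"
      unfolding plus_fun_apply
      by (intro continuous_map_plus continuous_map_tmul_coordinate[OF F] rs_path[OF R] cc pC qC pD
          continuous_map_gmul_coordinate continuous_map_rc_coordinate) (auto simp del: tw_dom.simps)
    show "continuous_map (subtopology euclidean ?S) euclidean
        (\<lambda>s. (h1 (Tri (Base y) (Base (w \<boxplus> w1 \<boxdot> rc s)) s) - h1 (Tri (Base a) (Base a') s)) K)"
      unfolding minus_apply
      using ab ab' dom by (intro continuous_map_diff rs_path[OF r] cc cw yC) auto
  next
    fix s u assume s: "s \<in> ?S" and su: "s * u = 1"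
    have sD: "Tri (a \<boxplus> a' \<boxdot> rc s) (b \<boxplus> b' \<boxdot> rc s) (?t s) \<in> D (Suc j)" using s by (simp only: line mem_Collect_eq)
    have E1: "G (p \<boxplus> q \<boxdot> rc s) - G p = tsmul \<tau> (?\<Delta> s) s"
      using s by (intro rs_line[OF R] pD qC) auto
    have E2: "tmul \<tau> (G (p \<boxplus> q \<boxdot> rc s)) (?t s) = h (y \<boxplus> (w \<boxplus> w1 \<boxdot> rc s) \<boxdot> rc s) - h (a \<boxplus> a' \<boxdot> rc s)"
      using eq[OF sD] by (simp only: line yline)
    have E3: "tmul \<tau> (G p) t = h y - h a" using eq[OF p] by (simp only: p_def y_def)
    have E4: "h (y \<boxplus> (w \<boxplus> w1 \<boxdot> rc s) \<boxdot> rc s) - h y = tsmul \<tau> (h1 (Tri (Base y) (Base (w \<boxplus> w1 \<boxdot> rc s)) s)) s"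
      using ab wC dom[OF s] by (intro rs_line[OF r] C_add C_mul) auto
    have E5: "h (a \<boxplus> a' \<boxdot> rc s) - h a = tsmul \<tau> (h1 (Tri (Base a) (Base a') s)) s"
      using ab ab' dom[OF s] by (intro rs_line[OF r])
    have "G p \<in> ev (enat n)" by (rule sm_ev[OF sR pD])
    then have Gc: "tmul \<tau> (G p) t' \<in> coef (enat n)" using ab' by (auto simp: ev_iff grass0_iff intro: F.coef_tmul)
    have "tsmul \<tau> (tmul \<tau> (?\<Delta> s) (?t s) + tmul \<tau> (G p) t') s
      = tmul \<tau> (G (p \<boxplus> q \<boxdot> rc s) - G p) (?t s) + tmul \<tau> (tmul \<tau> (G p) t') (rc s)"
      unfolding E1 by (simp add: tsmul_add tsmul_tmul F.tmul_rc_coef[OF Gc])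
    also have "\<dots> = tmul \<tau> (G (p \<boxplus> q \<boxdot> rc s)) (?t s) - tmul \<tau> (G p) t"
      by (simp add: F.tmul_diff_left F.tmul_add_right F.tmul_assoc)
    also have "\<dots> = (h (y \<boxplus> (w \<boxplus> w1 \<boxdot> rc s) \<boxdot> rc s) - h y) - (h (a \<boxplus> a' \<boxdot> rc s) - h a)"
      unfolding E2 E3 by simp
    also have "\<dots> = tsmul \<tau> (h1 (Tri (Base y) (Base (w \<boxplus> w1 \<boxdot> rc s)) s) - h1 (Tri (Base a) (Base a') s)) s"
      unfolding E4 E5 by (simp add: tsmul_diff)
    finally show "(tmul \<tau> (?\<Delta> s) (?t s) + tmul \<tau> (G p) t') K
      = (h1 (Tri (Base y) (Base (w \<boxplus> w1 \<boxdot> rc s)) s) - h1 (Tri (Base a) (Base a') s)) K"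
      by (rule fun_cong[OF tsmul_cancel_fun[OF _ su]])
  qed
  then show "?L K = ?R K"
    using wC by (simp add: line_zero[where j = j]) (simp add: p_def q_def y_def w_def)
qed

text \<open>After multiplication by the moved scalar both sides agree, by the equation for
  \<open>G\<close>, the expansion of \<open>h\<close> and \<open>quotient_derivative\<close>. The
  moved scalar has the same body as \<open>t\<close>, a unit, so it can be cancelled.\<close>

lemma quotient_nilpotent_unit:
  assumes half: "\<exists>y::'r. of_nat 2 * y = 1"
    and h: "ksm j h h1" and R: "rs (Suc j) G G1"
    and eq: "\<And>a b t. Tri a b t \<in> D (Suc j) \<Longrightarrow> tmul \<tau> (G (Tri a b t)) t = h (a \<boxplus> b \<boxdot> t) - h a"
    and p: "Tri a b t \<in> D (Suc j)" and q: "q \<in> C (Suc j)" and u: "t {} * u = 1"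
    and \<alpha>: "\<alpha> \<in> grass1 (enat n)" and \<beta>: "\<beta> \<in> grass1 (enat n)"
  shows "G (Tri a b t \<boxplus> q \<boxdot> gmul \<alpha> \<beta>)
    = G (Tri a b t) + tmul \<tau> (G1 (Tri (Base (Tri a b t)) (Base q) 0)) (gmul \<alpha> \<beta>)"
proof -
  define \<sigma> where "\<sigma> = gmul \<alpha> \<beta>"
  note \<sigma> = gmul_odd_product[OF half \<alpha> \<beta>, folded \<sigma>_def]
  obtain a' b' t' where q': "q = Tri a' b' t'" "a' \<in> C j" "b' \<in> C j" "t' \<in> \<Lambda>0" using q by auto
  define P where "P = Tri a b t"
  define y where "y = a \<boxplus> b \<boxdot> t"
  define w where "w = a' \<boxplus> b' \<boxdot> t \<boxplus> b \<boxdot> t'"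
  define dG where "dG = G1 (Tri (Base P) (Base q) 0)"
  have r: "rs j h h1" and K: "\<And>x v. x \<in> D j \<Longrightarrow> v \<in> C j \<Longrightarrow> h (x \<boxplus> v \<boxdot> \<sigma>) = h x + tmul \<tau> (h1 (Tri (Base x) (Base v) 0)) \<sigma>"
    using h \<alpha> \<beta> by (auto simp: ksm_def \<sigma>_def)
  have ab: "a \<in> D j" "b \<in> C j" "t \<in> \<Lambda>0" "y \<in> D j" "a \<in> C j" using p D_C[of j] by (auto simp: y_def)
  have PD: "P \<in> D (Suc j)" using p by (simp add: P_def)
  have yC: "y \<in> C j" using ab D_C by auto
  have wC: "w \<in> C j" unfolding w_def using ab q' by (auto intro!: C_add C_mul)
  have sR: "sm (Suc j) G" using R by (rule rsm_smooth)
  have QD: "P \<boxplus> q \<boxdot> \<sigma> \<in> D (Suc j)" by (rule D_nil[OF PD q \<sigma>(1,2)])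
  have line: "P \<boxplus> q \<boxdot> \<sigma> = Tri (a \<boxplus> a' \<boxdot> \<sigma>) (b \<boxplus> b' \<boxdot> \<sigma>) (t + gmul t' \<sigma>)"
    by (simp add: P_def q')
  \<comment> \<open>The second-order part is killed exactly, not just in the limit, because
    \<open>\<sigma>\<close> squares to 0.\<close>
  have wl: "(w \<boxplus> b' \<boxdot> t' \<boxdot> \<sigma>) \<boxdot> \<sigma> = w \<boxdot> \<sigma>"
    using wC q' \<sigma> by (simp add: mul_add_left[where j = j] mul_assoc[where j = j] C_mul grass0_gmul gmul_assoc
        mul_zero[where j = j] add_zero)
  have yline: "(a \<boxplus> a' \<boxdot> \<sigma>) \<boxplus> (b \<boxplus> b' \<boxdot> \<sigma>) \<boxdot> (t + gmul t' \<sigma>) = y \<boxplus> w \<boxdot> \<sigma>"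
    using line_identity[of a j a' b b' t t' \<sigma>] ab q' \<sigma> wl unfolding y_def w_def by simp
  have der: "tmul \<tau> dG t + tmul \<tau> (G P) t' = h1 (Tri (Base y) (Base w) 0) - h1 (Tri (Base a) (Base a') 0)"
    unfolding dG_def P_def y_def w_def q'(1)
    by (rule quotient_derivative[OF r R eq p]) (use q q' in auto)
  have E0: "tmul \<tau> (G P) t = h y - h a" using eq[OF p] by (simp only: P_def y_def)
  have "tmul \<tau> (G (P \<boxplus> q \<boxdot> \<sigma>)) (t + gmul t' \<sigma>) = h (y \<boxplus> w \<boxdot> \<sigma>) - h (a \<boxplus> a' \<boxdot> \<sigma>)"
    using eq[of "a \<boxplus> a' \<boxdot> \<sigma>" "b \<boxplus> b' \<boxdot> \<sigma>" "t + gmul t' \<sigma>"] QD by (simp only: line yline)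
  also have "\<dots> = (h y - h a) + tmul \<tau> (h1 (Tri (Base y) (Base w) 0) - h1 (Tri (Base a) (Base a') 0)) \<sigma>"
    using K ab q' wC by (simp add: F.tmul_diff_left)
  also have "\<dots> = tmul \<tau> (G P) t + tmul \<tau> (tmul \<tau> dG t + tmul \<tau> (G P) t') \<sigma>"
    unfolding der E0 ..
  also have "\<dots> = tmul \<tau> (G P + tmul \<tau> dG \<sigma>) (t + gmul t' \<sigma>)"
  proof -
    have "gmul \<sigma> (gmul t' \<sigma>) = gmul (gmul t' \<sigma>) \<sigma>" "gmul \<sigma> t = gmul t \<sigma>"
      by (rule gmul_cc[OF \<sigma>(1)])+
    then have "gmul \<sigma> (gmul t' \<sigma>) = 0" "gmul \<sigma> t = gmul t \<sigma>"
      by (simp_all add: gmul_assoc \<sigma>(3))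
    then show ?thesis by (simp add: F.tmul_add_left F.tmul_add_right F.tmul_assoc add_ac)
  qed
  finally have "tmul \<tau> (G (P \<boxplus> q \<boxdot> \<sigma>)) (t + gmul t' \<sigma>) = tmul \<tau> (G P + tmul \<tau> dG \<sigma>) (t + gmul t' \<sigma>)" .
  moreover have "(t + gmul t' \<sigma>) {} * u = 1" using u \<sigma> by (simp add: gmul_empty)
  moreover have "G (P \<boxplus> q \<boxdot> \<sigma>) \<in> coef (enat n)" using sm_ev[OF sR QD] by (simp add: ev_iff)
  moreover have "G P + tmul \<tau> dG \<sigma> \<in> coef (enat n)"
  proof -
    have "P \<boxplus> q \<boxdot> rc 0 \<in> D (Suc j)"
      using PD q D_C[of "Suc j"] by (simp add: line_zero[where j = "Suc j"] subset_iff del: tw_dom.simps tw_car.simps)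
    then have "dG \<in> ev (enat n)" unfolding dG_def by (intro rs_ev[OF R PD q])
    then show ?thesis
      using sm_ev[OF sR PD] \<sigma> by (auto simp: ev_iff grass0_iff intro: coef_add F.coef_tmul)
  qed
  ultimately show ?thesis unfolding P_def dG_def \<sigma>_def by (metis F.tmul_unit_cancel)
qed

text \<open>The inductive step of the tower: the quotient comes from
  \<open>quotient_on_restriction\<close> with all monomials included, and inherits the expansion
  first where the body of the scalar is a unit, then everywhere by density.\<close>

theorem quotient_exists:
  assumes half: "\<exists>y::'r. of_nat 2 * y = 1" and h: "ksm j h h1"
  shows "\<exists>G G1. ksm (Suc j) G G1 \<and>
    (\<forall>a b t. Tri a b t \<in> D (Suc j) \<longrightarrow> h (a \<boxplus> b \<boxdot> t) - h a = tmul \<tau> (G (Tri a b t)) t)"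
proof -
  let ?S = "{I. I \<subseteq> {..<n} \<and> even (card I) \<and> I \<noteq> {}}"
  have "finite ?S" by (rule finite_subset[of _ "Pow {..<n}"]) auto
  then obtain G where G: "sm (Suc j) G" and Geq: "\<And>a b t. Tri a b t \<in> D (Suc j) \<Longrightarrow>
    tmul \<tau> (G (Tri a b t)) (grestr ?S t) = h (a \<boxplus> b \<boxdot> grestr ?S t) - h a"
    using quotient_on_restriction[OF h, of ?S] by auto
  \<comment> \<open>\<open>?S\<close> contains every nonempty even index set of the algebra, so
    nothing is lost from an even scalar.\<close>
  have gr: "grestr ?S t = t" if "t \<in> \<Lambda>0" for t
    using that unfolding grass0_iff coef_enat by (auto simp: fun_eq_iff grestr_def)
  have eq: "tmul \<tau> (G (Tri a b t)) t = h (a \<boxplus> b \<boxdot> t) - h a" if "Tri a b t \<in> D (Suc j)" for a b t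
    using Geq[OF that] gr[of t] that by auto
  obtain G1 where R: "rs (Suc j) G G1" using sm_rs[OF G] by blast
  have "G (P \<boxplus> q \<boxdot> gmul \<alpha> \<beta>) = G P + tmul \<tau> (G1 (Tri (Base P) (Base q) 0)) (gmul \<alpha> \<beta>)"
    if P: "P \<in> D (Suc j)" and q: "q \<in> C (Suc j)" and \<alpha>: "\<alpha> \<in> grass1 (enat n)" and \<beta>: "\<beta> \<in> grass1 (enat n)"
    for P q \<alpha> \<beta>
  proof
    fix K
    obtain a b t where P': "P = Tri a b t" "a \<in> D j" "b \<in> C j" "t \<in> \<Lambda>0" "a \<in> C j"
      using P by (elim D_SucE)
    define \<sigma> where "\<sigma> = gmul \<alpha> \<beta>"
    note \<sigma> = gmul_odd_product[OF half \<alpha> \<beta>, folded \<sigma>_def]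
    \<comment> \<open>Replaces the body of \<open>t\<close> by \<open>s\<close> and leaves the rest
      of the triple unchanged, so that \<open>\<gamma> (t {}) = P\<close>. For units
      \<open>s\<close> the claim is already known.\<close>
    define \<gamma> where "\<gamma> s = P \<boxplus> bdir j \<boxdot> rc (s - t {})" for s
    have \<gamma>: "\<gamma> s = Tri a b (t + rc (s - t {}))" for s
      unfolding \<gamma>_def P' using P' by (intro bdir_line)
    have PC: "P \<in> C (Suc j)" using P D_C by blast
    have shift: "continuous_map euclidean euclidean (\<lambda>s :: 'r. s - t {})"
      by (auto intro!: continuous_intros)
    have \<gamma>c: "continuous_map euclidean (tw_top M (Suc j)) \<gamma>"
      using continuous_map_compose[OF shift cm_path[OF PC bdir_C]] unfolding comp_def \<gamma>_def .
    let ?S = "{s. \<gamma> s \<in> D (Suc j)}"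
    have \<gamma>C: "\<gamma> s \<in> C (Suc j)" if "s \<in> ?S" for s using that D_C by blast
    have \<gamma>q: "\<gamma> s \<boxplus> q \<boxdot> \<sigma> \<in> D (Suc j)" if "s \<in> ?S" for s
      using that by (intro D_nil q \<sigma>(1,2)) simp
    have \<gamma>0: "\<gamma> (t {}) = P" using P' by (simp add: \<gamma>)
    have "G (\<gamma> (t {}) \<boxplus> q \<boxdot> \<sigma>) K
      = (G (\<gamma> (t {})) + tmul \<tau> (G1 (Tri (Base (\<gamma> (t {}))) (Base q) 0)) \<sigma>) K"
    proof (rule unit_limit_unique[OF units, where S = ?S and c = "t {}" and A = "\<lambda>s. G (\<gamma> s \<boxplus> q \<boxdot> \<sigma>) K"
          and B = "\<lambda>s. (G (\<gamma> s) + tmul \<tau> (G1 (Tri (Base (\<gamma> s)) (Base q) 0)) \<sigma>) K"])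
      show "open ?S" by (rule open_path_preimage[OF \<gamma>c D_open])
      show "t {} \<in> ?S" using P by (simp only: \<gamma>0 mem_Collect_eq)
      have cc: "continuous_map (subtopology euclidean ?S) (tw_top M (Suc j)) (\<lambda>s. q)"
        using q by (simp only: continuous_map_const topspace_C simp_thms)
      have c: "continuous_map (subtopology euclidean ?S) (tw_top M (Suc j)) \<gamma>"
        by (rule continuous_map_from_subtopology[OF \<gamma>c])
      have c\<sigma>: "continuous_map (subtopology euclidean ?S) (grass0_top (enat n)) (\<lambda>s. \<sigma>)"
        using \<sigma> by simp
      show "continuous_map (subtopology euclidean ?S) euclidean (\<lambda>s. G (\<gamma> s \<boxplus> q \<boxdot> \<sigma>) K)"
        by (intro sm_path[OF G] cm_add cm_mul c cc c\<sigma> \<gamma>q)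
      have "continuous_map (subtopology euclidean ?S) euclidean (\<lambda>s. G1 (Tri (Base (\<gamma> s)) (Base q) 0) K)" for K
      proof (rule rs_path[OF R c cc])
        fix s assume s: "s \<in> ?S"
        then show "\<gamma> s \<in> D (Suc j)" by (simp only: mem_Collect_eq)
        then show "\<gamma> s \<boxplus> q \<boxdot> rc 0 \<in> D (Suc j)"
          using \<gamma>C[OF s] q by (simp add: line_zero[where j = "Suc j"] del: tw_dom.simps tw_car.simps)
      qed simp
      then show "continuous_map (subtopology euclidean ?S) euclidean
          (\<lambda>s. (G (\<gamma> s) + tmul \<tau> (G1 (Tri (Base (\<gamma> s)) (Base q) 0)) \<sigma>) K)"
        unfolding plus_fun_apply
        by (intro continuous_map_plus sm_path[OF G] c continuous_map_tmul_coordinate[OF F]) (auto simp del: tw_dom.simps)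
    next
      fix s u assume s: "s \<in> ?S" and su: "s * u = 1"
      have "Tri a b (t + rc (s - t {})) \<in> D (Suc j)" using s by (simp only: \<gamma> mem_Collect_eq)
      moreover have "(t + rc (s - t {})) {} * u = 1" using su by simp
      ultimately show "G (\<gamma> s \<boxplus> q \<boxdot> \<sigma>) K = (G (\<gamma> s) + tmul \<tau> (G1 (Tri (Base (\<gamma> s)) (Base q) 0)) \<sigma>) K"
        unfolding \<gamma> \<sigma>_def using quotient_nilpotent_unit[OF half h R eq _ q _ \<alpha> \<beta>] by metis
    qed
    then show "G (P \<boxplus> q \<boxdot> gmul \<alpha> \<beta>) K = (G P + tmul \<tau> (G1 (Tri (Base P) (Base q) 0)) (gmul \<alpha> \<beta>)) K"
      by (simp only: \<gamma>0 \<sigma>_def)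
  qed
  then have "ksm (Suc j) G G1" using R by (simp only: ksm_def) blast
  with eq show ?thesis by metis
qed

end

section \<open>Natural transformations\<close>

lemma unit_in_open:
  assumes "dense_units TYPE('r::{comm_ring_1,topological_space})" "open S" "(c :: 'r) \<in> S"
  obtains s u where "s \<in> S" "s * u = 1"
proof -
  have "c \<in> closure {u::'r. \<exists>v. u * v = 1}" using assms(1) by (simp add: dense_units_def)
  with assms have "S \<inter> {u::'r. \<exists>v. u * v = 1} \<noteq> {}"
    using open_Int_closure_eq_empty by blast
  then show ?thesis using that by blast
qed

lemma (in module) tmap_fix:
  assumes "\<And>I. I \<in> idx m \<Longrightarrow> \<phi> (gbasis I) = gbasis I" "x \<in> coef m"
  shows "tmap scale \<phi> x = x"
proof -
  have "tmap scale \<phi> x = tmap scale (\<lambda>a. a) x"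
    using assms by (auto simp: fun_eq_iff tmap_def coef_def intro!: sum.cong)
  then show ?thesis using tmap_id[OF assms(2)] by simp
qed

lemma Emod_L_simps [simp]:
  "mcar (Emod_L s0 s1 m) = ev m" "mtop (Emod_L s0 s1 m) = ev_top m" "madd (Emod_L s0 s1 m) = tadd"
  "mscal (Emod_L s0 s1 m) = tmul (esmul s0 s1)" "scar (Emod_L s0 s1 m) = grass0 m"
  "stop (Emod_L s0 s1 m) = grass0_top m" "sadd (Emod_L s0 s1 m) = gadd" "smul (Emod_L s0 s1 m) = gmul"
  by (simp_all add: Emod_L_def)

lemma Emod_R_simps [simp]:
  "mcar (Emod_R s0 s1 m) = ev m" "mtop (Emod_R s0 s1 m) = ev_top m" "madd (Emod_R s0 s1 m) = tadd"
  "mscal (Emod_R s0 s1 m) = tsmul (esmul s0 s1)" "scar (Emod_R s0 s1 m) = UNIV"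
  "stop (Emod_R s0 s1 m) = euclidean" "sadd (Emod_R s0 s1 m) = (+)" "smul (Emod_R s0 s1 m) = (*)"
  by (simp_all add: Emod_R_def)

locale ms = target t0 t1
  for t0 :: "'r::{comm_ring_1,topological_group_add,topological_semigroup_mult,t2_space} \<Rightarrow> 'f0::{ab_group_add,topological_group_add,t2_space} \<Rightarrow> 'f0"
    and t1 :: "'r \<Rightarrow> 'f1::{ab_group_add,topological_group_add,t2_space} \<Rightarrow> 'f1" +
  fixes s0 :: "'r \<Rightarrow> 'e0::{ab_group_add,topological_group_add,t2_space} \<Rightarrow> 'e0"
    and s1 :: "'r \<Rightarrow> 'e1::{ab_group_add,topological_group_add,t2_space} \<Rightarrow> 'e1"
    and \<U> :: "nat \<Rightarrow> (nat set \<Rightarrow> 'e0 \<times> 'e1) set"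
  assumes E0: "Hausdorff_top_module s0" and E1: "Hausdorff_top_module s1"
    and half: "\<exists>y::'r. of_nat 2 * y = 1"
    and \<U>: "open_subfunctor s0 s1 \<U>"
begin

abbreviation "\<sigma> \<equiv> esmul s0 s1"
abbreviation "N m \<equiv> Emod_L s0 s1 m"
abbreviation "V m \<equiv> Uobj s0 s1 \<U> m"
abbreviation "twm \<phi> \<equiv> tw_map (tmap \<sigma> \<phi>) \<phi>"

lemma E: "Hausdorff_top_module \<sigma>"
  by (rule Hausdorff_top_module_esmul[OF E0 E1])

sublocale E: module "esmul s0 s1"
  by (rule Hausdorff_top_moduleD(1)[OF E])

lemmas tmul_evE = ev_tmul[OF Hausdorff_top_moduleD(1)[OF E0] Hausdorff_top_moduleD(1)[OF E1]]
lemmas tmap_evE = ev_tmap[OF Hausdorff_top_moduleD(1)[OF E0] Hausdorff_top_moduleD(1)[OF E1]]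

section \<open>The open subfunctor and its iterated domains\<close>

lemma \<U>_ev: "\<U> n \<subseteq> ev (enat n)" and \<U>_open: "openin (ev_top (enat n)) (\<U> n)"
  and \<U>_functor: "ghom (enat m) (enat n) \<phi> \<Longrightarrow> x \<in> \<U> m \<Longrightarrow> tmap \<sigma> \<phi> x \<in> \<U> n"
  using \<U> by (auto simp: open_subfunctor_def)

lemma tmap_geps_ev: "x \<in> ev m \<Longrightarrow> tmap \<sigma> geps x = (\<lambda>K. if K = {} then x {} else 0)"
  by (rule E.tmap_geps[where m = m]) (simp add: ev_iff)

text \<open>Rescaling all generators by a unit close to \<open>0\<close> moves \<open>x\<close> into the open set \<open>\<U> n\<close>; the inverse
  rescaling moves it back.\<close>
lemma \<U>_body:
  assumes x: "x \<in> ev (enat n)" and eps: "tmap \<sigma> geps x \<in> \<U> 0"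
  shows "x \<in> \<U> n"
proof -
  have xc: "x \<in> coef (enat n)" using x by (simp add: ev_iff)
  define \<gamma> where "\<gamma> r = tmap \<sigma> (\<lambda>a I. prod (\<lambda>_. r) I * a I) x" for r :: 'r
  have \<gamma>: "\<gamma> r = (\<lambda>K. \<sigma> (prod (\<lambda>_. r) K) (x K))" for r
    unfolding \<gamma>_def by (rule E.tmap_diag[OF xc])
  have "continuous_map euclidean euclidean (\<lambda>r :: 'r. r ^ k)" for k
  proof (induction k)
    case (Suc k)
    have "continuous_map euclidean euclidean (\<lambda>r :: 'r. r)" by simp
    from continuous_map_times[OF this Suc] show ?case by simp
  qed simp
  then have "continuous_map euclidean euclidean (\<lambda>r :: 'r. prod (\<lambda>_. r) K)" for K :: "nat set"
    by (simp only: prod_constant)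
  then have "continuous_map euclidean euclidean (\<lambda>r. \<gamma> r K)" for K
    unfolding \<gamma> by (intro continuous_map_scal[OF E]) auto
  moreover have "\<gamma> r \<in> ev (enat n)" for r
    unfolding \<gamma>_def using ghom_diag x by (rule tmap_evE)
  ultimately have "continuous_map euclidean (ev_top (enat n)) \<gamma>"
    by (simp add: continuous_map_into_ev)
  then have op: "open {r. \<gamma> r \<in> \<U> n}" using \<U>_open by (rule open_path_preimage)
  \<comment> \<open>At \<open>r = 0\<close> only the empty product equals 1 among finite index sets,
    so just the body survives.\<close>
  have "\<gamma> 0 = tmap \<sigma> geps x"
    unfolding \<gamma> tmap_geps_ev[OF x]
  proof
    fix K show "\<sigma> (prod (\<lambda>_. 0) K) (x K) = (if K = {} then x {} else 0)"
      using coef_infinite[OF xc, of K] by (cases "finite K"; cases "K = {}") (auto simp: power_0_left)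
  qed
  also have "\<dots> = tmap \<sigma> (\<lambda>a. a) (tmap \<sigma> geps x)"
  proof -
    have "tmap \<sigma> geps x \<in> coef (enat 0)" by (rule E.coef_tmap[OF ghom_geps xc])
    then show ?thesis using E.tmap_id by simp
  qed
  also have "\<dots> \<in> \<U> n" by (rule \<U>_functor[OF ghom_id eps]) simp
  finally have "0 \<in> {r. \<gamma> r \<in> \<U> n}" by simp
  from unit_in_open[OF units op this] obtain r u where r: "\<gamma> r \<in> \<U> n" "r * u = 1" by blast
  then have "tmap \<sigma> (\<lambda>a I. prod (\<lambda>_. u) I * a I) (\<gamma> r) \<in> \<U> n"
    by (intro \<U>_functor[OF ghom_diag])
  moreover have "tmap \<sigma> (\<lambda>a I. prod (\<lambda>_. u) I * a I) (\<gamma> r) = x"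
  proof -
    have "\<gamma> r \<in> coef (enat n)" using subsetD[OF \<U>_ev r(1)] by (simp add: ev_iff)
    from E.tmap_diag[OF this, of "\<lambda>_. u"]
    have "tmap \<sigma> (\<lambda>a I. prod (\<lambda>_. u) I * a I) (\<gamma> r) = (\<lambda>K. \<sigma> (prod (\<lambda>_. r * u) K) (x K))"
      by (simp only: \<gamma> E.scale_scale prod.distrib mult.commute)
    then show ?thesis by (simp add: r)
  qed
  ultimately show ?thesis by simp
qed

text \<open>At finite objects this is the normal form of an open subfunctor, membership being
  decided by the body; at infinity it is the definition. All objects can now be treated
  alike.\<close>

lemma V_iff: "x \<in> V m \<longleftrightarrow> x \<in> ev m \<and> tmap \<sigma> geps x \<in> \<U> 0"
proof (cases m)
  case (enat n)
  have "tmap \<sigma> geps x \<in> \<U> 0" if "x \<in> \<U> n"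
    using \<U>_functor[OF ghom_geps that] .
  with enat show ?thesis using \<U>_body \<U>_ev by (auto simp: Uobj_def)
qed (simp add: Uobj_def)

lemma V_enat [simp]: "V (enat n) = \<U> n"
  by (simp add: Uobj_def)

lemma V_ev: "V m \<subseteq> ev m"
  using V_iff by blast

lemma V_tmap: "ghom m n \<phi> \<Longrightarrow> x \<in> V m \<Longrightarrow> tmap \<sigma> \<phi> x \<in> V n"
proof -
  assume \<phi>: "ghom m n \<phi>" and "x \<in> V m"
  then have x: "x \<in> ev m" "tmap \<sigma> geps x \<in> \<U> 0" by (auto simp: V_iff)
  have "tmap \<sigma> \<phi> x {} = x {}" using x by (intro E.tmap_body[OF \<phi>]) (simp add: ev_iff)
  then have "tmap \<sigma> geps (tmap \<sigma> \<phi> x) = tmap \<sigma> geps x"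
    using tmap_geps_ev[OF tmap_evE[OF \<phi> x(1)]] tmap_geps_ev[OF x(1)] by metis
  then show ?thesis using x tmap_evE[OF \<phi> x(1)] by (simp add: V_iff)
qed

lemma V_open: "openin (ev_top m) (V m)"
proof -
  have eq: "tmap \<sigma> geps x = (\<lambda>K. if K = {} then x {} else 0)" if "x \<in> ev m" for x
    using that by (rule tmap_geps_ev)
  have "continuous_map (ev_top m) (ev_top (enat 0)) (\<lambda>x :: nat set \<Rightarrow> 'e0 \<times> 'e1. tmap \<sigma> geps x)"
    unfolding continuous_map_into_ev
  proof (intro conjI ballI allI)
    fix K :: "nat set"
    have "continuous_map (ev_top m) euclidean (\<lambda>x :: nat set \<Rightarrow> 'e0 \<times> 'e1. if K = {} then x {} else 0)"
      using continuous_map_ev_coordinate[of m "{}"] by auto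
    then show "continuous_map (ev_top m) euclidean (\<lambda>x :: nat set \<Rightarrow> 'e0 \<times> 'e1. tmap \<sigma> geps x K)"
      by (rule continuous_map_eq) (simp add: eq)
  next
    fix x :: "nat set \<Rightarrow> 'e0 \<times> 'e1" assume "x \<in> topspace (ev_top m)"
    then show "tmap \<sigma> geps x \<in> ev (enat 0)" by (intro tmap_evE[OF ghom_geps]) simp
  qed
  from openin_continuous_map_preimage[OF this \<U>_open[of 0]]
  have "openin (ev_top m) {x \<in> ev m. tmap \<sigma> geps x \<in> \<U> 0}" by simp
  also have "{x \<in> ev m. tmap \<sigma> geps x \<in> \<U> 0} = V m" using V_iff by auto
  finally show ?thesis .
qed

text \<open>The operations on coefficient families do not mention the object; only carriers and
  topologies do. Points of different levels can therefore be compared directly.\<close>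

lemma N_plus: "tw_plus (N m) = tw_plus (N n)" and N_times: "tw_times (N m) = tw_times (N n)"
  by (simp_all add: tw_plus_def tw_times_def)

lemma N_add: "p \<in> tw_car (N m) j \<Longrightarrow> q \<in> tw_car (N m) j \<Longrightarrow> tw_plus (N n) p q \<in> tw_car (N m) j"
  by (induction j arbitrary: p q) (auto intro: ev_add grass0_add)

lemma N_mul: "p \<in> tw_car (N m) j \<Longrightarrow> c \<in> grass0 m \<Longrightarrow> tw_times (N n) p c \<in> tw_car (N m) j"
  by (induction j arbitrary: p) (auto intro: tmul_evE grass0_gmul)

lemma twm_car: "ghom m n \<phi> \<Longrightarrow> p \<in> tw_car (N m) j \<Longrightarrow> twm \<phi> p \<in> tw_car (N n) j"
  by (induction j arbitrary: p) (auto intro: tmap_evE ghomD)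

lemma twm_plus:
  "ghom m n \<phi> \<Longrightarrow> p \<in> tw_car (N m) j \<Longrightarrow> q \<in> tw_car (N m) j \<Longrightarrow>
    twm \<phi> (tw_plus (N k) p q) = tw_plus (N l) (twm \<phi> p) (twm \<phi> q)"
proof (induction j arbitrary: p q)
  case 0
  then show ?case by (auto simp: ev_iff E.tmap_add[where m = m] simp del: plus_fun_apply)
next
  case (Suc j)
  then show ?case by (auto simp: grass0_iff ghomD(2)[OF Suc.prems(1)] simp del: plus_fun_apply)
qed

lemma twm_times:
  "ghom m n \<phi> \<Longrightarrow> p \<in> tw_car (N m) j \<Longrightarrow> c \<in> grass0 m \<Longrightarrow>
    twm \<phi> (tw_times (N k) p c) = tw_times (N l) (twm \<phi> p) (\<phi> c)"
proof (induction j arbitrary: p)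
  case 0
  then show ?case by (auto simp: ev_iff grass0_iff E.tmap_tmul[OF 0(1)])
next
  case (Suc j)
  then show ?case by (auto simp: grass0_iff ghomD(4)[OF Suc.prems(1)])
qed

lemma twm_line:
  "ghom m n \<phi> \<Longrightarrow> a \<in> tw_car (N m) j \<Longrightarrow> b \<in> tw_car (N m) j \<Longrightarrow> t \<in> grass0 m \<Longrightarrow>
    twm \<phi> (tw_plus (N m) a (tw_times (N m) b t)) = tw_plus (N n) (twm \<phi> a) (tw_times (N n) (twm \<phi> b) (\<phi> t))"
  by (simp add: twm_plus[where l = n and j = j] twm_times[where l = n and j = j] N_mul)

lemma VD_car: "tw_dom (N m) (V m) j \<subseteq> tw_car (N m) j"
  by (rule tw_dom_subset_car) (simp add: V_ev)

text \<open>The augmentation is a morphism, so it commutes with forming end points; by induction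
  membership in each iterated domain depends on bodies alone.\<close>

lemma VD_body:
  "p \<in> tw_car (N m) j \<Longrightarrow> p \<in> tw_dom (N m) (V m) j \<longleftrightarrow> twm geps p \<in> tw_dom (N (enat 0)) (\<U> 0) j"
proof (induction j arbitrary: p)
  case 0
  then show ?case by (auto simp: V_iff)
next
  case (Suc j)
  obtain a b t where p: "p = Tri a b t" "a \<in> tw_car (N m) j" "b \<in> tw_car (N m) j" "t \<in> grass0 m"
    using Suc.prems by auto
  note g = ghom_geps[of m "enat 0", where ?'r = 'r]
  have "tw_plus (N m) a (tw_times (N m) b t) \<in> tw_car (N m) j" using p by (intro N_add N_mul)
  note IH = Suc.IH[OF p(2)] Suc.IH[OF this]
  show ?case
    using p(3,4) twm_car[OF g p(3)] ghomD(6)[OF g p(4)]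
    by (simp add: p(1) IH twm_line[OF g p(2-4)])
qed

text \<open>Consequently the domain defined through the augmentation is the iterated difference
  domain over the even part, and the calculus of \<open>tw_dom\<close> applies to it.\<close>

lemma MS_dom_eq: "MS_dom s0 s1 \<U> m j = tw_dom (N m) (V m) j"
proof (cases j)
  case (Suc k)
  show ?thesis
    unfolding Suc MS_dom.simps(2) using VD_body[of _ m "Suc k"] VD_car[of m "Suc k"] by blast
qed simp

lemma VD_tmap: "ghom m n \<phi> \<Longrightarrow> p \<in> tw_dom (N m) (V m) j \<Longrightarrow> twm \<phi> p \<in> tw_dom (N n) (V n) j"
proof (induction j arbitrary: p)
  case 0
  then show ?case using V_tmap by auto
next
  case (Suc j)
  obtain a b t where p: "p = Tri a b t" "a \<in> tw_dom (N m) (V m) j" "b \<in> tw_car (N m) j" "t \<in> grass0 m"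
    "tw_plus (N m) a (tw_times (N m) b t) \<in> tw_dom (N m) (V m) j"
    using Suc.prems by auto
  have a: "a \<in> tw_car (N m) j" using p VD_car by auto
  show ?case
    using p Suc.IH[OF Suc.prems(1) p(2)] Suc.IH[OF Suc.prems(1) p(5)] twm_line[OF Suc.prems(1) a p(3,4)]
      twm_car[OF Suc.prems(1) p(3)] ghomD(6)[OF Suc.prems(1) p(4)] by simp
qed

lemma N_add_cont:
  "continuous_map (prod_topology (ev_top (enat n)) (ev_top (enat n))) (ev_top (enat n))
     (\<lambda>(x, y). tadd x (y :: nat set \<Rightarrow> 'e0 \<times> 'e1))"
proof -
  have "continuous_map (prod_topology (ev_top (enat n)) (ev_top (enat n))) euclidean
     (\<lambda>p :: (nat set \<Rightarrow> 'e0 \<times> 'e1) \<times> (nat set \<Rightarrow> 'e0 \<times> 'e1). fst p K + snd p K)" for K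
    using continuous_map_compose[OF continuous_map_fst continuous_map_ev_coordinate[of "enat n" K]]
      continuous_map_compose[OF continuous_map_snd continuous_map_ev_coordinate[of "enat n" K]]
    unfolding comp_def by (rule continuous_map_plus)
  then show ?thesis unfolding continuous_map_into_ev by (auto simp: case_prod_beta intro: ev_add)
qed

lemma N_mul_cont:
  "continuous_map (prod_topology (ev_top (enat n)) (grass0_top (enat n))) (ev_top (enat n)) (\<lambda>(x, c). tmul \<sigma> x c)"
proof -
  have "continuous_map (prod_topology (ev_top (enat n)) (grass0_top (enat n))) euclidean
     (\<lambda>p :: (nat set \<Rightarrow> 'e0 \<times> 'e1) \<times> (nat set \<Rightarrow> 'r). tmul \<sigma> (fst p) (snd p) K)" for K
    using continuous_map_compose[OF continuous_map_fst continuous_map_ev_coordinate[of "enat n"]]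
      continuous_map_compose[OF continuous_map_snd continuous_map_grass0_coordinate[of "enat n"]]
    unfolding comp_def by (intro continuous_map_tmul_coordinate[OF E])
  then show ?thesis unfolding continuous_map_into_ev by (auto simp: case_prod_beta intro: tmul_evE)
qed

sublocale T: gtower t0 t1 n "Emod_L s0 s1 (enat n)" 0 "\<U> n" for n
proof
  show "madd (N (enat n)) x (mscal (N (enat n)) v c) \<in> \<U> n"
    if "x \<in> \<U> n" "v \<in> mcar (N (enat n))" "c \<in> grass0 (enat n)" "c {} = 0" for x v c
  proof -
    have x: "x \<in> ev (enat n)" using that \<U>_ev by auto
    have y: "x + tmul \<sigma> v c \<in> ev (enat n)" using that x by (auto intro: ev_add tmul_evE)
    \<comment> \<open>A scalar without body does not change the body of the point, and the body
      decides membership.\<close>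
    have "tmap \<sigma> geps (x + tmul \<sigma> v c) = tmap \<sigma> geps x"
      unfolding tmap_geps_ev[OF y] tmap_geps_ev[OF x] using that by (simp add: fun_eq_iff E.tmul_empty)
    moreover have "tmap \<sigma> geps x \<in> \<U> 0" using that(1) V_iff[of x "enat n"] by simp
    ultimately show ?thesis using \<U>_body[OF y] by simp
  qed
qed (use \<U>_open[of n] N_add_cont[of n] N_mul_cont[of n] in
    \<open>auto simp: E.tmul_add_left E.tmul_add_right E.tmul_assoc ev_iff ac_simps\<close>)

text \<open>At a finite level the sum can be taken over the fixed finite set of all monomials, which
  removes the dependence of its range on the support of \<open>y z\<close>.\<close>

lemma tmap_coordinate_cont:
  assumes "\<And>K. continuous_map Z euclidean (\<lambda>z. y z K)" "\<And>z. z \<in> topspace Z \<Longrightarrow> y z \<in> coef (enat m)"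
  shows "continuous_map Z euclidean (\<lambda>z. tmap \<tau> \<phi> (y z) K)"
proof (rule continuous_map_eq)
  show "continuous_map Z euclidean (\<lambda>z. \<Sum>I\<in>idx (enat m). \<tau> (\<phi> (gbasis I) K) (y z I))"
    using assms(1) by (intro continuous_map_sum_top continuous_map_scal[OF F]) auto
  show "(\<Sum>I\<in>idx (enat m). \<tau> (\<phi> (gbasis I) K) (y z I)) = tmap \<tau> \<phi> (y z) K" if "z \<in> topspace Z" for z
    using assms(2)[OF that] by (intro F.tmap_superset[symmetric]) (auto simp: coef_def)
qed

text \<open>The difference quotients inherit naturality, since the equation determining them can be
  solved wherever the scalar is a unit.\<close>
lemma quotient_natural:
  fixes h :: "nat \<Rightarrow> (nat set \<Rightarrow> 'e0 \<times> 'e1, nat set \<Rightarrow> 'r) tw \<Rightarrow> nat set \<Rightarrow> 'f0 \<times> 'f1"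
  assumes G: "\<And>n. T.sm n (Suc j) (G n)" and h: "\<And>n. T.sm n j (h n)"
    and eq: "\<And>n a b t. Tri a b t \<in> T.D n (Suc j) \<Longrightarrow>
      h n (tw_plus (N (enat n)) a (tw_times (N (enat n)) b t)) - h n a = tmul \<tau> (G n (Tri a b t)) t"
    and nat: "\<And>p. p \<in> T.D m j \<Longrightarrow> h n (twm \<phi> p) = tmap \<tau> \<phi> (h m p)"
    and \<phi>: "ghom (enat m) (enat n) \<phi>" and p: "p \<in> T.D m (Suc j)"
  shows "G n (twm \<phi> p) = tmap \<tau> \<phi> (G m p)"
proof
  fix K
  obtain a b t where P: "p = Tri a b t" "a \<in> T.D m j" "b \<in> T.C m j" "t \<in> grass0 (enat m)" "a \<in> T.C m j"
    using p by (elim T.D_SucE)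
  \<comment> \<open>Only the body of the scalar is varied: \<open>t' s\<close> has body
    \<open>s\<close>, and \<open>s = t {}\<close> gives back \<open>t\<close>.\<close>
  define t' where "t' s = t + rc (s - t {})" for s
  have t': "t' s \<in> grass0 (enat m)" "t' s {} = s" for s using P(4) by (auto simp: t'_def intro: grass0_add)
  define \<gamma> where "\<gamma> s = tw_plus (N (enat m)) p (tw_times (N (enat m)) (T.bdir j) (rc (s - t {})))" for s
  have \<gamma>: "\<gamma> s = Tri a b (t' s)" for s
    unfolding \<gamma>_def t'_def P(1) using P(5,3) by (rule T.bdir_line)
  have shift: "continuous_map euclidean euclidean (\<lambda>s :: 'r. s - t {})"
    by (auto intro!: continuous_intros)
  have pC: "p \<in> T.C m (Suc j)" using p T.D_C by blast
  have \<gamma>c: "continuous_map euclidean (tw_top (N (enat m)) (Suc j)) \<gamma>"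
    using continuous_map_compose[OF shift T.cm_path[OF pC T.bdir_C]] unfolding comp_def \<gamma>_def .
  have \<phi>t: "\<phi> (t' s) = \<phi> t + rc (s - t {})" for s
    unfolding t'_def using P(4) rc_grass0[of "s - t {}" "enat m"] ghomD(2)[OF \<phi>] ghom_rc[OF \<phi>]
    by (simp add: grass0_iff)
  have twa: "twm \<phi> a \<in> T.C n j" "twm \<phi> b \<in> T.C n j" using twm_car[OF \<phi>] P by auto
  have \<phi>\<gamma>: "twm \<phi> (\<gamma> s) = tw_plus (N (enat n)) (twm \<phi> p) (tw_times (N (enat n)) (T.bdir j) (rc (s - t {})))" for s
    unfolding \<gamma> P(1) tw_map.simps \<phi>t using twa by (intro T.bdir_line[symmetric])
  have \<phi>p: "twm \<phi> p \<in> T.C n (Suc j)" using twm_car[OF \<phi> pC] .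
  have \<phi>\<gamma>c: "continuous_map euclidean (tw_top (N (enat n)) (Suc j)) (\<lambda>s. twm \<phi> (\<gamma> s))"
    using continuous_map_compose[OF shift T.cm_path[OF \<phi>p T.bdir_C]] unfolding comp_def \<phi>\<gamma> .
  let ?S = "{s. \<gamma> s \<in> T.D m (Suc j)}"
  have \<phi>D: "twm \<phi> (\<gamma> s) \<in> T.D n (Suc j)" if "s \<in> ?S" for s
    using VD_tmap[OF \<phi>, of "\<gamma> s" "Suc j"] that by (simp only: V_enat mem_Collect_eq)
  have \<gamma>0: "\<gamma> (t {}) = p" by (simp add: \<gamma> P(1) t'_def)
  have "G n (twm \<phi> (\<gamma> (t {}))) K = tmap \<tau> \<phi> (G m (\<gamma> (t {}))) K"
  proof (rule unit_limit_unique[OF units, where S = ?S and c = "t {}" and A = "\<lambda>s. G n (twm \<phi> (\<gamma> s)) K"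
        and B = "\<lambda>s. tmap \<tau> \<phi> (G m (\<gamma> s)) K"])
    show "open ?S" by (rule open_path_preimage[OF \<gamma>c T.D_open])
    show "t {} \<in> ?S" using p by (simp only: \<gamma>0 mem_Collect_eq)
    show "continuous_map (subtopology euclidean ?S) euclidean (\<lambda>s. G n (twm \<phi> (\<gamma> s)) K)"
      by (rule T.sm_path[OF G continuous_map_from_subtopology[OF \<phi>\<gamma>c] \<phi>D])
    show "continuous_map (subtopology euclidean ?S) euclidean (\<lambda>s. tmap \<tau> \<phi> (G m (\<gamma> s)) K)"
    proof (rule tmap_coordinate_cont)
      show "continuous_map (subtopology euclidean ?S) euclidean (\<lambda>s. G m (\<gamma> s) K)" for K
        by (rule T.sm_path[OF G continuous_map_from_subtopology[OF \<gamma>c]]) (simp only: mem_Collect_eq)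
      show "G m (\<gamma> s) \<in> coef (enat m)" if s: "s \<in> topspace (subtopology euclidean ?S)" for s
      proof -
        have "\<gamma> s \<in> T.D m (Suc j)" using s by (simp only: topspace_subtopology Int_iff mem_Collect_eq)
        then show ?thesis using T.sm_ev[OF G] by (auto simp: ev_iff simp del: tw_dom.simps)
      qed
    qed
  next
    fix s u assume "s \<in> ?S" and su: "s * u = 1"
    then have sD: "Tri a b (t' s) \<in> T.D m (Suc j)" by (simp only: \<gamma> mem_Collect_eq)
    have \<phi>sD: "Tri (twm \<phi> a) (twm \<phi> b) (\<phi> (t' s)) \<in> T.D n (Suc j)"
      using \<phi>D[OF \<open>s \<in> ?S\<close>] by (simp only: \<gamma> tw_map.simps)
    have lD: "tw_plus (N (enat m)) a (tw_times (N (enat m)) b (t' s)) \<in> T.D m j" using sD by (simp only: T.Tri_D)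
    have Gm: "G m (Tri a b (t' s)) \<in> ev (enat m)" by (rule T.sm_ev[OF G sD])
    have Gn: "G n (Tri (twm \<phi> a) (twm \<phi> b) (\<phi> (t' s))) \<in> ev (enat n)" by (rule T.sm_ev[OF G \<phi>sD])
    have he: "h m q \<in> coef (enat m)" if "q \<in> T.D m j" for q using T.sm_ev[OF h that] by (simp add: ev_iff)
    have "tmul \<tau> (G n (Tri (twm \<phi> a) (twm \<phi> b) (\<phi> (t' s)))) (\<phi> (t' s))
      = h n (twm \<phi> (tw_plus (N (enat m)) a (tw_times (N (enat m)) b (t' s)))) - h n (twm \<phi> a)"
      unfolding eq[OF \<phi>sD, symmetric] twm_line[OF \<phi> P(5,3) t'(1)] ..
    also have "\<dots> = tmap \<tau> \<phi> (h m (tw_plus (N (enat m)) a (tw_times (N (enat m)) b (t' s))) - h m a)"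
      unfolding nat[OF lD] nat[OF P(2)] using F.tmap_diff[OF he[OF lD] he[OF P(2)]] by simp
    also have "\<dots> = tmul \<tau> (tmap \<tau> \<phi> (G m (Tri a b (t' s)))) (\<phi> (t' s))"
      unfolding eq[OF sD] using Gm t'(1) by (intro F.tmap_tmul[OF \<phi>]) (auto simp: ev_iff grass0_iff)
    finally have e: "tmul \<tau> (G n (Tri (twm \<phi> a) (twm \<phi> b) (\<phi> (t' s)))) (\<phi> (t' s))
      = tmul \<tau> (tmap \<tau> \<phi> (G m (Tri a b (t' s)))) (\<phi> (t' s))" .
    have c: "G n (Tri (twm \<phi> a) (twm \<phi> b) (\<phi> (t' s))) \<in> coef (enat n)" using Gn by (simp add: ev_iff)
    have d: "tmap \<tau> \<phi> (G m (Tri a b (t' s))) \<in> coef (enat n)"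
      using Gm by (intro F.coef_tmap[OF \<phi>]) (simp add: ev_iff)
    \<comment> \<open>Morphisms preserve bodies, so the image scalar still has the unit
      \<open>s\<close> as its body and can be cancelled.\<close>
    have "\<phi> (t' s) {} * u = 1"
      using su t'[of s] ghom_body[OF \<phi>, of "t' s"] by (simp add: grass0_iff)
    from F.tmul_unit_cancel[OF c d this e]
    have "G n (Tri (twm \<phi> a) (twm \<phi> b) (\<phi> (t' s))) = tmap \<tau> \<phi> (G m (Tri a b (t' s)))" .
    then show "G n (twm \<phi> (\<gamma> s)) K = tmap \<tau> \<phi> (G m (\<gamma> s)) K" by (simp only: \<gamma> tw_map.simps)
  qed
  then show "G n (twm \<phi> p) K = tmap \<tau> \<phi> (G m p) K" by (simp only: \<gamma>0)
qed

text \<open>The quotients are chosen for each \<open>n\<close> independently. No compatibility has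
  to be arranged between the choices, because \<open>quotient_natural\<close> makes any choice
  natural.\<close>

lemma MS_tower:
  assumes "\<And>n. \<exists>h1. T.ksm n j (h n) h1"
    and "\<And>m n \<phi> p. ghom (enat m) (enat n) \<phi> \<Longrightarrow> p \<in> T.D m j \<Longrightarrow> h n (twm \<phi> p) = tmap \<tau> \<phi> (h m p)"
    and "\<And>n. g (enat n) = h n"
  shows "MS_Ck Lam s0 s1 t0 t1 \<U> k j g"
  using assms
proof (induction k arbitrary: j h g)
  have natural: "MS_natural Lam s0 s1 t0 t1 \<U> j g"
    if ks: "\<And>n. \<exists>h1. T.ksm n j (h n) h1"
      and nat: "\<And>m n \<phi> p. ghom (enat m) (enat n) \<phi> \<Longrightarrow> p \<in> T.D m j \<Longrightarrow> h n (twm \<phi> p) = tmap \<tau> \<phi> (h m p)"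
      and g: "\<And>n. g (enat n) = h n"
    for j h g
    unfolding MS_natural_def MS_dom_eq
  proof (intro conjI ballI allI impI)
    fix ob assume "ob \<in> Lam"
    then obtain n where n: "ob = enat n" by (auto simp: Lam_def)
    obtain h1 where "T.ksm n j (h n) h1" using ks by blast
    then have "T.sm n j (h n)" using rsm_smooth by (auto simp: T.ksm_def)
    from BGN_smooth_continuous[OF this]
    show "continuous_map (subtopology (tw_top (N ob) j) (tw_dom (N ob) (V ob) j)) (ev_top ob) (g ob)"
      by (simp add: n g)
  next
    fix m n p and \<phi> :: "(nat set \<Rightarrow> 'r) \<Rightarrow> nat set \<Rightarrow> 'r" assume "m \<in> Lam" "n \<in> Lam" "ghom m n \<phi>" "p \<in> tw_dom (N m) (V m) j"
    then show "g n (twm \<phi> p) = tmap \<tau> \<phi> (g m p)"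
      using nat by (auto simp: Lam_def g)
  qed
  {
    case 0
    then show ?case using natural[of j h g] by simp
  next
    case (Suc k)
    have "\<exists>G G1. T.ksm n (Suc j) G G1 \<and> (\<forall>a b t. Tri a b t \<in> T.D n (Suc j) \<longrightarrow>
      h n (tw_plus (N (enat n)) a (tw_times (N (enat n)) b t)) - h n a = tmul \<tau> (G (Tri a b t)) t)" for n
    proof -
      obtain h1 where "T.ksm n j (h n) h1" using Suc.prems(1) by blast
      then show ?thesis by (rule T.quotient_exists[OF half])
    qed
    then obtain G where G: "\<And>n. \<exists>G1. T.ksm n (Suc j) (G n) G1"
      and Geq: "\<And>n a b t. Tri a b t \<in> T.D n (Suc j) \<Longrightarrow>
        h n (tw_plus (N (enat n)) a (tw_times (N (enat n)) b t)) - h n a = tmul \<tau> (G n (Tri a b t)) t"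
      by metis
    have Gs: "T.sm n (Suc j) (G n)" for n
      using G[of n] rsm_smooth by (auto simp only: T.ksm_def)
    have hs: "T.sm n j (h n)" for n
      using Suc.prems(1)[of n] rsm_smooth by (auto simp only: T.ksm_def)
    define g1 where "g1 ob = (case ob of enat n \<Rightarrow> G n | \<infinity> \<Rightarrow> undefined)" for ob
    have "MS_Ck Lam s0 s1 t0 t1 \<U> k (Suc j) g1"
    proof (rule Suc.IH[OF G])
      show "G n (twm \<phi> p) = tmap \<tau> \<phi> (G m p)"
        if "ghom (enat m) (enat n) \<phi>" "p \<in> T.D m (Suc j)" for m n \<phi> p
        by (rule quotient_natural[OF Gs hs Geq Suc.prems(2)[OF that(1)] that])
    qed (simp add: g1_def)
    moreover have "tdiff (g ob (tw_plus (N ob) a (tw_times (N ob) b t))) (g ob a) = tmul \<tau> (g1 ob (Tri a b t)) t"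
      if ob: "ob \<in> Lam" and d: "Tri a b t \<in> MS_dom s0 s1 \<U> ob (Suc j)" for ob a b t
    proof -
      obtain n where n: "ob = enat n" using ob by (auto simp: Lam_def)
      have "Tri a b t \<in> T.D n (Suc j)" using d unfolding MS_dom_eq n V_enat .
      from Geq[OF this] show ?thesis by (simp add: n Suc.prems(3) g1_def)
    qed
    ultimately show ?case
      unfolding MS_Ck.simps using natural[OF Suc.prems] by blast
  }
qed

section \<open>Derivatives over R and nilpotent increments\<close>

lemma path_module_R: "path_module (Emod_R s0 s1 m)"
  unfolding path_module_def
proof (intro conjI ballI)
  show "scalR (Emod_R s0 s1 m)" by (simp add: scalR_def)
next
  fix x v assume "x \<in> mcar (Emod_R s0 s1 m)" "v \<in> mcar (Emod_R s0 s1 m)"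
  then have xv: "x \<in> ev m" "v \<in> ev m" by simp_all
  obtain k where k: "x \<in> ev (enat k)" "v \<in> ev (enat k)" "enat k \<le> m"
  proof (cases m)
    case (enat k) then show ?thesis using xv that by auto
  next
    case infinity
    then obtain a b where "x \<in> ev (enat a)" "v \<in> ev (enat b)" using xv ev_infinity by blast
    then show ?thesis using that[of "max a b"] ev_mono[of "enat a" "enat (max a b)"] ev_mono[of "enat b" "enat (max a b)"] infinity
      by auto
  qed
  have "continuous_map euclidean (ev_top (enat k)) (\<lambda>s. x + tsmul \<sigma> v s)"
    unfolding continuous_map_into_ev
  proof (intro conjI ballI allI)
    fix s :: 'r
    have "tsmul \<sigma> v s = tmul \<sigma> v (rc s)"
      using k E.tmul_rc_coef[of v "enat k"] by (simp add: ev_iff)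
    moreover have "x + tmul \<sigma> v (rc s) \<in> ev (enat k)" by (intro ev_add tmul_evE k rc_grass0)
    ultimately show "x + tsmul \<sigma> v s \<in> ev (enat k)" by simp
  next
    fix K
    show "continuous_map euclidean euclidean (\<lambda>s. (x + tsmul \<sigma> v s) K)"
      unfolding plus_fun_apply tsmul_def by (intro continuous_map_plus continuous_map_scal[OF E]) auto
  qed
  from continuous_map_compose[OF this continuous_map_ev_incl[OF k(3)]]
  show "continuous_map euclidean (mtop (Emod_R s0 s1 m)) (\<lambda>s. madd (Emod_R s0 s1 m) x (mscal (Emod_R s0 s1 m) v s))"
    by (simp add: comp_def)
qed

lemma tsmul_tmul_rc: "v \<in> ev m \<Longrightarrow> tsmul \<sigma> v s = tmul \<sigma> v (rc s)"
  using E.tmul_rc_coef[of v m] by (simp add: ev_iff)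

abbreviation "dR m g \<equiv> BGN_deriv (Emod_R s0 s1 m) (V m) (Fcod_R t0 t1 m) 0 g"

text \<open>A change of presentation: level 0 of the tower wraps each point in one more
  \<open>Base\<close>, and its scalars from R act through \<open>rc\<close>.\<close>

lemma smooth_lift:
  assumes "BGN_smooth (Emod_R s0 s1 (enat n)) (\<U> n) (T.Y n) g"
  shows "T.sm n 0 (\<lambda>p. g (unBase p))"
proof -
  define L where "L q = (Base (unBase (unBase q)) :: (nat set \<Rightarrow> 'e0 \<times> 'e1, 'r) tw)"
    for q :: "((nat set \<Rightarrow> 'e0 \<times> 'e1, nat set \<Rightarrow> 'r) tw, 'r) tw"
  have Lc: "continuous_map (tw_top (T.RM n 0) 0) (tw_top (Emod_R s0 s1 (enat n)) 0) L"
  proof -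
    have 1: "continuous_map (tw_top (T.RM n 0) 0) (tw_top (N (enat n)) 0) unBase"
      using continuous_map_unBase[of "T.RM n 0"] by simp
    have 2: "continuous_map (tw_top (N (enat n)) 0) (mtop (Emod_R s0 s1 (enat n))) unBase"
      using continuous_map_unBase[of "N (enat n)"] by simp
    show ?thesis
      using continuous_map_compose[OF continuous_map_compose[OF 1 2] continuous_map_Base] by (simp add: L_def[abs_def] comp_def)
  qed
  have aff: "affine_map (T.RM n 0) 0 (Emod_R s0 s1 (enat n)) 0 (\<lambda>s. s) L L"
    unfolding affine_map_def using Lc
    by (auto simp: L_def tsmul_tmul_rc simp del: tw_top.simps)
  have "BGN_Ck (T.RM n 0) (T.D n 0) (T.Y n) k 0 (base_fun (\<lambda>p. g (unBase p)))" for k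
  proof (rule BGN_cong)
    show "BGN_Ck (T.RM n 0) (T.D n 0) (T.Y n) k 0 (\<lambda>q. base_fun g (L q))"
      by (rule BGN_transport[where P = "\<lambda>y. y" and M = "Emod_R s0 s1 (enat n)" and M' = "T.RM n 0" and Y = "T.Y n"
          and U = "\<U> n" and j = 0 and g = "base_fun g", OF _ _ _ _ _ _ _ _ _ _ _ aff])
        (use assms \<U>_ev in \<open>auto simp: BGN_smooth_def T.topspace_C L_def simp del: tw_top.simps\<close>)
  qed (auto simp: L_def)
  then show ?thesis by (simp add: BGN_smooth_def)
qed

lemma derivative_lift:
  assumes r: "T.rs n 0 (\<lambda>p. g (unBase p)) h1" and x: "x \<in> \<U> n" "v \<in> ev (enat n)"
  shows "dR (enat n) g x v = h1 (Tri (Base (Base x)) (Base (Base v)) 0)"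
proof -
  define g1 where "g1 q = h1 (Tri (Base (Base (unBase (tw1 q)))) (Base (Base (unBase (tw2 q)))) (tw3 q))"
    for q :: "(nat set \<Rightarrow> 'e0 \<times> 'e1, 'r) tw"
  have c: "continuous_map (subtopology (tw_top (Emod_R s0 s1 (enat n)) 1) (tw_dom (Emod_R s0 s1 (enat n)) (\<U> n) 1))
      (ev_top (enat n)) g1"
  proof -
    let ?E = "Emod_R s0 s1 (enat n)"
    let ?g = "\<lambda>q. Tri (Base (Base (unBase (tw1 q)))) (Base (Base (unBase (tw2 q)))) (tw3 q)"
    have u: "continuous_map (tw_top ?E 0) (mtop (T.RM n 0)) (\<lambda>p. Base (unBase p))"
      using continuous_map_compose[OF continuous_map_unBase[of ?E], of "mtop (T.RM n 0)" Base]
        continuous_map_Base[of "N (enat n)"] by (simp add: comp_def)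
    have "continuous_map (tw_top ?E 1) (tw_top (T.RM n 0) 1) ?g"
      using continuous_map_compose[OF continuous_map_tw1 u] continuous_map_compose[OF continuous_map_tw2 u]
        continuous_map_tw3[of ?E 0]
      by (intro continuous_map_Tri_Base) (simp_all only: One_nat_def T.RM_simps Emod_R_simps comp_def)
    then have "continuous_map (subtopology (tw_top ?E 1) (tw_dom ?E (\<U> n) 1))
      (subtopology (tw_top (T.RM n 0) 1) (tw_dom (T.RM n 0) (T.D n 0) 1)) ?g"
      by (auto simp: continuous_map_in_subtopology tsmul_tmul_rc elim!: tw_dom_1_cases intro!: continuous_map_from_subtopology
          simp del: tw_top.simps One_nat_def)
    from continuous_map_compose[OF this rsm_continuous[OF r]] show ?thesis by (simp add: g1_def[abs_def] comp_def)
  qed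
  have "dR (enat n) g x v = g1 (Tri (Base x) (Base v) 0)"
    unfolding V_enat
  proof (rule BGN_deriv_eq[OF path_module_R _ c])
    show "openin (mtop (Emod_R s0 s1 (enat n))) (\<U> n)" using \<U>_open by simp
    show "g (madd (Emod_R s0 s1 (enat n)) y (mscal (Emod_R s0 s1 (enat n)) w t)) - g y
      = tsmul \<tau> (g1 (Tri (Base y) (Base w) t)) t"
      if "y \<in> \<U> n" "w \<in> mcar (Emod_R s0 s1 (enat n))" "madd (Emod_R s0 s1 (enat n)) y (mscal (Emod_R s0 s1 (enat n)) w t) \<in> \<U> n"
      for y w t
      using T.rs_line[OF r, of "Base y" "Base w" t] that by (simp add: g1_def tsmul_tmul_rc[of w "enat n"])
    show "v \<in> mcar (Emod_R s0 s1 (enat n))" using x by simp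
    have "tsmul \<sigma> v 0 = 0" by (simp add: fun_eq_iff tsmul_def)
    then show "madd (Emod_R s0 s1 (enat n)) x (mscal (Emod_R s0 s1 (enat n)) v 0) \<in> \<U> n" using x by simp
  qed (fact x)
  then show ?thesis by (simp add: g1_def)
qed

text \<open>The derivative is determined along a single line: any continuous \<open>B\<close> that
  solves the quotient equation there agrees with the quotient at units, hence also at 0.\<close>

lemma line_limit:
  assumes r: "T.rs n 0 (\<lambda>p. g (unBase p)) h1" and x: "x \<in> \<U> n" and v: "v \<in> ev (enat n)"
    and S: "S = {s. x + tmul \<sigma> v (rc s) \<in> \<U> n}"
    and B: "\<And>K. continuous_map (subtopology euclidean S) euclidean (\<lambda>s. B s K)"
    and eq: "\<And>s. s \<in> S \<Longrightarrow> g (x + tmul \<sigma> v (rc s)) - g x = tsmul \<tau> (B s) s"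
  shows "h1 (Tri (Base (Base x)) (Base (Base v)) 0) = B 0"
proof
  fix K
  have xC: "Base x \<in> T.C n 0" and vC: "Base v \<in> T.C n 0" using x v \<U>_ev by auto
  have line: "tw_plus (N (enat n)) (Base x) (tw_times (N (enat n)) (Base v) (rc s)) = Base (x + tmul \<sigma> v (rc s))" for s
    by simp
  show "h1 (Tri (Base (Base x)) (Base (Base v)) 0) K = B 0 K"
  proof (rule unit_limit_unique[OF units, where S = S and A = "\<lambda>s. h1 (Tri (Base (Base x)) (Base (Base v)) s) K"])
    have "S = {s. tw_plus (N (enat n)) (Base x) (tw_times (N (enat n)) (Base v) (rc s)) \<in> T.D n 0}"
      by (auto simp: S)
    then show "open S" using open_path_preimage[OF T.cm_path[OF xC vC] T.D_open] by simp
    show "0 \<in> S" using x by (simp add: S)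
    show "continuous_map (subtopology euclidean S) euclidean (\<lambda>s. h1 (Tri (Base (Base x)) (Base (Base v)) s) K)"
      using xC vC x by (intro T.rs_path[OF r]) (auto simp: T.topspace_C S simp del: tw_top.simps)
    show "continuous_map (subtopology euclidean S) euclidean (\<lambda>s. B s K)" by (rule B)
  next
    fix s u assume s: "s \<in> S" and su: "s * u = 1"
    have "tsmul \<tau> (h1 (Tri (Base (Base x)) (Base (Base v)) s)) s = tsmul \<tau> (B s) s"
      using T.rs_line[OF r, of "Base x" "Base v" s] eq[OF s] x vC s by (simp add: S)
    then show "h1 (Tri (Base (Base x)) (Base (Base v)) s) K = B s K"
      using tsmul_cancel_fun[OF _ su] by metis
  qed
qed

text \<open>Adjoin two odd generators and rescale one of them: by naturality the value of \<open>f\<close> along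
  the resulting line is affine, so its increment is the derivative.\<close>
lemma natural_nilpotent:
  assumes nat: "\<And>m n \<phi> x. ghom (enat m) (enat n) \<phi> \<Longrightarrow> x \<in> \<U> m \<Longrightarrow> f n (tmap \<sigma> \<phi> x) = tmap \<tau> \<phi> (f m x)"
    and r: "\<And>n. T.rs n 0 (\<lambda>p. f n (unBase p)) (h1 n)"
    and lin: "\<And>n x v c. x \<in> \<U> n \<Longrightarrow> v \<in> ev (enat n) \<Longrightarrow> c \<in> grass0 (enat n) \<Longrightarrow>
      h1 n (Tri (Base (Base x)) (Base (Base (tmul \<sigma> v c))) 0) = tmul \<tau> (h1 n (Tri (Base (Base x)) (Base (Base v)) 0)) c"
    and x: "x \<in> \<U> n" and v: "v \<in> ev (enat n)" and \<alpha>: "\<alpha> \<in> grass1 (enat n)" and \<beta>: "\<beta> \<in> grass1 (enat n)"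
  shows "f n (x + tmul \<sigma> v (gmul \<alpha> \<beta>)) = f n x + tmul \<tau> (h1 n (Tri (Base (Base x)) (Base (Base v)) 0)) (gmul \<alpha> \<beta>)"
proof -
  \<comment> \<open>Room for two new odd generators, with indices \<open>n\<close> and
    \<open>Suc n\<close>, that occur neither in \<open>x\<close> nor in \<open>v\<close>.\<close>
  define N2 where "N2 = Suc (Suc n)"
  have le: "enat n \<le> enat (Suc n)" "enat n \<le> enat N2" "enat (Suc n) \<le> enat N2" by (auto simp: N2_def)
  have fev: "f m y \<in> ev (enat m)" if "y \<in> \<U> m" for m y
    using T.sm_ev[OF rsm_smooth[OF r], of "Base y" m] that by simp
  have id\<U>: "tmap \<sigma> (\<lambda>a. a) y = y" if "y \<in> ev (enat m)" for y m using that E.tmap_id[of y "enat m"] by (simp add: ev_iff)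
  have idF: "tmap \<tau> (\<lambda>a. a) y = y" if "y \<in> ev (enat m)" for y m using that F.tmap_id[of y "enat m"] by (simp add: ev_iff)
  have xe: "x \<in> ev (enat n)" using x \<U>_ev by auto
  have x2: "x \<in> \<U> N2" using \<U>_functor[OF ghom_id[OF le(2)] x] id\<U>[OF xe] by simp
  have f2: "f N2 y = f n y" if "y \<in> \<U> n" for y
    using nat[OF ghom_id[OF le(2)] that] id\<U>[OF subsetD[OF \<U>_ev that]] idF[OF fev[OF that]] by simp
  have v2: "v \<in> ev (enat N2)" using v ev_mono[OF le(2)] by auto
  define gn where "gn = (gbasis {n} :: nat set \<Rightarrow> 'r)"
  define gm where "gm = (gbasis {Suc n} :: nat set \<Rightarrow> 'r)"
  define \<theta> where "\<theta> = gmul gn gm"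
  have gn: "gn \<in> grass1 (enat (Suc n))" "gn \<in> grass1 (enat N2)" and gm: "gm \<in> grass1 (enat N2)"
    unfolding gn_def gm_def by (auto intro!: gbasis_grass1 simp: idx_enat N2_def)
  have \<theta>: "\<theta> \<in> grass0 (enat N2)" "\<theta> {} = 0"
    unfolding \<theta>_def using gmul_odd_product(1,2)[OF half gn(2) gm] by auto
  define y where "y = x + tmul \<sigma> v \<theta>"
  have y: "y \<in> \<U> N2" using T.U_nil[OF x2 _ \<theta>] v2 by (simp add: y_def)
  have vt: "tmul \<sigma> v \<theta> \<in> ev (enat N2)" using v2 \<theta> by (intro tmul_evE)
  define d where "d = h1 n (Tri (Base (Base x)) (Base (Base v)) 0)"
  have d: "d \<in> ev (enat n)"
    unfolding d_def using x v \<U>_ev by (intro T.rs_ev[OF r]) auto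
  \<comment> \<open>For \<open>x\<close> and \<open>v\<close> from level \<open>n\<close>,
    naturality under the inclusion makes \<open>f N2\<close> equal to \<open>f n\<close> along the
    line, so both levels have the same derivative there.\<close>
  have dd: "h1 N2 (Tri (Base (Base x)) (Base (Base v)) 0) = d"
    unfolding d_def
  proof (rule line_limit[OF r x2 v2, symmetric, THEN sym])
    let ?S = "{s. x + tmul \<sigma> v (rc s) \<in> \<U> N2}"
    have S: "x + tmul \<sigma> v (rc s) \<in> \<U> n" if "s \<in> ?S" for s
    proof -
      have "x + tmul \<sigma> v (rc s) \<in> ev (enat n)" using xe v by (intro ev_add tmul_evE rc_grass0)
      moreover have "tmap \<sigma> geps (x + tmul \<sigma> v (rc s)) \<in> \<U> 0" using that V_iff[of _ "enat N2"] by simp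
      ultimately show ?thesis by (rule \<U>_body)
    qed
    show "?S = {s. x + tmul \<sigma> v (rc s) \<in> \<U> N2}" ..
    show "continuous_map (subtopology euclidean ?S) euclidean (\<lambda>s. h1 n (Tri (Base (Base x)) (Base (Base v)) s) K)" for K
      using x v \<U>_ev S by (intro T.rs_path[OF r]) (auto simp: T.topspace_C simp del: tw_top.simps)
    show "f N2 (x + tmul \<sigma> v (rc s)) - f N2 x = tsmul \<tau> (h1 n (Tri (Base (Base x)) (Base (Base v)) s)) s"
      if "s \<in> ?S" for s
      using T.rs_line[OF r, of "Base x" n "Base v" s] S[OF that] x v f2 by simp
  qed
  \<comment> \<open>Scales the generator \<open>n\<close> by \<open>s\<close> and fixes all others.
    Applied to \<open>y = x + v \<theta>\<close> it yields the line
    \<open>x + v \<theta> s\<close>.\<close>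
  define \<Phi> where "\<Phi> s = (\<lambda>(a :: nat set \<Rightarrow> 'r) I. prod (\<lambda>i. if i = n then s else 1) I * a I)" for s :: 'r
  have gh: "ghom m m (\<Phi> s)" for m s unfolding \<Phi>_def by (rule ghom_diag)
  have \<Phi>fix: "\<Phi> s (gbasis I) = gbasis I" if "n \<notin> I" for s I
  proof -
    have "(\<Prod>i\<in>I. if i = n then s else 1) = (\<Prod>i\<in>I. 1)" using that by (intro prod.cong) auto
    then show ?thesis by (auto simp: \<Phi>_def gbasis_def fun_eq_iff)
  qed
  have \<Phi>gn: "\<Phi> s gn = gsmul s gn" for s
    by (auto simp: \<Phi>_def gn_def gbasis_def gsmul_def fun_eq_iff)
  have \<Phi>gm: "\<Phi> s gm = gm" for s unfolding gm_def by (rule \<Phi>fix) simp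
  have \<Phi>E: "tmap \<sigma> (\<Phi> s) w = w" if "w \<in> ev (enat n)" for w s
    using that by (intro E.tmap_fix[where m = "enat n"] \<Phi>fix) (auto simp: ev_iff idx_enat)
  have c: "v \<in> coef (enat N2)" "\<theta> \<in> coef (enat N2)" "gn \<in> coef (enat N2)" "gm \<in> coef (enat N2)"
    "x \<in> coef (enat N2)" "tmul \<sigma> v \<theta> \<in> coef (enat N2)"
    using v2 \<theta> gn gm x2 \<U>_ev[of N2] vt by (auto simp: ev_iff grass0_iff grass1_iff)
  have \<Phi>y: "tmap \<sigma> (\<Phi> s) y = x + tmul \<sigma> (tmul \<sigma> v \<theta>) (rc s)" for s
  proof -
    have "\<Phi> s \<theta> = gsmul s \<theta>"
      unfolding \<theta>_def using c by (simp add: ghomD(4)[OF gh] \<Phi>gn \<Phi>gm gmul_gsmul_left)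
    moreover have "gsmul s \<theta> = gmul \<theta> (rc s)"
    proof
      fix K show "gsmul s \<theta> K = gmul \<theta> (rc s) K"
        using coef_infinite[OF c(2), of K] by (cases "finite K") (auto simp: gmul_rc_right gsmul_def)
    qed
    ultimately show ?thesis
      unfolding y_def E.tmap_add[OF c(5,6)] E.tmap_tmul[OF gh c(1,2)] \<Phi>E[OF xe] \<Phi>E[OF v]
      by (simp add: E.tmul_assoc)
  qed
  define w where "w = f N2 y"
  have w: "w \<in> coef (enat N2)" using fev[OF y] by (simp add: w_def ev_iff)
  have f\<Phi>: "f N2 (x + tmul \<sigma> (tmul \<sigma> v \<theta>) (rc s)) = (\<lambda>K. \<tau> (prod (\<lambda>i. if i = n then s else 1) K) (w K))" for s
    unfolding \<Phi>y[symmetric] nat[OF gh y] w_def[symmetric] unfolding \<Phi>_def by (rule F.tmap_diag[OF w])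
  have P: "prod (\<lambda>i. if i = n then s else 1) K = (if n \<in> K then s else 1)" if "finite K" for s and K :: "nat set"
    using that by (simp add: prod.delta)
  \<comment> \<open>Scaling by 0 returns \<open>y\<close> to \<open>x\<close> and, by naturality,
    removes from \<open>w\<close> the coefficients involving the generator \<open>n\<close>. The
    other coefficients of \<open>w\<close> are unaffected by the scaling, so \<open>f N2\<close> is
    affine in \<open>s\<close> along the line.\<close>
  have fx: "f N2 x = (\<lambda>K. if n \<in> K then 0 else w K)"
  proof
    fix K
    have "tmul \<sigma> (tmul \<sigma> v \<theta>) (rc 0) = 0" by simp
    then have "f N2 x K = \<tau> (prod (\<lambda>i. if i = n then 0 else 1) K) (w K)"
      using f\<Phi>[of 0] by (metis add.right_neutral)
    then show "f N2 x K = (if n \<in> K then 0 else w K)"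
      using P[of K 0] coef_infinite[OF w, of K] by (cases "finite K") auto
  qed
  have inc: "f N2 (x + tmul \<sigma> (tmul \<sigma> v \<theta>) (rc s)) - f N2 x = tsmul \<tau> (w - f N2 x) s" for s
  proof
    fix K show "(f N2 (x + tmul \<sigma> (tmul \<sigma> v \<theta>) (rc s)) - f N2 x) K = tsmul \<tau> (w - f N2 x) s K"
      unfolding f\<Phi> fx using P[of K s] coef_infinite[OF w, of K] by (cases "finite K") (auto simp: tsmul_def)
  qed
  have "h1 N2 (Tri (Base (Base x)) (Base (Base (tmul \<sigma> v \<theta>))) 0) = w - f N2 x"
    by (rule line_limit[OF r x2 vt refl, where B = "\<lambda>_. w - f N2 x"])
      (use inc in \<open>auto simp del: plus_fun_apply\<close>)
  then have fy: "f N2 y = f n x + tmul \<tau> d \<theta>"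
    using lin[OF x2 v2 \<theta>(1)] f2[OF x] by (simp add: dd w_def)
  \<comment> \<open>\<open>gsubst\<close> removes the largest generator, so \<open>Suc n\<close> is
    replaced by \<open>\<beta>\<close> before \<open>n\<close> is replaced by
    \<open>\<alpha>\<close>. As \<open>\<beta>\<close> comes from level \<open>n\<close>, the second
    substitution does not affect it.\<close>
  define \<Psi>1 where "\<Psi>1 = gsubst (Suc n) \<beta>"
  define \<Psi>2 where "\<Psi>2 = gsubst n \<alpha>"
  have \<beta>1: "\<beta> \<in> grass1 (enat (Suc n))" using \<beta> grass1_mono[OF le(1)] by auto
  have g1: "ghom (enat N2) (enat (Suc n)) \<Psi>1" unfolding \<Psi>1_def N2_def by (rule ghom_gsubst[OF half \<beta>1])
  have g2: "ghom (enat (Suc n)) (enat n) \<Psi>2" unfolding \<Psi>2_def by (rule ghom_gsubst[OF half \<alpha>])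
  have \<Psi>1fix: "\<Psi>1 a = a" if "a \<in> coef (enat (Suc n))" for a unfolding \<Psi>1_def using that by (rule gsubst_id)
  have \<Psi>2fix: "\<Psi>2 a = a" if "a \<in> coef (enat n)" for a unfolding \<Psi>2_def using that by (rule gsubst_id)
  have cs: "\<beta> \<in> coef (enat n)" "\<beta> \<in> coef (enat (Suc n))" "\<alpha> \<in> coef (enat n)" "gn \<in> coef (enat (Suc n))"
    using \<alpha> \<beta> \<beta>1 gn by (auto simp: grass1_iff)
  have \<Psi>1\<theta>: "\<Psi>1 \<theta> = gmul gn \<beta>"
    unfolding \<theta>_def ghomD(4)[OF g1 c(3,4)] \<Psi>1fix[OF cs(4)] by (simp add: \<Psi>1_def gm_def gsubst_gbasis[OF cs(1)])
  have gnb: "gmul gn \<beta> \<in> coef (enat (Suc n))" using cs by (intro coef_gmul)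
  have \<Psi>2\<theta>: "\<Psi>2 (gmul gn \<beta>) = gmul \<alpha> \<beta>"
    unfolding ghomD(4)[OF g2 cs(4,2)] \<Psi>2fix[OF cs(1)] by (simp add: \<Psi>2_def gn_def gsubst_gbasis[OF cs(3)])
  have gb: "(gbasis I :: nat set \<Rightarrow> 'r) \<in> coef (enat n)" "(gbasis I :: nat set \<Rightarrow> 'r) \<in> coef (enat (Suc n))"
    if "I \<in> idx (enat n)" for I
    using gbasis_coef[OF that, where ?'a = 'r] coef_mono[OF le(1)] by auto
  have fixE: "tmap \<sigma> \<Psi>1 a = a" "tmap \<sigma> \<Psi>2 a = a" if "a \<in> ev (enat n)" for a
    using that by (auto intro!: E.tmap_fix[where m = "enat n"] \<Psi>1fix \<Psi>2fix gb simp: ev_iff)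
  have fixF: "tmap \<tau> \<Psi>1 a = a" "tmap \<tau> \<Psi>2 a = a" if "a \<in> ev (enat n)" for a
    using that by (auto intro!: F.tmap_fix[where m = "enat n"] \<Psi>1fix \<Psi>2fix gb simp: ev_iff)
  have cE: "a \<in> coef (enat (Suc n))" if "a \<in> ev (enat n)" for a :: "nat set \<Rightarrow> 'e0 \<times> 'e1"
    using that coef_mono[OF le(1)] by (auto simp: ev_iff)
  have cE2: "a \<in> coef (enat N2)" if "a \<in> ev (enat n)" for a :: "nat set \<Rightarrow> 'e0 \<times> 'e1"
    using that coef_mono[OF le(2)] by (auto simp: ev_iff)
  have cF: "a \<in> coef (enat (Suc n))" if "a \<in> ev (enat n)" for a :: "nat set \<Rightarrow> 'f0 \<times> 'f1"
    using that coef_mono[OF le(1)] by (auto simp: ev_iff)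
  have cF2: "a \<in> coef (enat N2)" if "a \<in> ev (enat n)" for a :: "nat set \<Rightarrow> 'f0 \<times> 'f1"
    using that coef_mono[OF le(2)] by (auto simp: ev_iff)
  have mapE: "tmap \<sigma> \<Psi>2 (tmap \<sigma> \<Psi>1 y) = x + tmul \<sigma> v (gmul \<alpha> \<beta>)"
  proof -
    have "tmap \<sigma> \<Psi>1 y = x + tmul \<sigma> v (gmul gn \<beta>)"
      unfolding y_def E.tmap_add[OF c(5,6)] E.tmap_tmul[OF g1 c(1,2)] fixE(1)[OF xe] fixE(1)[OF v] \<Psi>1\<theta> ..
    moreover have "tmap \<sigma> \<Psi>2 (x + tmul \<sigma> v (gmul gn \<beta>)) = x + tmul \<sigma> v (gmul \<alpha> \<beta>)"
      unfolding E.tmap_add[OF cE[OF xe] E.coef_tmul[OF cE[OF v] gnb]] E.tmap_tmul[OF g2 cE[OF v] gnb]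
        fixE(2)[OF xe] fixE(2)[OF v] \<Psi>2\<theta> ..
    ultimately show ?thesis by simp
  qed
  have mapF: "tmap \<tau> \<Psi>2 (tmap \<tau> \<Psi>1 (f N2 y)) = f n x + tmul \<tau> d (gmul \<alpha> \<beta>)"
  proof -
    note fxe = fev[OF x]
    have "tmap \<tau> \<Psi>1 (f N2 y) = f n x + tmul \<tau> d (gmul gn \<beta>)"
      unfolding fy F.tmap_add[OF cF2[OF fxe] F.coef_tmul[OF cF2[OF d] c(2)]] F.tmap_tmul[OF g1 cF2[OF d] c(2)]
        fixF(1)[OF fxe] fixF(1)[OF d] \<Psi>1\<theta> ..
    moreover have "tmap \<tau> \<Psi>2 (f n x + tmul \<tau> d (gmul gn \<beta>)) = f n x + tmul \<tau> d (gmul \<alpha> \<beta>)"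
      unfolding F.tmap_add[OF cF[OF fxe] F.coef_tmul[OF cF[OF d] gnb]] F.tmap_tmul[OF g2 cF[OF d] gnb]
        fixF(2)[OF fxe] fixF(2)[OF d] \<Psi>2\<theta> ..
    ultimately show ?thesis by simp
  qed
  have "tmap \<sigma> \<Psi>1 y \<in> \<U> (Suc n)" by (rule \<U>_functor[OF g1 y])
  from nat[OF g2 this] nat[OF g1 y] mapE mapF show ?thesis by (simp add: d_def)
qed

text \<open>\<open>natural_nilpotent\<close> turns naturality and linearity of the derivative into
  the invariant \<open>ksm\<close> on level 0; the tower then supplies quotients of all
  orders.\<close>

theorem smooth_imp_MS_smooth:
  assumes nat: "\<And>m n \<phi> x. ghom (enat m) (enat n) \<phi> \<Longrightarrow> x \<in> \<U> m \<Longrightarrow> f n (tmap \<sigma> \<phi> x) = tmap \<tau> \<phi> (f m x)"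
    and sm: "\<And>n. BGN_smooth (Emod_R s0 s1 (enat n)) (\<U> n) (Fcod_R t0 t1 (enat n)) (f n)"
    and lin: "\<And>n x v c. x \<in> \<U> n \<Longrightarrow> v \<in> ev (enat n) \<Longrightarrow> c \<in> grass0 (enat n) \<Longrightarrow>
      dR (enat n) (f n) x (tmul \<sigma> v c) = tmul \<tau> (dR (enat n) (f n) x v) c"
  shows "\<exists>g. MS_smooth Lam s0 s1 t0 t1 \<U> g \<and> (\<forall>n. \<forall>x\<in>\<U> n. g (enat n) (Base x) = f n x)"
proof -
  define h where "h n p = f n (unBase p)" for n and p :: "(nat set \<Rightarrow> 'e0 \<times> 'e1, nat set \<Rightarrow> 'r) tw"
  define g where "g ob = (case ob of enat n \<Rightarrow> h n | \<infinity> \<Rightarrow> undefined)" for ob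
  have "\<exists>h1. T.rs n 0 (h n) h1" for n
    unfolding h_def[abs_def] by (rule T.sm_rs[OF smooth_lift[OF sm]])
  then obtain h1 where r: "\<And>n. T.rs n 0 (h n) (h1 n)" by metis
  have r': "\<And>n. T.rs n 0 (\<lambda>p. f n (unBase p)) (h1 n)" using r unfolding h_def[abs_def] .
  have lin': "h1 n (Tri (Base (Base x)) (Base (Base (tmul \<sigma> v c))) 0) = tmul \<tau> (h1 n (Tri (Base (Base x)) (Base (Base v)) 0)) c"
    if "x \<in> \<U> n" "v \<in> ev (enat n)" "c \<in> grass0 (enat n)" for n x v c
    using lin[OF that] derivative_lift[OF r' that(1,2)] derivative_lift[OF r' that(1) tmul_evE[OF that(2,3)]] by simp
  have ks: "T.ksm n 0 (h n) (h1 n)" for n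
    unfolding T.ksm_def
  proof (intro conjI ballI r)
    fix p q and \<alpha> \<beta> :: "nat set \<Rightarrow> 'r" assume "p \<in> T.D n 0" "q \<in> T.C n 0" "\<alpha> \<in> grass1 (enat n)" "\<beta> \<in> grass1 (enat n)"
    then show "h n (tw_plus (N (enat n)) p (tw_times (N (enat n)) q (gmul \<alpha> \<beta>)))
      = h n p + tmul \<tau> (h1 n (Tri (Base p) (Base q) 0)) (gmul \<alpha> \<beta>)"
      using natural_nilpotent[of f h1, OF nat r' lin'] by (auto simp: h_def)
  qed
  have "MS_Ck Lam s0 s1 t0 t1 \<U> k 0 g" for k
  proof (rule MS_tower)
    show "\<exists>h1. T.ksm n 0 (h n) h1" for n using ks by blast
    show "h n (twm \<phi> p) = tmap \<tau> \<phi> (h m p)" if "ghom (enat m) (enat n) \<phi>" "p \<in> T.D m 0" for m n \<phi> p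
      using that nat by (auto simp: h_def)
  qed (simp add: g_def)
  then have "MS_smooth Lam s0 s1 t0 t1 \<U> g" by (simp add: MS_smooth_def)
  then show ?thesis by (intro exI[of _ g]) (simp add: g_def h_def)
qed

section \<open>From smoothness over the Grassmann algebra to smoothness over R\<close>

lemma Fcod_L_simps [simp]:
  "ytop (Fcod_L t0 t1 m) = ev_top m" "ydiff (Fcod_L t0 t1 m) = tdiff" "yscal (Fcod_L t0 t1 m) = tmul \<tau>"
  by (simp_all add: Fcod_L_def)

text \<open>At one object the natural quotients are quotients over its even part, since the domains
  agree by \<open>MS_dom_eq\<close>.\<close>

lemma MS_imp_BGN_L:
  "MS_Ck Obj s0 s1 t0 t1 \<U> k j g \<Longrightarrow> ob \<in> Obj \<Longrightarrow> BGN_Ck (N ob) (V ob) (Fcod_L t0 t1 ob) k j (g ob)"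
proof (induction k arbitrary: j g)
  case 0
  then show ?case by (simp add: MS_natural_def MS_dom_eq)
next
  case (Suc k)
  then obtain g1 where g1: "MS_natural Obj s0 s1 t0 t1 \<U> j g" "MS_Ck Obj s0 s1 t0 t1 \<U> k (Suc j) g1"
    "\<And>a b t. Tri a b t \<in> MS_dom s0 s1 \<U> ob (Suc j) \<Longrightarrow>
       tdiff (g ob (tw_plus (N ob) a (tw_times (N ob) b t))) (g ob a) = tmul \<tau> (g1 ob (Tri a b t)) t"
    unfolding MS_Ck.simps by blast
  have "continuous_map (subtopology (tw_top (N ob) j) (tw_dom (N ob) (V ob) j)) (ev_top ob) (g ob)"
    using g1(1) Suc.prems(2) by (simp add: MS_natural_def MS_dom_eq)
  then show ?case
    using Suc.IH[OF g1(2) Suc.prems(2)] g1(3)[unfolded MS_dom_eq]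
    unfolding BGN_Ck.simps Fcod_L_simps by blast
qed

lemma N_topspace: "topspace (mtop (N m)) = mcar (N m)" "topspace (stop (N m)) = scar (N m)"
  "topspace (mtop (Emod_R s0 s1 m)) = mcar (Emod_R s0 s1 m)" "topspace (stop (Emod_R s0 s1 m)) = scar (Emod_R s0 s1 m)"
  by simp_all

text \<open>Restriction of scalars along \<open>rc\<close>, as an instance of
  \<open>BGN_transport\<close>.\<close>

lemma BGN_L_imp_R:
  assumes g: "BGN_Ck (N ob) (V ob) (Fcod_L t0 t1 ob) k 0 g" and f: "\<And>x. x \<in> V ob \<Longrightarrow> g (Base x) = f x"
  shows "BGN_Ck (Emod_R s0 s1 ob) (V ob) (Fcod_R t0 t1 ob) k 0 (base_fun f)"
proof (rule BGN_cong)
  define L where "L q = (Base (unBase q) :: (nat set \<Rightarrow> 'e0 \<times> 'e1, nat set \<Rightarrow> 'r) tw)"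
    for q :: "(nat set \<Rightarrow> 'e0 \<times> 'e1, 'r) tw"
  have "continuous_map (tw_top (Emod_R s0 s1 ob) 0) (tw_top (N ob) 0) L"
    using continuous_map_compose[OF continuous_map_unBase[of "Emod_R s0 s1 ob"], of "tw_top (N ob) 0" Base]
      continuous_map_Base[of "N ob"] by (simp add: L_def[abs_def] comp_def)
  then have aff: "affine_map (Emod_R s0 s1 ob) 0 (N ob) 0 rc L L"
    unfolding affine_map_def by (auto simp: L_def tsmul_tmul_rc simp del: tw_top.simps)
  show "BGN_Ck (Emod_R s0 s1 ob) (V ob) (Fcod_R t0 t1 ob) k 0 (\<lambda>q. g (L q))"
  proof (rule BGN_transport[where P = "\<lambda>y. y", OF N_topspace _ _ _ _ _ _ _ aff _ g])
    show "yscal (Fcod_L t0 t1 ob) y (rc t) = yscal (Fcod_R t0 t1 ob) y t"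
      if "y \<in> topspace (ytop (Fcod_L t0 t1 ob))" for y t
      using that F.tmul_rc_coef[of y ob t] by (simp add: ev_iff)
  qed (use V_ev in \<open>auto simp: L_def continuous_map_rc rc_add rc_mult\<close>)
  show "g (L p) = base_fun f p" if "p \<in> tw_dom (Emod_R s0 s1 ob) (V ob) 0" for p
    using that f by (auto simp: L_def)
qed

lemma common_level:
  assumes "x \<in> ev m" "v \<in> ev m" "w \<in> ev m" "c \<in> grass0 m"
  obtains k where "x \<in> ev (enat k)" "v \<in> ev (enat k)" "w \<in> ev (enat k)" "c \<in> grass0 (enat k)" "enat k \<le> m"
proof (cases m)
  case (enat k) then show ?thesis using assms that by auto
next
  case infinity
  then obtain i j l o' where ijl: "x \<in> ev (enat i)" "v \<in> ev (enat j)" "w \<in> ev (enat l)" "c \<in> grass0 (enat o')"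
    using assms ev_infinity grass0_infinity by metis
  let ?k = "i + j + l + o'"
  show ?thesis
  proof (rule that)
    show "x \<in> ev (enat ?k)" using ijl(1) ev_mono[of "enat i" "enat ?k"] by auto
    show "v \<in> ev (enat ?k)" using ijl(2) ev_mono[of "enat j" "enat ?k"] by auto
    show "w \<in> ev (enat ?k)" using ijl(3) ev_mono[of "enat l" "enat ?k"] by auto
    show "c \<in> grass0 (enat ?k)" using ijl(4) grass0_mono[of "enat o'" "enat ?k"] by auto
  qed (simp add: infinity)
qed

lemma continuous_map_level_ev:
  assumes "enat k \<le> m" "\<And>s. s \<in> topspace Z \<Longrightarrow> x s \<in> ev (enat k)" "\<And>K. continuous_map Z euclidean (\<lambda>s. x s K)"
  shows "continuous_map Z (ev_top m) x"
proof -
  have "continuous_map Z (ev_top (enat k)) x" using assms by (simp add: continuous_map_into_ev)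
  from continuous_map_compose[OF this continuous_map_ev_incl[OF assms(1)]] show ?thesis by (simp add: comp_def)
qed

lemma continuous_map_level_grass0:
  assumes "enat k \<le> m" "\<And>s. s \<in> topspace Z \<Longrightarrow> x s \<in> grass0 (enat k)" "\<And>K. continuous_map Z euclidean (\<lambda>s. x s K)"
  shows "continuous_map Z (grass0_top m) x"
proof -
  have "continuous_map Z (grass0_top (enat k)) x" using assms by (simp add: continuous_map_into_grass0)
  from continuous_map_compose[OF this continuous_map_grass0_incl[OF assms(1)]] show ?thesis by (simp add: comp_def)
qed

lemma quotient_path:
  assumes A: "continuous_map (subtopology (tw_top (N m) 1) (tw_dom (N m) (V m) 1)) (ev_top m) A"
    and "continuous_map (subtopology euclidean S) (ev_top m) x" "continuous_map (subtopology euclidean S) (ev_top m) v"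
      "continuous_map (subtopology euclidean S) (grass0_top m) c"
    and "\<And>s. s \<in> S \<Longrightarrow> x s \<in> V m" "\<And>s. s \<in> S \<Longrightarrow> x s + tmul \<sigma> (v s) (c s) \<in> V m"
  shows "continuous_map (subtopology euclidean S) euclidean (\<lambda>s. A (Tri (Base (x s)) (Base (v s)) (c s)) K)"
proof (rule continuous_map_path_coordinate[OF A, where \<gamma> = "\<lambda>s. Tri (Base (x s)) (Base (v s)) (c s)"])
  show "continuous_map (subtopology euclidean S) (tw_top (N m) 1) (\<lambda>s. Tri (Base (x s)) (Base (v s)) (c s))"
    using assms by (intro continuous_map_Tri_Base) auto
  have "v s \<in> ev m" "c s \<in> grass0 m" if "s \<in> S" for s
    using assms(3,4)[THEN continuous_map_image_subset_topspace] that by auto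
  then show "Tri (Base (x s)) (Base (v s)) (c s) \<in> tw_dom (N m) (V m) 1" if "s \<in> S" for s
    using assms(5,6) that by simp
qed

lemma line_cont:
  assumes "x \<in> ev (enat k)" "v \<in> ev (enat k)" "enat k \<le> m"
  shows "continuous_map (subtopology euclidean S) (ev_top m) (\<lambda>s. x + tmul \<sigma> v (rc s))"
proof (rule continuous_map_level_ev[OF assms(3)])
  show "x + tmul \<sigma> v (rc s) \<in> ev (enat k)" for s by (intro ev_add tmul_evE assms rc_grass0)
  show "continuous_map (subtopology euclidean S) euclidean (\<lambda>s. (x + tmul \<sigma> v (rc s)) K)" for K
    unfolding plus_fun_apply
    by (intro continuous_map_plus continuous_map_tmul_coordinate[OF E] continuous_map_rc_coordinate) auto
qed

text \<open>Both laws come from describing one increment of \<open>f\<close> in two ways, dividing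
  by a unit \<open>s\<close> and passing to \<open>s = 0\<close>. The points involved are first
  placed on a common finite level, where the paths are continuous coordinatewise.\<close>

lemma MS_quotient_linear:
  assumes A: "continuous_map (subtopology (tw_top (N m) 1) (tw_dom (N m) (V m) 1)) (ev_top m) A"
    and eq: "\<And>x v c. x \<in> V m \<Longrightarrow> v \<in> ev m \<Longrightarrow> c \<in> grass0 m \<Longrightarrow> x + tmul \<sigma> v c \<in> V m \<Longrightarrow>
      f (x + tmul \<sigma> v c) - f x = tmul \<tau> (A (Tri (Base x) (Base v) c)) c"
    and x: "x \<in> V m" and v: "v \<in> ev m" and w: "w \<in> ev m" and c: "c \<in> grass0 m"
  shows "A (Tri (Base x) (Base (tmul \<sigma> v c)) 0) = tmul \<tau> (A (Tri (Base x) (Base v) 0)) c" (is ?hom)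
    and "A (Tri (Base x) (Base (v + w)) 0) = A (Tri (Base x) (Base v) 0) + A (Tri (Base x) (Base w) 0)" (is ?add)
proof -
  have xe: "x \<in> ev m" using x V_ev by auto
  from xe v w c obtain k where k: "x \<in> ev (enat k)" "v \<in> ev (enat k)" "w \<in> ev (enat k)" "c \<in> grass0 (enat k)"
    and km: "enat k \<le> m" by (rule common_level)
  have Aev: "A (Tri (Base x) (Base v) c) \<in> ev m"
    if "x \<in> V m" "v \<in> ev m" "c \<in> grass0 m" "x + tmul \<sigma> v c \<in> V m" for x v c
  proof -
    have d: "Tri (Base x) (Base v) c \<in> tw_dom (N m) (V m) 1" using that by simp
    moreover have "tw_dom (N m) (V m) 1 \<subseteq> topspace (tw_top (N m) 1)"
      using VD_car topspace_tw_top[OF N_topspace(1,2)] by blast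
    ultimately have "Tri (Base x) (Base v) c \<in> topspace (subtopology (tw_top (N m) 1) (tw_dom (N m) (V m) 1))"
      by (simp only: topspace_subtopology) blast
    then show ?thesis using continuous_map_image_subset_topspace[OF A] by auto
  qed
  have scal: "tmul \<tau> y (rc s) = tsmul \<tau> y s" if "y \<in> ev m" for y s
    using that F.tmul_rc_coef[of y m s] by (simp add: ev_iff)
  have op: "open {s. x + tmul \<sigma> u (rc s) \<in> V m}" if "u \<in> ev (enat k)" for u
    using open_path_preimage[OF line_cont[OF k(1) that km, of UNIV, simplified] V_open] .
  have const: "continuous_map (subtopology euclidean S) (ev_top m) (\<lambda>_. u)" if "u \<in> ev (enat k)" for u and S :: "'r set"
    using that ev_mono[OF km] by auto
  have mem: "u \<in> ev m" if "u \<in> ev (enat k)" for u :: "nat set \<Rightarrow> 'e0 \<times> 'e1" using that ev_mono[OF km] by auto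
  have rcont: "continuous_map (subtopology euclidean S) (grass0_top m) (rc :: 'r \<Rightarrow> _)" for S
    by (intro continuous_map_from_subtopology continuous_map_rc)
  have z: "tmul \<sigma> u (rc 0) = 0" for u by simp
  show ?hom
  proof
    fix K
    let ?S = "{s. x + tmul \<sigma> (tmul \<sigma> v c) (rc s) \<in> V m}"
    have vc: "tmul \<sigma> v c \<in> ev (enat k)" using k by (intro tmul_evE)
    have cs: "gmul c (rc s) \<in> grass0 (enat k)" for s using k by (intro grass0_gmul rc_grass0)
    have cs': "gmul c (rc s) \<in> grass0 m" for s using cs grass0_mono[OF km] by auto
    \<comment> \<open>The increment is read as direction \<open>v c\<close> with scalar
      \<open>s\<close>, and as direction \<open>v\<close> with scalar \<open>c s\<close>. The second
      reading is available because the quotient accepts scalars outside R.\<close>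
    have "A (Tri (Base x) (Base (tmul \<sigma> v c)) (rc 0)) K = tmul \<tau> (A (Tri (Base x) (Base v) (gmul c (rc 0)))) c K"
    proof (rule unit_limit_unique[OF units, where S = ?S and c = 0 and A = "\<lambda>s. A (Tri (Base x) (Base (tmul \<sigma> v c)) (rc s)) K"
          and B = "\<lambda>s. tmul \<tau> (A (Tri (Base x) (Base v) (gmul c (rc s)))) c K"])
      show "open ?S" by (rule op[OF vc])
      show "0 \<in> ?S" using x by simp
      show "continuous_map (subtopology euclidean ?S) euclidean (\<lambda>s. A (Tri (Base x) (Base (tmul \<sigma> v c)) (rc s)) K)"
        using x by (intro quotient_path[OF A] const k vc rcont) (auto simp del: plus_fun_apply)
      have cc: "continuous_map (subtopology euclidean ?S) (grass0_top m) (\<lambda>s. gmul c (rc s))"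
        by (intro continuous_map_level_grass0[OF km] cs continuous_map_gmul_coordinate continuous_map_rc_coordinate) auto
      show "continuous_map (subtopology euclidean ?S) euclidean (\<lambda>s. tmul \<tau> (A (Tri (Base x) (Base v) (gmul c (rc s)))) c K)"
        using x by (intro continuous_map_tmul_coordinate[OF F] quotient_path[OF A] const k cc)
            (auto simp: E.tmul_assoc simp del: plus_fun_apply)
    next
      fix s u assume s: "s \<in> ?S" and su: "s * u = 1"
      have "tsmul \<tau> (A (Tri (Base x) (Base (tmul \<sigma> v c)) (rc s))) s = f (x + tmul \<sigma> (tmul \<sigma> v c) (rc s)) - f x"
        using eq[OF x mem[OF vc] rc_grass0, of s] scal[OF Aev[OF x mem[OF vc] rc_grass0, of s]] s by simp
      also have "\<dots> = tmul \<tau> (A (Tri (Base x) (Base v) (gmul c (rc s)))) (gmul c (rc s))"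
        using eq[OF x v cs', of s] s by (simp add: E.tmul_assoc)
      also have "\<dots> = tsmul \<tau> (tmul \<tau> (A (Tri (Base x) (Base v) (gmul c (rc s)))) c) s"
        using scal[of "tmul \<tau> (A (Tri (Base x) (Base v) (gmul c (rc s)))) c" s] Aev[OF x v cs', of s] s c
        by (simp add: E.tmul_assoc F.tmul_assoc tmul_ev)
      finally show "A (Tri (Base x) (Base (tmul \<sigma> v c)) (rc s)) K = tmul \<tau> (A (Tri (Base x) (Base v) (gmul c (rc s)))) c K"
        by (rule fun_cong[OF tsmul_cancel_fun[OF _ su]])
    qed
    then show "A (Tri (Base x) (Base (tmul \<sigma> v c)) 0) K = tmul \<tau> (A (Tri (Base x) (Base v) 0)) c K" by simp
  qed
  show ?add
  proof
    fix K
    let ?S = "{s. x + tmul \<sigma> v (rc s) \<in> V m} \<inter> {s. x + tmul \<sigma> (v + w) (rc s) \<in> V m}"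
    have vw: "v + w \<in> ev (enat k)" using k by (intro ev_add)
    have split: "x + tmul \<sigma> (v + w) (rc s) = (x + tmul \<sigma> v (rc s)) + tmul \<sigma> w (rc s)" for s
      by (simp add: E.tmul_add_left add.assoc)
    \<comment> \<open>A step along \<open>v + w\<close> is a step along \<open>v\<close> followed by
      one along \<open>w\<close> from the shifted base point, which returns to \<open>x\<close> at
      \<open>s = 0\<close>.\<close>
    have "A (Tri (Base x) (Base (v + w)) (rc 0)) K
      = (A (Tri (Base x) (Base v) (rc 0)) + A (Tri (Base (x + tmul \<sigma> v (rc 0))) (Base w) (rc 0))) K"
    proof (rule unit_limit_unique[OF units, where S = ?S and c = 0 and A = "\<lambda>s. A (Tri (Base x) (Base (v + w)) (rc s)) K"
          and B = "\<lambda>s. (A (Tri (Base x) (Base v) (rc s)) + A (Tri (Base (x + tmul \<sigma> v (rc s))) (Base w) (rc s))) K"])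
      show "open ?S" by (intro open_Int op k vw)
      show "0 \<in> ?S" using x by simp
      show "continuous_map (subtopology euclidean ?S) euclidean (\<lambda>s. A (Tri (Base x) (Base (v + w)) (rc s)) K)"
        using x by (intro quotient_path[OF A] const k vw rcont) (auto simp del: plus_fun_apply)
      have "continuous_map (subtopology euclidean ?S) euclidean
          (\<lambda>s. A (Tri (Base x) (Base v) (rc s)) K + A (Tri (Base (x + tmul \<sigma> v (rc s))) (Base w) (rc s)) K)"
        using x by (intro continuous_map_plus quotient_path[OF A] const k rcont line_cont[OF k(1,2) km])
            (auto simp: split simp del: plus_fun_apply)
      then show "continuous_map (subtopology euclidean ?S) euclidean
          (\<lambda>s. (A (Tri (Base x) (Base v) (rc s)) + A (Tri (Base (x + tmul \<sigma> v (rc s))) (Base w) (rc s))) K)"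
        by (simp only: plus_fun_apply)
    next
      fix s u assume s: "s \<in> ?S" and su: "s * u = 1"
      then have d: "x + tmul \<sigma> v (rc s) \<in> V m" "x + tmul \<sigma> (v + w) (rc s) \<in> V m"
        "(x + tmul \<sigma> v (rc s)) + tmul \<sigma> w (rc s) \<in> V m" by (auto simp: split)
      have "tsmul \<tau> (A (Tri (Base x) (Base (v + w)) (rc s))) s = f (x + tmul \<sigma> (v + w) (rc s)) - f x"
        using eq[OF x mem[OF vw] rc_grass0 d(2)] scal[OF Aev[OF x mem[OF vw] rc_grass0 d(2)]] by simp
      also have "\<dots> = (f (x + tmul \<sigma> v (rc s)) - f x)
          + (f ((x + tmul \<sigma> v (rc s)) + tmul \<sigma> w (rc s)) - f (x + tmul \<sigma> v (rc s)))"
        by (simp add: split)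
      also have "\<dots> = tsmul \<tau> (A (Tri (Base x) (Base v) (rc s)) + A (Tri (Base (x + tmul \<sigma> v (rc s))) (Base w) (rc s))) s"
        unfolding tsmul_add eq[OF x v rc_grass0 d(1)] eq[OF d(1) w rc_grass0 d(3)]
          scal[OF Aev[OF x v rc_grass0 d(1)]] scal[OF Aev[OF d(1) w rc_grass0 d(3)]] ..
      finally show "A (Tri (Base x) (Base (v + w)) (rc s)) K
        = (A (Tri (Base x) (Base v) (rc s)) + A (Tri (Base (x + tmul \<sigma> v (rc s))) (Base w) (rc s))) K"
        by (rule fun_cong[OF tsmul_cancel_fun[OF _ su]])
    qed
    then show "A (Tri (Base x) (Base (v + w)) 0) K = (A (Tri (Base x) (Base v) 0) + A (Tri (Base x) (Base w) 0)) K"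
      by simp
  qed
qed

text \<open>The quotient \<open>A\<close> over the even part serves twice for the derivative:
  restricted along \<open>rc\<close> it is a continuous quotient over R, and so its values at scalar
  0 are the derivative, where \<open>MS_quotient_linear\<close> applies.\<close>

theorem MS_smooth_imp_smooth:
  assumes g: "MS_smooth Obj s0 s1 t0 t1 \<U> g" and ob: "ob \<in> Obj" and f: "\<And>x. x \<in> V ob \<Longrightarrow> g ob (Base x) = f x"
  shows "BGN_smooth (Emod_R s0 s1 ob) (V ob) (Fcod_R t0 t1 ob) f"
    and "continuous_map (subtopology (ev_top ob) (V ob)) (ev_top ob) f"
    and "x \<in> V ob \<Longrightarrow> v \<in> ev ob \<Longrightarrow> w \<in> ev ob \<Longrightarrow> dR ob f x (v + w) = dR ob f x v + dR ob f x w"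
    and "x \<in> V ob \<Longrightarrow> v \<in> ev ob \<Longrightarrow> c \<in> grass0 ob \<Longrightarrow> dR ob f x (tmul \<sigma> v c) = tmul \<tau> (dR ob f x v) c"
proof -
  have L: "BGN_Ck (N ob) (V ob) (Fcod_L t0 t1 ob) k 0 (g ob)" for k
    using g ob by (intro MS_imp_BGN_L) (auto simp: MS_smooth_def)
  show sm: "BGN_smooth (Emod_R s0 s1 ob) (V ob) (Fcod_R t0 t1 ob) f"
    unfolding BGN_smooth_def using BGN_L_imp_R[OF L f] by blast
  show "continuous_map (subtopology (ev_top ob) (V ob)) (ev_top ob) f"
    using BGN_smooth_continuous[OF sm] by simp
  obtain A where A: "BGN_Ck (N ob) (V ob) (Fcod_L t0 t1 ob) 0 1 A"
    and Aeq: "\<And>a b t. Tri a b t \<in> tw_dom (N ob) (V ob) 1 \<Longrightarrow>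
      g ob (tw_plus (N ob) a (tw_times (N ob) b t)) - g ob a = tmul \<tau> (A (Tri a b t)) t"
    using L[of "Suc 0"] unfolding BGN_Ck.simps(2) One_nat_def Fcod_L_simps tdiff_eq by blast
  have Ac: "continuous_map (subtopology (tw_top (N ob) 1) (tw_dom (N ob) (V ob) 1)) (ev_top ob) A"
    using A by simp
  have eq: "f (x + tmul \<sigma> v c) - f x = tmul \<tau> (A (Tri (Base x) (Base v) c)) c"
    if "x \<in> V ob" "v \<in> ev ob" "c \<in> grass0 ob" "x + tmul \<sigma> v c \<in> V ob" for x v c
    using Aeq[of "Base x" "Base v" c] that by (simp add: f)
  \<comment> \<open>The restriction of \<open>A\<close> to scalars from R; by
    \<open>BGN_deriv_eq\<close> it computes \<open>dR\<close>.\<close>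
  define A' where "A' q = A (Tri (Base (unBase (tw1 q))) (Base (unBase (tw2 q))) (rc (tw3 q)))"
    for q :: "(nat set \<Rightarrow> 'e0 \<times> 'e1, 'r) tw"
  have A'c: "continuous_map (subtopology (tw_top (Emod_R s0 s1 ob) 1) (tw_dom (Emod_R s0 s1 ob) (V ob) 1)) (ev_top ob) A'"
  proof -
    let ?E = "Emod_R s0 s1 ob"
    let ?g = "\<lambda>q. Tri (Base (unBase (tw1 q))) (Base (unBase (tw2 q))) (rc (tw3 q))"
    have c: "continuous_map (tw_top ?E 1) (tw_top (N ob) 1) ?g"
      using continuous_map_compose[OF continuous_map_tw1 continuous_map_unBase[of ?E]]
        continuous_map_compose[OF continuous_map_tw2 continuous_map_unBase[of ?E]]
        continuous_map_compose[OF continuous_map_tw3[of ?E 0], of "grass0_top ob" rc] continuous_map_rc[of ob]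
      by (intro continuous_map_Tri_Base) (simp_all only: One_nat_def Emod_R_simps Emod_L_simps comp_def)
    have "?g q \<in> tw_dom (N ob) (V ob) 1" if "q \<in> tw_dom ?E (V ob) 1" for q
      using that by (elim tw_dom_1_cases) (simp add: tsmul_tmul_rc)
    with c have "continuous_map (subtopology (tw_top ?E 1) (tw_dom ?E (V ob) 1))
      (subtopology (tw_top (N ob) 1) (tw_dom (N ob) (V ob) 1)) ?g"
      unfolding continuous_map_in_subtopology
      by (intro conjI continuous_map_from_subtopology) (auto simp only: topspace_subtopology)
    from continuous_map_compose[OF this Ac] show ?thesis by (simp add: A'_def[abs_def] comp_def)
  qed
  have dA: "dR ob f x v = A (Tri (Base x) (Base v) 0)" if x: "x \<in> V ob" and v: "v \<in> ev ob" for x v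
  proof -
    have "dR ob f x v = A' (Tri (Base x) (Base v) 0)"
    proof (rule BGN_deriv_eq[OF path_module_R _ A'c])
      show "openin (mtop (Emod_R s0 s1 ob)) (V ob)" using V_open by simp
      show "f (madd (Emod_R s0 s1 ob) y (mscal (Emod_R s0 s1 ob) u t)) - f y = tsmul \<tau> (A' (Tri (Base y) (Base u) t)) t"
        if "y \<in> V ob" "u \<in> mcar (Emod_R s0 s1 ob)" "madd (Emod_R s0 s1 ob) y (mscal (Emod_R s0 s1 ob) u t) \<in> V ob"
        for y u t
      proof -
        have d: "y + tmul \<sigma> u (rc t) \<in> V ob" using that by (simp add: tsmul_tmul_rc[of u ob])
        have "Tri (Base y) (Base u) (rc t) \<in> topspace (subtopology (tw_top (N ob) 1) (tw_dom (N ob) (V ob) 1))"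
        proof -
          have "Tri (Base y) (Base u) (rc t) \<in> tw_dom (N ob) (V ob) 1" using that d by simp
          moreover have "tw_dom (N ob) (V ob) 1 \<subseteq> topspace (tw_top (N ob) 1)"
            using VD_car topspace_tw_top[OF N_topspace(1,2)] by blast
          ultimately show ?thesis by (simp only: topspace_subtopology) blast
        qed
        then have "A (Tri (Base y) (Base u) (rc t)) \<in> ev ob"
          using continuous_map_image_subset_topspace[OF Ac] by auto
        then show ?thesis
          using eq[OF that(1) _ rc_grass0 d] that F.tmul_rc_coef[of "A (Tri (Base y) (Base u) (rc t))" ob t]
          by (simp add: A'_def tsmul_tmul_rc[of u ob] ev_iff)
      qed
      have "tsmul \<sigma> v 0 = 0" by (simp add: fun_eq_iff tsmul_def)
      then show "madd (Emod_R s0 s1 ob) x (mscal (Emod_R s0 s1 ob) v 0) \<in> V ob" using x by simp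
    qed (use x v in auto)
    then show ?thesis by (simp add: A'_def)
  qed
  show "dR ob f x (v + w) = dR ob f x v + dR ob f x w" if "x \<in> V ob" "v \<in> ev ob" "w \<in> ev ob"
    unfolding dA[OF that(1) ev_add[OF that(2,3)]] dA[OF that(1,2)] dA[OF that(1,3)]
    by (rule MS_quotient_linear(2)[where f = f, OF Ac _ that grass0_zero]) (rule eq)
  show "dR ob f x (tmul \<sigma> v c) = tmul \<tau> (dR ob f x v) c" if "x \<in> V ob" "v \<in> ev ob" "c \<in> grass0 ob"
    unfolding dA[OF that(1) tmul_evE[OF that(2,3)]] dA[OF that(1,2)]
    by (rule MS_quotient_linear(1)[where f = f, OF Ac _ that(1,2) ev_zero that(3)]) (rule eq)
qed

section \<open>Restriction from infinity to a finite level\<close>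

definition trunc :: "nat \<Rightarrow> (nat set \<Rightarrow> 'f0 \<times> 'f1) \<Rightarrow> nat set \<Rightarrow> 'f0 \<times> 'f1" where
  "trunc n y K = (if K \<subseteq> {..<n} then y K else 0)"

lemma trunc_id: "y \<in> ev (enat n) \<Longrightarrow> trunc n y = y"
  by (auto simp: ev_iff coef_enat trunc_def fun_eq_iff)

lemma trunc_ev: "y \<in> ev m \<Longrightarrow> trunc n y \<in> ev (enat n)"
  by (auto simp: ev_iff coef_enat trunc_def)

lemma trunc_cont: "continuous_map (ev_top m) (ev_top (enat n)) (trunc n)"
proof -
  have "continuous_map (ev_top m) euclidean (\<lambda>y. trunc n y K)" for K
    using continuous_map_ev_coordinate[of m K] by (cases "K \<subseteq> {..<n}") (auto simp: trunc_def)
  then show ?thesis using trunc_ev by (auto simp: continuous_map_into_ev)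
qed

text \<open>\<open>trunc n\<close> is induced by the morphism killing the generators from
  \<open>n\<close> on, and \<open>c\<close> involves none of these. Thus a discarded monomial of the
  product can only come from a discarded monomial of \<open>y\<close>.\<close>

lemma trunc_tmul:
  assumes c: "c \<in> grass0 (enat n)"
  shows "trunc n (tmul \<tau> y c) = tmul \<tau> (trunc n y) c"
proof
  fix K
  show "trunc n (tmul \<tau> y c) K = tmul \<tau> (trunc n y) c K"
  proof (cases "K \<subseteq> {..<n}")
    case True
    then have "trunc n y I = y I" if "I \<subseteq> K" for I using that by (auto simp: trunc_def)
    with True show ?thesis unfolding trunc_def[of n "tmul \<tau> y c"] tmul_def by (auto intro!: sum.cong)
  next
    case False
    have "tmul \<tau> (trunc n y) c K = 0"
    proof (rule F.tmul_not_supp)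
      fix I assume "I \<subseteq> K"
      then show "trunc n y I = 0 \<or> c (K - I) = 0"
        using False c unfolding grass0_iff coef_enat trunc_def by fastforce
    qed
    with False show ?thesis by (simp add: trunc_def)
  qed
qed

lemma R_incl_cont:
  assumes "enat n \<le> m"
  shows "continuous_map (tw_top (Emod_R s0 s1 (enat n)) j) (tw_top (Emod_R s0 s1 m) j) (\<lambda>p. p)"
proof (induction j)
  let ?A = "Emod_R s0 s1 (enat n)" and ?B = "Emod_R s0 s1 m"
  {
    case 0
    have "continuous_map (mtop ?A) (mtop ?B) (\<lambda>x. x)" using continuous_map_ev_incl[OF assms] by simp
    from continuous_map_compose[OF continuous_map_compose[OF continuous_map_unBase this] continuous_map_Base]
    show ?case
      by (rule continuous_map_eq) (auto simp: topspace_tw_top[OF N_topspace(3,4)] simp del: tw_top.simps)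
  next
    case (Suc j)
    have c3: "continuous_map (tw_top ?A (Suc j)) (stop ?B) tw3"
      using continuous_map_tw3[of ?A j] by (simp only: Emod_R_simps)
    have "continuous_map (tw_top ?A (Suc j)) (tw_top ?B (Suc j)) (\<lambda>p. Tri (tw1 p) (tw2 p) (tw3 p))"
      using continuous_map_compose[OF continuous_map_tw1 Suc] continuous_map_compose[OF continuous_map_tw2 Suc] c3
      by (intro continuous_map_Tri) (simp_all only: comp_def)
    then show ?case
      by (rule continuous_map_eq) (auto simp: topspace_tw_top[OF N_topspace(3,4)] simp del: tw_top.simps)
  }
qed

lemma \<U>_V_infinity: "x \<in> \<U> n \<Longrightarrow> x \<in> V \<infinity>"
  using V_iff[of x "enat n"] V_iff[of x \<infinity>] ev_mono[of "enat n" \<infinity>] by auto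

text \<open>On level \<open>n\<close> the map is the inclusion, then \<open>finf\<close>, then
  \<open>trunc n\<close>. Projecting back is needed because the quotients of \<open>finf\<close>
  take their values at infinity; linearity survives by \<open>trunc_tmul\<close>.\<close>

theorem smooth_infinity_restrict:
  assumes f: "\<And>n x. x \<in> \<U> n \<Longrightarrow> finf x = f n x" and fm: "\<And>n x. x \<in> \<U> n \<Longrightarrow> f n x \<in> ev (enat n)"
    and sm: "BGN_smooth (Emod_R s0 s1 \<infinity>) (V \<infinity>) (Fcod_R t0 t1 \<infinity>) finf"
    and lin: "\<And>x v c. x \<in> V \<infinity> \<Longrightarrow> v \<in> ev \<infinity> \<Longrightarrow> c \<in> grass0 \<infinity> \<Longrightarrow>
      dR \<infinity> finf x (tmul \<sigma> v c) = tmul \<tau> (dR \<infinity> finf x v) c"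
  shows "BGN_smooth (Emod_R s0 s1 (enat n)) (\<U> n) (Fcod_R t0 t1 (enat n)) (f n)"
    and "x \<in> \<U> n \<Longrightarrow> v \<in> ev (enat n) \<Longrightarrow> c \<in> grass0 (enat n) \<Longrightarrow>
      dR (enat n) (f n) x (tmul \<sigma> v c) = tmul \<tau> (dR (enat n) (f n) x v) c"
proof -
  let ?A = "Emod_R s0 s1 (enat n)" and ?B = "Emod_R s0 s1 \<infinity>"
  have arith: "tw_plus ?A = tw_plus ?B" "tw_times ?A = tw_times ?B" by (simp_all add: tw_plus_def tw_times_def)
  have aff: "affine_map ?A 0 ?B 0 (\<lambda>s. s) (\<lambda>p. p) (\<lambda>p. p)"
    unfolding affine_map_def arith using R_incl_cont[of n \<infinity> 0] by auto
  have ts: "trunc n (tsmul \<tau> y t) = tsmul \<tau> (trunc n y) t" for y t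
    by (auto simp: fun_eq_iff trunc_def tsmul_def)
  have "BGN_Ck ?A (\<U> n) (Fcod_R t0 t1 (enat n)) k 0 (base_fun (f n))" for k
  proof (rule BGN_cong)
    have "BGN_Ck ?B (V \<infinity>) (Fcod_R t0 t1 \<infinity>) k 0 (base_fun finf)" using sm by (simp add: BGN_smooth_def)
    then show "BGN_Ck ?A (\<U> n) (Fcod_R t0 t1 (enat n)) k 0 (\<lambda>q. trunc n (base_fun finf q))"
      by (rule BGN_transport[where M = ?B and U = "V \<infinity>" and Y = "Fcod_R t0 t1 \<infinity>" and P = "trunc n" and j = 0,
            OF _ _ _ _ _ _ _ _ _ _ _ aff, rotated -1])
        (use V_ev \<U>_ev \<U>_V_infinity trunc_cont in \<open>auto simp: ts trunc_def fun_eq_iff subset_iff\<close>)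
    show "trunc n (base_fun finf p) = base_fun (f n) p" if "p \<in> tw_dom ?A (\<U> n) 0" for p
      using that f fm trunc_id by auto
  qed
  then show "BGN_smooth ?A (\<U> n) (Fcod_R t0 t1 (enat n)) (f n)" by (simp add: BGN_smooth_def)
  have Vo: "openin (mtop ?B) (V \<infinity>)" using V_open by simp
  obtain k1 where k1: "rsm ?B (V \<infinity>) (Fcod_R t0 t1 \<infinity>) finf k1"
    using smooth_rsm[OF path_module_R Vo sm] by blast
  have k1c: "continuous_map (subtopology (tw_top ?B 1) (tw_dom ?B (V \<infinity>) 1)) (ev_top \<infinity>) k1"
    using rsm_continuous[OF k1] by simp
  have k1eq: "finf (y + tsmul \<sigma> u t) - finf y = tsmul \<tau> (k1 (Tri (Base y) (Base u) t)) t"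
    if "y \<in> V \<infinity>" "u \<in> ev \<infinity>" "y + tsmul \<sigma> u t \<in> V \<infinity>" for y u t
    using rsm_quotient[OF k1, of y u t] that by simp
  have z: "tsmul \<sigma> u 0 = 0" for u by (simp add: fun_eq_iff tsmul_def)
  have dB: "dR \<infinity> finf y u = k1 (Tri (Base y) (Base u) 0)" if "y \<in> V \<infinity>" "u \<in> ev \<infinity>" for y u
    by (rule BGN_deriv_eq[OF path_module_R Vo k1c]) (use that k1eq z in auto)
  have dA: "dR (enat n) (f n) y u = trunc n (k1 (Tri (Base y) (Base u) 0))" if y: "y \<in> \<U> n" and u: "u \<in> ev (enat n)" for y u
    unfolding V_enat
  proof (rule BGN_deriv_eq[OF path_module_R, where ?g1.0 = "\<lambda>q. trunc n (k1 q)"])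
    show "openin (mtop ?A) (\<U> n)" using \<U>_open by simp
    have "q \<in> tw_dom ?B (V \<infinity>) 1" if "q \<in> tw_dom ?A (\<U> n) 1" for q
      using that \<U>_V_infinity ev_mono[of "enat n" \<infinity>] by (elim tw_dom_1_cases) auto
    then have "continuous_map (subtopology (tw_top ?A 1) (tw_dom ?A (\<U> n) 1)) (subtopology (tw_top ?B 1) (tw_dom ?B (V \<infinity>) 1)) (\<lambda>p. p)"
      using R_incl_cont[of n \<infinity> 1] unfolding continuous_map_in_subtopology
      by (intro conjI continuous_map_from_subtopology) (auto simp only: topspace_subtopology enat_ord_simps)
    from continuous_map_compose[OF continuous_map_compose[OF this k1c] trunc_cont]
    show "continuous_map (subtopology (tw_top ?A 1) (tw_dom ?A (\<U> n) 1)) (ev_top (enat n)) (\<lambda>q. trunc n (k1 q))"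
      by (simp add: comp_def)
  next
    fix y u t assume a: "y \<in> \<U> n" "u \<in> mcar ?A" "madd ?A y (mscal ?A u t) \<in> \<U> n"
    then have "u \<in> ev \<infinity>" using ev_mono[of "enat n" \<infinity>] by auto
    with a have "finf (y + tsmul \<sigma> u t) - finf y = tsmul \<tau> (k1 (Tri (Base y) (Base u) t)) t"
      by (intro k1eq) (auto intro: \<U>_V_infinity)
    then have "trunc n (f n (y + tsmul \<sigma> u t) - f n y) = tsmul \<tau> (trunc n (k1 (Tri (Base y) (Base u) t))) t"
      using a f by (simp add: ts)
    moreover have "f n (y + tsmul \<sigma> u t) - f n y \<in> ev (enat n)" using a fm by (intro ev_diff) auto
    ultimately show "f n (madd ?A y (mscal ?A u t)) - f n y = tsmul \<tau> (trunc n (k1 (Tri (Base y) (Base u) t))) t"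
      using trunc_id by simp
  qed (use y u z in auto)
  show "dR (enat n) (f n) x (tmul \<sigma> v c) = tmul \<tau> (dR (enat n) (f n) x v) c"
    if x: "x \<in> \<U> n" and v: "v \<in> ev (enat n)" and c: "c \<in> grass0 (enat n)"
  proof -
    have i: "v \<in> ev \<infinity>" "c \<in> grass0 \<infinity>" "x \<in> V \<infinity>"
      using v c x ev_mono[of "enat n" \<infinity>] grass0_mono[of "enat n" \<infinity>] \<U>_V_infinity by auto
    have "dR (enat n) (f n) x (tmul \<sigma> v c) = trunc n (dR \<infinity> finf x (tmul \<sigma> v c))"
      using dA[OF x tmul_evE[OF v c]] dB[OF i(3) tmul_evE[OF i(1,2)]] by simp
    also have "\<dots> = tmul \<tau> (trunc n (dR \<infinity> finf x v)) c"
      unfolding lin[OF i(3,1,2)] by (rule trunc_tmul[OF c])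
    also have "trunc n (dR \<infinity> finf x v) = dR (enat n) (f n) x v"
      using dA[OF x v] dB[OF i(3,1)] by simp
    finally show ?thesis .
  qed
qed

end

section \<open>Locally \<open>k\<^sub>\<omega>\<close> spaces and direct limits\<close>

text \<open>A compact set of one space stays compact, hence closed, in the later Hausdorff spaces,
  and each space is normal. Both facts are used when neighbourhoods are grown along the
  chain.\<close>

definition compact_chain :: "(nat \<Rightarrow> 'a topology) \<Rightarrow> bool" where
  "compact_chain A \<longleftrightarrow> (\<forall>i. compact_space (A i) \<and> Hausdorff_space (A i) \<and> continuous_map (A i) (A (Suc i)) (\<lambda>x. x))"

lemma chain_mono:
  assumes "\<And>i. continuous_map (A i) (A (Suc i)) (\<lambda>x. x)" "i \<le> j"
  shows "continuous_map (A i) (A j) (\<lambda>x. x)"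
  using assms(2)
proof (induction j rule: dec_induct)
  case (step j)
  from continuous_map_compose[OF step.IH assms(1)] show ?case by (simp add: comp_def)
qed simp

lemma openin_incl:
  assumes "continuous_map A B (\<lambda>x. x)" "openin B V"
  shows "openin A (V \<inter> topspace A)"
  using openin_continuous_map_preimage[OF assms] by (simp add: Collect_conj_eq Int_commute)

text \<open>Wallace's theorem gives an open box around the compact box \<open>C \<times> D\<close>
  inside \<open>W\<close>; normality of the factors leaves space for closures.\<close>

lemma tube_step:
  assumes X: "compact_space X" "Hausdorff_space X" and Y: "compact_space Y" "Hausdorff_space Y"
    and C: "closedin X C" and D: "closedin Y D" and W: "openin (prod_topology X Y) W" and sub: "C \<times> D \<subseteq> W"
  shows "\<exists>P C' Q D'. openin X P \<and> closedin X C' \<and> openin Y Q \<and> closedin Y D' \<and>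
    C \<subseteq> P \<and> P \<subseteq> C' \<and> D \<subseteq> Q \<and> Q \<subseteq> D' \<and> C' \<times> D' \<subseteq> W"
proof -
  have "compactin X C" "compactin Y D" using X Y C D by (auto intro: closedin_compact_space)
  from Wallace_theorem_prod_topology[OF this W sub]
  obtain U V where UV: "openin X U" "openin Y V" "C \<subseteq> U" "D \<subseteq> V" "U \<times> V \<subseteq> W" by blast
  have "normal_space X" "normal_space Y"
    using X Y by (auto intro: compact_Hausdorff_or_regular_imp_normal_space)
  then obtain P Q where P: "openin X P" "C \<subseteq> P" "X closure_of P \<subseteq> U" and Q: "openin Y Q" "D \<subseteq> Q" "Y closure_of Q \<subseteq> V"
    unfolding normal_space_alt using C D UV by meson
  have "P \<subseteq> X closure_of P" "Q \<subseteq> Y closure_of Q"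
    using P Q by (auto intro!: closure_of_subset openin_subset)
  moreover have "closedin X (X closure_of P)" "closedin Y (Y closure_of Q)" by auto
  moreover have "(X closure_of P) \<times> (Y closure_of Q) \<subseteq> W" using P Q UV by blast
  ultimately show ?thesis using P Q by meson
qed

text \<open>The neighbourhoods are grown along the chain, keeping the product of their closures inside
  \<open>W\<close>.\<close>
lemma chain_tube:
  assumes A: "compact_chain A" and B: "compact_chain B"
    and W: "\<And>i. openin (prod_topology (A i) (B i)) (W \<inter> topspace (A i) \<times> topspace (B i))"
    and xy: "(x, y) \<in> W" "x \<in> topspace (A 0)" "y \<in> topspace (B 0)"
  shows "\<exists>P Q. x \<in> P \<and> y \<in> Q \<and> P \<times> Q \<subseteq> W \<and> P \<subseteq> (\<Union>i. topspace (A i)) \<and> Q \<subseteq> (\<Union>i. topspace (B i)) \<and>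
    (\<forall>i. openin (A i) (P \<inter> topspace (A i))) \<and> (\<forall>i. openin (B i) (Q \<inter> topspace (B i)))"
proof -
  have cA: "\<And>i. compact_space (A i)" "\<And>i. Hausdorff_space (A i)" "\<And>i. continuous_map (A i) (A (Suc i)) (\<lambda>x. x)"
    and cB: "\<And>i. compact_space (B i)" "\<And>i. Hausdorff_space (B i)" "\<And>i. continuous_map (B i) (B (Suc i)) (\<lambda>x. x)"
    using A B by (auto simp: compact_chain_def)
  \<comment> \<open>A stage consists of open sets inside closed ones, with
    \<open>C \<times> D \<subseteq> W\<close>. Being compact, \<open>C\<close> and \<open>D\<close>
    remain closed in the next spaces, where \<open>tube_step\<close> can be applied to them
    again.\<close>
  define good where "good i r \<longleftrightarrow> (case r of (P, C, Q, D) \<Rightarrow> openin (A i) P \<and> closedin (A i) C \<and> openin (B i) Q \<and>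
      closedin (B i) D \<and> x \<in> P \<and> y \<in> Q \<and> P \<subseteq> C \<and> Q \<subseteq> D \<and> C \<times> D \<subseteq> W)" for i r
  define rel where "rel r r' \<longleftrightarrow> (case r of (P, C, Q, D) \<Rightarrow> case r' of (P', C', Q', D') \<Rightarrow> C \<subseteq> P' \<and> D \<subseteq> Q')"
    for r r' :: "'a set \<times> 'a set \<times> 'b set \<times> 'b set"
  have "\<exists>f. \<forall>i. good i (f i) \<and> rel (f i) (f (Suc i))"
  proof (rule dependent_nat_choice)
    have "closedin (A 0) {x}" "closedin (B 0) {y}"
      using xy cA cB by (auto simp: closedin_Hausdorff_singleton)
    moreover have "{x} \<times> {y} \<subseteq> W \<inter> topspace (A 0) \<times> topspace (B 0)" using xy by auto
    ultimately obtain P C Q D where "openin (A 0) P" "closedin (A 0) C" "openin (B 0) Q" "closedin (B 0) D"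
      "{x} \<subseteq> P" "P \<subseteq> C" "{y} \<subseteq> Q" "Q \<subseteq> D" "C \<times> D \<subseteq> W \<inter> topspace (A 0) \<times> topspace (B 0)"
      using tube_step[OF cA(1,2) cB(1,2) _ _ W] by meson
    then show "\<exists>r. good 0 r" by (intro exI[of _ "(P, C, Q, D)"]) (auto simp: good_def)
  next
    fix r i assume "good i r"
    then obtain P C Q D where r: "r = (P, C, Q, D)" "openin (A i) P" "closedin (A i) C" "openin (B i) Q" "closedin (B i) D"
      "x \<in> P" "y \<in> Q" "P \<subseteq> C" "Q \<subseteq> D" "C \<times> D \<subseteq> W"
      by (auto simp: good_def split: prod.splits)
    have "compactin (A i) C" "compactin (B i) D" using r cA cB by (auto intro: closedin_compact_space)
    then have c: "compactin (A (Suc i)) C" "compactin (B (Suc i)) D"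
      using image_compactin[OF _ cA(3)] image_compactin[OF _ cB(3)] by fastforce+
    then have "closedin (A (Suc i)) C" "closedin (B (Suc i)) D"
      using cA cB by (auto intro: compactin_imp_closedin)
    moreover have "C \<times> D \<subseteq> W \<inter> topspace (A (Suc i)) \<times> topspace (B (Suc i))"
      using r c[THEN compactin_subset_topspace] by auto
    ultimately obtain P' C' Q' D' where "openin (A (Suc i)) P'" "closedin (A (Suc i)) C'"
      "openin (B (Suc i)) Q'" "closedin (B (Suc i)) D'"
      "C \<subseteq> P'" "P' \<subseteq> C'" "D \<subseteq> Q'" "Q' \<subseteq> D'" "C' \<times> D' \<subseteq> W \<inter> topspace (A (Suc i)) \<times> topspace (B (Suc i))"
      using tube_step[OF cA(1,2) cB(1,2) _ _ W] by meson
    then show "\<exists>r'. good (Suc i) r' \<and> rel r r'"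
      using r by (intro exI[of _ "(P', C', Q', D')"]) (auto simp: good_def rel_def)
  qed
  then obtain f where f: "\<And>i. good i (f i)" "\<And>i. rel (f i) (f (Suc i))" by blast
  define P where "P i = fst (f i)" for i
  define C where "C i = fst (snd (f i))" for i
  define Q where "Q i = fst (snd (snd (f i)))" for i
  define D where "D i = snd (snd (snd (f i)))" for i
  have g: "openin (A i) (P i)" "openin (B i) (Q i)" "x \<in> P i" "y \<in> Q i" "P i \<subseteq> C i" "Q i \<subseteq> D i"
    "C i \<times> D i \<subseteq> W" "C i \<subseteq> P (Suc i)" "D i \<subseteq> Q (Suc i)" for i
    using f(1)[of i] f(2)[of i] unfolding good_def rel_def P_def C_def Q_def D_def by (auto split: prod.splits)
  have "P i \<subseteq> P (Suc i)" "Q i \<subseteq> Q (Suc i)" for i using g[of i] by auto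
  then have mono: "P i \<subseteq> P j" "Q i \<subseteq> Q j" if "i \<le> j" for i j
    using that lift_Suc_mono_le[of P i j] lift_Suc_mono_le[of Q i j] by auto
  \<comment> \<open>The \<open>P k\<close> increase, so the tail \<open>k \<ge> i\<close> gives the
    whole union; there \<open>P k\<close> is open in a later space, and its trace on
    \<open>A i\<close> is open.\<close>
  have oP: "openin (A i) ((\<Union>k. P k) \<inter> topspace (A i))" for i
  proof -
    have "openin (A i) (P k \<inter> topspace (A i))" if "i \<le> k" for k
      using openin_incl[OF chain_mono[where A = A and i = i and j = k, OF cA(3) that] g(1)] .
    moreover have "(\<Union>k. P k) \<inter> topspace (A i) = (\<Union>k\<in>{i..}. P k \<inter> topspace (A i))"
    proof -
      have "\<exists>l\<in>{i..}. x \<in> P l" if "x \<in> P k" for x k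
        using mono(1)[of k "max i k"] that by (intro bexI[of _ "max i k"]) auto
      then show ?thesis by blast
    qed
    moreover have "openin (A i) (\<Union>k\<in>{i..}. P k \<inter> topspace (A i))"
      by (rule openin_Union) (use calculation(1) in blast)
    ultimately show ?thesis by simp
  qed
  have oQ: "openin (B i) ((\<Union>k. Q k) \<inter> topspace (B i))" for i
  proof -
    have "openin (B i) (Q k \<inter> topspace (B i))" if "i \<le> k" for k
      using openin_incl[OF chain_mono[where A = B and i = i and j = k, OF cB(3) that] g(2)] .
    moreover have "(\<Union>k. Q k) \<inter> topspace (B i) = (\<Union>k\<in>{i..}. Q k \<inter> topspace (B i))"
    proof -
      have "\<exists>l\<in>{i..}. x \<in> Q l" if "x \<in> Q k" for x k
        using mono(2)[of k "max i k"] that by (intro bexI[of _ "max i k"]) auto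
      then show ?thesis by blast
    qed
    moreover have "openin (B i) (\<Union>k\<in>{i..}. Q k \<inter> topspace (B i))"
      by (rule openin_Union) (use calculation(1) in blast)
    ultimately show ?thesis by simp
  qed
  have "P i \<times> Q j \<subseteq> W" for i j
    using mono(1)[of i "max i j"] mono(2)[of j "max i j"] g(5,6,7)[of "max i j"] by fastforce
  then have "(\<Union>k. P k) \<times> (\<Union>k. Q k) \<subseteq> W" by blast
  moreover have "(\<Union>k. P k) \<subseteq> (\<Union>i. topspace (A i))" "(\<Union>k. Q k) \<subseteq> (\<Union>i. topspace (B i))"
    using g(1,2)[THEN openin_subset] by blast+
  ultimately show ?thesis using g(3,4) oP oQ by (intro exI[of _ "\<Union>k. P k"] exI[of _ "\<Union>k. Q k"]) auto
qed

lemma is_k_omegaI: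
  assumes "Hausdorff_space T" "incseq K" "\<And>n. compactin T (K n)" "(\<Union>n. K n) = topspace T"
    and "\<And>V. V \<subseteq> topspace T \<Longrightarrow> (\<And>n. openin (subtopology T (K n)) (V \<inter> K n)) \<Longrightarrow> openin T V"
  shows "is_k_omega T"
  unfolding is_k_omega_def
proof (intro conjI exI[of _ K] allI impI iffI)
  show "openin T V" if "V \<subseteq> topspace T" "\<forall>n. openin (subtopology T (K n)) (V \<inter> K n)" for V
    using assms(5) that by blast
  show "openin (subtopology T (K n)) (V \<inter> K n)" if "openin T V" for V n
    using that by (rule openin_subtopology_Int)
qed (use assms(1-4) in simp_all)

lemma is_k_omegaE:
  assumes "is_k_omega T"
  obtains K where "Hausdorff_space T" "incseq K" "\<forall>n. compactin T (K n)" "(\<Union>n. K n) = topspace T"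
    "\<forall>V. V \<subseteq> topspace T \<longrightarrow> (\<forall>n. openin (subtopology T (K n)) (V \<inter> K n)) \<longrightarrow> openin T V"
proof -
  from assms obtain K where "Hausdorff_space T" "incseq K" "\<forall>n. compactin T (K n)" "(\<Union>n. K n) = topspace T"
    "\<forall>V\<subseteq>topspace T. openin T V \<longleftrightarrow> (\<forall>n. openin (subtopology T (K n)) (V \<inter> K n))"
    unfolding is_k_omega_def by (elim conjE exE)
  then show thesis by (intro that[of K]) simp_all
qed

text \<open>The shift by \<open>m\<close> allows the chain to start at a compact set containing a
  given point.\<close>

lemma compact_chain_subtopology:
  assumes "Hausdorff_space T" "incseq K" "\<And>n. compactin T (K n)"
  shows "compact_chain (\<lambda>i. subtopology T (K (m + i)))"
  unfolding compact_chain_def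
proof (intro allI conjI)
  fix i
  show "compact_space (subtopology T (K (m + i)))" using assms(3) by (rule compact_space_subtopology)
  show "Hausdorff_space (subtopology T (K (m + i)))" using assms(1) by (rule Hausdorff_space_subtopology)
  show "continuous_map (subtopology T (K (m + i))) (subtopology T (K (m + Suc i))) (\<lambda>x. x)"
    using incseqD[OF assms(2), of "m + i" "m + Suc i"]
    by (auto simp: continuous_map_in_subtopology intro: continuous_map_from_subtopology)
qed

text \<open>The products \<open>K n \<times> L n\<close> exhaust the space. That they determine its
  topology is seen at each point by growing an open box with \<open>chain_tube\<close>.\<close>

lemma is_k_omega_prod:
  assumes "is_k_omega X" "is_k_omega Y"
  shows "is_k_omega (prod_topology X Y)"
proof -
  obtain K where K': "Hausdorff_space X" "incseq K" "\<forall>n. compactin X (K n)" "(\<Union>n. K n) = topspace X"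
    "\<forall>V. V \<subseteq> topspace X \<longrightarrow> (\<forall>n. openin (subtopology X (K n)) (V \<inter> K n)) \<longrightarrow> openin X V"
    using assms(1) by (rule is_k_omegaE)
  note K = K'[rule_format]
  obtain L where L': "Hausdorff_space Y" "incseq L" "\<forall>n. compactin Y (L n)" "(\<Union>n. L n) = topspace Y"
    "\<forall>V. V \<subseteq> topspace Y \<longrightarrow> (\<forall>n. openin (subtopology Y (L n)) (V \<inter> L n)) \<longrightarrow> openin Y V"
    using assms(2) by (rule is_k_omegaE)
  note L = L'[rule_format]
  \<comment> \<open>For an increasing exhaustion it suffices to test openness on a tail.\<close>
  have tail: "openin T V" if cov: "\<And>V. V \<subseteq> topspace T \<Longrightarrow> (\<And>n. openin (subtopology T (J n)) (V \<inter> J n)) \<Longrightarrow> openin T V"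
    and inc: "incseq J" and V: "V \<subseteq> topspace T" and o: "\<And>i. openin (subtopology T (J (m + i))) (V \<inter> J (m + i))"
    for T :: "'z topology" and J V m
  proof (rule cov[OF V])
    fix n
    have sub: "J n \<subseteq> J (m + n)" using inc by (simp add: incseq_def)
    from o[of n] obtain G where "openin T G" "V \<inter> J (m + n) = G \<inter> J (m + n)" by (auto simp: openin_subtopology)
    with sub show "openin (subtopology T (J n)) (V \<inter> J n)" by (auto simp: openin_subtopology intro!: exI[of _ G])
  qed
  show ?thesis
  proof (rule is_k_omegaI[where K = "\<lambda>n. K n \<times> L n"])
    show "Hausdorff_space (prod_topology X Y)" using K L by (simp add: Hausdorff_space_prod_topology)
    show "incseq (\<lambda>n. K n \<times> L n)" using K(2) L(2) unfolding incseq_def by blast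
    show "compactin (prod_topology X Y) (K n \<times> L n)" for n using K(3) L(3) by (simp add: compactin_Times)
    show "(\<Union>n. K n \<times> L n) = topspace (prod_topology X Y)"
    proof -
      have "x \<in> K i \<Longrightarrow> y \<in> L j \<Longrightarrow> x \<in> K (max i j) \<and> y \<in> L (max i j)" for x y i j
        using K(2) L(2) by (meson incseqD max.cobounded1 max.cobounded2 subsetD)
      then show ?thesis using K(4) L(4) by (simp only: topspace_prod_topology flip: K(4) L(4)) blast
    qed
    fix V assume V: "V \<subseteq> topspace (prod_topology X Y)"
      and o: "\<And>n. openin (subtopology (prod_topology X Y) (K n \<times> L n)) (V \<inter> K n \<times> L n)"
    show "openin (prod_topology X Y) V"
      unfolding openin_prod_topology_alt
    proof (intro allI impI)
      fix x y assume xy: "(x, y) \<in> V"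
      then have "x \<in> (\<Union>n. K n)" "y \<in> (\<Union>n. L n)" using V unfolding K(4) L(4) by auto
      then obtain i j where "x \<in> K i" "y \<in> L j" by blast
      then have m: "x \<in> K (max i j)" "y \<in> L (max i j)"
        using K(2) L(2) by (meson incseqD max.cobounded1 max.cobounded2 subsetD)+
      define m where "m = max i j"
      let ?A = "\<lambda>i. subtopology X (K (m + i))" and ?B = "\<lambda>i. subtopology Y (L (m + i))"
      have ts: "topspace (?A i) = K (m + i)" "topspace (?B i) = L (m + i)" for i
        using K(3)[THEN compactin_subset_topspace] L(3)[THEN compactin_subset_topspace] by auto
      have "\<exists>P Q. x \<in> P \<and> y \<in> Q \<and> P \<times> Q \<subseteq> V \<and> P \<subseteq> (\<Union>i. topspace (?A i)) \<and> Q \<subseteq> (\<Union>i. topspace (?B i)) \<and>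
        (\<forall>i. openin (?A i) (P \<inter> topspace (?A i))) \<and> (\<forall>i. openin (?B i) (Q \<inter> topspace (?B i)))"
      proof (rule chain_tube[OF compact_chain_subtopology[OF K(1-3)] compact_chain_subtopology[OF L(1-3)] _ xy])
        show "openin (prod_topology (?A i) (?B i)) (V \<inter> topspace (?A i) \<times> topspace (?B i))" for i
          using o[of "m + i"] unfolding ts subtopology_Times .
        show "x \<in> topspace (?A 0)" "y \<in> topspace (?B 0)" unfolding ts using m by (simp_all add: m_def)
      qed
      then obtain P Q where PQ': "x \<in> P \<and> y \<in> Q \<and> P \<times> Q \<subseteq> V" "P \<subseteq> (\<Union>i. K (m + i)) \<and> Q \<subseteq> (\<Union>i. L (m + i))"
        "\<forall>i. openin (?A i) (P \<inter> K (m + i))" "\<forall>i. openin (?B i) (Q \<inter> L (m + i))"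
        unfolding ts by (elim exE conjE) (rule that; (intro conjI)?; assumption)
      then have PQ: "x \<in> P" "y \<in> Q" "P \<times> Q \<subseteq> V" by blast+
      have sub: "P \<subseteq> topspace X" "Q \<subseteq> topspace Y" unfolding K(4)[symmetric] L(4)[symmetric] using PQ'(2) by blast+
      have "openin X P" by (rule tail[OF K(5) K(2) sub(1) PQ'(3)[rule_format]])
      moreover have "openin Y Q" by (rule tail[OF L(5) L(2) sub(2) PQ'(4)[rule_format]])
      ultimately show "\<exists>U W. openin X U \<and> openin Y W \<and> x \<in> U \<and> y \<in> W \<and> U \<times> W \<subseteq> V" using PQ by blast
    qed
  qed
qed

lemma locally_k_omega_prod:
  assumes "locally_k_omega X" "locally_k_omega Y"
  shows "locally_k_omega (prod_topology X Y)"
  unfolding locally_k_omega_def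
proof (intro conjI ballI)
  show "Hausdorff_space (prod_topology X Y)"
    using assms by (simp add: locally_k_omega_def Hausdorff_space_prod_topology)
  fix p assume "p \<in> topspace (prod_topology X Y)"
  then obtain x y where p: "p = (x, y)" "x \<in> topspace X" "y \<in> topspace Y" by auto
  obtain V where V: "openin X V" "x \<in> V" "is_k_omega (subtopology X V)"
    using assms(1) p(2) by (auto simp: locally_k_omega_def)
  obtain W where W: "openin Y W" "y \<in> W" "is_k_omega (subtopology Y W)"
    using assms(2) p(3) by (auto simp: locally_k_omega_def)
  show "\<exists>Z. openin (prod_topology X Y) Z \<and> p \<in> Z \<and> is_k_omega (subtopology (prod_topology X Y) Z)"
    using V W p by (intro exI[of _ "V \<times> W"]) (simp add: openin_prod_Times_iff subtopology_Times is_k_omega_prod)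
qed

lemma is_k_omega_homeomorphic:
  assumes f: "homeomorphic_map X Y f" and X: "is_k_omega X"
  shows "is_k_omega Y"
proof -
  obtain K where K': "Hausdorff_space X" "incseq K" "\<forall>n. compactin X (K n)" "(\<Union>n. K n) = topspace X"
    "\<forall>V. V \<subseteq> topspace X \<longrightarrow> (\<forall>n. openin (subtopology X (K n)) (V \<inter> K n)) \<longrightarrow> openin X V"
    using X by (rule is_k_omegaE)
  note K = K'[rule_format]
  have c: "continuous_map X Y f" and o: "open_map X Y f" and s: "f ` topspace X = topspace Y"
    using f by (auto simp: homeomorphic_eq_everything_map)
  show ?thesis
  proof (rule is_k_omegaI[where K = "\<lambda>n. f ` K n"])
    show "Hausdorff_space Y"
      using f K(1) homeomorphic_map_imp_homeomorphic_space homeomorphic_Hausdorff_space by blast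
    show "incseq (\<lambda>n. f ` K n)" using K(2) by (auto simp: incseq_def)
    show "compactin Y (f ` K n)" for n using K(3) c by (rule image_compactin)
    show "(\<Union>n. f ` K n) = topspace Y" unfolding s[symmetric] K(4)[symmetric] by blast
    fix V assume V: "V \<subseteq> topspace Y" and oV: "\<And>n. openin (subtopology Y (f ` K n)) (V \<inter> f ` K n)"
    let ?P = "{x \<in> topspace X. f x \<in> V}"
    have "openin X ?P"
    proof (rule K(5))
      fix n
      have Kn: "K n \<subseteq> topspace X" by (rule compactin_subset_topspace[OF K(3)])
      obtain G where G: "openin Y G" "V \<inter> f ` K n = G \<inter> f ` K n" using oV[of n] by (auto simp: openin_subtopology)
      have "openin X {x \<in> topspace X. f x \<in> G}" using c G(1) by (rule openin_continuous_map_preimage)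
      moreover have "?P \<inter> K n = {x \<in> topspace X. f x \<in> G} \<inter> K n" using G(2) Kn by blast
      ultimately show "openin (subtopology X (K n)) (?P \<inter> K n)" by (simp add: openin_subtopology_Int)
    qed auto
    then have "openin Y (f ` ?P)" using o by (auto simp: open_map_def)
    also have "f ` ?P = V" using V s by auto
    finally show "openin Y V" .
  qed
qed

lemma locally_k_omega_homeomorphic:
  assumes f: "homeomorphic_map X Y f" and X: "locally_k_omega X"
  shows "locally_k_omega Y"
  unfolding locally_k_omega_def
proof (intro conjI ballI)
  have o: "open_map X Y f" and s: "f ` topspace X = topspace Y"
    using f by (auto simp: homeomorphic_eq_everything_map)
  show "Hausdorff_space Y"
    using f X homeomorphic_map_imp_homeomorphic_space homeomorphic_Hausdorff_space unfolding locally_k_omega_def by blast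
  fix y assume "y \<in> topspace Y"
  then obtain x where x: "x \<in> topspace X" "y = f x" using s by auto
  obtain V where V: "openin X V" "x \<in> V" "is_k_omega (subtopology X V)"
    using X x(1) by (auto simp: locally_k_omega_def)
  have "homeomorphic_map (subtopology X V) (subtopology Y (f ` V)) f"
    using f V(1)[THEN openin_subset] by (intro homeomorphic_map_subtopologies) (auto simp: s[symmetric])
  then have "is_k_omega (subtopology Y (f ` V))" using V(3) by (rule is_k_omega_homeomorphic)
  then show "\<exists>V. openin Y V \<and> y \<in> V \<and> is_k_omega (subtopology Y V)"
    using V x o by (intro exI[of _ "f ` V"]) (auto simp: open_map_def)
qed

lemma is_k_omega_closed:
  assumes X: "is_k_omega X" and C: "closedin X C"
  shows "is_k_omega (subtopology X C)"
proof -
  obtain K where K': "Hausdorff_space X" "incseq K" "\<forall>n. compactin X (K n)" "(\<Union>n. K n) = topspace X"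
    "\<forall>V. V \<subseteq> topspace X \<longrightarrow> (\<forall>n. openin (subtopology X (K n)) (V \<inter> K n)) \<longrightarrow> openin X V"
    using X by (rule is_k_omegaE)
  note K = K'[rule_format]
  have CX: "C \<subseteq> topspace X" using C by (rule closedin_subset)
  show ?thesis
  proof (rule is_k_omegaI[where K = "\<lambda>n. C \<inter> K n"])
    show "Hausdorff_space (subtopology X C)" using K(1) by (rule Hausdorff_space_subtopology)
    show "incseq (\<lambda>n. C \<inter> K n)" using K(2) unfolding incseq_def by blast
    show "compactin (subtopology X C) (C \<inter> K n)" for n
      using closed_Int_compactin[OF C K(3)] by (simp add: compactin_subtopology)
    show "(\<Union>n. C \<inter> K n) = topspace (subtopology X C)" using K(4) CX by auto
    fix V assume V: "V \<subseteq> topspace (subtopology X C)"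
      and o: "\<And>n. openin (subtopology (subtopology X C) (C \<inter> K n)) (V \<inter> (C \<inter> K n))"
    \<comment> \<open>Adding the open complement of \<open>C\<close> turns \<open>V\<close> into a
      set whose openness can be tested in \<open>X\<close>; intersecting with \<open>C\<close>
      recovers \<open>V\<close>.\<close>
    have "openin X (V \<union> (topspace X - C))"
    proof (rule K(5))
      fix n
      have Kn: "K n \<subseteq> topspace X" by (rule compactin_subset_topspace[OF K(3)])
      obtain G where G: "openin X G" "V \<inter> (C \<inter> K n) = G \<inter> (C \<inter> K n)"
        using o[of n] by (auto simp: subtopology_subtopology openin_subtopology)
      have "openin X (G \<union> (topspace X - C))" using G(1) C by (auto intro: openin_diff)
      moreover have "(V \<union> (topspace X - C)) \<inter> K n = (G \<union> (topspace X - C)) \<inter> K n"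
        using G(2) Kn V by auto
      ultimately show "openin (subtopology X (K n)) ((V \<union> (topspace X - C)) \<inter> K n)" by (simp add: openin_subtopology_Int)
    qed (use V in auto)
    moreover have "(V \<union> (topspace X - C)) \<inter> C = V" using V by auto
    ultimately show "openin (subtopology X C) V" by (metis openin_subtopology_Int)
  qed
qed

lemma locally_k_omega_closed:
  assumes X: "locally_k_omega X" and C: "closedin X C"
  shows "locally_k_omega (subtopology X C)"
  unfolding locally_k_omega_def
proof (intro conjI ballI)
  show "Hausdorff_space (subtopology X C)" using X by (simp add: locally_k_omega_def Hausdorff_space_subtopology)
  fix x assume x: "x \<in> topspace (subtopology X C)"
  then obtain V where V: "openin X V" "x \<in> V" "is_k_omega (subtopology X V)"
    using X by (auto simp: locally_k_omega_def)
  have "closedin (subtopology X V) (C \<inter> V)" using C by (auto simp: closedin_subtopology)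
  from is_k_omega_closed[OF V(3) this] have "is_k_omega (subtopology (subtopology X C) (C \<inter> V))"
    by (simp add: subtopology_subtopology Int_absorb2 Int_ac)
  moreover have "openin (subtopology X C) (C \<inter> V)" using V(1) openin_subtopology_Int[of X V C] by (simp add: Int_commute)
  ultimately show "\<exists>W. openin (subtopology X C) W \<and> x \<in> W \<and> is_k_omega (subtopology (subtopology X C) W)"
    using x V by (intro exI[of _ "C \<inter> V"]) auto
qed

text \<open>The exhaustions of the \<open>U i\<close> are merged by taking at stage \<open>n\<close>
  the sets \<open>K i n\<close> with \<open>i \<le> n\<close>. Openness is then tested on each open
  set \<open>U i\<close> separately.\<close>

lemma is_k_omega_Union:
  assumes X: "Hausdorff_space X" and U: "\<And>i::nat. openin X (U i)" and k: "\<And>i. is_k_omega (subtopology X (U i))"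
  shows "is_k_omega (subtopology X (\<Union>i. U i))"
proof -
  have "\<exists>K. incseq K \<and> (\<forall>n. compactin X (K n)) \<and> (\<Union>n. K n) = U i \<and>
    (\<forall>V\<subseteq>U i. (\<forall>n. openin (subtopology X (K n)) (V \<inter> K n)) \<longrightarrow> openin X V)" for i
  proof -
    have UX: "U i \<subseteq> topspace X" using U by (rule openin_subset)
    obtain K where K': "Hausdorff_space (subtopology X (U i))" "incseq K" "\<forall>n. compactin (subtopology X (U i)) (K n)" "(\<Union>n. K n) = topspace (subtopology X (U i))"
      "\<forall>V. V \<subseteq> topspace (subtopology X (U i)) \<longrightarrow> (\<forall>n. openin (subtopology (subtopology X (U i)) (K n)) (V \<inter> K n)) \<longrightarrow>
        openin (subtopology X (U i)) V"
      using k[of i] by (rule is_k_omegaE)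
    note K = K'(2-)[rule_format]
    have Kn: "K n \<subseteq> U i" "compactin X (K n)" for n using K(2)[of n] by (auto simp: compactin_subtopology)
    have s: "subtopology (subtopology X (U i)) (K n) = subtopology X (K n)" for n
      using Kn(1)[of n] by (simp add: subtopology_subtopology Int_absorb1)
    have "openin X V" if "V \<subseteq> U i" "\<forall>n. openin (subtopology X (K n)) (V \<inter> K n)" for V
    proof -
      have "openin (subtopology X (U i)) V" using that UX by (intro K(4)) (auto simp: s)
      then show ?thesis using U openin_trans_full by blast
    qed
    then show ?thesis using K(1,3) Kn UX by (intro exI[of _ K]) auto
  qed
  then obtain K where K: "\<And>i. incseq (K i)" "\<And>i n. compactin X (K i n)" "\<And>i. (\<Union>n. K i n) = U i"
    "\<And>i V. V \<subseteq> U i \<Longrightarrow> (\<And>n. openin (subtopology X (K i n)) (V \<inter> K i n)) \<Longrightarrow> openin X V" by metis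
  let ?U = "\<Union>i. U i" and ?K = "\<lambda>n. \<Union>i\<le>n. K i n"
  have UX: "?U \<subseteq> topspace X" using U openin_subset by blast
  have KU: "?K n \<subseteq> ?U" for n using K(3) by blast
  show ?thesis
  proof (rule is_k_omegaI[where K = ?K])
    show "Hausdorff_space (subtopology X ?U)" using X by (rule Hausdorff_space_subtopology)
    show "incseq ?K"
    proof (rule incseq_SucI)
      show "?K n \<subseteq> ?K (Suc n)" for n using K(1)[THEN incseq_SucD] by fastforce
    qed
    show "compactin (subtopology X ?U) (?K n)" for n
      using K(2) KU[of n] by (auto simp: compactin_subtopology intro!: compactin_Union)
    have "x \<in> (\<Union>n. ?K n)" if "x \<in> ?U" for x
    proof -
      have "x \<in> (\<Union>i n. K i n)" using that unfolding K(3) .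
      then obtain i n where "x \<in> K i n" by blast
      then have "x \<in> K i (max i n)" using incseqD[OF K(1), of n "max i n" i] by auto
      then show ?thesis by (auto intro!: exI[of _ "max i n"] bexI[of _ i])
    qed
    then have "?U \<subseteq> (\<Union>n. ?K n)" by blast
    moreover have "(\<Union>n. ?K n) \<subseteq> ?U" using KU by (rule UN_least)
    ultimately have e: "(\<Union>n. ?K n) = ?U" by (rule antisym[rotated])
    have "topspace (subtopology X ?U) = ?U" using UX by (simp add: Int_absorb1)
    with e show "(\<Union>n. ?K n) = topspace (subtopology X ?U)" by (simp only:)
    fix V assume V: "V \<subseteq> topspace (subtopology X ?U)"
      and o: "\<And>n. openin (subtopology (subtopology X ?U) (?K n)) (V \<inter> ?K n)"
    have "openin X (V \<inter> U i)" for i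
    proof (rule K(4))
      fix n
      define m where "m = max i n"
      have sub: "K i n \<subseteq> K i m" using K(1) by (simp add: m_def incseqD)
      then have sub2: "K i n \<subseteq> ?K m" by (intro subset_trans[OF _ UN_upper[of i]]) (auto simp: m_def)
      obtain G where G: "openin X G" "V \<inter> ?K m = G \<inter> ?U \<inter> ?K m"
        using o[of m] by (auto simp: openin_subtopology)
      have "V \<inter> U i \<inter> K i n = G \<inter> K i n"
      proof -
        have z: "K i n \<subseteq> U i" "U i \<subseteq> ?U" using K(3)[of i] by blast+
        have "V \<inter> U i \<inter> K i n = (V \<inter> ?K m) \<inter> K i n" using z(1) sub2 by blast
        also have "\<dots> = G \<inter> K i n" unfolding G(2) using z sub2 by blast
        finally show ?thesis .
      qed
      then show "openin (subtopology X (K i n)) (V \<inter> U i \<inter> K i n)" using G(1) by (simp add: openin_subtopology_Int)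
    qed simp
    then have "openin X (\<Union>i. V \<inter> U i)" by blast
    moreover have "(\<Union>i. V \<inter> U i) \<inter> ?U = V" using V by auto
    ultimately show "openin (subtopology X ?U) V" by (metis openin_subtopology_Int)
  qed
qed

text \<open>Finitely many open k-omega sets cover each \<open>C n\<close>, so countably many cover
  the union, and \<open>is_k_omega_Union\<close> applies.\<close>

lemma sigma_compact_k_omega_nbhd:
  assumes X: "locally_k_omega X" and C: "\<And>n::nat. compactin X (C n)"
  shows "\<exists>U. openin X U \<and> (\<Union>n. C n) \<subseteq> U \<and> is_k_omega (subtopology X U)"
proof (cases "(\<Union>n. C n) = {}")
  case True
  have "is_k_omega (subtopology X {})"
    by (rule is_k_omegaI[where K = "\<lambda>_. {}"]) (auto simp: incseq_def Hausdorff_space_subtopology X[unfolded locally_k_omega_def])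
  with True show ?thesis by (intro exI[of _ "{}"]) auto
next
  case False
  have H: "Hausdorff_space X" using X by (simp add: locally_k_omega_def)
  define \<F> where "\<F> = {V. openin X V \<and> is_k_omega (subtopology X V)}"
  have "\<exists>\<G>. finite \<G> \<and> \<G> \<subseteq> \<F> \<and> C n \<subseteq> \<Union>\<G>" for n
  proof -
    have "C n \<subseteq> \<Union>\<F>"
      using compactin_subset_topspace[OF C[of n]] X unfolding locally_k_omega_def \<F>_def by blast
    then show ?thesis using C[of n] unfolding compactin_def \<F>_def by (metis (no_types, lifting) mem_Collect_eq)
  qed
  then obtain \<G> where \<G>: "\<And>n. finite (\<G> n)" "\<And>n. \<G> n \<subseteq> \<F>" "\<And>n. C n \<subseteq> \<Union>(\<G> n)" by metis
  let ?H = "\<Union>n. \<G> n"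
  have cH: "countable ?H" using \<G>(1) by (auto intro: countable_finite)
  have "?H \<noteq> {}" using False \<G>(3) by fastforce
  then have r: "range (from_nat_into ?H) = ?H" using cH by (rule range_from_nat_into)
  then have F: "from_nat_into ?H i \<in> \<F>" for i using \<G>(2) by blast
  have "is_k_omega (subtopology X (\<Union>i. from_nat_into ?H i))"
    using F by (intro is_k_omega_Union[OF H]) (auto simp: \<F>_def)
  moreover have "openin X (\<Union>i. from_nat_into ?H i)" using F by (auto simp: \<F>_def)
  moreover have "(\<Union>n. C n) \<subseteq> (\<Union>i. from_nat_into ?H i)" unfolding r using \<G>(3) by fastforce
  ultimately show ?thesis by blast
qed

text \<open>A property of \<open>X\<close> rather than a construction, because the limits at hand
  arise as subspaces, products and images of direct limits.\<close>

definition dlimits :: "(nat \<Rightarrow> 'a topology) \<Rightarrow> 'a topology \<Rightarrow> bool" where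
  "dlimits T X \<longleftrightarrow> (\<forall>n. continuous_map (T n) (T (Suc n)) (\<lambda>x. x)) \<and> (\<forall>n. continuous_map (T n) X (\<lambda>x. x)) \<and>
    topspace X = (\<Union>n. topspace (T n)) \<and>
    (\<forall>V\<subseteq>topspace X. (\<forall>n. openin (T n) (V \<inter> topspace (T n))) \<longrightarrow> openin X V)"

text \<open>Open k-omega neighbourhoods of \<open>x\<close> are chosen in the successive spaces,
  each containing the previous one. The diagonal of their compact exhaustions is a chain of compacta
  whose union is open in \<open>X\<close> and on which openness in \<open>X\<close> can be
  tested.\<close>

lemma dlimits_exhaustion:
  assumes T: "dlimits T X" and lk: "\<And>n. locally_k_omega (T n)" and x: "x \<in> topspace (T m)"
  shows "\<exists>K. compact_chain (\<lambda>i. subtopology (T (m + i)) (K i)) \<and> x \<in> K 0 \<and> (\<forall>i. K i \<subseteq> topspace (T (m + i))) \<and>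
    (\<forall>V. V \<subseteq> (\<Union>i. K i) \<longrightarrow> (\<forall>i. openin (subtopology (T (m + i)) (K i)) (V \<inter> K i)) \<longrightarrow> openin X V)"
proof -
  have cT: "continuous_map (T i) (T j) (\<lambda>x. x)" if "i \<le> j" for i j
    using T chain_mono[OF _ that] by (auto simp: dlimits_def)
  have H: "Hausdorff_space (T n)" for n using lk by (simp add: locally_k_omega_def)
  define good where "good i c \<longleftrightarrow> incseq c \<and> (\<forall>n. compactin (T (m + i)) (c n)) \<and> openin (T (m + i)) (\<Union>n. c n) \<and>
     (\<forall>V\<subseteq>(\<Union>n. c n). (\<forall>n. openin (subtopology (T (m + i)) (c n)) (V \<inter> c n)) \<longrightarrow> openin (T (m + i)) V) \<and> x \<in> c 0" for i c
  have ex: "\<exists>c. good i c \<and> (\<Union>n. d n) \<subseteq> (\<Union>n. c n)"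
    if d: "\<And>n::nat. compactin (T (m + i)) (d n)" and xd: "x \<in> (\<Union>n. d n)" for i d
  proof -
    obtain U where U: "openin (T (m + i)) U" "(\<Union>n. d n) \<subseteq> U" "is_k_omega (subtopology (T (m + i)) U)"
      using sigma_compact_k_omega_nbhd[where X = "T (m + i)" and C = d, OF lk d] by (elim exE conjE) (rule that)
    have UX: "U \<subseteq> topspace (T (m + i))" using U(1) by (rule openin_subset)
    obtain K where K': "Hausdorff_space (subtopology (T (m + i)) U)" "incseq K" "\<forall>n. compactin (subtopology (T (m + i)) U) (K n)"
      "(\<Union>n. K n) = topspace (subtopology (T (m + i)) U)"
      "\<forall>V. V \<subseteq> topspace (subtopology (T (m + i)) U) \<longrightarrow>
        (\<forall>n. openin (subtopology (subtopology (T (m + i)) U) (K n)) (V \<inter> K n)) \<longrightarrow> openin (subtopology (T (m + i)) U) V"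
      using U(3) by (rule is_k_omegaE)
    note K = K'(2-)[rule_format]
    have KU: "(\<Union>n. K n) = U" using K(3) UX by auto
    have Kn: "K n \<subseteq> U" "compactin (T (m + i)) (K n)" for n using K(2)[of n] by (auto simp: compactin_subtopology)
    have s: "subtopology (subtopology (T (m + i)) U) (K n) = subtopology (T (m + i)) (K n)" for n
      using Kn(1)[of n] by (simp add: subtopology_subtopology Int_absorb1)
    have oV: "openin (T (m + i)) V" if "V \<subseteq> U" "\<forall>n. openin (subtopology (T (m + i)) (K n)) (V \<inter> K n)" for V
    proof -
      have "openin (subtopology (T (m + i)) U) V" using that UX by (intro K(4)) (auto simp: s)
      then show ?thesis using U openin_trans_full by blast
    qed
    obtain l where l: "x \<in> K l" using xd U(2) KU by blast
    \<comment> \<open>The shift puts \<open>x\<close> into the first set already.\<close>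
    define c where "c n = K (l + n)" for n
    have ck: "c n \<subseteq> K (l + n)" "K n \<subseteq> c n" for n using K(1) by (auto simp: c_def incseq_def)
    have cU: "(\<Union>n. c n) = U"
    proof (rule antisym)
      show "(\<Union>n. c n) \<subseteq> U" using KU by (auto simp: c_def)
      show "U \<subseteq> (\<Union>n. c n)" unfolding KU[symmetric] using ck(2) by blast
    qed
    have "good i c"
      unfolding good_def cU
    proof (intro conjI allI impI)
      show "incseq c" using K(1) by (simp add: c_def incseq_def)
      show "openin (T (m + i)) V" if VU: "V \<subseteq> U" and Vc: "\<forall>n. openin (subtopology (T (m + i)) (c n)) (V \<inter> c n)" for V
      proof (rule oV[OF VU], intro allI)
        fix n
        obtain G where "openin (T (m + i)) G" "V \<inter> c n = G \<inter> c n" using Vc by (auto simp: openin_subtopology)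
        moreover from this have "V \<inter> K n = G \<inter> K n" using ck(2)[of n] by blast
        ultimately show "openin (subtopology (T (m + i)) (K n)) (V \<inter> K n)" by (simp add: openin_subtopology_Int)
      qed
    qed (use U Kn l in \<open>auto simp: c_def\<close>)
    then show ?thesis using cU U(2) by blast
  qed
  have "\<exists>f. \<forall>i. good i (f i) \<and> (\<Union>n. f i n) \<subseteq> (\<Union>n. f (Suc i) n)"
  proof (rule dependent_nat_choice)
    have "compactin (T (m + 0)) {x}" using x by simp
    then show "\<exists>c. good 0 c" using ex[of 0 "\<lambda>_. {x}"] by auto
  next
    fix c i assume c: "good i c"
    have "compactin (T (m + Suc i)) (c n)" for n
      using image_compactin[OF _ cT[of "m + i" "m + Suc i"]] c by (fastforce simp: good_def)
    moreover have "x \<in> (\<Union>n. c n)" using c by (auto simp: good_def)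
    ultimately show "\<exists>c'. good (Suc i) c' \<and> (\<Union>n. c n) \<subseteq> (\<Union>n. c' n)" by (rule ex)
  qed
  then obtain c where cc: "\<forall>i. good i (c i) \<and> (\<Union>n. c i n) \<subseteq> (\<Union>n. c (Suc i) n)" ..
  then have c: "good i (c i)" and inc: "(\<Union>n. c i n) \<subseteq> (\<Union>n. c (Suc i) n)" for i by simp_all
  note g = c[unfolded good_def]
  have ginc: "incseq (c i)" and gcomp: "compactin (T (m + i)) (c i n)" and gopen: "openin (T (m + i)) (\<Union>n. c i n)"
    and gx: "x \<in> c i 0" for i n using g[of i] by auto
  have gcoh: "openin (T (m + i)) V" if "V \<subseteq> (\<Union>n. c i n)" "\<And>n. openin (subtopology (T (m + i)) (c i n)) (V \<inter> c i n)" for i V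
    using g[of i] that by (elim conjE) simp
  \<comment> \<open>The diagonal: only stages \<open>l \<le> i\<close> enter, since their compact
    sets are carried into \<open>T (m + i)\<close> by the inclusions.\<close>
  define K where "K i = (\<Union>l\<le>i. c l i)" for i
  have Kcomp: "compactin (T (m + i)) (K i)" for i
    unfolding K_def
  proof (rule compactin_Union)
    fix S assume "S \<in> (\<lambda>l. c l i) ` {..i}"
    then obtain l where l: "l \<le> i" "S = c l i" by auto
    then show "compactin (T (m + i)) S"
      using image_compactin[OF gcomp[of l i] cT[of "m + l" "m + i"]] by simp
  qed simp
  have KSuc: "K i \<subseteq> K (Suc i)" for i
    using ginc[THEN incseq_SucD] by (fastforce simp: K_def)
  have UK: "(\<Union>i. K i) = (\<Union>l n. c l n)"
  proof -
    have "x \<in> K (max l n)" if "x \<in> c l n" for x l n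
      unfolding K_def using incseqD[OF ginc, of n "max l n" l] that by (intro UN_I[of l]) auto
    then have "c l n \<subseteq> (\<Union>i. K i)" for l n by blast
    moreover have "K i \<subseteq> (\<Union>l n. c l n)" for i by (auto simp: K_def)
    ultimately show ?thesis by (intro antisym UN_least)
  qed
  have Ucmono: "(\<Union>n. c i n) \<subseteq> (\<Union>n. c j n)" if "i \<le> j" for i j
    using lift_Suc_mono_le[of "\<lambda>i. \<Union>n. c i n", OF inc that] .
  have "openin X V" if V: "V \<subseteq> (\<Union>i. K i)" and o: "\<forall>i. openin (subtopology (T (m + i)) (K i)) (V \<inter> K i)" for V
  proof -
    \<comment> \<open>Each \<open>c l n\<close> lies in \<open>K (max l n)\<close>, so openness
      along the \<open>K i\<close> passes to the exhaustion of stage \<open>l\<close>.\<close>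
    have Vl: "openin (T (m + l)) (V \<inter> (\<Union>n. c l n))" for l
    proof (rule gcoh)
      fix n
      define i where "i = max l n"
      have sub: "c l n \<subseteq> K i"
        unfolding K_def using incseqD[OF ginc, of n i l] by (intro subset_trans[OF _ UN_upper[of l]]) (auto simp: i_def)
      obtain G where G: "openin (T (m + i)) G" "V \<inter> K i = G \<inter> K i" using o by (auto simp: openin_subtopology)
      have "openin (T (m + l)) (G \<inter> topspace (T (m + l)))"
        by (rule openin_incl[OF cT G(1)]) (simp add: i_def)
      moreover have "V \<inter> (\<Union>n. c l n) \<inter> c l n = (G \<inter> topspace (T (m + l))) \<inter> c l n"
        using G(2) sub compactin_subset_topspace[OF gcomp[of l n]] by blast
      ultimately show "openin (subtopology (T (m + l)) (c l n)) (V \<inter> (\<Union>n. c l n) \<inter> c l n)"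
        by (simp only: openin_subtopology_Int)
    qed simp
    have "openin (T n) (V \<inter> topspace (T n))" for n
    proof -
      have "openin (T n) ((V \<inter> (\<Union>k. c l k)) \<inter> topspace (T n))" if "n \<le> m + l" for l
        by (rule openin_incl[OF cT[OF that] Vl])
      then have "openin (T n) (\<Union>l\<in>{n..}. (V \<inter> (\<Union>k. c l k)) \<inter> topspace (T n))"
        by (intro openin_Union) auto
      moreover have "(\<Union>l\<in>{n..}. (V \<inter> (\<Union>k. c l k)) \<inter> topspace (T n)) = V \<inter> topspace (T n)"
      proof -
        have "\<exists>l\<ge>n. x \<in> (\<Union>k. c l k)" if "x \<in> V" for x
        proof -
          obtain l k where "x \<in> c l k" using subsetD[OF V \<open>x \<in> V\<close>] unfolding UK by blast
          then have "x \<in> (\<Union>k. c (max n l) k)" using Ucmono[of l "max n l"] by auto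
          then show ?thesis by (intro exI[of _ "max n l"]) simp
        qed
        then show ?thesis by blast
      qed
      ultimately show ?thesis by simp
    qed
    moreover have "V \<subseteq> topspace X"
    proof -
      have "K i \<subseteq> topspace X" for i
        using compactin_subset_topspace[OF Kcomp[of i]] T by (auto simp: dlimits_def)
      then show ?thesis using V by blast
    qed
    ultimately show ?thesis using T by (auto simp: dlimits_def)
  qed
  moreover have "compact_chain (\<lambda>i. subtopology (T (m + i)) (K i))"
    unfolding compact_chain_def
  proof (intro allI conjI)
    fix i
    show "compact_space (subtopology (T (m + i)) (K i))" using Kcomp by (rule compact_space_subtopology)
    show "Hausdorff_space (subtopology (T (m + i)) (K i))" using H by (rule Hausdorff_space_subtopology)
    show "continuous_map (subtopology (T (m + i)) (K i)) (subtopology (T (m + Suc i)) (K (Suc i))) (\<lambda>x. x)"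
      using KSuc[of i] cT[of "m + i" "m + Suc i"]
      by (auto simp: continuous_map_in_subtopology intro: continuous_map_from_subtopology)
  qed
  moreover have "x \<in> K 0" using gx[of 0] by (simp add: K_def)
  moreover have "K i \<subseteq> topspace (T (m + i))" for i by (rule compactin_subset_topspace[OF Kcomp])
  ultimately show ?thesis by blast
qed

text \<open>The finer limit topology is compared with the product topology at each point. Exhausting
  both factors by chains of compacta reduces the question to \<open>chain_tube\<close>; local
  k-omega is what provides these chains.\<close>

theorem dlimits_prod:
  assumes T: "dlimits T X" and S: "dlimits S Y"
    and lT: "\<And>n. locally_k_omega (T n)" and lS: "\<And>n. locally_k_omega (S n)"
  shows "dlimits (\<lambda>n. prod_topology (T n) (S n)) (prod_topology X Y)"
proof -
  have cT: "continuous_map (T i) (T j) (\<lambda>x. x)" and cS: "continuous_map (S i) (S j) (\<lambda>x. x)" if "i \<le> j" for i j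
    using T S chain_mono[OF _ that] by (auto simp: dlimits_def)
  have tX: "topspace X = (\<Union>n. topspace (T n))" and tY: "topspace Y = (\<Union>n. topspace (S n))"
    using T S by (simp_all add: dlimits_def)
  have cX: "continuous_map (T i) X (\<lambda>x. x)" and cY: "continuous_map (S i) Y (\<lambda>x. x)" for i
    using T S by (auto simp: dlimits_def)
  have pm: "continuous_map (prod_topology A B) (prod_topology A' B') (\<lambda>x. x)"
    if "continuous_map A A' (\<lambda>x. x)" "continuous_map B B' (\<lambda>x. x)"
    for A A' :: "'a topology" and B B' :: "'b topology"
    using continuous_map_compose[OF continuous_map_fst that(1)] continuous_map_compose[OF continuous_map_snd that(2)]
    by (auto simp: continuous_map_pairwise comp_def)
  have mT: "x \<in> topspace (T j)" if "x \<in> topspace (T i)" "i \<le> j" for x i j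
    using continuous_map_image_subset_topspace[OF cT[OF that(2)]] that(1) by auto
  have mS: "x \<in> topspace (S j)" if "x \<in> topspace (S i)" "i \<le> j" for x i j
    using continuous_map_image_subset_topspace[OF cS[OF that(2)]] that(1) by auto
  show ?thesis
    unfolding dlimits_def
  proof (intro conjI allI impI)
    show "continuous_map (prod_topology (T n) (S n)) (prod_topology (T (Suc n)) (S (Suc n))) (\<lambda>x. x)" for n
      by (intro pm cT cS) simp_all
    show "continuous_map (prod_topology (T n) (S n)) (prod_topology X Y) (\<lambda>x. x)" for n
      by (intro pm cX cY)
    show "topspace (prod_topology X Y) = (\<Union>n. topspace (prod_topology (T n) (S n)))"
    proof -
      have "(x, y) \<in> (\<Union>n. topspace (T n) \<times> topspace (S n))" if "x \<in> topspace (T i)" "y \<in> topspace (S j)" for x y i j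
        using mT[OF that(1), of "max i j"] mS[OF that(2), of "max i j"] by auto
      then show ?thesis unfolding topspace_prod_topology tX tY by blast
    qed
    fix V assume V: "V \<subseteq> topspace (prod_topology X Y)"
      and o: "\<forall>n. openin (prod_topology (T n) (S n)) (V \<inter> topspace (prod_topology (T n) (S n)))"
    show "openin (prod_topology X Y) V"
      unfolding openin_prod_topology_alt
    proof (intro allI impI)
      fix x y assume xy: "(x, y) \<in> V"
      have "x \<in> (\<Union>n. topspace (T n))" "y \<in> (\<Union>n. topspace (S n))" using V xy tX tY by auto
      then obtain i j where ij: "x \<in> topspace (T i)" "y \<in> topspace (S j)" by blast
      define m where "m = max i j"
      have m: "x \<in> topspace (T m)" "y \<in> topspace (S m)"
        by (auto intro: mT[OF ij(1)] mS[OF ij(2)] simp: m_def)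
      obtain K where K: "compact_chain (\<lambda>i. subtopology (T (m + i)) (K i))" "x \<in> K 0" "\<And>i. K i \<subseteq> topspace (T (m + i))"
        "\<And>V. V \<subseteq> (\<Union>i. K i) \<Longrightarrow> (\<And>i. openin (subtopology (T (m + i)) (K i)) (V \<inter> K i)) \<Longrightarrow> openin X V"
        using dlimits_exhaustion[OF T lT m(1)] by blast
      obtain L where L: "compact_chain (\<lambda>i. subtopology (S (m + i)) (L i))" "y \<in> L 0" "\<And>i. L i \<subseteq> topspace (S (m + i))"
        "\<And>V. V \<subseteq> (\<Union>i. L i) \<Longrightarrow> (\<And>i. openin (subtopology (S (m + i)) (L i)) (V \<inter> L i)) \<Longrightarrow> openin Y V"
        using dlimits_exhaustion[OF S lS m(2)] by blast
      let ?A = "\<lambda>i. subtopology (T (m + i)) (K i)" and ?B = "\<lambda>i. subtopology (S (m + i)) (L i)"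
      have ts: "topspace (?A i) = K i" "topspace (?B i) = L i" for i using K(3) L(3) by auto
      have "\<exists>P Q. x \<in> P \<and> y \<in> Q \<and> P \<times> Q \<subseteq> V \<and> P \<subseteq> (\<Union>i. topspace (?A i)) \<and> Q \<subseteq> (\<Union>i. topspace (?B i)) \<and>
        (\<forall>i. openin (?A i) (P \<inter> topspace (?A i))) \<and> (\<forall>i. openin (?B i) (Q \<inter> topspace (?B i)))"
      proof (rule chain_tube[OF K(1) L(1) _ xy])
        fix i
        have "openin (prod_topology (T (m + i)) (S (m + i))) (V \<inter> topspace (prod_topology (T (m + i)) (S (m + i))))"
          using o by blast
        then have "openin (subtopology (prod_topology (T (m + i)) (S (m + i))) (K i \<times> L i))
          (V \<inter> topspace (prod_topology (T (m + i)) (S (m + i))) \<inter> K i \<times> L i)" by (rule openin_subtopology_Int)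
        moreover have "V \<inter> topspace (prod_topology (T (m + i)) (S (m + i))) \<inter> K i \<times> L i = V \<inter> K i \<times> L i"
          using K(3)[of i] L(3)[of i] by auto
        ultimately show "openin (prod_topology (?A i) (?B i)) (V \<inter> topspace (?A i) \<times> topspace (?B i))"
          unfolding ts subtopology_Times by simp
      next
        show "x \<in> topspace (?A 0)" "y \<in> topspace (?B 0)" unfolding ts by fact+
      qed
      then obtain P Q where PQ: "x \<in> P" "y \<in> Q" "P \<times> Q \<subseteq> V" "P \<subseteq> (\<Union>i. K i)" "Q \<subseteq> (\<Union>i. L i)"
        "\<And>i. openin (?A i) (P \<inter> K i)" "\<And>i. openin (?B i) (Q \<inter> L i)"
        unfolding ts by blast
      then have "openin X P" "openin Y Q" by (auto intro: K(4) L(4))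
      then show "\<exists>U W. openin X U \<and> openin Y W \<and> x \<in> U \<and> y \<in> W \<and> U \<times> W \<subseteq> V" using PQ by blast
    qed
  qed
qed

lemma dlimits_img:
  assumes T: "dlimits T X" and f: "inj f"
  shows "dlimits (\<lambda>n. img_topology f (T n)) (img_topology f X)"
proof -
  have c: "continuous_map (img_topology f A) (img_topology f B) (\<lambda>x. x)" if "continuous_map A B (\<lambda>x. x)" for A B
  proof -
    have "continuous_map (img_topology f A) A (inv f)"
      using f by (intro continuous_map_img_inverse) auto
    from continuous_map_compose[OF continuous_map_compose[OF this that]
        homeomorphic_imp_continuous_map[OF homeomorphic_map_img_topology[OF f]]]
    show ?thesis by (rule continuous_map_eq) (use f in \<open>auto simp: topspace_img_topology\<close>)
  qed
  have "openin (img_topology f X) V"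
    if V: "V \<subseteq> topspace (img_topology f X)" "\<forall>n. openin (img_topology f (T n)) (V \<inter> topspace (img_topology f (T n)))" for V
  proof -
    let ?W = "f -` V"
    have "openin (T n) (?W \<inter> topspace (T n))" for n
    proof -
      obtain G where G: "openin (T n) G" "V \<inter> f ` topspace (T n) = f ` G"
        using V(2) unfolding openin_img_topology[OF f] topspace_img_topology[OF f] by blast
      have "?W \<inter> topspace (T n) = G"
      proof -
        have "z \<in> ?W \<inter> topspace (T n) \<longleftrightarrow> f z \<in> V \<inter> f ` topspace (T n)" for z
          using f by (auto simp: inj_image_mem_iff)
        then show ?thesis unfolding G(2) using f by (auto simp: inj_image_mem_iff)
      qed
      with G(1) show ?thesis by simp
    qed
    moreover have "?W \<subseteq> topspace X" using V(1) f by (auto simp: topspace_img_topology inj_def image_iff)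
    ultimately have "openin X ?W" using T by (auto simp: dlimits_def)
    moreover have "f ` ?W = V" using V(1) by (auto simp: topspace_img_topology[OF f])
    ultimately show ?thesis by (metis openin_img_topology[OF f])
  qed
  then show ?thesis using T c by (auto simp: dlimits_def topspace_img_topology[OF f])
qed

lemma locally_k_omega_img: "locally_k_omega X \<Longrightarrow> inj f \<Longrightarrow> locally_k_omega (img_topology f X)"
  using locally_k_omega_homeomorphic homeomorphic_map_img_topology by blast

lemma locally_k_omega_compact:
  assumes "compact_space X" "Hausdorff_space X"
  shows "locally_k_omega X"
proof -
  have "is_k_omega X"
    by (rule is_k_omegaI[where K = "\<lambda>_. topspace X"])
      (use assms in \<open>auto simp: incseq_def compact_space_def Int_absorb2\<close>)
  then show ?thesis using assms(2) unfolding locally_k_omega_def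
    by (auto intro!: exI[of _ "topspace X"])
qed

text \<open>Enlarging \<open>A\<close> by one index is, up to homeomorphism, a product with one more
  copy of the coefficient space.\<close>

lemma locally_k_omega_finite_power:
  assumes "finite A" and k: "locally_k_omega (euclidean :: 'v::{zero,t2_space} topology)"
  shows "locally_k_omega (subtopology (product_topology (\<lambda>_. euclidean) UNIV) {x :: 'i \<Rightarrow> 'v. \<forall>I. I \<notin> A \<longrightarrow> x I = 0})"
  using assms(1)
proof (induction A rule: finite_induct)
  case empty
  have "{x :: 'i \<Rightarrow> 'v. \<forall>I. I \<notin> {} \<longrightarrow> x I = 0} = {\<lambda>_. 0}" by auto
  moreover have "Hausdorff_space (product_topology (\<lambda>_ :: 'i. euclidean :: 'v topology) UNIV)"
    using k by (simp add: Hausdorff_space_product_topology locally_k_omega_def)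
  ultimately show ?case
    by (intro locally_k_omega_compact Hausdorff_space_subtopology compact_space_subtopology) simp_all
next
  case (insert a A)
  let ?P = "\<lambda>A. subtopology (product_topology (\<lambda>_. euclidean) UNIV) {x :: 'i \<Rightarrow> 'v. \<forall>I. I \<notin> A \<longrightarrow> x I = 0}"
  have co: "continuous_map (subtopology (product_topology (\<lambda>_. euclidean) UNIV) S) euclidean (\<lambda>x :: 'i \<Rightarrow> 'v. x I)" for S I
    by (intro continuous_map_from_subtopology continuous_map_product_projection) simp
  have "homeomorphic_maps (prod_topology (?P A) euclidean) (?P (insert a A)) (\<lambda>(x, c). x(a := c)) (\<lambda>y. (y(a := 0), y a))"
    unfolding homeomorphic_maps_def
  proof (intro conjI ballI)
    have "continuous_map (prod_topology (?P A) euclidean) euclidean (\<lambda>z. if I = a then snd z else fst z I)" for I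
      using continuous_map_compose[OF continuous_map_fst co] by (auto simp: comp_def intro: continuous_map_snd)
    then show "continuous_map (prod_topology (?P A) euclidean) (?P (insert a A)) (\<lambda>(x, c). x(a := c))"
      by (auto simp: continuous_map_in_subtopology continuous_map_componentwise_UNIV case_prod_beta fun_upd_def)
    have "continuous_map (?P (insert a A)) euclidean (\<lambda>y. if I = a then 0 else y I)" for I
      using co by auto
    then show "continuous_map (?P (insert a A)) (prod_topology (?P A) euclidean) (\<lambda>y. (y(a := 0), y a))"
      using co by (auto simp: continuous_map_pairedI continuous_map_in_subtopology continuous_map_componentwise_UNIV fun_upd_def)
  qed (use insert in \<open>auto simp: fun_eq_iff\<close>)
  then have "homeomorphic_map (prod_topology (?P A) euclidean) (?P (insert a A)) (\<lambda>(x, c). x(a := c))"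
    by (rule homeomorphic_maps_map[THEN iffD1, THEN conjunct1])
  then show ?case using locally_k_omega_prod[OF insert.IH k] by (rule locally_k_omega_homeomorphic)
qed

section \<open>The coefficient spaces as direct limits\<close>

lemma locally_k_omega_coef_top:
  assumes "locally_k_omega (euclidean :: 'v::{zero,t2_space} topology)"
  shows "locally_k_omega (coef_top (enat n) :: (nat set \<Rightarrow> 'v) topology)"
proof -
  have "coef (enat n) = {x :: nat set \<Rightarrow> 'v. \<forall>I. I \<notin> idx (enat n) \<longrightarrow> x I = 0}"
    unfolding set_eq_iff coef_enat mem_Collect_eq idx_enat Pow_iff by blast
  then show ?thesis using locally_k_omega_finite_power[OF finite_idx_enat assms] by (simp add: coef_top_def)
qed

lemma dlimits_openin:
  "dlimits T X \<Longrightarrow> V \<subseteq> topspace X \<Longrightarrow> (\<And>n. openin (T n) (V \<inter> topspace (T n))) \<Longrightarrow> openin X V"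
  by (simp add: dlimits_def)

lemma dlimits_coef_top:
  "dlimits (\<lambda>n. coef_top (enat n)) (coef_top \<infinity> :: (nat set \<Rightarrow> 'a::{zero,topological_space}) topology)"
proof -
  have "continuous_map (coef_top (enat n)) (coef_top m) (\<lambda>x :: nat set \<Rightarrow> 'a. x)" if "enat n \<le> m" for n m
    using that by (rule continuous_map_coef_incl)
  moreover have "openin (coef_top \<infinity>) V"
    if "V \<subseteq> coef \<infinity>" "\<forall>n. openin (coef_top (enat n)) (V \<inter> coef (enat n))" for V :: "(nat set \<Rightarrow> 'a) set"
    using that coef_infinity by (fastforce simp: coef_top_def openin_dlim_topology)
  moreover have "coef \<infinity> = (\<Union>n. coef (enat n) :: (nat set \<Rightarrow> 'a) set)"
    using coef_infinity coef_mono[of "enat _" \<infinity>] by fastforce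
  ultimately show ?thesis by (simp add: dlimits_def)
qed

text \<open>The even parts are cut out of the full coefficient spaces by coordinatewise retractions \<open>p I\<close>.\<close>
lemma
  fixes p :: "nat set \<Rightarrow> 'v::{zero,t2_space} \<Rightarrow> 'v"
  assumes p: "\<And>I. continuous_on UNIV (p I)" "\<And>I v. p I (p I v) = p I v" "\<And>I. p I 0 = 0"
  shows locally_k_omega_retract: "locally_k_omega (euclidean :: 'v topology) \<Longrightarrow>
      locally_k_omega (subtopology (coef_top (enat n)) {x. \<forall>I. p I (x I) = x I})"
    and dlimits_retract: "dlimits (\<lambda>n. subtopology (coef_top (enat n)) {x. \<forall>I. p I (x I) = x I})
      (subtopology (coef_top \<infinity>) {x. \<forall>I. p I (x I) = x I})"
proof -
  let ?S = "{x :: nat set \<Rightarrow> 'v. \<forall>I. p I (x I) = x I}"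
  assume k: "locally_k_omega (euclidean :: 'v topology)"
  have "closedin (coef_top (enat n)) {x \<in> topspace (coef_top (enat n)). x I \<in> {v. p I v = v}}" for I
    using continuous_map_coef_coordinate
  proof (rule closedin_continuous_map_preimage)
    show "closedin euclidean {v. p I v = v}" using p(1) by (auto intro: closed_Collect_eq)
  qed
  then have "closedin (coef_top (enat n)) (\<Inter>I. {x \<in> topspace (coef_top (enat n)). x I \<in> {v. p I v = v}})"
    by (intro closedin_Inter) auto
  also have "(\<Inter>I. {x \<in> topspace (coef_top (enat n)). x I \<in> {v. p I v = v}}) = ?S \<inter> coef (enat n)" by auto
  finally have "locally_k_omega (subtopology (coef_top (enat n)) (?S \<inter> coef (enat n)))"
    by (rule locally_k_omega_closed[OF locally_k_omega_coef_top[OF k]])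
  also have "subtopology (coef_top (enat n)) (?S \<inter> coef (enat n)) = subtopology (coef_top (enat n)) ?S"
    using subtopology_restrict[of "coef_top (enat n)" ?S] by (simp add: Int_commute)
  finally show "locally_k_omega (subtopology (coef_top (enat n)) ?S)" .
next
  let ?S = "{x :: nat set \<Rightarrow> 'v. \<forall>I. p I (x I) = x I}" and ?\<pi> = "\<lambda>x I. p I (x I)"
  have "continuous_map (subtopology (coef_top (enat n)) ?S) (subtopology (coef_top m) ?S) (\<lambda>x. x)" if "enat n \<le> m" for n m
    using continuous_map_coef_incl[OF that]
    by (auto simp: continuous_map_in_subtopology intro: continuous_map_from_subtopology)
  moreover have "topspace (subtopology (coef_top \<infinity>) ?S) = (\<Union>n. topspace (subtopology (coef_top (enat n)) ?S))"
    using coef_infinity coef_mono[of "enat _" \<infinity>] by fastforce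
  moreover have "openin (subtopology (coef_top \<infinity>) ?S) V"
    if V: "V \<subseteq> topspace (subtopology (coef_top \<infinity>) ?S)"
      and o: "\<forall>n. openin (subtopology (coef_top (enat n)) ?S) (V \<inter> topspace (subtopology (coef_top (enat n)) ?S))" for V
  proof -
    \<comment> \<open>Subspaces of direct limits need not be direct limits. The preimage under the
      retraction extends \<open>V\<close> to a set whose openness can be tested levelwise in the
      ambient limit.\<close>
    let ?V = "{x \<in> coef \<infinity>. ?\<pi> x \<in> V}"
    have pc: "?\<pi> x \<in> coef (enat n)" if "x \<in> coef (enat n)" for x n
      using that p(3) unfolding coef_enat by metis
    have "openin (coef_top (enat n)) (?V \<inter> coef (enat n))" for n
    proof -
      have "continuous_map (coef_top (enat n)) euclidean (\<lambda>x. p I (x I))" for I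
        using continuous_map_compose[OF continuous_map_coef_coordinate, of euclidean "p I" "enat n" I] p(1)
        by (simp add: comp_def)
      then have "continuous_map (coef_top (enat n)) (subtopology (coef_top (enat n)) ?S) ?\<pi>"
        unfolding continuous_map_in_subtopology continuous_map_into_coef using pc p(2) by auto
      from openin_continuous_map_preimage[OF this o[rule_format]]
      have "openin (coef_top (enat n)) {x \<in> coef (enat n). ?\<pi> x \<in> V \<inter> (coef (enat n) \<inter> ?S)}" by simp
      also have "{x \<in> coef (enat n). ?\<pi> x \<in> V \<inter> (coef (enat n) \<inter> ?S)} = ?V \<inter> coef (enat n)"
        using pc p(2) coef_mono[of "enat n" \<infinity>] by auto
      finally show ?thesis .
    qed
    moreover have "?V \<subseteq> topspace (coef_top \<infinity>)" by auto
    ultimately have "openin (coef_top \<infinity>) ?V"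
      by (intro dlimits_openin[OF dlimits_coef_top]) simp_all
    moreover have "V = ?V \<inter> ?S" using V by auto
    ultimately show ?thesis by (auto simp: openin_subtopology)
  qed
  ultimately show "dlimits (\<lambda>n. subtopology (coef_top (enat n)) ?S) (subtopology (coef_top \<infinity>) ?S)"
    unfolding dlimits_def by (simp del: topspace_subtopology)
qed

definition par_ev :: "nat set \<Rightarrow> 'a::zero \<times> 'b::zero \<Rightarrow> 'a \<times> 'b" where
  "par_ev I v = (if even (card I) then (fst v, 0) else (0, snd v))"

definition par_even :: "nat set \<Rightarrow> 'a::zero \<Rightarrow> 'a" where
  "par_even I v = (if even (card I) then v else 0)"

lemma ev_top_retract:
  "(ev_top m :: (nat set \<Rightarrow> 'a::{zero,topological_space} \<times> 'b::{zero,topological_space}) topology) =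
    subtopology (coef_top m) {x. \<forall>I. par_ev I (x I) = x I}"
proof -
  have "(ev m :: (nat set \<Rightarrow> 'a \<times> 'b) set) = coef m \<inter> {x. \<forall>I. par_ev I (x I) = x I}"
    by (auto simp: ev_def par_ev_def prod_eq_iff split: if_splits)
  then show ?thesis
    unfolding ev_top_def using subtopology_restrict[of "coef_top m" "{x. \<forall>I. par_ev I (x I) = x I}"] by simp
qed

lemma grass0_top_retract:
  "(grass0_top m :: (nat set \<Rightarrow> 'a::{comm_ring_1,topological_space}) topology) =
    subtopology (coef_top m) {x. \<forall>I. par_even I (x I) = x I}"
proof -
  have "(grass0 m :: (nat set \<Rightarrow> 'a) set) = coef m \<inter> {x. \<forall>I. par_even I (x I) = x I}"
    by (auto simp: grass0_iff par_even_def split: if_splits)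
  then show ?thesis
    unfolding grass0_top_def using subtopology_restrict[of "coef_top m" "{x. \<forall>I. par_even I (x I) = x I}"] by simp
qed

lemma par_ev:
  fixes v :: "'a::{zero,topological_space} \<times> 'b::{zero,topological_space}"
  shows "continuous_on UNIV (par_ev I :: 'a \<times> 'b \<Rightarrow> _)" "par_ev I (par_ev I v) = par_ev I v" "par_ev I (0 :: 'a \<times> 'b) = 0"
  by (cases "even (card I)"; auto simp: par_ev_def prod_eq_iff intro!: continuous_intros)+

lemma par_even:
  fixes v :: "'a::{zero,topological_space}"
  shows "continuous_on UNIV (par_even I :: 'a \<Rightarrow> _)" "par_even I (par_even I v) = par_even I v" "par_even I (0 :: 'a) = 0"
  by (cases "even (card I)"; auto simp: par_even_def)+

lemma dlimits_ev_top: "dlimits (\<lambda>n. ev_top (enat n)) (ev_top \<infinity> :: (nat set \<Rightarrow> 'a::{zero,t2_space} \<times> 'b::{zero,t2_space}) topology)"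
  and locally_k_omega_ev_top: "locally_k_omega (euclidean :: ('a \<times> 'b) topology) \<Longrightarrow>
    locally_k_omega (ev_top (enat n) :: (nat set \<Rightarrow> 'a \<times> 'b) topology)"
  unfolding ev_top_retract by (intro dlimits_retract locally_k_omega_retract par_ev; assumption)+

lemma dlimits_grass0_top: "dlimits (\<lambda>n. grass0_top (enat n)) (grass0_top \<infinity> :: (nat set \<Rightarrow> 'a::{comm_ring_1,t2_space}) topology)"
  and locally_k_omega_grass0_top: "locally_k_omega (euclidean :: 'a topology) \<Longrightarrow>
    locally_k_omega (grass0_top (enat n) :: (nat set \<Rightarrow> 'a) topology)"
  unfolding grass0_top_retract by (intro dlimits_retract locally_k_omega_retract par_even; assumption)+

text \<open>Because \<open>D\<close> is open on every level, a relatively open preimage in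
  \<open>D\<close> is open in that level, and the limit topology can be tested without leaving the
  ambient spaces.\<close>

lemma dlimits_continuous_map:
  assumes T: "dlimits T X" and D: "D \<subseteq> topspace X" and o: "\<And>n. openin (T n) (D \<inter> topspace (T n))"
    and c: "\<And>n. continuous_map (subtopology (T n) D) Z h"
  shows "continuous_map (subtopology X D) Z h"
  unfolding continuous_map_def
proof (intro conjI allI impI)
  have tX: "topspace X = (\<Union>n. topspace (T n))" using T by (simp add: dlimits_def)
  have "h x \<in> topspace Z" if x: "x \<in> D" for x
  proof -
    obtain n where "x \<in> topspace (T n)" using x D unfolding tX by blast
    then show ?thesis using continuous_map_image_subset_topspace[OF c[of n]] x by auto
  qed
  then show "h \<in> topspace (subtopology X D) \<rightarrow> topspace Z" by auto
  fix W assume W: "openin Z W"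
  let ?P = "{x \<in> D. h x \<in> W}"
  have "openin (T n) (?P \<inter> topspace (T n))" for n
  proof -
    from openin_continuous_map_preimage[OF c W]
    have "openin (subtopology (T n) D) {x \<in> topspace (T n) \<inter> D. h x \<in> W}" by simp
    then have "openin (subtopology (T n) (D \<inter> topspace (T n))) {x \<in> topspace (T n) \<inter> D. h x \<in> W}"
      using subtopology_restrict[of "T n" D] by (simp add: Int_commute)
    then have "openin (T n) {x \<in> topspace (T n) \<inter> D. h x \<in> W}" using o openin_trans_full by blast
    also have "{x \<in> topspace (T n) \<inter> D. h x \<in> W} = ?P \<inter> topspace (T n)" by auto
    finally show ?thesis .
  qed
  moreover have "?P \<subseteq> topspace X" using D by auto
  ultimately have "openin X ?P" using T by (simp add: dlimits_def)
  moreover have "{x \<in> topspace (subtopology X D). h x \<in> W} = ?P \<inter> D" using D by auto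
  ultimately show "openin (subtopology X D) {x \<in> topspace (subtopology X D). h x \<in> W}"
    by (metis openin_subtopology_Int)
qed

text \<open>The images of the finitely many monomials of level \<open>k\<close> lie on a common
  finite level, and they determine the morphism.\<close>

lemma ghom_finite_level:
  assumes \<phi>: "ghom (enat k) \<infinity> \<phi>"
  shows "\<exists>n. ghom (enat k) (enat n) \<phi>"
proof -
  have "\<forall>I\<in>idx (enat k). \<exists>n. \<phi> (gbasis I) \<in> coef (enat n)"
    using ghomD(1)[OF \<phi> gbasis_coef] coef_infinity by blast
  then obtain n where n: "\<And>I. I \<in> idx (enat k) \<Longrightarrow> \<phi> (gbasis I) \<in> coef (enat (n I))" by metis
  define l where "l = Max (n ` idx (enat k))"
  have l: "\<phi> (gbasis I) \<in> coef (enat l)" if "I \<in> idx (enat k)" for I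
  proof -
    have "n I \<le> l" unfolding l_def using that by (intro Max_ge) auto
    then show ?thesis using n[OF that] coef_mono[of "enat (n I)" "enat l"] by auto
  qed
  have c: "\<phi> a \<in> coef (enat l)" if a: "a \<in> coef (enat k)" for a
    unfolding coef_enat
  proof (intro allI impI)
    fix K assume "\<phi> a K \<noteq> 0"
    then have "(\<Sum>I\<in>supp a. \<phi> (gbasis I) K * a I) \<noteq> 0"
      unfolding ghom_tmap[OF \<phi> a] tmap_def .
    then obtain I where "I \<in> supp a" "\<phi> (gbasis I) K \<noteq> 0" by (metis (no_types, lifting) mult_zero_left sum.neutral)
    moreover from this have "I \<in> idx (enat k)" using a by (auto simp: coef_def)
    ultimately show "K \<subseteq> {..<l}" using l[of I] by (auto simp: coef_enat)
  qed
  have "ghom (enat k) (enat l) \<phi>"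
  proof (rule ghomI)
    show "\<phi> a \<in> grass0 (enat l)" if "a \<in> grass0 (enat k)" for a
      using that ghomD(6)[OF \<phi> that] c[of a] by (auto simp: grass0_iff)
    show "\<phi> a \<in> grass1 (enat l)" if "a \<in> grass1 (enat k)" for a
      using that ghomD(7)[OF \<phi> that] c[of a] by (auto simp: grass1_iff)
  qed (use c ghomD[OF \<phi>] in auto)
  then show ?thesis by blast
qed

section \<open>Extension of natural transformations to infinity\<close>

context ms begin

abbreviation "VD m j \<equiv> tw_dom (N m) (V m) j"

lemma twm_id: "p \<in> tw_car (N m) j \<Longrightarrow> twm (\<lambda>a. a) p = p"
  by (induction j arbitrary: p) (auto simp: ev_iff E.tmap_id[where m = m])

lemma car_mono: "m \<le> n \<Longrightarrow> p \<in> tw_car (N m) j \<Longrightarrow> p \<in> tw_car (N n) j"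
  using twm_car[OF ghom_id, of m n p j] twm_id[of p m j] by simp

lemma VD_mono: "m \<le> n \<Longrightarrow> p \<in> VD m j \<Longrightarrow> p \<in> VD n j"
  using VD_tmap[OF ghom_id, of m n p j] twm_id[OF subsetD[OF VD_car], of p m j] by simp

lemma car_infinity: "p \<in> tw_car (N \<infinity>) j \<Longrightarrow> \<exists>n. p \<in> tw_car (N (enat n)) j"
proof (induction j arbitrary: p)
  case 0
  then show ?case using ev_infinity by fastforce
next
  case (Suc j)
  obtain a b t where p: "p = Tri a b t" "a \<in> tw_car (N \<infinity>) j" "b \<in> tw_car (N \<infinity>) j" "t \<in> grass0 \<infinity>"
    using Suc.prems by auto
  obtain k l i where k: "a \<in> tw_car (N (enat k)) j" "b \<in> tw_car (N (enat l)) j" "t \<in> grass0 (enat i)"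
    using Suc.IH[OF p(2)] Suc.IH[OF p(3)] grass0_infinity[OF p(4)] by blast
  let ?n = "max k (max l i)"
  have "a \<in> tw_car (N (enat ?n)) j" "b \<in> tw_car (N (enat ?n)) j" "t \<in> grass0 (enat ?n)"
    using car_mono[OF _ k(1), of "enat ?n"] car_mono[OF _ k(2), of "enat ?n"]
      subsetD[OF grass0_mono k(3), of "enat ?n"] by auto
  then show ?case using p(1) by auto
qed

text \<open>Membership in the domain is decided by the body, which does not depend on the
  level.\<close>

lemma VD_level: "p \<in> VD m j \<Longrightarrow> p \<in> tw_car (N n) j \<Longrightarrow> p \<in> VD n j"
  using VD_body[of p m j] VD_body[of p n j] VD_car by blast

lemma VD_infinity:
  assumes "p \<in> VD m j"
  obtains n where "p \<in> VD (enat n) j" "enat n \<le> m"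
proof (cases m)
  case (enat n)
  then show ?thesis using assms that by simp
next
  case infinity
  then obtain n where "p \<in> tw_car (N (enat n)) j" using assms VD_car car_infinity by blast
  from VD_level[OF assms this] show ?thesis by (rule that) (simp add: infinity)
qed

lemma natural_continuous:
  "MS_natural Obj s0 s1 t0 t1 \<U> j g \<Longrightarrow> m \<in> Obj \<Longrightarrow>
    continuous_map (subtopology (tw_top (N m) j) (VD m j)) (ev_top m) (g m)"
  by (simp add: MS_natural_def MS_dom_eq)

lemma natural_eq:
  "MS_natural Obj s0 s1 t0 t1 \<U> j g \<Longrightarrow> m \<in> Obj \<Longrightarrow> n \<in> Obj \<Longrightarrow> ghom m n \<phi> \<Longrightarrow> p \<in> VD m j \<Longrightarrow>
    g n (twm \<phi> p) = tmap \<tau> \<phi> (g m p)"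
  by (simp add: MS_natural_def MS_dom_eq)

text \<open>At infinity a point is evaluated on a finite level containing it. For a natural
  transformation all such levels give the same value; \<open>LEAST\<close> merely fixes one.\<close>

definition extend :: "nat \<Rightarrow> (enat \<Rightarrow> (nat set \<Rightarrow> 'e0 \<times> 'e1, nat set \<Rightarrow> 'r) tw \<Rightarrow> nat set \<Rightarrow> 'f0 \<times> 'f1) \<Rightarrow>
    enat \<Rightarrow> (nat set \<Rightarrow> 'e0 \<times> 'e1, nat set \<Rightarrow> 'r) tw \<Rightarrow> nat set \<Rightarrow> 'f0 \<times> 'f1" where
  "extend j g m p = (case m of enat n \<Rightarrow> g (enat n) p | \<infinity> \<Rightarrow> g (enat (LEAST n. p \<in> VD (enat n) j)) p)"

lemma extend_enat [simp]: "extend j g (enat n) = g (enat n)"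
  by (simp add: extend_def fun_eq_iff)

text \<open>Naturality along the inclusion of levels, which acts as the identity on coefficient
  families, says that the components agree.\<close>

lemma extend_eq:
  assumes g: "MS_natural Lam s0 s1 t0 t1 \<U> j g" and p: "p \<in> VD (enat n) j" and m: "enat n \<le> m"
  shows "extend j g m p = g (enat n) p"
proof -
  have "g (enat l) p = g (enat k) p" if "p \<in> VD (enat k) j" "k \<le> l" for k l
  proof -
    have "g (enat k) p \<in> ev (enat k)"
      using continuous_map_image_subset_topspace[OF natural_continuous[OF g, of "enat k"]] that(1) VD_car[of "enat k" j]
      by (auto simp: Lam_def topspace_tw_top[OF N_topspace(1,2)])
    then have "tmap \<tau> (\<lambda>a. a) (g (enat k) p) = g (enat k) p" by (intro F.tmap_id[where m = "enat k"]) (simp add: ev_iff)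
    moreover have "g (enat l) (twm (\<lambda>a. a) p) = tmap \<tau> (\<lambda>a. a) (g (enat k) p)"
      using that by (intro natural_eq[OF g _ _ ghom_id]) (simp_all add: Lam_def)
    ultimately show ?thesis using twm_id[of p "enat k" j] VD_car[of "enat k" j] that(1) by auto
  qed
  note mono = this
  show ?thesis
  proof (cases m)
    case (enat l)
    then show ?thesis using mono[OF p, of l] m by simp
  next
    case infinity
    let ?k = "LEAST n. p \<in> VD (enat n) j"
    have "p \<in> VD (enat ?k) j" by (rule LeastI[of "\<lambda>n. p \<in> VD (enat n) j", OF p])
    moreover have "?k \<le> n" by (rule Least_le[of "\<lambda>n. p \<in> VD (enat n) j", OF p])
    ultimately show ?thesis using mono[of ?k n] infinity by (simp add: extend_def del: V_enat)
  qed
qed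

context
  assumes kr: "locally_k_omega (euclidean :: 'r topology)" and ke: "locally_k_omega (euclidean :: ('e0 \<times> 'e1) topology)"
begin

text \<open>The two claims climb together: local k-omega of the levels lets the limit commute with
  the products that form the next domain, and it is inherited by these products.\<close>

lemma dlimits_tw_top:
  "dlimits (\<lambda>n. tw_top (N (enat n)) j) (tw_top (N \<infinity>) j) \<and> (\<forall>n. locally_k_omega (tw_top (N (enat n)) j))"
proof (induction j)
  case 0
  show ?case
    using dlimits_ev_top[where 'a = 'e0 and 'b = 'e1] locally_k_omega_ev_top[OF ke]
    by (auto intro!: dlimits_img locally_k_omega_img inj_Base)
next
  case (Suc j)
  note g = dlimits_grass0_top[where 'a = 'r] locally_k_omega_grass0_top[OF kr]
  show ?case
    using Suc g by (auto intro!: dlimits_img dlimits_prod locally_k_omega_img locally_k_omega_prod inj_Tri)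
qed

text \<open>Continuity at infinity is tested on the finite levels. For naturality, a point lies on
  some finite level \<open>k\<close>, and a morphism restricted to level \<open>k\<close> lands on a
  finite level, so a naturality square over \<open>Lam\<close> applies.\<close>

lemma extend_natural:
  assumes g: "MS_natural Lam s0 s1 t0 t1 \<U> j g"
  shows "MS_natural UNIV s0 s1 t0 t1 \<U> j (extend j g)"
  unfolding MS_natural_def MS_dom_eq
proof (intro conjI ballI allI impI)
  have c: "continuous_map (subtopology (tw_top (N (enat n)) j) (VD (enat n) j)) (ev_top (enat n)) (g (enat n))" for n
    by (rule natural_continuous[OF g]) (simp add: Lam_def)
  fix m
  show "continuous_map (subtopology (tw_top (N m) j) (VD m j)) (ev_top m) (extend j g m)"
  proof (cases m)
    case (enat n)
    then show ?thesis using c by simp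
  next
    case infinity
    have top: "topspace (tw_top (N m) j) = tw_car (N m) j" for m by (rule topspace_tw_top[OF N_topspace(1,2)])
    have D: "VD \<infinity> j \<inter> tw_car (N (enat n)) j = VD (enat n) j" for n
      using VD_level[of _ \<infinity> j "enat n"] VD_mono[of "enat n" \<infinity>] VD_car[of "enat n" j] by auto
    show ?thesis
      unfolding infinity
    proof (rule dlimits_continuous_map[OF dlimits_tw_top[THEN conjunct1]])
      show "VD \<infinity> j \<subseteq> topspace (tw_top (N \<infinity>) j)" unfolding top by (rule VD_car)
      show "openin (tw_top (N (enat n)) j) (VD \<infinity> j \<inter> topspace (tw_top (N (enat n)) j))" for n
        unfolding top D using T.D_open by simp
      fix n
      have "subtopology (tw_top (N (enat n)) j) (VD \<infinity> j) = subtopology (tw_top (N (enat n)) j) (VD (enat n) j)"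
        unfolding D[symmetric] using subtopology_restrict[of "tw_top (N (enat n)) j" "VD \<infinity> j"] by (simp add: top Int_commute)
      moreover have "continuous_map (subtopology (tw_top (N (enat n)) j) (VD (enat n) j)) (ev_top \<infinity>) (g (enat n))"
        using continuous_map_compose[OF c continuous_map_ev_incl[of n \<infinity>]] by (simp add: comp_def)
      then have "continuous_map (subtopology (tw_top (N (enat n)) j) (VD (enat n) j)) (ev_top \<infinity>) (extend j g \<infinity>)"
        by (rule continuous_map_eq) (simp add: extend_eq[OF g, of _ n \<infinity>])
      ultimately show "continuous_map (subtopology (tw_top (N (enat n)) j) (VD \<infinity> j)) (ev_top \<infinity>) (extend j g \<infinity>)" by simp
    qed
  qed
next
  fix m n p and \<phi> :: "(nat set \<Rightarrow> 'r) \<Rightarrow> nat set \<Rightarrow> 'r"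
  assume \<phi>: "ghom m n \<phi>" and "p \<in> VD m j"
  then obtain k where k: "p \<in> VD (enat k) j" "enat k \<le> m" by (rule_tac VD_infinity)
  have "ghom (enat k) n \<phi>" using \<phi> k(2) by (rule ghom_source_mono)
  then obtain l where l: "ghom (enat k) (enat l) \<phi>" "enat l \<le> n"
    using ghom_finite_level by (cases n) auto
  have "extend j g n (twm \<phi> p) = g (enat l) (twm \<phi> p)"
    using VD_tmap[OF l(1) k(1)] l(2) by (rule extend_eq[OF g])
  also have "\<dots> = tmap \<tau> \<phi> (g (enat k) p)"
    by (rule natural_eq[OF g _ _ l(1) k(1)]) (simp_all add: Lam_def)
  also have "g (enat k) p = extend j g m p" using extend_eq[OF g k] by simp
  finally show "extend j g n (twm \<phi> p) = tmap \<tau> \<phi> (extend j g m p)" .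
qed

lemma extend_Ck: "MS_Ck Lam s0 s1 t0 t1 \<U> k j g \<Longrightarrow> MS_Ck UNIV s0 s1 t0 t1 \<U> k j (extend j g)"
proof (induction k arbitrary: j g)
  case 0
  then show ?case by (simp add: extend_natural)
next
  case (Suc k)
  have g: "MS_natural Lam s0 s1 t0 t1 \<U> j g" using Suc.prems by simp
  from Suc.prems obtain g1 where eq: "\<And>ob a b t. ob \<in> Lam \<Longrightarrow> Tri a b t \<in> VD ob (Suc j) \<Longrightarrow>
      tdiff (g ob (tw_plus (N ob) a (tw_times (N ob) b t))) (g ob a) = tmul \<tau> (g1 ob (Tri a b t)) t"
    and g1: "MS_Ck Lam s0 s1 t0 t1 \<U> k (Suc j) g1" unfolding MS_Ck.simps MS_dom_eq by blast
  have g1n: "MS_natural Lam s0 s1 t0 t1 \<U> (Suc j) g1" using g1 by (cases k) auto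
  have "tdiff (extend j g ob (tw_plus (N ob) a (tw_times (N ob) b t))) (extend j g ob a)
      = tmul \<tau> (extend (Suc j) g1 ob (Tri a b t)) t" if abt: "Tri a b t \<in> VD ob (Suc j)" for ob a b t
  proof -
    obtain n where n: "Tri a b t \<in> VD (enat n) (Suc j)" "enat n \<le> ob" using abt by (rule VD_infinity)
    then have "a \<in> VD (enat n) j" "tw_plus (N ob) a (tw_times (N ob) b t) \<in> VD (enat n) j"
      by (auto simp: N_plus[of ob "enat n"] N_times[of ob "enat n"])
    then show ?thesis
      using eq[OF _ n(1)] extend_eq[OF g _ n(2)] extend_eq[OF g1n n]
      by (simp add: Lam_def N_plus[of ob "enat n"] N_times[of ob "enat n"])
  qed
  then show ?case using extend_natural[OF g] Suc.IH[OF g1] unfolding MS_Ck.simps MS_dom_eq by blast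
qed

theorem MS_smooth_extend: "MS_smooth Lam s0 s1 t0 t1 \<U> g \<Longrightarrow> MS_smooth UNIV s0 s1 t0 t1 \<U> (extend 0 g)"
  by (simp add: MS_smooth_def extend_Ck)

end

end

theorem theorem2p19:
  fixes s0 :: "'r::{comm_ring_1,topological_group_add,topological_semigroup_mult,t2_space} \<Rightarrow> 'e0::{ab_group_add,topological_group_add,t2_space} \<Rightarrow> 'e0"
    and s1 :: "'r \<Rightarrow> 'e1::{ab_group_add,topological_group_add,t2_space} \<Rightarrow> 'e1"
    and t0 :: "'r \<Rightarrow> 'f0::{ab_group_add,topological_group_add,t2_space} \<Rightarrow> 'f0"
    and t1 :: "'r \<Rightarrow> 'f1::{ab_group_add,topological_group_add,t2_space} \<Rightarrow> 'f1"
    and \<U> :: "nat \<Rightarrow> (nat set \<Rightarrow> 'e0 \<times> 'e1) set"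
    and f :: "nat \<Rightarrow> (nat set \<Rightarrow> 'e0 \<times> 'e1) \<Rightarrow> (nat set \<Rightarrow> 'f0 \<times> 'f1)"
  assumes Qalg: "\<forall>n::nat. n > 0 \<longrightarrow> (\<exists>y::'r. of_nat n * y = 1)"
    and units_dense: "closure {u::'r. \<exists>v. u * v = 1} = UNIV"
    and E0: "Hausdorff_top_module s0" and E1: "Hausdorff_top_module s1"
    and F0: "Hausdorff_top_module t0" and F1: "Hausdorff_top_module t1"
    and U: "open_subfunctor s0 s1 \<U>"
    and f_maps: "\<forall>n. \<forall>x\<in>\<U> n. f n x \<in> ev (enat n)"
  shows
   "((\<exists>g. MS_smooth Lam s0 s1 t0 t1 \<U> g \<and> (\<forall>n. \<forall>x\<in>\<U> n. g (enat n) (Base x) = f n x))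
     \<longleftrightarrow>
     ((\<forall>n. continuous_map (subtopology (ev_top (enat n)) (\<U> n)) (ev_top (enat n)) (f n)) \<and>
      (\<forall>m n \<phi>. ghom (enat m) (enat n) \<phi> \<longrightarrow>
          (\<forall>x\<in>\<U> m. f n (tmap (esmul s0 s1) \<phi> x) = tmap (esmul t0 t1) \<phi> (f m x))) \<and>
      (\<forall>n. BGN_smooth (Emod_R s0 s1 (enat n)) (\<U> n) (Fcod_R t0 t1 (enat n)) (f n) \<and>
           (\<forall>x\<in>\<U> n.
              (\<forall>v\<in>ev (enat n). \<forall>w\<in>ev (enat n).
                  BGN_deriv (Emod_R s0 s1 (enat n)) (\<U> n) (Fcod_R t0 t1 (enat n)) 0 (f n) x (tadd v w)
                = tadd (BGN_deriv (Emod_R s0 s1 (enat n)) (\<U> n) (Fcod_R t0 t1 (enat n)) 0 (f n) x v)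
                       (BGN_deriv (Emod_R s0 s1 (enat n)) (\<U> n) (Fcod_R t0 t1 (enat n)) 0 (f n) x w)) \<and>
              (\<forall>v\<in>ev (enat n). \<forall>c\<in>grass0 (enat n).
                  BGN_deriv (Emod_R s0 s1 (enat n)) (\<U> n) (Fcod_R t0 t1 (enat n)) 0 (f n) x (tmul (esmul s0 s1) v c)
                = tmul (esmul t0 t1) (BGN_deriv (Emod_R s0 s1 (enat n)) (\<U> n) (Fcod_R t0 t1 (enat n)) 0 (f n) x v) c)))))
   \<and>
   (locally_k_omega (euclidean :: 'r topology) \<and>
    locally_k_omega (euclidean :: ('e0 \<times> 'e1) topology) \<and>
    locally_k_omega (euclidean :: ('f0 \<times> 'f1) topology) \<longrightarrow>
     ((\<exists>g. MS_smooth Lam s0 s1 t0 t1 \<U> g \<and> (\<forall>n. \<forall>x\<in>\<U> n. g (enat n) (Base x) = f n x))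
      \<longleftrightarrow> (\<exists>g. MS_smooth UNIV s0 s1 t0 t1 \<U> g \<and> (\<forall>n. \<forall>x\<in>\<U> n. g (enat n) (Base x) = f n x)))
     \<and>
     ((\<exists>g. MS_smooth Lam s0 s1 t0 t1 \<U> g \<and> (\<forall>n. \<forall>x\<in>\<U> n. g (enat n) (Base x) = f n x))
      \<longleftrightarrow>
      (\<exists>finf. (\<forall>n. \<forall>x\<in>\<U> n. finf x = f n x) \<and>
         (let F = (\<lambda>ob. case ob of enat n \<Rightarrow> f n | \<infinity> \<Rightarrow> finf);
              Ui = Uobj s0 s1 \<U> \<infinity>;
              D = BGN_deriv (Emod_R s0 s1 \<infinity>) Ui (Fcod_R t0 t1 \<infinity>) 0 finf
          in (\<forall>ob. continuous_map (subtopology (ev_top ob) (Uobj s0 s1 \<U> ob)) (ev_top ob) (F ob)) \<and>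
             (\<forall>m n \<phi>. ghom m n \<phi> \<longrightarrow>
                (\<forall>x\<in>Uobj s0 s1 \<U> m. F n (tmap (esmul s0 s1) \<phi> x) = tmap (esmul t0 t1) \<phi> (F m x))) \<and>
             BGN_smooth (Emod_R s0 s1 \<infinity>) Ui (Fcod_R t0 t1 \<infinity>) finf \<and>
             (\<forall>x\<in>Ui.
                (\<forall>v\<in>ev \<infinity>. \<forall>w\<in>ev \<infinity>. D x (tadd v w) = tadd (D x v) (D x w)) \<and>
                (\<forall>v\<in>ev \<infinity>. \<forall>c\<in>grass0 \<infinity>. D x (tmul (esmul s0 s1) v c) = tmul (esmul t0 t1) (D x v) c))))))"
proof -
  interpret ms t0 t1 s0 s1 \<U>
  proof
    show "dense_units TYPE('r)" using units_dense by (simp add: dense_units_def)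
    show "\<exists>y::'r. of_nat 2 * y = 1" using Qalg[rule_format, of 2] by simp
  qed fact+
  define i where "i Obj \<longleftrightarrow> (\<exists>g. MS_smooth Obj s0 s1 t0 t1 \<U> g \<and> (\<forall>n. \<forall>x\<in>\<U> n. g (enat n) (Base x) = f n x))" for Obj
  define ii where "ii \<longleftrightarrow>
    (\<forall>n. continuous_map (subtopology (ev_top (enat n)) (\<U> n)) (ev_top (enat n)) (f n)) \<and>
    (\<forall>m n \<phi>. ghom (enat m) (enat n) \<phi> \<longrightarrow> (\<forall>x\<in>\<U> m. f n (tmap \<sigma> \<phi> x) = tmap \<tau> \<phi> (f m x))) \<and>
    (\<forall>n. BGN_smooth (Emod_R s0 s1 (enat n)) (\<U> n) (Fcod_R t0 t1 (enat n)) (f n) \<and>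
      (\<forall>x\<in>\<U> n.
        (\<forall>v\<in>ev (enat n). \<forall>w\<in>ev (enat n). dR (enat n) (f n) x (tadd v w) = tadd (dR (enat n) (f n) x v) (dR (enat n) (f n) x w)) \<and>
        (\<forall>v\<in>ev (enat n). \<forall>c\<in>grass0 (enat n). dR (enat n) (f n) x (tmul \<sigma> v c) = tmul \<tau> (dR (enat n) (f n) x v) c)))"
  define F where "F h ob = (case ob of enat n \<Rightarrow> f n | \<infinity> \<Rightarrow> h)" for h ob
  have F: "F h (enat n) = f n" "F h \<infinity> = h" for h n by (simp_all add: F_def)
  define ii' where "ii' \<longleftrightarrow> (\<exists>h. (\<forall>n. \<forall>x\<in>\<U> n. h x = f n x) \<and>
    (\<forall>ob. continuous_map (subtopology (ev_top ob) (V ob)) (ev_top ob) (F h ob)) \<and>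
    (\<forall>m n \<phi>. ghom m n \<phi> \<longrightarrow> (\<forall>x\<in>V m. F h n (tmap \<sigma> \<phi> x) = tmap \<tau> \<phi> (F h m x))) \<and>
    BGN_smooth (Emod_R s0 s1 \<infinity>) (V \<infinity>) (Fcod_R t0 t1 \<infinity>) h \<and>
    (\<forall>x\<in>V \<infinity>.
      (\<forall>v\<in>ev \<infinity>. \<forall>w\<in>ev \<infinity>. dR \<infinity> h x (tadd v w) = tadd (dR \<infinity> h x v) (dR \<infinity> h x w)) \<and>
      (\<forall>v\<in>ev \<infinity>. \<forall>c\<in>grass0 \<infinity>. dR \<infinity> h x (tmul \<sigma> v c) = tmul \<tau> (dR \<infinity> h x v) c)))"
  have natural: "g n (Base (tmap \<sigma> \<phi> x)) = tmap \<tau> \<phi> (g m (Base x))"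
    if "MS_smooth Obj s0 s1 t0 t1 \<U> g" "m \<in> Obj" "n \<in> Obj" "ghom m n \<phi>" "x \<in> V m" for Obj g m n \<phi> x
  proof -
    have "MS_natural Obj s0 s1 t0 t1 \<U> 0 g" using that(1)[unfolded MS_smooth_def, rule_format, of 0] by simp
    from natural_eq[OF this that(2-4), of "Base x"] that(5) show ?thesis by simp
  qed
  have i_imp_ii: ii if i: "i Lam"
  proof -
    obtain g where g: "MS_smooth Lam s0 s1 t0 t1 \<U> g" and gf: "\<And>n x. x \<in> \<U> n \<Longrightarrow> g (enat n) (Base x) = f n x"
      using i by (auto simp: i_def)
    have L: "enat n \<in> Lam" for n by (simp add: Lam_def)
    note s = MS_smooth_imp_smooth[OF g L, of _ "f _", unfolded V_enat, OF gf]
    have "f n (tmap \<sigma> \<phi> x) = tmap \<tau> \<phi> (f m x)" if "ghom (enat m) (enat n) \<phi>" "x \<in> \<U> m" for m n \<phi> x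
      using natural[OF g L L that(1), of x] that(2) gf[OF \<U>_functor[OF that]] gf[OF that(2)] by simp
    then show ?thesis unfolding ii_def V_enat tadd_eq using s by blast
  qed
  have ii_imp_i: "i Lam" if ii
    unfolding i_def using that by (intro smooth_imp_MS_smooth) (simp_all add: ii_def)
  have i_imp_i': "i UNIV"
    if k: "locally_k_omega (euclidean :: 'r topology)" "locally_k_omega (euclidean :: ('e0 \<times> 'e1) topology)" and i: "i Lam"
  proof -
    obtain g where "MS_smooth Lam s0 s1 t0 t1 \<U> g" "\<forall>n. \<forall>x\<in>\<U> n. g (enat n) (Base x) = f n x"
      using i by (auto simp: i_def)
    then show ?thesis unfolding i_def using MS_smooth_extend[OF k] by (intro exI[of _ "extend 0 g"]) simp
  qed
  have i'_imp_ii': ii' if i': "i UNIV"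
  proof -
    obtain g where g: "MS_smooth UNIV s0 s1 t0 t1 \<U> g" and gf: "\<And>n x. x \<in> \<U> n \<Longrightarrow> g (enat n) (Base x) = f n x"
      using i' by (auto simp: i_def)
    define h where "h x = g \<infinity> (Base x)" for x
    have gF: "g ob (Base x) = F h ob x" if "x \<in> V ob" for ob x
      using that gf by (cases ob) (auto simp: F h_def)
    note s = MS_smooth_imp_smooth[OF g UNIV_I gF]
    have "h x = f n x" if x: "x \<in> \<U> n" for n x
    proof -
      have "x \<in> ev (enat n)" "f n x \<in> ev (enat n)" using x \<U>_ev f_maps by auto
      then have "tmap \<sigma> (\<lambda>a. a) x = x" "tmap \<tau> (\<lambda>a. a) (f n x) = f n x"
        by (auto simp: ev_iff intro: E.tmap_id F.tmap_id)
      then show ?thesis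
        using natural[OF g UNIV_I UNIV_I ghom_id, of "enat n" \<infinity> x] x gf by (simp add: h_def)
    qed
    moreover have "F h n (tmap \<sigma> \<phi> x) = tmap \<tau> \<phi> (F h m x)" if "ghom m n \<phi>" "x \<in> V m" for m n \<phi> x
      using natural[OF g UNIV_I UNIV_I that] gF[OF that(2)] gF[OF V_tmap[OF that]] by simp
    ultimately show ?thesis
      unfolding ii'_def tadd_eq using s(2) s(1,3,4)[where ob = \<infinity>] by (intro exI[of _ h]) (simp add: F)
  qed
  have ii'_imp_ii: ii if ii': ii'
  proof -
    obtain h where hf: "\<And>n x. x \<in> \<U> n \<Longrightarrow> h x = f n x"
      and c: "\<And>ob. continuous_map (subtopology (ev_top ob) (V ob)) (ev_top ob) (F h ob)"
      and nat: "\<And>m n \<phi> x. ghom m n \<phi> \<Longrightarrow> x \<in> V m \<Longrightarrow> F h n (tmap \<sigma> \<phi> x) = tmap \<tau> \<phi> (F h m x)"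
      and sm: "BGN_smooth (Emod_R s0 s1 \<infinity>) (V \<infinity>) (Fcod_R t0 t1 \<infinity>) h"
      and lin: "\<And>x v c. x \<in> V \<infinity> \<Longrightarrow> v \<in> ev \<infinity> \<Longrightarrow> c \<in> grass0 \<infinity> \<Longrightarrow> dR \<infinity> h x (tmul \<sigma> v c) = tmul \<tau> (dR \<infinity> h x v) c"
      using ii' unfolding ii'_def by (elim exE conjE) (rule that; blast)
    have fm: "f n x \<in> ev (enat n)" if "x \<in> \<U> n" for n x using f_maps that by blast
    note s = smooth_infinity_restrict[OF hf fm sm lin]
    \<comment> \<open>The detour through \<open>i Lam\<close> supplies the remaining clauses of
      \<open>ii\<close>, such as additivity of the derivatives.\<close>
    have "i Lam" unfolding i_def
      using nat[of "enat _" "enat _"] s by (intro smooth_imp_MS_smooth) (auto simp: F)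
    then show ?thesis by (rule i_imp_ii)
  qed
  \<comment> \<open>The implications close up: \<open>i Lam\<close> to \<open>i UNIV\<close> to
    \<open>ii'\<close> to \<open>ii\<close> and back to \<open>i Lam\<close>. Only the passage to
    \<open>i UNIV\<close> uses the k-omega conditions.\<close>
  have "(i Lam \<longleftrightarrow> ii) \<and>
    (locally_k_omega (euclidean :: 'r topology) \<and> locally_k_omega (euclidean :: ('e0 \<times> 'e1) topology) \<and>
     locally_k_omega (euclidean :: ('f0 \<times> 'f1) topology) \<longrightarrow> (i Lam \<longleftrightarrow> i UNIV) \<and> (i Lam \<longleftrightarrow> ii'))"
    using i_imp_ii ii_imp_i i_imp_i' i'_imp_ii' ii'_imp_ii by blast
  then show ?thesis
    unfolding i_def ii_def ii'_def F_def Let_def V_enat .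
qed

end
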